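(* Let $1\le p,q,p_1,p_2,q_1,q_2\le\infty$ and $\tau\in\{0,1\}$. Then $$\forall\sigma\in W(\mathscr{F}L^p,L^q)(\mathbb{R}^{2d})\Longrightarrow OP_\tau(\sigma):\mathcal{M}^{p_1,q_1}(\mathbb{R}^d)\longrightarrow M^{p_2,q_2}(\mathbb{R}^d)$$ if and only if $$q_2',p_1\le p'\quad\text{and}\quad p_2',q_2',q_1\le q'\qquad\text{in the case }\tau=0,$$ $$q_1,p_2'\le p'\quad\text{and}\quad p_1,q_1,q_2'\le q'\qquad\text{in the case }\tau=1.$$
   Context: $p'$ denotes the conjugate exponent, $1/p+1/p'=1$, with $1/\infty=0$. $\langle\cdot,\cdot\rangle$ extends $\langle f,g\rangle=\int f\bar g$ to $\mathcal{S}'\times\mathcal{S}$. $\tau$-Wigner distribution: $W_\tau(f_1,f_2)(x,\xi)=\int_{\mathbb{R}^d}f_1(x+\tau t)\overline{f_2(x-(1-\tau)t)}e^{-2\pi i\xi\cdot t}\,dt$. $\tau$-pseudodifferential operator with symbol $\sigma\in\mathcal{S}'(\mathbb{R}^{2d})$: $\langle OP_\tau(\sigma)f,g\rangle=\langle\sigma,W_\tau(g,f)\rangle$ for $f,g\in\mathcal{S}(\mathbb{R}^d)$ ($\tau=0$ is the Kohn–Nirenberg operator, $\tau=1$ the anti-Kohn–Nirenberg operator). Function spaces: for $f\in\mathcal{S}'(\mathbb{R}^n)$ and a fixed nonzero $\phi\in\mathcal{S}(\mathbb{R}^n)$, $V_\phi f(x,\xi)=\langle f,M_\xi T_x\phi\rangle$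 with $T_xg(t)=g(t-x)$, $M_\xi g(t)=e^{2\pi it\cdot\xi}g(t)$. $M^{p,q}(\mathbb{R}^n)$ is the set of $f\in\mathcal{S}'(\mathbb{R}^n)$ with $\|f\|_{M^{p,q}}=\big(\int(\int|V_\phi f(x,\xi)|^pdx)^{q/p}d\xi\big)^{1/q}<\infty$ (usual modification if $p$ or $q$ is $\infty$; different $\phi$ give equivalent norms). $\mathcal{M}^{p,q}(\mathbb{R}^n)$ is the closure of $\mathcal{S}(\mathbb{R}^n)$ in $M^{p,q}(\mathbb{R}^n)$. The Wiener amalgam space $W(\mathscr{F}L^p,L^q)(\mathbb{R}^{2d})=\mathscr{F}M^{p,q}(\mathbb{R}^{2d})$ is the set of $F\in\mathcal{S}'(\mathbb{R}^{2d})$ with (up to equivalence) $\|F\|=\big(\int_{\mathbb{R}^{2d}}(\int_{\mathbb{R}^{2d}}|V_\Phi F(\zeta,-z)|^pdz)^{q/p}d\zeta\big)^{1/q}<\infty$ for a nonzero $\Phi\in\mathcal{S}(\mathbb{R}^{2d})$ (usual modifications). The notation "$\forall\sigma\in X\Longrightarrow OP_\tau(\sigma):\mathcal{M}^{p_1,q_1}\to M^{p_2,q_2}$" means that for every $\sigma\in X$ there is $C_\sigma$ with $\|OP_\tau(\sigma)f\|_{M^{p_2,q_2}}\le C_\sigma\|f\|_{M^{p_1,q_1}}$ for all $f\in\mathcal{S}(\mathbb{R}^d)$. *)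

theory Defs
  imports "HOL-Analysis.Analysis" "HOL-Probability.Essential_Supremum"
begin

section \<open>Schwartz functions and tempered distributions\<close>

text \<open>A multi-index is encoded as a list of standard basis vectors, one entry for each
  differentiation; for smooth functions the order of the entries is irrelevant.\<close>

primrec partials :: "'a::euclidean_space list \<Rightarrow> ('a \<Rightarrow> complex) \<Rightarrow> 'a \<Rightarrow> complex" where
  "partials [] f = f"
| "partials (b # bs) f = (\<lambda>x. frechet_derivative (partials bs f) (at x) b)"

definition smooth :: "('a::euclidean_space \<Rightarrow> complex) \<Rightarrow> bool" where
  "smooth f \<longleftrightarrow> (\<forall>bs\<in>lists Basis. \<forall>x. partials bs f differentiable (at x))"

definition schwartz :: "('a::euclidean_space \<Rightarrow> complex) set" where
  "schwartz = {f. smooth f \<and>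
     (\<forall>k. \<forall>bs\<in>lists Basis. bdd_above (range (\<lambda>x. norm x ^ k * cmod (partials bs f x))))}"

definition schwartz_seminorm ::
    "nat \<Rightarrow> 'a::euclidean_space list \<Rightarrow> ('a \<Rightarrow> complex) \<Rightarrow> real" where
  "schwartz_seminorm k bs f = (SUP x. norm x ^ k * cmod (partials bs f x))"

text \<open>Since the pairing of a distribution with a test function extends
  \<open>\<integral> f * cnj g\<close>, a tempered distribution is a continuous \<^emph>\<open>conjugate-linear\<close> functional
  on the Schwartz space. Continuity for the topology generated by the seminorms is expressed by
  domination by finitely many of them. The values of the functional outside the Schwartz space
  are irrelevant: nothing below ever depends on them.\<close>

definition tempered :: "(('a::euclidean_space \<Rightarrow> complex) \<Rightarrow> complex) set" where
  "tempered = {u.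
     (\<forall>f\<in>schwartz. \<forall>g\<in>schwartz. u (\<lambda>x. f x + g x) = u f + u g) \<and>
     (\<forall>c. \<forall>f\<in>schwartz. u (\<lambda>x. c * f x) = cnj c * u f) \<and>
     (\<exists>C N. \<forall>f\<in>schwartz.
        cmod (u f) \<le> C * (\<Sum>k\<le>N. \<Sum>bs\<in>{bs\<in>lists Basis. length bs \<le> N}. schwartz_seminorm k bs f))}"

text \<open>The embedding of functions into distributions.\<close>

definition pairing :: "('a::euclidean_space \<Rightarrow> complex) \<Rightarrow> ('a \<Rightarrow> complex) \<Rightarrow> complex" where
  "pairing f g = (LINT x|lborel. f x * cnj (g x))"

section \<open>Mixed norms\<close>

text \<open>The power \<open>x\<^sup>r\<close> is only used with \<open>0 < r < \<infinity>\<close>.\<close>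

definition ennreal_powr :: "ennreal \<Rightarrow> real \<Rightarrow> ennreal" where
  "ennreal_powr x r = (if x = \<infinity> then \<infinity> else ennreal (enn2real x powr r))"

definition Lp_norm :: "ennreal \<Rightarrow> ('a::euclidean_space \<Rightarrow> ennreal) \<Rightarrow> ennreal" where
  "Lp_norm p f =
     (if p = \<infinity> then esssup lborel f
      else ennreal_powr (\<integral>\<^sup>+ x. ennreal_powr (f x) (enn2real p) \<partial>lborel) (1 / enn2real p))"

text \<open>For extended nonnegative reals, \<open>inverse 0 = \<infinity>\<close> and \<open>inverse \<infinity> = 0\<close>.\<close>

definition conj_exponent :: "ennreal \<Rightarrow> ennreal" where
  "conj_exponent p = inverse (1 - inverse p)"

lemma conj_exponent:
  assumes "1 \<le> p"
  shows "1 / p + 1 / conj_exponent p = 1"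
proof (cases p)
  case top
  then show ?thesis by (simp add: conj_exponent_def divide_ennreal_def)
next
  case (real r)
  then have r: "1 \<le> r" using assms by (metis ennreal_1 ennreal_le_iff)
  have inv: "inverse p = ennreal (inverse r)" using real r by (simp add: inverse_ennreal)
  have diff: "1 - inverse p = ennreal (1 - inverse r)"
    unfolding inv using r by (metis ennreal_1 ennreal_minus inverse_nonnegative_iff_nonnegative real(1))
  show ?thesis
  proof (cases "r = 1")
    case True
    then show ?thesis using real by (simp add: conj_exponent_def divide_ennreal_def)
  next
    case False
    then have pos: "0 < 1 - inverse r" using r by (simp add: field_simps)
    have "inverse (conj_exponent p) = ennreal (1 - inverse r)"
      unfolding conj_exponent_def diff using pos by (simp add: inverse_ennreal)
    then show ?thesis
      using pos r by (simp add: divide_ennreal_def inv flip: ennreal_plus)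
  qed
qed

section \<open>Modulation and Wiener amalgam spaces\<close>

definition translation :: "'a::euclidean_space \<Rightarrow> ('a \<Rightarrow> complex) \<Rightarrow> 'a \<Rightarrow> complex" where
  "translation x g = (\<lambda>t. g (t - x))"

definition modulation :: "'a::euclidean_space \<Rightarrow> ('a \<Rightarrow> complex) \<Rightarrow> 'a \<Rightarrow> complex" where
  "modulation \<xi> g = (\<lambda>t. exp (2 * pi * \<i> * (t \<bullet> \<xi>)) * g t)"

definition STFT ::
    "('a::euclidean_space \<Rightarrow> complex) \<Rightarrow> (('a \<Rightarrow> complex) \<Rightarrow> complex) \<Rightarrow> 'a \<Rightarrow> 'a \<Rightarrow> complex" where
  "STFT \<phi> u x \<xi> = u (modulation \<xi> (translation x \<phi>))"

definition modulation_norm ::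
    "('a::euclidean_space \<Rightarrow> complex) \<Rightarrow> ennreal \<Rightarrow> ennreal \<Rightarrow> (('a \<Rightarrow> complex) \<Rightarrow> complex) \<Rightarrow> ennreal" where
  "modulation_norm \<phi> p q u = Lp_norm q (\<lambda>\<xi>. Lp_norm p (\<lambda>x. ennreal (cmod (STFT \<phi> u x \<xi>))))"

definition amalgam_norm ::
    "('a::euclidean_space \<Rightarrow> complex) \<Rightarrow> ennreal \<Rightarrow> ennreal \<Rightarrow> (('a \<Rightarrow> complex) \<Rightarrow> complex) \<Rightarrow> ennreal" where
  "amalgam_norm \<Phi> p q u = Lp_norm q (\<lambda>\<zeta>. Lp_norm p (\<lambda>z. ennreal (cmod (STFT \<Phi> u \<zeta> (- z)))))"

definition wiener_amalgam ::
    "('a::euclidean_space \<Rightarrow> complex) \<Rightarrow> ennreal \<Rightarrow> ennreal \<Rightarrow> (('a \<Rightarrow> complex) \<Rightarrow> complex) set" where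
  "wiener_amalgam \<Phi> p q = {u\<in>tempered. amalgam_norm \<Phi> p q u < \<infinity>}"

section \<open>Pseudodifferential operators\<close>

definition tau_wigner ::
    "real \<Rightarrow> ('a::euclidean_space \<Rightarrow> complex) \<Rightarrow> ('a \<Rightarrow> complex) \<Rightarrow> 'a \<times> 'a \<Rightarrow> complex" where
  "tau_wigner \<tau> f\<^sub>1 f\<^sub>2 = (\<lambda>(x, \<xi>).
     LINT t|lborel. f\<^sub>1 (x + \<tau> *\<^sub>R t) * cnj (f\<^sub>2 (x - (1 - \<tau>) *\<^sub>R t)) * exp (- 2 * pi * \<i> * (\<xi> \<bullet> t)))"

definition OP ::
    "real \<Rightarrow> (('a::euclidean_space \<times> 'a \<Rightarrow> complex) \<Rightarrow> complex)
     \<Rightarrow> ('a \<Rightarrow> complex) \<Rightarrow> ('a \<Rightarrow> complex) \<Rightarrow> complex" where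
  "OP \<tau> \<sigma> f = (\<lambda>g. \<sigma> (tau_wigner \<tau> g f))"

text \<open>Boundedness from the closure of the Schwartz space in \<open>M\<^bsup>p1,q1\<^esup>\<close> into \<open>M\<^bsup>p2,q2\<^esup>\<close> is the
  estimate on Schwartz functions. There the right-hand side is finite, so the estimate includes
  that \<open>T f\<close> lies in \<open>M\<^bsup>p2,q2\<^esup>\<close>.\<close>

definition bounded_on_modulation ::
    "('a::euclidean_space \<Rightarrow> complex) \<Rightarrow> ennreal \<Rightarrow> ennreal \<Rightarrow> ennreal \<Rightarrow> ennreal
     \<Rightarrow> (('a \<Rightarrow> complex) \<Rightarrow> (('a \<Rightarrow> complex) \<Rightarrow> complex)) \<Rightarrow> bool" where
  "bounded_on_modulation \<phi> p\<^sub>1 q\<^sub>1 p\<^sub>2 q\<^sub>2 T \<longleftrightarrow>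
     (\<exists>C::real. \<forall>f\<in>schwartz.
        modulation_norm \<phi> p\<^sub>2 q\<^sub>2 (T f) \<le> ennreal C * modulation_norm \<phi> p\<^sub>1 q\<^sub>1 (pairing f))"

end

theory Submission
  imports Defs "HOL-Probability.Probability"
begin

text \<open>
  With the window \<open>W\<^sub>\<tau>(\<phi>, \<phi>)\<close> the short-time Fourier transform of \<open>W\<^sub>\<tau>(g, f)\<close> is, up to a phase and a shear
  of the variables, the product of those of \<open>g\<close> and \<open>f\<close>. Hence, by the reproducing formula, that of \<open>OP\<^sub>\<tau>(\<sigma>) f\<close>
  is dominated by an integral of \<open>\<bar>V\<sigma>\<bar>\<close> against shifted copies of \<open>\<bar>Vf\<bar>\<close> and a rapidly decaying kernel, and
  sufficiency is a matter of the inequalities of H\<ouml>lder, Young and Minkowski, followed by the inclusions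
  between modulation spaces. For necessity, Moyal's identity shows that symbols which are superpositions of
  Wigner distributions of dilated Gaussians act in a transparent way. Wide, narrow and chirped Gaussians of
  scale \<open>2 ^ i\<close> have time-frequency content spread along the time axis, the frequency axis and the diagonal,
  and comparing the growth rates of their norms yields the inequalities between the exponents one by one.
\<close>

section \<open>Calculus of Schwartz functions\<close>

text \<open>The constant in the boundedness estimate may depend on the symbol, so a sequence of
  symbols with worse and worse quotients refutes nothing by itself. The sequence is therefore packed
  into one symbol, a series with geometric weights that still lies in the Wiener amalgam space and
  whose operator alone violates every estimate. With D = 2 ^ d, d the dimension, the squared L2
  norms of the test families grow like D ^ i, and their mixed norms like D ^ (i / r), where r is the
  exponent of the variable along which the family spreads. Each condition then reads 1 \<le> E + F
  for two reciprocal exponents, and a gap 1 - E - F > 0 leaves room for the weights. For a chirp the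
  outer exponent r is decisive in both orders of integration; this yields
  \<open>conj_exponent q\<^sub>2\<close> \<le> \<open>conj_exponent q\<close> for \<tau> = 0 and
  \<open>q\<^sub>1\<close> \<le> \<open>conj_exponent q\<close> for \<tau> = 1. In the other
  direction a distribution is a bare functional on functions, so taking it inside an integral of
  test functions has to be justified by finite sums that converge in all the seminorms that control
  it.\<close>

definition pd :: "'a::euclidean_space \<Rightarrow> ('a \<Rightarrow> complex) \<Rightarrow> 'a \<Rightarrow> complex" where
  "pd b f = (\<lambda>x. frechet_derivative f (at x) b)"

lemma partials_Cons: "partials (b # bs) f = pd b (partials bs f)"
  by (simp add: pd_def)

text \<open>\<open>partials\<close> applies the head of the list last. Peeling off the innermost
  derivative instead lets a property of all derivatives of f pass to \<open>pd b f\<close>.\<close>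

lemma partials_snoc: "partials (bs @ [b]) f = partials bs (pd b f)"
  by (induction bs) (simp_all add: pd_def)

declare partials.simps(2) [simp del]

lemma pd_eqI: "(\<And>x. (f has_derivative f' x) (at x)) \<Longrightarrow> pd b f = (\<lambda>x. f' x b)"
  unfolding pd_def by (metis frechet_derivative_at)

text \<open>The invariant of a coinduction: membership in a set closed under differentiation gives
  smoothness, and with a bound valid on the whole set also bounds for all derivatives. This replaces
  explicit formulas for higher derivatives.\<close>

definition deriv_closed :: "('a::euclidean_space \<Rightarrow> complex) set \<Rightarrow> bool" where
  "deriv_closed A \<longleftrightarrow> (\<forall>f\<in>A. (\<forall>x. f differentiable (at x)) \<and> (\<forall>b\<in>Basis. pd b f \<in> A))"

lemma deriv_closedI:
  assumes "\<And>f. f \<in> A \<Longrightarrow> \<exists>f'. (\<forall>x. (f has_derivative f' x) (at x)) \<and> (\<forall>b\<in>Basis. (\<lambda>x. f' x b) \<in> A)"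
  shows "deriv_closed A"
  unfolding deriv_closed_def
proof (intro ballI conjI allI)
  fix f assume "f \<in> A"
  then obtain f' where f': "\<And>x. (f has_derivative f' x) (at x)" "\<And>b. b \<in> Basis \<Longrightarrow> (\<lambda>x. f' x b) \<in> A"
    using assms by metis
  show "f differentiable (at x)" for x using f'(1) differentiable_def by blast
  show "pd b f \<in> A" if "b \<in> Basis" for b
    using f'(2)[OF that] by (simp add: pd_eqI[OF f'(1)])
qed

lemma deriv_closedD:
  assumes "deriv_closed A" "f \<in> A"
  shows "(f has_derivative (\<lambda>h. pd h f x)) (at x)" "b \<in> Basis \<Longrightarrow> pd b f \<in> A"
  using assms frechet_derivative_works unfolding deriv_closed_def pd_def by blast+

lemma deriv_closed_partials:
  assumes "deriv_closed A" "f \<in> A" "bs \<in> lists Basis"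
  shows "partials bs f \<in> A"
  using assms(3)
proof (induction bs)
  case (Cons b bs)
  then show ?case using deriv_closedD[OF assms(1)] by (simp add: partials_Cons)
qed (use assms in simp)

lemma smooth_coinduct: "deriv_closed A \<Longrightarrow> f \<in> A \<Longrightarrow> smooth f"
  using deriv_closed_partials unfolding smooth_def deriv_closed_def by blast

lemma smooth_has_derivative:
  assumes "smooth f"
  shows "(f has_derivative (\<lambda>h. pd h f x)) (at x)"
proof -
  have "f differentiable (at x)"
    using assms unfolding smooth_def by (metis lists.Nil partials.simps(1))
  then show ?thesis using frechet_derivative_works unfolding pd_def by blast
qed

lemma pd_sum_Basis:
  assumes "smooth f"
  shows "pd h f x = (\<Sum>b\<in>Basis. of_real (h \<bullet> b) * pd b f x)"
proof -
  have "bounded_linear (\<lambda>h. pd h f x)"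
    using smooth_has_derivative[OF assms] by (rule has_derivative_bounded_linear)
  then interpret bounded_linear "\<lambda>h. pd h f x" .
  have "pd h f x = pd (\<Sum>b\<in>Basis. (h \<bullet> b) *\<^sub>R b) f x"
    by (simp add: euclidean_representation)
  also have "\<dots> = (\<Sum>b\<in>Basis. of_real (h \<bullet> b) * pd b f x)"
    by (simp add: sum scale scaleR_conv_of_real)
  finally show ?thesis .
qed

lemma ball_lists_snoc: "(\<forall>bs\<in>lists Basis. P (partials bs f)) \<Longrightarrow> b \<in> Basis \<Longrightarrow> \<forall>bs\<in>lists Basis. P (partials bs (pd b f))"
  by (auto simp flip: partials_snoc)

lemma smooth_pd: "smooth f \<Longrightarrow> b \<in> Basis \<Longrightarrow> smooth (pd b f)"
  unfolding smooth_def by (rule ball_lists_snoc)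

lemma smooth_continuous: "smooth f \<Longrightarrow> continuous_on UNIV f"
  by (meson continuous_at_imp_continuous_on has_derivative_continuous smooth_has_derivative)

text \<open>The weight 1 + |x|, unlike |x|, is at least 1 and submultiplicative under translations
  and products, so decay of different orders combines without case distinctions.
  \<open>rapid_iff\<close> links it to the seminorms.\<close>

definition rapid :: "('a::euclidean_space \<Rightarrow> complex) \<Rightarrow> bool" where
  "rapid f \<longleftrightarrow> (\<forall>k. \<exists>C. \<forall>x. (1 + norm x) ^ k * cmod (f x) \<le> C)"

lemma one_plus_power_le:
  fixes n :: real assumes "n \<ge> 0"
  shows "(1 + n) ^ k \<le> 2 ^ k * (1 + n ^ k)"
proof -
  have "(1 + n) ^ k \<le> (2 * max 1 n) ^ k" using assms by (intro power_mono) auto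
  also have "\<dots> = 2 ^ k * (max 1 n) ^ k" by (simp add: power_mult_distrib)
  also have "(max 1 n) ^ k \<le> 1 + n ^ k" using assms by (auto simp: max_def)
  finally show ?thesis by simp
qed

lemma rapid_iff: "rapid f \<longleftrightarrow> (\<forall>k. bdd_above (range (\<lambda>x. norm x ^ k * cmod (f x))))"
proof safe
  fix k assume "rapid f"
  then obtain C where C: "\<And>x. (1 + norm x) ^ k * cmod (f x) \<le> C" unfolding rapid_def by blast
  have "norm x ^ k * cmod (f x) \<le> C" for x
    by (rule order_trans[OF mult_right_mono C]) (auto intro: power_mono)
  then show "bdd_above (range (\<lambda>x. norm x ^ k * cmod (f x)))" by (auto intro!: bdd_aboveI)
next
  assume *: "\<forall>k. bdd_above (range (\<lambda>x. norm x ^ k * cmod (f x)))"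
  show "rapid f" unfolding rapid_def
  proof
    fix k
    obtain C where C: "\<And>x. norm x ^ k * cmod (f x) \<le> C"
      using * unfolding bdd_above_def by blast
    obtain D where D: "\<And>x. norm x ^ 0 * cmod (f x) \<le> D"
      using *[rule_format, of 0] unfolding bdd_above_def by blast
    have "(1 + norm x) ^ k * cmod (f x) \<le> 2 ^ k * (D + C)" for x
    proof -
      have "(1 + norm x) ^ k * cmod (f x) \<le> 2 ^ k * (1 + norm x ^ k) * cmod (f x)"
        by (intro mult_right_mono one_plus_power_le) auto
      also have "\<dots> = 2 ^ k * (cmod (f x) + norm x ^ k * cmod (f x))" by (simp add: algebra_simps)
      also have "\<dots> \<le> 2 ^ k * (D + C)" using C[of x] D[of x] by (intro mult_left_mono) auto
      finally show ?thesis .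
    qed
    then show "\<exists>C. \<forall>x. (1 + norm x) ^ k * cmod (f x) \<le> C" by blast
  qed
qed

lemma schwartz_iff: "f \<in> schwartz \<longleftrightarrow> smooth f \<and> (\<forall>bs\<in>lists Basis. rapid (partials bs f))"
  unfolding schwartz_def rapid_iff by auto

lemma schwartz_coinduct:
  assumes "deriv_closed A" "\<And>g. g \<in> A \<Longrightarrow> rapid g" "f \<in> A"
  shows "f \<in> schwartz"
  using assms deriv_closed_partials smooth_coinduct schwartz_iff by blast

lemma deriv_closed_image:
  assumes "\<And>f x. f \<in> S \<Longrightarrow> (T f has_derivative F f x) (at x)"
    and "\<And>f b. f \<in> S \<Longrightarrow> b \<in> Basis \<Longrightarrow> (\<lambda>x. F f x b) \<in> T ` S"
  shows "deriv_closed (T ` S)"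
proof (rule deriv_closedI)
  fix h assume "h \<in> T ` S"
  then obtain f where h: "h = T f" and f: "f \<in> S" by (rule imageE)
  show "\<exists>f'. (\<forall>x. (h has_derivative f' x) (at x)) \<and> (\<forall>b\<in>Basis. (\<lambda>x. f' x b) \<in> T ` S)"
    unfolding h by (rule exI[of _ "F f"], intro conjI allI ballI assms f)
qed

text \<open>The coinduction in the form used for operations on functions: the invariant is the image
  of S under T, so it suffices that a derivative of \<open>T f\<close> is T of another element. S
  need not consist of Schwartz functions; below it is also a set of pairs and the set of
  multipliers.\<close>

lemma schwartz_image:
  assumes "f \<in> S" "\<And>f x. f \<in> S \<Longrightarrow> (T f has_derivative F f x) (at x)"
    and "\<And>f b. f \<in> S \<Longrightarrow> b \<in> Basis \<Longrightarrow> (\<lambda>x. F f x b) \<in> T ` S"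
    and "\<And>f. f \<in> S \<Longrightarrow> rapid (T f)"
  shows "T f \<in> schwartz"
proof (rule schwartz_coinduct[OF deriv_closed_image[of S T F]])
  show "rapid g" if "g \<in> T ` S" for g using that by (rule imageE) (simp add: assms(4))
qed (use assms in auto)

lemma schwartz_smooth: "f \<in> schwartz \<Longrightarrow> smooth f"
  and schwartz_rapid: "f \<in> schwartz \<Longrightarrow> rapid f"
  unfolding schwartz_iff by (auto dest: bspec[of _ _ "[]"])

lemma schwartz_pd: "f \<in> schwartz \<Longrightarrow> b \<in> Basis \<Longrightarrow> pd b f \<in> schwartz"
  unfolding schwartz_iff using ball_lists_snoc[of rapid] by (blast intro: smooth_pd)

lemma schwartz_partials: "f \<in> schwartz \<Longrightarrow> bs \<in> lists Basis \<Longrightarrow> partials bs f \<in> schwartz"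
  by (induction bs) (auto simp: partials_Cons schwartz_pd)

lemma schwartz_deriv_closed: "deriv_closed schwartz"
  unfolding deriv_closed_def
  using schwartz_pd smooth_has_derivative[OF schwartz_smooth] differentiableI by blast

lemma schwartz_has_derivative: "f \<in> schwartz \<Longrightarrow> (f has_derivative (\<lambda>h. pd h f x)) (at x)"
  by (simp add: schwartz_smooth smooth_has_derivative)

lemma schwartz_continuous: "f \<in> schwartz \<Longrightarrow> continuous_on UNIV f"
  by (simp add: schwartz_smooth smooth_continuous)

lemma schwartz_measurable: "f \<in> schwartz \<Longrightarrow> f \<in> borel_measurable borel"
  by (simp add: schwartz_continuous borel_measurable_continuous_onI)

lemma rapidE:
  assumes "rapid f"
  obtains C where "C > 0" "\<And>x. (1 + norm x) ^ k * cmod (f x) \<le> C"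
proof -
  obtain C where C: "\<And>x. (1 + norm x) ^ k * cmod (f x) \<le> C" using assms unfolding rapid_def by blast
  show thesis by (rule that[of "max C 1"]) (use C in \<open>auto simp: le_max_iff_disj\<close>)
qed

lemma rapid_add: "rapid f \<Longrightarrow> rapid g \<Longrightarrow> rapid (\<lambda>x. f x + g x)"
  unfolding rapid_def
proof
  fix k
  assume f: "\<forall>k. \<exists>C. \<forall>x. (1 + norm x) ^ k * cmod (f x) \<le> C" and g: "\<forall>k. \<exists>C. \<forall>x. (1 + norm x) ^ k * cmod (g x) \<le> C"
  obtain C D where C: "\<And>x. (1 + norm x) ^ k * cmod (f x) \<le> C"
    and D: "\<And>x. (1 + norm x) ^ k * cmod (g x) \<le> D" using f g by metis
  have "(1 + norm x) ^ k * cmod (f x + g x) \<le> C + D" for x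
  proof -
    have "(1 + norm x) ^ k * cmod (f x + g x) \<le> (1 + norm x) ^ k * (cmod (f x) + cmod (g x))"
      by (intro mult_left_mono norm_triangle_ineq) auto
    then show ?thesis using C[of x] D[of x] by (simp add: algebra_simps)
  qed
  then show "\<exists>C. \<forall>x. (1 + norm x) ^ k * cmod (f x + g x) \<le> C" by blast
qed

lemma rapid_bound:
  assumes "rapid g" "\<And>x. cmod (f x) \<le> K * (1 + norm x) ^ m * cmod (g x)"
  shows "rapid f"
  unfolding rapid_def
proof
  fix k
  obtain C where C: "C > 0" "\<And>x. (1 + norm x) ^ (k + m) * cmod (g x) \<le> C"
    using rapidE[OF assms(1)] by blast
  have "(1 + norm x) ^ k * cmod (f x) \<le> \<bar>K\<bar> * C" for x
  proof -
    have "(1 + norm x) ^ k * cmod (f x) \<le> (1 + norm x) ^ k * (\<bar>K\<bar> * (1 + norm x) ^ m * cmod (g x))"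
      by (intro mult_left_mono order_trans[OF assms(2)] mult_right_mono) auto
    also have "\<dots> = \<bar>K\<bar> * ((1 + norm x) ^ (k + m) * cmod (g x))" by (simp add: power_add algebra_simps)
    also have "\<dots> \<le> \<bar>K\<bar> * C" using C by (intro mult_left_mono) auto
    finally show ?thesis .
  qed
  then show "\<exists>C. \<forall>x. (1 + norm x) ^ k * cmod (f x) \<le> C" by blast
qed

subsection \<open>Multipliers\<close>

text \<open>The multipliers of the Schwartz space: smooth functions all of whose derivatives have
  polynomial growth. The phases of the Fourier transform and the chirps belong to it.\<close>

definition slow :: "('a::euclidean_space \<Rightarrow> complex) set" where
  "slow = {f. smooth f \<and>
     (\<forall>bs\<in>lists Basis. \<exists>k C. \<forall>x. cmod (partials bs f x) \<le> C * (1 + norm x) ^ k)}"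

lemma slow_coinduct:
  assumes "deriv_closed A" "\<And>g. g \<in> A \<Longrightarrow> \<exists>k C. \<forall>x. cmod (g x) \<le> C * (1 + norm x) ^ k" "f \<in> A"
  shows "f \<in> slow"
  using assms deriv_closed_partials[OF assms(1,3)] smooth_coinduct unfolding slow_def by blast

lemma slow_smooth: "f \<in> slow \<Longrightarrow> smooth f"
  by (simp add: slow_def)

lemma slow_bound:
  assumes "f \<in> slow" obtains k C where "C > 0" "\<And>x. cmod (f x) \<le> C * (1 + norm x) ^ k"
proof -
  obtain k C where C: "\<And>x. cmod (f x) \<le> C * (1 + norm x) ^ k"
    using assms unfolding slow_def mem_Collect_eq by (metis lists.Nil partials.simps(1))
  have "cmod (f x) \<le> max C 1 * (1 + norm x) ^ k" for x
    by (rule order_trans[OF C mult_right_mono]) auto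
  then show thesis using that[of "max C 1" k] by simp
qed

lemma slow_pd: "f \<in> slow \<Longrightarrow> b \<in> Basis \<Longrightarrow> pd b f \<in> slow"
  unfolding slow_def mem_Collect_eq
  using ball_lists_snoc[of "\<lambda>f. \<exists>k C. \<forall>x. cmod (f x) \<le> C * (1 + norm x) ^ k"] by (blast intro: smooth_pd)

lemma slow_deriv_closed: "deriv_closed slow"
  unfolding deriv_closed_def
  using slow_pd smooth_has_derivative[OF slow_smooth] differentiableI by blast

lemma schwartz_slow: "f \<in> schwartz \<Longrightarrow> f \<in> slow"
proof (rule slow_coinduct[OF schwartz_deriv_closed])
  fix g :: "'a \<Rightarrow> complex" assume "g \<in> schwartz"
  then obtain C where "\<And>x. (1 + norm x) ^ 0 * cmod (g x) \<le> C"
    using rapidE schwartz_rapid by metis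
  then show "\<exists>k C. \<forall>x. cmod (g x) \<le> C * (1 + norm x) ^ k"
    by (intro exI[of _ 0] exI[of _ C]) auto
qed

text \<open>The Leibniz rule turns one product into a sum of two, so a set of products is not closed
  under differentiation, but its finite sums are.\<close>

inductive_set sumspan :: "('a \<Rightarrow> complex) set \<Rightarrow> ('a \<Rightarrow> complex) set" for A where
  base: "f \<in> A \<Longrightarrow> f \<in> sumspan A"
| add: "f \<in> sumspan A \<Longrightarrow> g \<in> sumspan A \<Longrightarrow> (\<lambda>x. f x + g x) \<in> sumspan A"

lemma deriv_closed_sumspan:
  assumes "\<And>f. f \<in> A \<Longrightarrow> \<exists>f'. (\<forall>x. (f has_derivative f' x) (at x)) \<and> (\<forall>b\<in>Basis. (\<lambda>x. f' x b) \<in> sumspan A)"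
  shows "deriv_closed (sumspan A)"
proof (rule deriv_closedI)
  fix f assume "f \<in> sumspan A"
  then show "\<exists>f'. (\<forall>x. (f has_derivative f' x) (at x)) \<and> (\<forall>b\<in>Basis. (\<lambda>x. f' x b) \<in> sumspan A)"
  proof induction
    case (base f)
    then show ?case using assms by blast
  next
    case (add f g)
    then obtain f' g' where *: "\<And>x. (f has_derivative f' x) (at x)" "\<And>b. b\<in>Basis \<Longrightarrow> (\<lambda>x. f' x b) \<in> sumspan A"
      "\<And>x. (g has_derivative g' x) (at x)" "\<And>b. b\<in>Basis \<Longrightarrow> (\<lambda>x. g' x b) \<in> sumspan A"
      by metis
    show ?case
      by (rule exI[of _ "\<lambda>x h. f' x h + g' x h"])
        (auto intro!: has_derivative_add * sumspan.add)
  qed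
qed

definition products :: "('a \<Rightarrow> complex) set \<Rightarrow> ('a \<Rightarrow> complex) set \<Rightarrow> ('a \<Rightarrow> complex) set" where
  "products X Y = (\<lambda>(f, g) x. f x * g x) ` (X \<times> Y)"

lemma productsI: "f \<in> X \<Longrightarrow> g \<in> Y \<Longrightarrow> (\<lambda>x. f x * g x) \<in> products X Y"
  unfolding products_def by (rule image_eqI[of _ _ "(f, g)"]) auto

lemma productsE:
  assumes "h \<in> products X Y" obtains f g where "h = (\<lambda>x. f x * g x)" "f \<in> X" "g \<in> Y"
  using assms unfolding products_def by auto

lemma deriv_closed_mult:
  assumes "deriv_closed X" "deriv_closed Y"
  shows "deriv_closed (sumspan (products X Y))"
proof (rule deriv_closed_sumspan)
  fix h assume "h \<in> products X Y"
  then obtain f g where h: "h = (\<lambda>x. f x * g x)" and fg: "f \<in> X" "g \<in> Y" by (rule productsE)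
  have d: "(h has_derivative (\<lambda>v. f x * pd v g x + pd v f x * g x)) (at x)" for x
    unfolding h by (rule has_derivative_mult[OF deriv_closedD(1)[OF assms(1) fg(1)] deriv_closedD(1)[OF assms(2) fg(2)]])
  show "\<exists>f'. (\<forall>x. (h has_derivative f' x) (at x)) \<and> (\<forall>b\<in>Basis. (\<lambda>x. f' x b) \<in> sumspan (products X Y))"
    by (rule exI[of _ "\<lambda>x v. f x * pd v g x + pd v f x * g x"])
      (intro conjI allI ballI d sumspan.add sumspan.base productsI fg
        deriv_closedD(2)[OF assms(1) fg(1)] deriv_closedD(2)[OF assms(2) fg(2)])
qed

lemma schwartz_slow_mult:
  assumes "f \<in> slow" "g \<in> schwartz"
  shows "(\<lambda>x. f x * g x) \<in> schwartz"
proof (rule schwartz_coinduct[OF deriv_closed_mult[OF slow_deriv_closed schwartz_deriv_closed]])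
  fix h :: "'a \<Rightarrow> complex" assume "h \<in> sumspan (products slow schwartz)"
  then show "rapid h"
  proof induction
    case (base h)
    then obtain f g where h: "h = (\<lambda>x. f x * g x)" and fg: "f \<in> slow" "g \<in> schwartz" by (rule productsE)
    obtain k C where C: "C > 0" "\<And>x. cmod (f x) \<le> C * (1 + norm x) ^ k"
      using slow_bound[OF fg(1)] by blast
    show ?case
      by (rule rapid_bound[OF schwartz_rapid[OF fg(2)], of _ C k])
        (use C in \<open>auto simp: h norm_mult intro!: mult_right_mono\<close>)
  qed (rule rapid_add)
qed (intro sumspan.base productsI assms)

lemma slow_bound_add:
  assumes "\<exists>k C. \<forall>x. cmod (f x) \<le> C * (1 + norm x) ^ k" "\<exists>k C. \<forall>x. cmod (g x) \<le> C * (1 + norm x) ^ k"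
  shows "\<exists>k C. \<forall>x::'a::real_normed_vector. cmod (f x + g x) \<le> C * (1 + norm x) ^ k"
proof -
  obtain k C l D where *: "\<And>x. cmod (f x) \<le> C * (1 + norm x) ^ k" "\<And>x. cmod (g x) \<le> D * (1 + norm x) ^ l"
    using assms by metis
  have "cmod (f x + g x) \<le> (\<bar>C\<bar> + \<bar>D\<bar>) * (1 + norm x) ^ (k + l)" for x
  proof -
    have "cmod (f x) \<le> \<bar>C\<bar> * (1 + norm x) ^ (k + l)"
      by (rule order_trans[OF *(1) mult_mono]) (auto intro: power_increasing)
    moreover have "cmod (g x) \<le> \<bar>D\<bar> * (1 + norm x) ^ (k + l)"
      by (rule order_trans[OF *(2) mult_mono]) (auto intro: power_increasing)
    ultimately show ?thesis using norm_triangle_ineq[of "f x" "g x"] by (simp add: algebra_simps)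
  qed
  then show ?thesis by blast
qed

lemma slow_mult:
  assumes "f \<in> slow" "g \<in> slow"
  shows "(\<lambda>x. f x * g x) \<in> slow"
proof (rule slow_coinduct[OF deriv_closed_mult[OF slow_deriv_closed slow_deriv_closed]])
  fix h :: "'a \<Rightarrow> complex" assume "h \<in> sumspan (products slow slow)"
  then show "\<exists>k C. \<forall>x. cmod (h x) \<le> C * (1 + norm x) ^ k"
  proof induction
    case (base h)
    then obtain f g where h: "h = (\<lambda>x. f x * g x)" and fg: "f \<in> slow" "g \<in> slow" by (rule productsE)
    obtain k C where C: "C > 0" "\<And>x. cmod (f x) \<le> C * (1 + norm x) ^ k"
      using slow_bound[OF fg(1)] by blast
    obtain l D where D: "D > 0" "\<And>x. cmod (g x) \<le> D * (1 + norm x) ^ l"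
      using slow_bound[OF fg(2)] by blast
    have "cmod (h x) \<le> (C * D) * (1 + norm x) ^ (k + l)" for x
    proof -
      have "cmod (h x) \<le> (C * (1 + norm x) ^ k) * (D * (1 + norm x) ^ l)"
        unfolding h norm_mult using C D by (intro mult_mono) auto
      then show ?thesis by (simp add: power_add mult_ac)
    qed
    then show ?case by blast
  qed (rule slow_bound_add)
qed (intro sumspan.base productsI assms)

lemma deriv_closed_add:
  assumes "deriv_closed X" shows "deriv_closed (sumspan X)"
proof (rule deriv_closed_sumspan)
  fix f assume f: "f \<in> X"
  show "\<exists>f'. (\<forall>x. (f has_derivative f' x) (at x)) \<and> (\<forall>b\<in>Basis. (\<lambda>x. f' x b) \<in> sumspan X)"
    using deriv_closedD[OF assms f] by (intro exI[of _ "\<lambda>x h. pd h f x"]) (simp add: sumspan.base)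
qed

lemma schwartz_add:
  assumes "f \<in> schwartz" "g \<in> schwartz"
  shows "(\<lambda>x. f x + g x) \<in> schwartz"
proof (rule schwartz_coinduct[OF deriv_closed_add[OF schwartz_deriv_closed]])
  fix h :: "'a \<Rightarrow> complex" assume "h \<in> sumspan schwartz"
  then show "rapid h" by induction (simp_all add: schwartz_rapid rapid_add)
qed (intro sumspan.intros assms)

lemma slow_add:
  assumes "f \<in> slow" "g \<in> slow"
  shows "(\<lambda>x. f x + g x) \<in> slow"
proof (rule slow_coinduct[OF deriv_closed_add[OF slow_deriv_closed]])
  fix h :: "'a \<Rightarrow> complex" assume "h \<in> sumspan slow"
  then show "\<exists>k C. \<forall>x. cmod (h x) \<le> C * (1 + norm x) ^ k"
  proof induction
    case (base f)
    then show ?case using slow_bound[of f] by metis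
  qed (rule slow_bound_add)
qed (intro sumspan.intros assms)

lemma slow_const: "(\<lambda>x. c) \<in> slow"
proof (rule slow_coinduct[of "range (\<lambda>c x. c)"])
  show "deriv_closed (range (\<lambda>(c::complex) (x::'a). c))"
  proof (rule deriv_closedI)
    fix f :: "'a \<Rightarrow> complex" assume "f \<in> range (\<lambda>c x. c)"
    then obtain c where f: "f = (\<lambda>x. c)" by blast
    show "\<exists>f'. (\<forall>x. (f has_derivative f' x) (at x)) \<and> (\<forall>b\<in>Basis. (\<lambda>x. f' x b) \<in> range (\<lambda>c x. c))"
      by (rule exI[of _ "\<lambda>x h. 0"]) (simp add: f)
  qed
  show "\<exists>k C. \<forall>x. cmod (g x) \<le> C * (1 + norm x) ^ k" if g: "g \<in> range (\<lambda>c (x::'a). c)" for g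
  proof -
    obtain c where "g = (\<lambda>x. c)" using g by blast
    then have "\<forall>x. cmod (g x) \<le> cmod c * (1 + norm x) ^ 0" by simp
    then show ?thesis by blast
  qed
qed auto

lemma schwartz_cmult: "f \<in> schwartz \<Longrightarrow> (\<lambda>x. c * f x) \<in> schwartz"
  by (rule schwartz_slow_mult[OF slow_const])

lemma schwartz_mult: "f \<in> schwartz \<Longrightarrow> g \<in> schwartz \<Longrightarrow> (\<lambda>x. f x * g x) \<in> schwartz"
  by (rule schwartz_slow_mult[OF schwartz_slow])

lemma schwartz_zero: "(\<lambda>x. 0) \<in> schwartz"
proof (rule schwartz_coinduct[of "{\<lambda>x. 0}"])
  show "deriv_closed {\<lambda>x::'a. 0::complex}"
    by (rule deriv_closedI, rule exI[of _ "\<lambda>x h. 0"]) simp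
qed (auto simp: rapid_def)

lemma schwartz_sum: "finite I \<Longrightarrow> (\<And>i. i \<in> I \<Longrightarrow> f i \<in> schwartz) \<Longrightarrow> (\<lambda>x. \<Sum>i\<in>I. f i x) \<in> schwartz"
  by (induction I rule: finite_induct) (simp_all add: schwartz_zero schwartz_add)

lemma schwartz_diff:
  assumes "f \<in> schwartz" "g \<in> schwartz"
  shows "(\<lambda>x. f x - g x) \<in> schwartz"
  using schwartz_add[OF assms(1) schwartz_cmult[OF assms(2), of "-1"]] by simp

lemma slow_sum: "finite I \<Longrightarrow> (\<And>i. i \<in> I \<Longrightarrow> f i \<in> slow) \<Longrightarrow> (\<lambda>x. \<Sum>i\<in>I. f i x) \<in> slow"
  by (induction I rule: finite_induct) (simp_all add: slow_const slow_add)

lemma slow_linear: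
  assumes "bounded_linear L"
  shows "(\<lambda>x. of_real (L x)) \<in> slow"
proof (rule slow_coinduct[of "insert (\<lambda>x. of_real (L x)) (range (\<lambda>c x. c))"])
  interpret bounded_linear L by fact
  show "deriv_closed (insert (\<lambda>x. of_real (L x)) (range (\<lambda>c (x::'a). c)))"
  proof (rule deriv_closedI)
    fix f :: "'a \<Rightarrow> complex" assume "f \<in> insert (\<lambda>x. of_real (L x)) (range (\<lambda>c x. c))"
    then consider "f = (\<lambda>x. of_real (L x))" | c where "f = (\<lambda>x. c)" by blast
    then show "\<exists>f'. (\<forall>x. (f has_derivative f' x) (at x)) \<and>
        (\<forall>b\<in>Basis. (\<lambda>x. f' x b) \<in> insert (\<lambda>x. of_real (L x)) (range (\<lambda>c x. c)))"
    proof cases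
      case 1
      show ?thesis unfolding 1
        by (rule exI[of _ "\<lambda>x h. of_real (L h)"])
          (simp add: has_derivative_of_real bounded_linear_imp_has_derivative assms)
    next
      case 2
      then show ?thesis by (intro exI[of _ "\<lambda>x h. 0"]) simp
    qed
  qed
  show "\<exists>k C. \<forall>x. cmod (g x) \<le> C * (1 + norm x) ^ k"
    if g: "g \<in> insert (\<lambda>x. of_real (L x)) (range (\<lambda>c (x::'a). c))" for g
  proof -
    consider "g = (\<lambda>x. of_real (L x))" | c where "g = (\<lambda>x. c)" using g by blast
    then show ?thesis
    proof cases
      case 1
      obtain K where K: "\<And>x. norm (L x) \<le> norm x * K" "K > 0" using pos_bounded by blast
      have "cmod (g x) \<le> K * (1 + norm x) ^ 1" for x
        using K(1)[of x] K(2) by (simp add: 1 algebra_simps)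
      then show ?thesis by blast
    next
      case 2
      then have "\<forall>x. cmod (g x) \<le> cmod c * (1 + norm x) ^ 0" by simp
      then show ?thesis by blast
    qed
  qed
qed auto

text \<open>Differentiating P exp(iQ) replaces P by P' + iPQ', so these functions with P in
  \<open>slow\<close> form a closed set. As Q is real the exponential has modulus 1 and the growth
  is that of P.\<close>

lemma slow_exp_i:
  assumes Q: "(\<lambda>x. complex_of_real (Q x)) \<in> slow"
  shows "(\<lambda>x. exp (\<i> * of_real (Q x))) \<in> slow"
proof (rule slow_coinduct)
  let ?Q = "\<lambda>x. complex_of_real (Q x)"
  let ?T = "\<lambda>P x. P x * exp (\<i> * ?Q x)"
  show "deriv_closed (?T ` slow)"
  proof (rule deriv_closed_image)
    fix P :: "'a \<Rightarrow> complex" assume P: "P \<in> slow"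
    show "(?T P has_derivative (\<lambda>v. (pd v P x + P x * (\<i> * pd v ?Q x)) * exp (\<i> * ?Q x))) (at x)" for x
    proof -
      have "((\<lambda>x. exp (\<i> * ?Q x)) has_derivative (\<lambda>v. exp (\<i> * ?Q x) * (\<i> * pd v ?Q x))) (at x)"
        by (rule has_derivative_compose[OF has_derivative_mult_right[OF smooth_has_derivative[OF slow_smooth[OF Q]]]
              DERIV_exp[unfolded has_field_derivative_def]])
      from has_derivative_mult[OF smooth_has_derivative[OF slow_smooth[OF P]] this]
      show ?thesis by (simp add: algebra_simps)
    qed
    show "(\<lambda>x. (pd b P x + P x * (\<i> * pd b ?Q x)) * exp (\<i> * ?Q x)) \<in> ?T ` slow" if "b \<in> Basis" for b
      using that by (intro image_eqI[where f = ?T, OF refl] slow_add slow_mult slow_pd slow_const P Q)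
  qed
  show "\<exists>k C. \<forall>x. cmod (g x) \<le> C * (1 + norm x) ^ k" if "g \<in> ?T ` slow" for g
    using that
  proof (rule imageE)
    fix P :: "'a \<Rightarrow> complex" assume g: "g = ?T P" and P: "P \<in> slow"
    show ?thesis using slow_bound[OF P] by (simp add: g norm_mult norm_exp_i_times) blast
  qed
  show "(\<lambda>x. exp (\<i> * of_real (Q x))) \<in> ?T ` slow"
    by (rule image_eqI[OF _ slow_const[of 1]]) simp
qed

lemma slow_inner:
  fixes L M :: "'a::euclidean_space \<Rightarrow> 'b::euclidean_space"
  assumes "bounded_linear L" "bounded_linear M"
  shows "(\<lambda>x. complex_of_real (L x \<bullet> M x)) \<in> slow"
proof -
  have "(\<lambda>x. \<Sum>b\<in>Basis. complex_of_real (L x \<bullet> b) * complex_of_real (M x \<bullet> b)) \<in> slow"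
    by (intro slow_sum slow_mult slow_linear bounded_linear_inner_left_comp assms) auto
  moreover have "complex_of_real (L x \<bullet> M x) = (\<Sum>b\<in>Basis. complex_of_real (L x \<bullet> b) * complex_of_real (M x \<bullet> b))" for x
    unfolding euclidean_inner[of "L x" "M x"] by simp
  ultimately show ?thesis by simp
qed

lemma slow_chirp:
  fixes L M :: "'a::euclidean_space \<Rightarrow> 'b::euclidean_space" and r :: real
  assumes "bounded_linear L" "bounded_linear M"
  shows "(\<lambda>x. exp (\<i> * of_real (r * (L x \<bullet> M x)))) \<in> slow"
proof (rule slow_exp_i)
  show "(\<lambda>x. complex_of_real (r * (L x \<bullet> M x))) \<in> slow"
    using slow_mult[OF slow_const slow_inner[OF assms], of "of_real r"] by simp
qed

lemma slow_character: "(\<lambda>x. exp (\<i> * of_real (r * (x \<bullet> a)))) \<in> slow"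
proof (rule slow_exp_i)
  show "(\<lambda>x. complex_of_real (r * (x \<bullet> a))) \<in> slow"
    by (rule slow_linear) (intro bounded_linear_mult_const bounded_linear_inner_left bounded_linear_const_mult)
qed

subsection \<open>Changes of variables\<close>

lemma schwartz_cnj:
  assumes "f \<in> schwartz" shows "(\<lambda>x. cnj (f x)) \<in> schwartz"
proof (rule schwartz_image[OF assms])
  fix f :: "'a \<Rightarrow> complex" assume f: "f \<in> schwartz"
  show "((\<lambda>x. cnj (f x)) has_derivative (\<lambda>v. cnj (pd v f x))) (at x)" for x
    by (rule has_derivative_cnj[OF schwartz_has_derivative[OF f]])
  show "(\<lambda>x. cnj (pd b f x)) \<in> (\<lambda>f x. cnj (f x)) ` schwartz" if "b \<in> Basis" for b
    by (rule image_eqI[OF refl schwartz_pd[OF f that]])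
  show "rapid (\<lambda>x. cnj (f x))" using schwartz_rapid[OF f] by (simp add: rapid_def)
qed

text \<open>The lower bound on |L x| converts decay in \<open>L x\<close> into decay in x. It allows
  L to go into a larger space; in the applications L is a shear of a product.\<close>

lemma schwartz_linear_comp:
  fixes L :: "'a::euclidean_space \<Rightarrow> 'b::euclidean_space"
  assumes "bounded_linear L" and inj: "\<And>x. norm x \<le> K * norm (L x)" and f: "f \<in> schwartz"
  shows "(\<lambda>x. f (L x)) \<in> schwartz"
proof (rule schwartz_image[OF f])
  interpret bounded_linear L by fact
  fix f :: "'b \<Rightarrow> complex" assume f: "f \<in> schwartz"
  show "((\<lambda>x. f (L x)) has_derivative (\<lambda>v. pd (L v) f (L x))) (at x)" for x
    by (rule has_derivative_compose[OF bounded_linear_imp_has_derivative[OF assms(1)] schwartz_has_derivative[OF f]])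
  \<comment> \<open>\<open>L b\<close> is in general no basis vector, so the derivative in this
    direction is expanded in partial derivatives to see that it is a Schwartz function.\<close>
  show "(\<lambda>x. pd (L b) f (L x)) \<in> (\<lambda>f x. f (L x)) ` schwartz" for b
  proof (rule image_eqI[OF refl])
    have "(\<lambda>y. \<Sum>c\<in>Basis. of_real (L b \<bullet> c) * pd c f y) \<in> schwartz"
      by (intro schwartz_sum schwartz_cmult schwartz_pd f) auto
    then show "pd (L b) f \<in> schwartz"
      unfolding pd_sum_Basis[OF schwartz_smooth[OF f], of "L b", symmetric] .
  qed
  let ?g = "\<lambda>x. f (L x)"
  show "rapid ?g" unfolding rapid_def
  proof
    fix k
    obtain C where C: "C > 0" "\<And>x. (1 + norm x) ^ k * cmod (f x) \<le> C"
      using rapidE schwartz_rapid f by metis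
    have "(1 + norm x) ^ k * cmod (?g x) \<le> (1 + \<bar>K\<bar>) ^ k * C" for x
    proof -
      have "norm x \<le> \<bar>K\<bar> * norm (L x)"
        by (rule order_trans[OF inj mult_right_mono]) auto
      then have "1 + norm x \<le> (1 + \<bar>K\<bar>) * (1 + norm (L x))"
      proof -
        have "(1 + \<bar>K\<bar>) * (1 + norm (L x)) = 1 + \<bar>K\<bar> + norm (L x) + \<bar>K\<bar> * norm (L x)"
          by (simp add: algebra_simps)
        then show ?thesis
          using \<open>norm x \<le> \<bar>K\<bar> * norm (L x)\<close> norm_ge_zero[of "L x"] abs_ge_zero[of K] by linarith
      qed
      then have "(1 + norm x) ^ k \<le> ((1 + \<bar>K\<bar>) * (1 + norm (L x))) ^ k"
        by (intro power_mono) auto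
      then have "(1 + norm x) ^ k * cmod (?g x) \<le> ((1 + \<bar>K\<bar>) * (1 + norm (L x))) ^ k * cmod (f (L x))"
        by (intro mult_right_mono) auto
      also have "\<dots> = (1 + \<bar>K\<bar>) ^ k * ((1 + norm (L x)) ^ k * cmod (f (L x)))"
        by (simp add: power_mult_distrib)
      also have "\<dots> \<le> (1 + \<bar>K\<bar>) ^ k * C" using C by (intro mult_left_mono) auto
      finally show ?thesis .
    qed
    then show "\<exists>C. \<forall>x. (1 + norm x) ^ k * cmod (?g x) \<le> C" by blast
  qed
qed

lemma one_plus_le_mult:
  fixes a b n :: real
  assumes "n \<le> a + b" "a \<ge> 0" "b \<ge> 0" shows "1 + n \<le> (1 + a) * (1 + b)"
proof -
  have "(1 + a) * (1 + b) = 1 + a + b + a * b" by (simp add: algebra_simps)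
  then show ?thesis using assms mult_nonneg_nonneg[OF assms(2,3)] by linarith
qed

lemma one_plus_norm_shift: "1 + norm x \<le> (1 + norm a) * (1 + norm (x - a))"
  using norm_triangle_ineq[of a "x - a"] by (intro one_plus_le_mult) auto

lemma schwartz_translation:
  assumes "f \<in> schwartz" shows "(\<lambda>x. f (x - a)) \<in> schwartz"
proof (rule schwartz_image[OF assms])
  fix f :: "'a \<Rightarrow> complex" assume f: "f \<in> schwartz"
  show "((\<lambda>x. f (x - a)) has_derivative (\<lambda>v. pd v f (x - a))) (at x)" for x
    by (rule has_derivative_compose[OF _ schwartz_has_derivative[OF f]]) (auto intro!: derivative_eq_intros)
  show "(\<lambda>x. pd b f (x - a)) \<in> (\<lambda>f x. f (x - a)) ` schwartz" if "b \<in> Basis" for b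
    by (rule image_eqI[OF refl schwartz_pd[OF f that]])
  let ?g = "\<lambda>x. f (x - a)"
  show "rapid ?g" unfolding rapid_def
  proof
    fix k
    obtain C where C: "C > 0" "\<And>x. (1 + norm x) ^ k * cmod (f x) \<le> C"
      using rapidE schwartz_rapid f by metis
    have "(1 + norm x) ^ k * cmod (?g x) \<le> (1 + norm a) ^ k * C" for x
    proof -
      have "(1 + norm x) ^ k * cmod (?g x) \<le> ((1 + norm a) * (1 + norm (x - a))) ^ k * cmod (f (x - a))"
        by (intro mult_right_mono power_mono one_plus_norm_shift) auto
      also have "\<dots> = (1 + norm a) ^ k * ((1 + norm (x - a)) ^ k * cmod (f (x - a)))"
        by (simp add: power_mult_distrib)
      also have "\<dots> \<le> (1 + norm a) ^ k * C" using C by (intro mult_left_mono) auto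
      finally show ?thesis .
    qed
    then show "\<exists>C. \<forall>x. (1 + norm x) ^ k * cmod (?g x) \<le> C" by blast
  qed
qed

lemma schwartz_tensor_fst_snd:
  fixes f :: "'a::euclidean_space \<Rightarrow> complex" and g :: "'b::euclidean_space \<Rightarrow> complex"
  assumes "f \<in> schwartz" "g \<in> schwartz"
  shows "(\<lambda>z. f (fst z) * g (snd z)) \<in> schwartz"
proof -
  define T :: "('a \<Rightarrow> complex) \<times> ('b \<Rightarrow> complex) \<Rightarrow> 'a \<times> 'b \<Rightarrow> complex"
    where "T = (\<lambda>(f, g) z. f (fst z) * g (snd z))"
  have "T (f, g) \<in> schwartz"
  proof (rule schwartz_image)
    show "(f, g) \<in> schwartz \<times> schwartz" using assms by simp
  next
    fix h :: "('a \<Rightarrow> complex) \<times> ('b \<Rightarrow> complex)" and z :: "'a \<times> 'b" assume "h \<in> schwartz \<times> schwartz"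
    then have fg: "fst h \<in> schwartz" "snd h \<in> schwartz" by auto
    have 1: "((\<lambda>z. fst h (fst z)) has_derivative (\<lambda>v. pd (fst v) (fst h) (fst z))) (at z)"
      by (rule has_derivative_compose[OF has_derivative_fst[OF has_derivative_ident] schwartz_has_derivative[OF fg(1)]])
    have 2: "((\<lambda>z. snd h (snd z)) has_derivative (\<lambda>v. pd (snd v) (snd h) (snd z))) (at z)"
      by (rule has_derivative_compose[OF has_derivative_snd[OF has_derivative_ident] schwartz_has_derivative[OF fg(2)]])
    show "(T h has_derivative
        (\<lambda>v. fst h (fst z) * pd (snd v) (snd h) (snd z) + pd (fst v) (fst h) (fst z) * snd h (snd z))) (at z)"
      unfolding T_def case_prod_unfold by (rule has_derivative_mult[OF 1 2])
  next
    fix h :: "('a \<Rightarrow> complex) \<times> ('b \<Rightarrow> complex)" and b :: "'a \<times> 'b"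
    assume "h \<in> schwartz \<times> schwartz" and b: "b \<in> Basis"
    then have fg: "fst h \<in> schwartz" "snd h \<in> schwartz" by auto
    have 0: "pd 0 (fst h) x = 0" "pd 0 (snd h) y = 0" for x y
      using linear_0[OF bounded_linear.linear[OF has_derivative_bounded_linear[OF schwartz_has_derivative[OF fg(1)]]]]
        linear_0[OF bounded_linear.linear[OF has_derivative_bounded_linear[OF schwartz_has_derivative[OF fg(2)]]]]
      by auto
    let ?F = "\<lambda>z::'a \<times> 'b. fst h (fst z) * pd (snd b) (snd h) (snd z) + pd (fst b) (fst h) (fst z) * snd h (snd z)"
    \<comment> \<open>A basis vector of the product has one vanishing component. One Leibniz term
      therefore drops out by \<open>0\<close>, and the derivative is again a tensor product.\<close>
    consider u where "u \<in> Basis" "b = (u, 0)" | v where "v \<in> Basis" "b = (0, v)"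
      using b by (auto simp: Basis_prod_def)
    then show "?F \<in> T ` (schwartz \<times> schwartz)"
    proof cases
      case 1
      then have "?F = T (pd u (fst h), snd h)" by (simp add: T_def 0)
      then show ?thesis by (rule image_eqI) (use 1 fg schwartz_pd in auto)
    next
      case 2
      then have "?F = T (fst h, pd v (snd h))" by (simp add: T_def 0)
      then show ?thesis by (rule image_eqI) (use 2 fg schwartz_pd in auto)
    qed
  next
    fix h :: "('a \<Rightarrow> complex) \<times> ('b \<Rightarrow> complex)" assume "h \<in> schwartz \<times> schwartz"
    then obtain f g where h: "h = (f, g)" and fg: "f \<in> schwartz" "g \<in> schwartz" by auto
    show "rapid (T h)" unfolding rapid_def h T_def prod.case
    proof
    fix k
    obtain C where C: "C > 0" "\<And>x. (1 + norm x) ^ k * cmod (f x) \<le> C"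
      using rapidE schwartz_rapid fg by metis
    obtain D where D: "D > 0" "\<And>x. (1 + norm x) ^ k * cmod (g x) \<le> D"
      using rapidE schwartz_rapid fg by metis
    have "(1 + norm z) ^ k * cmod (f (fst z) * g (snd z)) \<le> C * D" for z
    proof -
      obtain x y where z: "z = (x, y)" by (cases z)
      have "1 + norm z \<le> (1 + norm x) * (1 + norm y)"
        using norm_Pair_le[of x y] by (intro one_plus_le_mult) (auto simp: z)
      then have "(1 + norm z) ^ k \<le> ((1 + norm x) * (1 + norm y)) ^ k" by (intro power_mono) auto
      then have "(1 + norm z) ^ k * cmod (f (fst z) * g (snd z)) \<le> ((1 + norm x) * (1 + norm y)) ^ k * cmod (f x * g y)"
        unfolding z fst_conv snd_conv by (rule mult_right_mono) simp
      also have "\<dots> = ((1 + norm x) ^ k * cmod (f x)) * ((1 + norm y) ^ k * cmod (g y))"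
        by (simp add: power_mult_distrib norm_mult mult_ac)
      also have "\<dots> \<le> C * D" using C D by (intro mult_mono) auto
      finally show ?thesis .
    qed
    then show "\<exists>C. \<forall>x. (1 + norm x) ^ k * cmod (f (fst x) * g (snd x)) \<le> C" by blast
  qed
  qed
  then show ?thesis by (simp add: T_def)
qed

lemma schwartz_tensor: "f \<in> schwartz \<Longrightarrow> g \<in> schwartz \<Longrightarrow> (\<lambda>(x, y). f x * g y) \<in> schwartz"
  unfolding case_prod_unfold by (rule schwartz_tensor_fst_snd)

section \<open>Integrals of Schwartz functions\<close>

text \<open>The standard integrable majorant. The exponent 2d is large enough for (1 + |x|)^(2d) to
  dominate a product of d one-dimensional quadratic factors.\<close>

definition wt :: "'a::euclidean_space \<Rightarrow> real" where
  "wt x = 1 / (1 + norm x) ^ (2 * DIM('a))"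

lemma wt_pos: "0 < wt x" and wt_le_1: "wt x \<le> 1"
proof -
  have "0 < (1 + norm x) ^ k" for k by (intro zero_less_power) (simp add: add_pos_nonneg)
  moreover have "1 \<le> (1 + norm x) ^ k" for k by (intro one_le_power) simp
  ultimately show "0 < wt x" "wt x \<le> 1" unfolding wt_def by (simp_all add: divide_le_eq_1)
qed

lemma wt_nonneg [simp]: "0 \<le> wt x"
  using wt_pos less_imp_le by blast

lemma measurable_wt [measurable]: "wt \<in> borel_measurable borel"
  unfolding wt_def[abs_def] by measurable

text \<open>\<open>wt x\<close> is at most the product over the coordinates of 1 / (1 + t^2), and
  Tonelli reduces the integral to a power of the arctangent integral.\<close>

lemma nn_integral_wt: "(\<integral>\<^sup>+ x. ennreal (wt (x::'a::euclidean_space)) \<partial>lborel) < \<infinity>"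
proof -
  let ?J = "\<integral>\<^sup>+ (x::real). ennreal (inverse (1 + x\<^sup>2)) \<partial>lborel"
  have J: "?J < \<infinity>"
  proof -
    have e: "einterval (-\<infinity>) \<infinity> = (UNIV :: real set)" by (auto simp: einterval_def)
    have "integrable lborel (\<lambda>x::real. inverse (1 + x\<^sup>2))"
      using integrable_inverse_1_plus_square unfolding set_integrable_def e by simp
    then show ?thesis by (subst nn_integral_eq_integral) (auto simp: add_nonneg_nonneg)
  qed
  have "(\<integral>\<^sup>+ x. ennreal (wt x) \<partial>(lborel :: 'a measure)) \<le>
    (\<integral>\<^sup>+ x. (\<Prod>b\<in>Basis. ennreal (inverse (1 + (x \<bullet> b)\<^sup>2))) \<partial>(lborel :: 'a measure))"
  proof (rule nn_integral_mono)
    fix x :: 'a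
    have "(\<Prod>b\<in>Basis. 1 + (x \<bullet> b)\<^sup>2) \<le> (\<Prod>b\<in>(Basis :: 'a set). (1 + norm x)\<^sup>2)"
    proof (rule prod_mono)
      fix b :: 'a assume b: "b \<in> Basis"
      have "\<bar>x \<bullet> b\<bar>\<^sup>2 \<le> (norm x)\<^sup>2" using Basis_le_norm[OF b, of x] by (intro power_mono) auto
      then show "0 \<le> 1 + (x \<bullet> b)\<^sup>2 \<and> 1 + (x \<bullet> b)\<^sup>2 \<le> (1 + norm x)\<^sup>2"
        by (simp add: power2_sum) (smt (verit) norm_ge_zero)
    qed
    also have "\<dots> = (1 + norm x) ^ (2 * DIM('a))" by (simp flip: power_mult)
    finally have le: "(\<Prod>b\<in>Basis. 1 + (x \<bullet> b)\<^sup>2) \<le> (1 + norm x) ^ (2 * DIM('a))" .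
    have pos: "0 < (\<Prod>b\<in>Basis. 1 + (x \<bullet> b)\<^sup>2)" by (intro prod_pos) (simp add: add_pos_nonneg)
    have "wt x \<le> inverse (\<Prod>b\<in>Basis. 1 + (x \<bullet> b)\<^sup>2)"
      unfolding wt_def using le_imp_inverse_le[OF le pos] by (simp add: inverse_eq_divide)
    then show "ennreal (wt x) \<le> (\<Prod>b\<in>Basis. ennreal (inverse (1 + (x \<bullet> b)\<^sup>2)))"
      by (subst prod_ennreal) (auto simp: prod_inversef[symmetric] o_def add_nonneg_nonneg intro!: ennreal_leI)
  qed
  also have "\<dots> = (\<Prod>b\<in>(Basis::'a set). ?J)"
    by (rule nn_integral_lborel_prod) auto
  also have "\<dots> < \<infinity>" using J by (simp add: power_less_top_ennreal)
  finally show ?thesis .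
qed

lemma integrable_wt: "integrable lborel wt"
  using nn_integral_wt by (intro integrableI_bounded) auto

lemma rapid_wt_bound:
  assumes "rapid (f :: 'a::euclidean_space \<Rightarrow> complex)"
  obtains C where "C > 0" "\<And>x. (1 + norm x) ^ k * cmod (f x) \<le> C * wt x ^ m"
proof -
  obtain C where C: "C > 0" "\<And>x. (1 + norm x) ^ (k + 2 * DIM('a) * m) * cmod (f x) \<le> C"
    using rapidE[OF assms] by blast
  have "(1 + norm x) ^ k * cmod (f x) \<le> C * wt x ^ m" for x
  proof -
    have "0 < (1 + norm x) ^ (2 * DIM('a) * m)" by (intro zero_less_power) (simp add: add_pos_nonneg)
    then show ?thesis using C(2)[of x]
      by (simp add: wt_def power_divide power_mult[symmetric] pos_le_divide_eq power_add mult_ac)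
  qed
  then show thesis using that C(1) by blast
qed

lemma rapid_integrable:
  assumes "rapid f" "f \<in> borel_measurable borel"
  shows "integrable lborel f"
proof -
  obtain C where C: "C > 0" "\<And>x. (1 + norm x) ^ 0 * cmod (f x) \<le> C * wt x ^ 1"
    using rapid_wt_bound[OF assms(1)] by blast
  show ?thesis
    by (rule Bochner_Integration.integrable_bound[of _ "\<lambda>x. C * wt x"])
      (use assms C in \<open>simp_all add: integrable_wt abs_mult\<close>)
qed

lemma schwartz_integrable: "f \<in> schwartz \<Longrightarrow> integrable lborel f"
  by (simp add: rapid_integrable schwartz_rapid schwartz_measurable)

lemma one_plus_norm_Pair:
  "(1 + norm w) ^ m * (1 + norm t) ^ k \<le> (1 + norm (w, t)) ^ (m + k)"
proof -
  have "norm w \<le> norm (w, t)" "norm t \<le> norm (w, t)"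
    using norm_fst_le[of w t] norm_snd_le[of t w] by auto
  then show ?thesis unfolding power_add by (intro mult_mono power_mono) auto
qed

lemma rapid_prod_bound:
  fixes K :: "'w::euclidean_space \<times> 'a::euclidean_space \<Rightarrow> complex"
  assumes "rapid K"
  obtains C where "C > 0" "\<And>w t. (1 + norm t) ^ k * cmod (K (w, t)) \<le> C * wt w ^ m"
proof -
  obtain C where C: "C > 0" "\<And>x. (1 + norm x) ^ (2 * DIM('w) * m + k) * cmod (K x) \<le> C"
    using rapidE[OF assms] by blast
  have "(1 + norm t) ^ k * cmod (K (w, t)) \<le> C * wt w ^ m" for w t
  proof -
    have "(1 + norm w) ^ (2 * DIM('w) * m) * (1 + norm t) ^ k * cmod (K (w, t)) \<le> C"
      by (rule order_trans[OF mult_right_mono[OF one_plus_norm_Pair] C(2)]) simp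
    moreover have "0 < (1 + norm w) ^ (2 * DIM('w) * m)" by (intro zero_less_power) (simp add: add_pos_nonneg)
    ultimately show ?thesis
      by (simp add: wt_def power_divide power_mult[symmetric] pos_le_divide_eq mult_ac)
  qed
  then show thesis using that C(1) by blast
qed

text \<open>The mean value inequality bounds each increment by B w times the step, hence the
  remainder divided by the step by 2 B w. This majorant is integrable, and dominated convergence
  along sequences sends the remainder of the integral to 0.\<close>

lemma has_derivative_integral_dominated:
  fixes f :: "'w::euclidean_space \<Rightarrow> 'a::euclidean_space \<Rightarrow> complex"
  assumes f': "\<And>w x. (f w has_derivative f' w x) (at x)"
    and B: "\<And>w x h. norm (f' w x h) \<le> B w * norm h" "integrable lborel B"
    and int: "\<And>x. integrable lborel (\<lambda>w. f w x)"
    and meas: "\<And>x h. (\<lambda>w. f' w x h) \<in> borel_measurable borel"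
  shows "((\<lambda>x. LINT w|lborel. f w x) has_derivative (\<lambda>h. LINT w|lborel. f' w x h)) (at x)"
proof -
  have lin: "bounded_linear (f' w x)" for w x using f' by (rule has_derivative_bounded_linear)
  have B0: "B w \<ge> 0" for w
  proof -
    obtain b :: 'a where "b \<in> Basis" using nonempty_Basis by blast
    then show ?thesis using order_trans[OF norm_ge_zero B(1)[of w 0 b]] by simp
  qed
  have int': "integrable lborel (\<lambda>w. f' w x h)" for h
    by (rule Bochner_Integration.integrable_bound[of _ "\<lambda>w. B w * norm h"])
      (use B meas B0 in \<open>auto intro!: integrable_mult_left\<close>)
  have lip: "norm (f w y - f w x) \<le> B w * norm (y - x)" for w y
    by (rule differentiable_bound[of UNIV _ "f' w"]) (auto intro!: f' B onorm_bound B0 simp: mult.commute)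
  have "bounded_linear (\<lambda>h. LINT w|lborel. f' w x h)"
  proof (rule bounded_linear_intro[where K="LINT w|lborel. B w"])
    fix h k :: 'a and r :: real
    show "(LINT w|lborel. f' w x (h + k)) = (LINT w|lborel. f' w x h) + (LINT w|lborel. f' w x k)"
      using int' by (simp add: linear_add[OF bounded_linear.linear[OF lin]])
    show "(LINT w|lborel. f' w x (r *\<^sub>R h)) = r *\<^sub>R (LINT w|lborel. f' w x h)"
      by (simp add: linear_scale[OF bounded_linear.linear[OF lin]])
    have "norm (LINT w|lborel. f' w x h) \<le> (LINT w|lborel. B w * norm h)"
      by (rule Bochner_Integration.integral_norm_bound_integral[OF int']) (use B in auto)
    then show "norm (LINT w|lborel. f' w x h) \<le> norm h * (LINT w|lborel. B w)"
      by (simp add: mult.commute)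
  qed
  moreover have "((\<lambda>y. ((LINT w|lborel. f w y) - (LINT w|lborel. f w x) - (LINT w|lborel. f' w x (y - x))) /\<^sub>R norm (y - x)) \<longlongrightarrow> 0) (at x)"
    unfolding tendsto_at_iff_sequentially o_def
  proof (intro allI impI)
    fix X assume X: "\<forall>i. X i \<in> UNIV - {x}" "X \<longlonglongrightarrow> x"
    let ?g = "\<lambda>i w. (f w (X i) - f w x - f' w x (X i - x)) /\<^sub>R norm (X i - x)"
    have "(\<lambda>i. LINT w|lborel. ?g i w) \<longlonglongrightarrow> (LINT (w::'w)|lborel. 0)"
    proof (rule integral_dominated_convergence[where w="\<lambda>w. 2 * B w"])
      show "?g i \<in> borel_measurable lborel" for i
        using int[THEN borel_measurable_integrable] meas by measurable
      show "AE w in lborel. (\<lambda>i. ?g i w) \<longlonglongrightarrow> 0"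
      proof (intro always_eventually allI)
        fix w
        have "((\<lambda>y. (f w y - f w x - f' w x (y - x)) /\<^sub>R norm (y - x)) \<longlongrightarrow> 0) (at x)"
          using f'[of w x] unfolding has_derivative_def by simp
        then show "(\<lambda>i. ?g i w) \<longlonglongrightarrow> 0"
          using X unfolding tendsto_at_iff_sequentially o_def by blast
      qed
      show "AE w in lborel. norm (?g i w) \<le> 2 * B w" for i
      proof (intro always_eventually allI)
        fix w
        have n: "norm (X i - x) > 0" using X by simp
        have "norm (f w (X i) - f w x - f' w x (X i - x)) \<le> B w * norm (X i - x) + B w * norm (X i - x)"
          by (rule order_trans[OF norm_triangle_ineq4 add_mono[OF lip B(1)]])
        then show "norm (?g i w) \<le> 2 * B w" using n by (simp add: divide_simps mult_ac)
      qed
    qed (use B in auto)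
    moreover have e: "(LINT w|lborel. ?g i w) =
      ((LINT w|lborel. f w (X i)) - (LINT w|lborel. f w x) - (LINT w|lborel. f' w x (X i - x))) /\<^sub>R norm (X i - x)" for i
      using int int' by simp
    ultimately show "(\<lambda>i. ((LINT w|lborel. f w (X i)) - (LINT w|lborel. f w x) - (LINT w|lborel. f' w x (X i - x))) /\<^sub>R norm (X i - x)) \<longlonglongrightarrow> 0"
      by (simp only: e Bochner_Integration.integral_zero)
  qed
  ultimately show ?thesis unfolding has_derivative_def by simp
qed

subsection \<open>Sections and marginals\<close>

lemma Pair0_Basis: "b \<in> Basis \<Longrightarrow> (0, b) \<in> Basis"
  by (simp add: Basis_prod_def)

text \<open>From here on a family of test functions is one Schwartz function K of a pair (w, t) in
  which w is the parameter. The joint decay of K then supplies every uniformity in w that is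
  required.\<close>

lemma section_has_derivative:
  fixes K :: "'w::euclidean_space \<times> 'a::euclidean_space \<Rightarrow> complex"
  assumes "K \<in> schwartz"
  shows "((\<lambda>t. K (w, t)) has_derivative (\<lambda>v. pd (0, v) K (w, t))) (at t)"
  by (rule has_derivative_compose[OF has_derivative_Pair[OF has_derivative_const has_derivative_ident]
        schwartz_has_derivative[OF assms]])

lemma rapid_section:
  fixes K :: "'w::euclidean_space \<times> 'a::euclidean_space \<Rightarrow> complex"
  assumes "rapid K" shows "rapid (\<lambda>t. K (w, t))"
  unfolding rapid_def
proof
  fix k
  obtain C where "\<And>w t. (1 + norm t) ^ k * cmod (K (w, t)) \<le> C * wt w ^ 0"
    using rapid_prod_bound[OF assms] by blast
  then show "\<exists>C. \<forall>t. (1 + norm t) ^ k * cmod (K (w, t)) \<le> C" by auto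
qed

lemma schwartz_section:
  fixes K :: "'w::euclidean_space \<times> 'a::euclidean_space \<Rightarrow> complex"
  assumes "K \<in> schwartz" shows "(\<lambda>t. K (w, t)) \<in> schwartz"
proof (rule schwartz_image[OF assms])
  fix K :: "'w \<times> 'a \<Rightarrow> complex" assume K: "K \<in> schwartz"
  show "((\<lambda>t. K (w, t)) has_derivative (\<lambda>v. pd (0, v) K (w, t))) (at t)" for t
    by (rule section_has_derivative[OF K])
  show "(\<lambda>t. pd (0, b) K (w, t)) \<in> (\<lambda>(K :: 'w \<times> 'a \<Rightarrow> complex) t. K (w, t)) ` schwartz" if "b \<in> Basis" for b
    by (rule image_eqI[where x = "pd (0, b) K"], rule refl, rule schwartz_pd[OF K Pair0_Basis[OF that]])
  show "rapid (\<lambda>t. K (w, t))" by (rule rapid_section[OF schwartz_rapid[OF K]])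
qed

lemma partials_section:
  fixes K :: "'w::euclidean_space \<times> 'a::euclidean_space \<Rightarrow> complex"
  assumes "K \<in> schwartz" "bs \<in> lists Basis"
  shows "partials bs (\<lambda>t. K (w, t)) = (\<lambda>t. partials (map (Pair 0) bs) K (w, t))"
  using assms(2)
proof (induction bs)
  case (Cons b bs)
  have "partials (map (Pair 0) bs) K \<in> schwartz"
    using Cons.hyps by (intro schwartz_partials assms(1)) (auto simp: Pair0_Basis)
  from pd_eqI[OF section_has_derivative[OF this]]
  show ?case unfolding partials_Cons list.map Cons.IH .
qed simp

lemma schwartz_section_integrable:
  fixes K :: "'w::euclidean_space \<times> 'a::euclidean_space \<Rightarrow> complex"
  assumes "K \<in> schwartz" shows "integrable lborel (\<lambda>w. K (w, t))"
proof -
  obtain C where C: "C > 0" "\<And>w t. (1 + norm t) ^ 0 * cmod (K (w, t)) \<le> C * wt w ^ 1"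
    using rapid_prod_bound[OF schwartz_rapid[OF assms]] by blast
  have [measurable]: "K \<in> borel_measurable borel" by (rule schwartz_measurable[OF assms])
  show ?thesis
    by (rule Bochner_Integration.integrable_bound[of _ "\<lambda>x. C * wt x"])
      (use C in \<open>simp_all add: integrable_wt abs_mult\<close>)
qed

text \<open>The integrable majorant for differentiation under the integral: linear in the direction
  v, uniform in t, and integrable in w because of \<open>wt w\<close>.\<close>

lemma schwartz_pd_prod_bound:
  fixes K :: "'w::euclidean_space \<times> 'a::euclidean_space \<Rightarrow> complex"
  assumes "K \<in> schwartz"
  obtains C where "C > 0" "\<And>w t v. cmod (pd (0, v) K (w, t)) \<le> C * wt w * norm v"
proof -
  have "\<exists>C. \<forall>w t. cmod (pd (0, b) K (w, t)) \<le> C * wt w" if "b \<in> Basis" for b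
  proof -
    obtain C where "\<And>w t. (1 + norm t) ^ 0 * cmod (pd (0, b) K (w, t)) \<le> C * wt w ^ 1"
      using rapid_prod_bound[OF schwartz_rapid[OF schwartz_pd[OF assms Pair0_Basis[OF \<open>b \<in> Basis\<close>]]]] by blast
    then show ?thesis by auto
  qed
  then obtain C where C: "\<And>b w t. b \<in> Basis \<Longrightarrow> cmod (pd (0, b) K (w, t)) \<le> C b * wt w" by metis
  have "cmod (pd (0, v) K (w, t)) \<le> ((\<Sum>b\<in>Basis. \<bar>C b\<bar>) + 1) * wt w * norm v" for w t v
  proof -
    have "((\<lambda>t. K (w, t)) has_derivative (\<lambda>v. pd (0, v) K (w, t))) (at t)"
      by (rule section_has_derivative[OF assms])
    then have "bounded_linear (\<lambda>v. pd (0, v) K (w, t))" by (rule has_derivative_bounded_linear)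
    then interpret bounded_linear "\<lambda>v. pd (0, v) K (w, t)" .
    have "pd (0, v) K (w, t) = pd (0, \<Sum>b\<in>Basis. (v \<bullet> b) *\<^sub>R b) K (w, t)"
      by (simp add: euclidean_representation)
    also have "\<dots> = (\<Sum>b\<in>Basis. of_real (v \<bullet> b) * pd (0, b) K (w, t))"
      by (simp add: sum scale scaleR_conv_of_real)
    finally have "cmod (pd (0, v) K (w, t)) \<le> (\<Sum>b\<in>Basis. \<bar>v \<bullet> b\<bar> * cmod (pd (0, b) K (w, t)))"
      by (simp add: norm_mult order_trans[OF norm_sum])
    also have "\<dots> \<le> (\<Sum>b\<in>Basis. norm v * (\<bar>C b\<bar> * wt w))"
    proof (intro sum_mono mult_mono)
      fix b :: 'a assume b: "b \<in> Basis"
      show "\<bar>v \<bullet> b\<bar> \<le> norm v" by (rule Basis_le_norm[OF b])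
      show "cmod (pd (0, b) K (w, t)) \<le> \<bar>C b\<bar> * wt w"
        by (rule order_trans[OF C[OF b] mult_right_mono]) auto
    qed auto
    also have "\<dots> \<le> ((\<Sum>b\<in>Basis. \<bar>C b\<bar>) + 1) * wt w * norm v"
      by (simp add: sum_distrib_left[symmetric] sum_distrib_right[symmetric] mult_ac mult_left_mono)
    finally show ?thesis .
  qed
  moreover have "(\<Sum>b\<in>Basis. \<bar>C b\<bar>) + 1 > 0" by (simp add: sum_nonneg add_nonneg_pos)
  ultimately show thesis using that by blast
qed

lemma marginal_has_derivative:
  fixes K :: "'w::euclidean_space \<times> 'a::euclidean_space \<Rightarrow> complex"
  assumes "K \<in> schwartz"
  shows "((\<lambda>t. LINT w|lborel. K (w, t)) has_derivative (\<lambda>v. LINT w|lborel. pd (0, v) K (w, t))) (at t)"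
proof -
  obtain C where "C > 0" and C: "\<And>w t v. cmod (pd (0, v) K (w, t)) \<le> C * wt w * norm v"
    using schwartz_pd_prod_bound[OF assms] by metis
  show ?thesis
  proof (rule has_derivative_integral_dominated[where f = "\<lambda>w t. K (w, t)"
        and f' = "\<lambda>w t v. pd (0, v) K (w, t)" and B = "\<lambda>w. C * wt w"])
    show "((\<lambda>t. K (w, t)) has_derivative (\<lambda>v. pd (0, v) K (w, t))) (at t)" for w t
      by (rule section_has_derivative[OF assms])
    show "cmod (pd (0, v) K (w, t)) \<le> C * wt w * norm v" for w t v by (rule C)
    show "integrable lborel (\<lambda>w :: 'w. C * wt w)" by (intro integrable_mult_right integrable_wt)
    show "integrable lborel (\<lambda>w. K (w, t))" for t by (rule schwartz_section_integrable[OF assms])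
    fix t v
    have "(\<lambda>x. \<Sum>b\<in>Basis. complex_of_real ((0, v) \<bullet> b) * pd b K x) \<in> schwartz"
      by (intro schwartz_sum schwartz_cmult schwartz_pd assms) auto
    then have "pd (0, v) K \<in> schwartz"
      by (simp only: pd_sum_Basis[OF schwartz_smooth[OF assms], of "(0, v)", symmetric])
    then have [measurable]: "pd (0, v) K \<in> borel_measurable borel" by (rule schwartz_measurable)
    show "(\<lambda>w. pd (0, v) K (w, t)) \<in> borel_measurable borel" by measurable
  qed
qed

lemma schwartz_marginal:
  fixes K :: "'w::euclidean_space \<times> 'a::euclidean_space \<Rightarrow> complex"
  assumes "K \<in> schwartz" shows "(\<lambda>t. LINT w|lborel. K (w, t)) \<in> schwartz"
proof (rule schwartz_image[OF assms])
  fix K :: "'w \<times> 'a \<Rightarrow> complex" assume K: "K \<in> schwartz"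
  show "((\<lambda>t. LINT w|lborel. K (w, t)) has_derivative (\<lambda>v. LINT w|lborel. pd (0, v) K (w, t))) (at t)" for t
    by (rule marginal_has_derivative[OF K])
  show "(\<lambda>t. LINT w|lborel. pd (0, b) K (w, t)) \<in> (\<lambda>(K :: 'w \<times> 'a \<Rightarrow> complex) t. LINT w|lborel. K (w, t)) ` schwartz" if "b \<in> Basis" for b
    by (rule image_eqI[where x = "pd (0, b) K"], rule refl, rule schwartz_pd[OF K Pair0_Basis[OF that]])
  show "rapid (\<lambda>t. LINT w|lborel. K (w, t))"
    unfolding rapid_def
  proof
    fix k
    obtain C where C: "\<And>w t. (1 + norm t) ^ k * cmod (K (w, t)) \<le> C * wt w ^ 1"
      using rapid_prod_bound[OF schwartz_rapid[OF K]] by blast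
    have "(1 + norm t) ^ k * cmod (LINT w|lborel. K (w, t)) \<le> (LINT (w::'w)|lborel. C * wt w)" for t
    proof -
      have "(1 + norm t) ^ k * cmod (LINT w|lborel. K (w, t)) = cmod (LINT w|lborel. of_real ((1 + norm t) ^ k) * K (w, t))"
        by (simp add: norm_mult del: of_real_power)
      also have "\<dots> \<le> (LINT (w::'w)|lborel. C * wt w)"
        using C[of t] schwartz_section_integrable[OF K]
        by (intro Bochner_Integration.integral_norm_bound_integral integrable_mult_right integrable_wt)
          (auto simp: norm_mult simp del: of_real_power)
      finally show ?thesis .
    qed
    then show "\<exists>C. \<forall>t. (1 + norm t) ^ k * cmod (LINT w|lborel. K (w, t)) \<le> C" by blast
  qed
qed

lemma partials_marginal:
  fixes K :: "'w::euclidean_space \<times> 'a::euclidean_space \<Rightarrow> complex"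
  assumes "K \<in> schwartz" "bs \<in> lists Basis"
  shows "partials bs (\<lambda>t. LINT w|lborel. K (w, t)) = (\<lambda>t. LINT w|lborel. partials (map (Pair 0) bs) K (w, t))"
  using assms(2)
proof (induction bs)
  case (Cons b bs)
  have "partials (map (Pair 0) bs) K \<in> schwartz"
    using Cons.hyps by (intro schwartz_partials assms(1)) (auto simp: Pair0_Basis)
  from pd_eqI[OF marginal_has_derivative[OF this]]
  show ?case unfolding partials_Cons list.map Cons.IH .
qed simp

section \<open>Tempered distributions and integrals of test functions\<close>

lemma tempered_add: "u \<in> tempered \<Longrightarrow> f \<in> schwartz \<Longrightarrow> g \<in> schwartz \<Longrightarrow> u (\<lambda>x. f x + g x) = u f + u g"
  and tempered_cmult: "u \<in> tempered \<Longrightarrow> f \<in> schwartz \<Longrightarrow> u (\<lambda>x. c * f x) = cnj c * u f"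
  unfolding tempered_def by blast+

lemma tempered_diff:
  assumes "u \<in> tempered" "f \<in> schwartz" "g \<in> schwartz"
  shows "u (\<lambda>x. f x - g x) = u f - u g"
  using tempered_add[OF assms(1,2) schwartz_cmult[OF assms(3)], of "-1"]
    tempered_cmult[OF assms(1,3), of "-1"] by simp

lemma tempered_sum:
  assumes "u \<in> tempered" "finite I" "\<And>i. i \<in> I \<Longrightarrow> f i \<in> schwartz"
  shows "u (\<lambda>x. \<Sum>i\<in>I. c i * f i x) = (\<Sum>i\<in>I. cnj (c i) * u (f i))"
  using assms(2,3)
proof (induction I rule: finite_induct)
  case empty
  show ?case using tempered_cmult[OF assms(1) schwartz_zero, of 0] by simp
next
  case (insert i I)
  then show ?case
    using tempered_add[OF assms(1) schwartz_cmult[of "f i" "c i"] schwartz_sum[of I "\<lambda>i x. c i * f i x"]]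
    by (simp add: schwartz_cmult tempered_cmult[OF assms(1)])
qed

lemma pd_cmult: "f \<in> schwartz \<Longrightarrow> pd b (\<lambda>x. c * f x) = (\<lambda>x. c * pd b f x)"
  by (rule pd_eqI[OF has_derivative_mult_right[OF schwartz_has_derivative]])

lemma partials_cmult: "f \<in> schwartz \<Longrightarrow> bs \<in> lists Basis \<Longrightarrow> partials bs (\<lambda>x. c * f x) = (\<lambda>x. c * partials bs f x)"
proof (induction bs)
  case (Cons b bs)
  then show ?case by (simp add: partials_Cons pd_cmult schwartz_partials)
qed simp

lemma pd_add: "f \<in> schwartz \<Longrightarrow> g \<in> schwartz \<Longrightarrow> pd b (\<lambda>x. f x + g x) = (\<lambda>x. pd b f x + pd b g x)"
  by (rule pd_eqI[OF has_derivative_add[OF schwartz_has_derivative schwartz_has_derivative]])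

lemma partials_add:
  "f \<in> schwartz \<Longrightarrow> g \<in> schwartz \<Longrightarrow> bs \<in> lists Basis \<Longrightarrow>
    partials bs (\<lambda>x. f x + g x) = (\<lambda>x. partials bs f x + partials bs g x)"
proof (induction bs)
  case (Cons b bs)
  then show ?case by (simp add: partials_Cons pd_add schwartz_partials)
qed simp

lemma partials_diff:
  assumes "f \<in> schwartz" "g \<in> schwartz" "bs \<in> lists Basis"
  shows "partials bs (\<lambda>x. f x - g x) = (\<lambda>x. partials bs f x - partials bs g x)"
  using partials_add[OF assms(1) schwartz_cmult[OF assms(2), of "-1"] assms(3)]
    partials_cmult[OF assms(2,3), of "-1"] by simp

lemma partials_zero: "bs \<in> lists Basis \<Longrightarrow> partials bs (\<lambda>x. 0) = (\<lambda>x. 0)"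
  using partials_cmult[OF schwartz_zero, of bs 0] by simp

lemma partials_sum:
  assumes "finite I" "\<And>i. i \<in> I \<Longrightarrow> f i \<in> schwartz" "bs \<in> lists Basis"
  shows "partials bs (\<lambda>x. \<Sum>i\<in>I. c i * f i x) = (\<lambda>x. \<Sum>i\<in>I. c i * partials bs (f i) x)"
  using assms(1,2)
proof (induction I rule: finite_induct)
  case (insert i I)
  then show ?case using assms(3)
    by (simp add: partials_add schwartz_cmult schwartz_sum partials_cmult)
qed (simp add: partials_zero assms(3))

section \<open>Dependence of a distribution on a parameter of its test function\<close>

definition orders :: "nat \<Rightarrow> (nat \<times> 'a::euclidean_space list) set" where
  "orders N = {..N} \<times> {bs \<in> lists Basis. length bs \<le> N}"

lemma finite_orders: "finite (orders N)"
  unfolding orders_def lists_eq_set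
  using finite_lists_length_le[OF finite_Basis, of N] by (intro finite_cartesian_product finite_atMost) (simp add: conj_commute)

text \<open>Pointwise bounds with one common e replace the suprema of
  \<open>schwartz_seminorm\<close>, so continuity of a distribution can be applied without
  evaluating any supremum.\<close>

definition seminorms_le :: "nat \<Rightarrow> ('a::euclidean_space \<Rightarrow> complex) \<Rightarrow> real \<Rightarrow> bool" where
  "seminorms_le N f e \<longleftrightarrow> (\<forall>(k, bs)\<in>orders N. \<forall>x. norm x ^ k * cmod (partials bs f x) \<le> e)"

lemma seminorms_leI:
  "(\<And>k bs x. (k, bs) \<in> orders N \<Longrightarrow> norm x ^ k * cmod (partials bs f x) \<le> e) \<Longrightarrow> seminorms_le N f e"
  unfolding seminorms_le_def by blast

lemma tempered_bound:
  fixes u :: "('a::euclidean_space \<Rightarrow> complex) \<Rightarrow> complex"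
  assumes "u \<in> tempered"
  shows "\<exists>C N. 0 \<le> C \<and> (\<forall>f\<in>schwartz. \<forall>e. seminorms_le N f e \<longrightarrow> cmod (u f) \<le> C * e)"
proof -
  obtain C N where C: "\<And>f. f \<in> schwartz \<Longrightarrow>
      cmod (u f) \<le> C * (\<Sum>k\<le>N. \<Sum>bs\<in>{bs\<in>lists Basis. length bs \<le> N}. schwartz_seminorm k bs f)"
    using assms unfolding tempered_def by blast
  let ?L = "{bs\<in>lists Basis. length bs \<le> N} :: 'a list set"
  let ?c = "real (card {..N}) * real (card ?L)"
  have "cmod (u f) \<le> (\<bar>C\<bar> * ?c) * e"
    if f: "f \<in> schwartz" and e: "seminorms_le N f e" for f e
  proof -
    have le: "schwartz_seminorm k bs f \<le> e" if "k \<le> N" "bs \<in> ?L" for k bs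
      unfolding schwartz_seminorm_def using that e by (intro cSUP_least) (auto simp: orders_def seminorms_le_def)
    have nonneg: "0 \<le> schwartz_seminorm k bs f" if "bs \<in> ?L" for k bs
    proof -
      have "bdd_above (range (\<lambda>x. norm x ^ k * cmod (partials bs f x)))"
        using f that unfolding schwartz_def by auto
      then have "norm 0 ^ k * cmod (partials bs f 0) \<le> schwartz_seminorm k bs f"
        unfolding schwartz_seminorm_def using cSUP_upper[of 0 UNIV "\<lambda>x. norm x ^ k * cmod (partials bs f x)"] by simp
      then show ?thesis by (rule order_trans[rotated]) simp
    qed
    have "(\<Sum>k\<le>N. \<Sum>bs\<in>?L. schwartz_seminorm k bs f) \<le> (\<Sum>k\<le>N. \<Sum>bs\<in>?L. e)"
      by (intro sum_mono le) auto
    moreover have "0 \<le> (\<Sum>k\<le>N. \<Sum>bs\<in>?L. schwartz_seminorm k bs f)"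
      by (intro sum_nonneg nonneg) auto
    ultimately have "C * (\<Sum>k\<le>N. \<Sum>bs\<in>?L. schwartz_seminorm k bs f) \<le> \<bar>C\<bar> * (?c * e)"
      by (intro mult_mono) (auto simp: mult_ac)
    then show ?thesis using C[OF f] by (simp add: mult_ac)
  qed
  then show ?thesis by (intro exI[of _ "\<bar>C\<bar> * ?c"] exI[of _ N]) auto
qed

lemma uniform_bound:
  fixes P :: "'i \<Rightarrow> 'x \<Rightarrow> real"
  assumes "finite I" "\<And>i. i \<in> I \<Longrightarrow> \<exists>L. \<forall>x. P i x \<le> L * g x" "\<And>x. 0 \<le> g x"
  shows "\<exists>L\<ge>0. \<forall>i\<in>I. \<forall>x. P i x \<le> L * g x"
proof -
  obtain L where L: "\<And>i x. i \<in> I \<Longrightarrow> P i x \<le> L i * g x" using assms(2) by metis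
  have "P i x \<le> (\<Sum>i\<in>I. \<bar>L i\<bar>) * g x" if "i \<in> I" for i x
  proof -
    have "L i \<le> (\<Sum>i\<in>I. \<bar>L i\<bar>)"
      using member_le_sum[OF that _ assms(1), of "\<lambda>i. \<bar>L i\<bar>"] by simp
    then show ?thesis using L[OF that, of x] mult_right_mono[OF _ assms(3)] order_trans by blast
  qed
  then show ?thesis by (intro exI[of _ "\<Sum>i\<in>I. \<bar>L i\<bar>"]) (simp add: sum_nonneg)
qed

text \<open>This is the mean value inequality in the parameter w, weighted by |t|^k. The variables
  w, w', t are packed into one tuple x = (w, w', t) so that \<open>uniform_bound\<close> can be
  applied to finitely many such statements at once.\<close>

lemma schwartz_prod_lipschitz:
  fixes F :: "'w::euclidean_space \<times> 'a::euclidean_space \<Rightarrow> complex"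
  assumes "F \<in> schwartz"
  shows "\<exists>L. \<forall>x. norm (snd (snd x)) ^ k * cmod (F (fst x, snd (snd x)) - F (fst (snd x), snd (snd x))) \<le>
    L * norm (fst x - fst (snd x))"
proof -
  have "\<exists>C. \<forall>x. norm (snd x) ^ k * cmod (pd (b, 0) F x) \<le> C * 1" if "b \<in> Basis" for b
  proof -
    have "(b, 0) \<in> Basis" using that by (simp add: Basis_prod_def)
    from rapidE[OF schwartz_rapid[OF schwartz_pd[OF assms this]], of k]
    obtain C where C: "\<And>x. (1 + norm x) ^ k * cmod (pd (b, 0) F x) \<le> C" by blast
    have "norm (snd x) ^ k * cmod (pd (b, 0) F x) \<le> C * 1" for x
    proof -
      have "norm (snd x) \<le> 1 + norm x" using norm_snd_le[of "snd x" "fst x"] by simp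
      then have "norm (snd x) ^ k \<le> (1 + norm x) ^ k" by (intro power_mono) auto
      then show ?thesis using C[of x] mult_right_mono[of "norm (snd x) ^ k" "(1 + norm x) ^ k" "cmod (pd (b, 0) F x)"] by simp
    qed
    then show ?thesis by blast
  qed
  then have "\<exists>C\<ge>0. \<forall>b\<in>Basis. \<forall>x. norm (snd x) ^ k * cmod (pd (b, 0) F x) \<le> C * 1"
    by (intro uniform_bound) auto
  then obtain C where C: "C \<ge> 0"
    "\<And>b x. b \<in> Basis \<Longrightarrow> norm (snd x) ^ k * cmod (pd (b, 0) F x) \<le> C" by auto
  have "norm t ^ k * cmod (F (w, t) - F (w', t)) \<le> (real DIM('w) * C) * norm (w - w')" for w w' t
  proof -
    let ?f = "\<lambda>w. complex_of_real (norm t ^ k) * F (w, t)"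
    let ?f' = "\<lambda>w v. complex_of_real (norm t ^ k) * pd (v, 0) F (w, t)"
    have d: "((\<lambda>w. F (w, t)) has_derivative (\<lambda>v. pd (v, 0) F (w, t))) (at w)" for w
      by (rule has_derivative_compose[OF has_derivative_Pair[OF has_derivative_ident has_derivative_const]
            schwartz_has_derivative[OF assms]])
    have "norm (?f w - ?f w') \<le> real DIM('w) * C * norm (w - w')"
    proof (rule differentiable_bound[of UNIV ?f ?f'])
      show "(?f has_derivative ?f' w) (at w within UNIV)" for w
        by (rule has_derivative_mult_right) (use d in simp)
      show "onorm (?f' w) \<le> real DIM('w) * C" for w
      proof (rule onorm_bound)
        fix v :: 'w
        have "bounded_linear (\<lambda>v. pd (v, 0) F (w, t))" using d by (rule has_derivative_bounded_linear)
        then interpret bounded_linear "\<lambda>v. pd (v, 0) F (w, t)" .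
        have "pd (v, 0) F (w, t) = pd (\<Sum>b\<in>Basis. (v \<bullet> b) *\<^sub>R b, 0) F (w, t)"
          by (simp add: euclidean_representation)
        also have "\<dots> = (\<Sum>b\<in>Basis. of_real (v \<bullet> b) * pd (b, 0) F (w, t))"
          by (simp add: sum scale scaleR_conv_of_real)
        finally have "norm (?f' w v) = cmod (\<Sum>b\<in>Basis. of_real (norm t ^ k) * (of_real (v \<bullet> b) * pd (b, 0) F (w, t)))"
          by (simp add: sum_distrib_left)
        also have "\<dots> \<le> (\<Sum>b\<in>(Basis::'w set). norm v * C)"
        proof (intro order_trans[OF norm_sum] sum_mono)
          fix b :: 'w assume b: "b \<in> Basis"
          have "cmod (of_real (norm t ^ k) * (of_real (v \<bullet> b) * pd (b, 0) F (w, t))) =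
            \<bar>v \<bullet> b\<bar> * (norm (snd (w, t)) ^ k * cmod (pd (b, 0) F (w, t)))"
            by (simp add: norm_mult norm_power mult_ac)
          also have "\<dots> \<le> norm v * C" by (intro mult_mono C b Basis_le_norm) auto
          finally show "cmod (of_real (norm t ^ k) * (of_real (v \<bullet> b) * pd (b, 0) F (w, t))) \<le> norm v * C" .
        qed
        also have "\<dots> = real DIM('w) * C * norm v" by simp
        finally show "norm (?f' w v) \<le> real DIM('w) * C * norm v" .
      qed (use C in simp)
    qed auto
    moreover have "norm (?f w - ?f w') = norm t ^ k * cmod (F (w, t) - F (w', t))"
      by (simp add: norm_mult norm_power flip: right_diff_distrib)
    ultimately show ?thesis by simp
  qed
  then show ?thesis by (rule_tac x = "real DIM('w) * C" in exI) (rule allI)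
qed

lemma orders_lift: "(k, bs) \<in> orders N \<Longrightarrow> bs \<in> lists Basis \<and> map (Pair 0) bs \<in> lists Basis"
  unfolding orders_def by (simp add: in_lists_conv_set, use Pair0_Basis in blast)

lemma tempered_section_lipschitz:
  fixes K :: "'w::euclidean_space \<times> 'a::euclidean_space \<Rightarrow> complex"
  assumes "K \<in> schwartz"
  shows "\<exists>L\<ge>0. \<forall>(k, bs)\<in>orders N. \<forall>w w' t.
    norm t ^ k * cmod (partials (map (Pair 0) bs) K (w, t) - partials (map (Pair 0) bs) K (w', t)) \<le> L * norm (w - w')"
proof -
  have "\<exists>L\<ge>0. \<forall>i\<in>orders N. \<forall>x. norm (snd (snd x)) ^ (fst i) *
     cmod (partials (map (Pair 0) (snd i)) K (fst x, snd (snd x)) - partials (map (Pair 0) (snd i)) K (fst (snd x), snd (snd x))) \<le>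
    L * norm (fst x - fst (snd x))"
  proof (rule uniform_bound[OF finite_orders])
    fix i :: "nat \<times> 'a list" assume "i \<in> orders N"
    then have "map (Pair 0) (snd i) \<in> (lists Basis :: ('w \<times> 'a) list set)" using orders_lift[of "fst i" "snd i"] by auto
    then show "\<exists>L. \<forall>x. norm (snd (snd x)) ^ (fst i) *
       cmod (partials (map (Pair 0) (snd i)) K (fst x, snd (snd x)) - partials (map (Pair 0) (snd i)) K (fst (snd x), snd (snd x))) \<le>
      L * norm (fst x - fst (snd x))"
      by (rule schwartz_prod_lipschitz[OF schwartz_partials[OF assms]])
  qed simp
  then obtain L where "L \<ge> 0" and L: "\<forall>i\<in>orders N. \<forall>x. norm (snd (snd x)) ^ (fst i) *
     cmod (partials (map (Pair 0) (snd i)) K (fst x, snd (snd x)) - partials (map (Pair 0) (snd i)) K (fst (snd x), snd (snd x))) \<le>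
    L * norm (fst x - fst (snd x))" by blast
  then show ?thesis
    using L[rule_format, of "(k, bs)" "(w, w', t)" for k bs w w' t] by (intro exI[of _ L]) auto
qed

lemma tempered_section_decay:
  fixes K :: "'w::euclidean_space \<times> 'a::euclidean_space \<Rightarrow> complex"
  assumes "K \<in> schwartz"
  shows "\<exists>D\<ge>0. \<forall>(k, bs)\<in>orders N. \<forall>w t. norm t ^ k * cmod (partials (map (Pair 0) bs) K (w, t)) \<le> D * wt w"
proof -
  have "\<exists>L\<ge>0. \<forall>i\<in>orders N. \<forall>x. norm (snd x) ^ (fst i) *
     cmod (partials (map (Pair 0) (snd i)) K x) \<le> L * wt (fst x)"
  proof (rule uniform_bound[OF finite_orders])
    fix i :: "nat \<times> 'a list" assume "i \<in> orders N"
    then have "map (Pair 0) (snd i) \<in> (lists Basis :: ('w \<times> 'a) list set)" using orders_lift[of "fst i" "snd i"] by auto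
    then have "partials (map (Pair 0) (snd i)) K \<in> schwartz" by (intro schwartz_partials assms)
    from rapid_prod_bound[OF schwartz_rapid[OF this], of "fst i" 1] obtain C where
      C: "\<And>w t. (1 + norm t) ^ fst i * cmod (partials (map (Pair 0) (snd i)) K (w, t)) \<le> C * wt w ^ 1" by metis
    have "norm (snd x) ^ (fst i) * cmod (partials (map (Pair 0) (snd i)) K x) \<le> C * wt (fst x)" for x
    proof -
      have "norm (snd x) ^ fst i \<le> (1 + norm (snd x)) ^ fst i" by (intro power_mono) auto
      from mult_right_mono[OF this, of "cmod (partials (map (Pair 0) (snd i)) K x)"]
      show ?thesis using C[of "snd x" "fst x"] by simp
    qed
    then show "\<exists>L. \<forall>x. norm (snd x) ^ (fst i) * cmod (partials (map (Pair 0) (snd i)) K x) \<le> L * wt (fst x)" by blast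
  qed simp
  then obtain L where "L \<ge> 0" and L: "\<forall>i\<in>orders N. \<forall>x. norm (snd x) ^ (fst i) *
     cmod (partials (map (Pair 0) (snd i)) K x) \<le> L * wt (fst x)" by blast
  then show ?thesis
    using L[rule_format, of "(k, bs)" "(w, t)" for k bs w t] by (intro exI[of _ L]) auto
qed

lemma tempered_section_continuous:
  fixes K :: "'w::euclidean_space \<times> 'a::euclidean_space \<Rightarrow> complex"
  assumes "u \<in> tempered" "K \<in> schwartz"
  shows "continuous_on UNIV (\<lambda>w. u (\<lambda>t. K (w, t)))"
proof -
  obtain C N where C: "0 \<le> C" "\<And>f e. f \<in> schwartz \<Longrightarrow> seminorms_le N f e \<Longrightarrow> cmod (u f) \<le> C * e"
    using tempered_bound[OF assms(1)] by metis
  obtain L where L: "L \<ge> 0" "\<And>k bs w w' t. (k, bs) \<in> orders N \<Longrightarrow>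
    norm t ^ k * cmod (partials (map (Pair 0) bs) K (w, t) - partials (map (Pair 0) bs) K (w', t)) \<le> L * norm (w - w')"
    using tempered_section_lipschitz[OF assms(2), of N] by blast
  have "dist (u (\<lambda>t. K (w, t))) (u (\<lambda>t. K (w', t))) \<le> (C * L) * dist w w'" for w w'
  proof -
    have "cmod (u (\<lambda>t. K (w, t) - K (w', t))) \<le> C * (L * norm (w - w'))"
    proof (rule C(2)[OF schwartz_diff seminorms_leI])
      fix k and bs :: "'a list" and t assume o: "(k, bs) \<in> orders N"
      have b: "bs \<in> lists Basis" using orders_lift[OF o] by blast
      show "norm t ^ k * cmod (partials bs (\<lambda>t. K (w, t) - K (w', t)) t) \<le> L * norm (w - w')"
        using L(2)[OF o] by (simp add: partials_diff schwartz_section assms(2) b partials_section)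
    qed (rule schwartz_section[OF assms(2)])+
    then show ?thesis
      by (simp add: tempered_diff[OF assms(1) schwartz_section[OF assms(2)] schwartz_section[OF assms(2)]] dist_norm mult_ac)
  qed
  then have "(C * L)-lipschitz_on UNIV (\<lambda>w. u (\<lambda>t. K (w, t)))"
    using C(1) L(1) by (intro lipschitz_onI) auto
  then show ?thesis by (rule lipschitz_on_continuous_on)
qed

text \<open>On a ball, integrating along a simple function gives a finite sum over its values, and
  into a finite sum a distribution can be taken by linearity alone.\<close>

lemma simple_integral_bounded:
  fixes g :: "'w::euclidean_space \<Rightarrow> complex"
  assumes "simple_function lborel s"
  shows "(LINT (w::'w)|lborel. indicator (ball 0 r) w *\<^sub>R g (s w)) =
    (\<Sum>y\<in>range s. of_real (measure lborel (ball 0 r \<inter> s -` {y})) * g y)" (is "?L = _")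
    and "integrable lborel (\<lambda>w::'w. indicator (ball 0 r) w *\<^sub>R g (s w))"
proof -
  have fin: "finite (range s)" using assms by (auto simp: simple_function_def)
  have sets: "ball 0 r \<inter> s -` {y} \<in> sets lborel" for y
    using simple_functionD(2)[OF assms, of "{y}"] by auto
  have finm: "emeasure lborel (ball 0 r \<inter> s -` {y}) < \<infinity>" for y
    by (rule le_less_trans[OF emeasure_mono emeasure_lborel_ball_finite[of 0 r]]) auto
  have e: "(\<lambda>w. indicator (ball 0 r) w *\<^sub>R g (s w)) =
    (\<lambda>w. \<Sum>y\<in>range s. indicator (ball 0 r \<inter> s -` {y}) w *\<^sub>R g y)"
  proof
    fix w
    have "(\<Sum>y\<in>range s. indicator (ball 0 r \<inter> s -` {y}) w *\<^sub>R g y) =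
      (\<Sum>y\<in>{s w}. indicator (ball 0 r \<inter> s -` {y}) w *\<^sub>R g y)"
      by (rule sum.mono_neutral_right) (auto simp: fin indicator_def)
    then show "indicator (ball 0 r) w *\<^sub>R g (s w) = (\<Sum>y\<in>range s. indicator (ball 0 r \<inter> s -` {y}) w *\<^sub>R g y)"
      by (simp add: indicator_def)
  qed
  have int: "integrable lborel (\<lambda>w. indicator (ball 0 r \<inter> s -` {y}) w *\<^sub>R g y)" for y
    by (intro integrable_scaleR_left integrable_real_indicator sets finm)
  show "integrable lborel (\<lambda>w. indicator (ball 0 r) w *\<^sub>R g (s w))"
    unfolding e using int by simp
  show "?L = (\<Sum>y\<in>range s. of_real (measure lborel (ball 0 r \<inter> s -` {y})) * g y)"
    unfolding e using int sets finm
    by (subst Bochner_Integration.integral_sum) (auto simp: scaleR_conv_of_real less_top[symmetric])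
qed

text \<open>The parameter w is replaced by simple functions \<open>s i w\<close> on a ball of radius
  r, which turns the integral into a finite sum. The difference between integral and sum is small in
  each of the finitely many seminorms controlling u; first i, then r tends to infinity.\<close>

lemma tempered_integral:
  fixes K :: "'w::euclidean_space \<times> 'a::euclidean_space \<Rightarrow> complex"
  assumes "u \<in> tempered" "K \<in> schwartz"
  shows "integrable lborel (\<lambda>w. u (\<lambda>t. K (w, t)))"
    and "u (\<lambda>t. LINT w|lborel. K (w, t)) = (LINT w|lborel. u (\<lambda>t. K (w, t)))"
proof -
  obtain C N where C: "0 \<le> C" "\<And>f e. f \<in> schwartz \<Longrightarrow> seminorms_le N f e \<Longrightarrow> cmod (u f) \<le> C * e"
    using tempered_bound[OF assms(1)] by metis
  obtain L where L: "L \<ge> 0" "\<And>k bs w w' t. (k, bs) \<in> orders N \<Longrightarrow>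
    norm t ^ k * cmod (partials (map (Pair 0) bs) K (w, t) - partials (map (Pair 0) bs) K (w', t)) \<le> L * norm (w - w')"
    using tempered_section_lipschitz[OF assms(2), of N] by blast
  obtain D where D: "D \<ge> 0" "\<And>k bs w t. (k, bs) \<in> orders N \<Longrightarrow>
    norm t ^ k * cmod (partials (map (Pair 0) bs) K (w, t)) \<le> D * wt w"
    using tempered_section_decay[OF assms(2), of N] by blast
  define U where "U = (\<lambda>w. u (\<lambda>t. K (w, t)))"
  have U_cont: "continuous_on UNIV U" unfolding U_def by (rule tempered_section_continuous[OF assms])
  then have U_meas [measurable]: "U \<in> borel_measurable borel" by (rule borel_measurable_continuous_onI)
  have U_bound: "cmod (U w) \<le> C * (D * wt w)" for w
    unfolding U_def
  proof (rule C(2)[OF schwartz_section[OF assms(2)] seminorms_leI])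
    fix k and bs :: "'a list" and t assume o: "(k, bs) \<in> orders N"
    show "norm t ^ k * cmod (partials bs (\<lambda>t. K (w, t)) t) \<le> D * wt w"
      unfolding partials_section[OF assms(2) conjunct1[OF orders_lift[OF o]]] by (rule D(2)[OF o])
  qed
  show U_int: "integrable lborel (\<lambda>w. u (\<lambda>t. K (w, t)))"
    unfolding U_def[symmetric]
    by (rule Bochner_Integration.integrable_bound[of _ "\<lambda>w. C * (D * wt w)"])
      (use U_bound C(1) D(1) in \<open>simp_all add: integrable_wt abs_mult\<close>)
  obtain s :: "nat \<Rightarrow> 'w \<Rightarrow> 'w" where s: "\<And>i. simple_function lborel (s i)" "\<And>w. (\<lambda>i. s i w) \<longlonglongrightarrow> w"
    "\<And>i w. dist (s i w) 0 \<le> 2 * dist w 0"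
  proof -
    have "(\<lambda>w::'w. w) \<in> borel_measurable lborel" by simp
    from borel_measurable_implies_sequence_metric[OF this, of 0] show thesis using that by auto
  qed
  let ?G = "\<lambda>t. LINT w|lborel. K (w, t)"
  \<comment> \<open>The two sources of error: \<open>e1\<close> measures the approximation inside
    the ball and is multiplied by the Lipschitz constant L, \<open>e2\<close> measures the tail
    outside and is multiplied by the decay constant D.\<close>
  define e1 where "e1 r i = (LINT (w::'w)|lborel. indicator (ball 0 r) w *\<^sub>R norm (w - s i w))" for r i
  define e2 where "e2 r = (LINT (w::'w)|lborel. indicator (- ball 0 r) w *\<^sub>R wt w)" for r
  have s_meas [measurable]: "s i \<in> borel_measurable borel" for i
    using borel_measurable_simple_function[OF s(1)[of i]] by simp
  have ball_meas [measurable]: "ball (0::'w) r \<in> sets borel" for r by simp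
  have intB: "integrable lborel (\<lambda>w::'w. indicator (ball 0 r) w *\<^sub>R (c::real))" for r c
    by (intro integrable_scaleR_left integrable_real_indicator) (auto intro: emeasure_lborel_ball_finite[unfolded infinity_ennreal_def])
  \<comment> \<open>The bound 3 r comes from |s i w| \<le> 2 |w|, which gives |w - s i w| \<le> 3
    |w| on the ball.\<close>
  have int1: "integrable lborel (\<lambda>w::'w. indicator (ball 0 r) w *\<^sub>R norm (w - s i w))" for r i
  proof (rule Bochner_Integration.integrable_bound[of _ "\<lambda>w. indicator (ball 0 r) w *\<^sub>R (3 * r)"])
    show "integrable lborel (\<lambda>w::'w. indicator (ball 0 r) w *\<^sub>R (3 * r))"
      by (rule intB)
    show "AE w in lborel. norm (indicator (ball 0 r) w *\<^sub>R norm (w - s i w)) \<le> norm (indicator (ball 0 r) w *\<^sub>R (3 * r))"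
    proof (intro always_eventually allI)
      fix w :: 'w
      show "norm (indicator (ball 0 r) w *\<^sub>R norm (w - s i w)) \<le> norm (indicator (ball 0 r) w *\<^sub>R (3 * r))"
        using s(3)[of i w] norm_triangle_ineq4[of w "s i w"] by (auto simp: indicator_def dist_norm)
    qed
  qed measurable
  have int2: "integrable lborel (\<lambda>w::'w. indicator (- ball 0 r) w *\<^sub>R wt w)" for r
    by (rule Bochner_Integration.integrable_bound[OF integrable_wt]) (auto simp: indicator_def)
  \<comment> \<open>The estimate is made in every seminorm of order N before u is applied;
    \<open>?R\<close> is the finite sum approximating the integral \<open>?G\<close>.\<close>
  have approx: "cmod (u ?G - (LINT w|lborel. indicator (ball 0 r) w *\<^sub>R U (s i w))) \<le> C * (L * e1 r i + D * e2 r)" for r i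
  proof -
    let ?m = "\<lambda>y. measure lborel (ball 0 r \<inter> s i -` {y})"
    let ?R = "\<lambda>t. \<Sum>y\<in>range (s i). of_real (?m y) * K (y, t)"
    have fin: "finite (range (s i))" using s(1)[of i] by (auto simp: simple_function_def)
    have R: "?R \<in> schwartz" by (intro schwartz_sum fin schwartz_cmult schwartz_section assms)
    have uR: "u ?R = (LINT w|lborel. indicator (ball 0 r) w *\<^sub>R U (s i w))"
      unfolding simple_integral_bounded(1)[OF s(1)]
      by (subst tempered_sum[OF assms(1) fin schwartz_section[OF assms(2)]]) (simp add: U_def)
    have "cmod (u (\<lambda>t. ?G t - ?R t)) \<le> C * (L * e1 r i + D * e2 r)"
    proof (rule C(2)[OF schwartz_diff[OF schwartz_marginal[OF assms(2)] R] seminorms_leI])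
      fix k and bs :: "'a list" and t assume o: "(k, bs) \<in> orders N"
      have b: "bs \<in> lists Basis" "map (Pair 0) bs \<in> (lists Basis :: ('w \<times> 'a) list set)"
        using orders_lift[OF o] by blast+
      let ?F = "partials (map (Pair 0) bs) K"
      have F: "?F \<in> schwartz" by (rule schwartz_partials[OF assms(2) b(2)])
      have "partials bs (\<lambda>t. ?G t - ?R t) t = (LINT w|lborel. ?F (w, t)) - (\<Sum>y\<in>range (s i). of_real (?m y) * ?F (y, t))"
        unfolding partials_diff[OF schwartz_marginal[OF assms(2)] R b(1)] partials_marginal[OF assms(2) b(1)]
          partials_sum[OF fin schwartz_section[OF assms(2)] b(1)] partials_section[OF assms(2) b(1)] ..
      also have "\<dots> = (LINT w|lborel. ?F (w, t)) - (LINT w|lborel. indicator (ball 0 r) w *\<^sub>R ?F (s i w, t))"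
        by (subst simple_integral_bounded(1)[where g = "\<lambda>y. ?F (y, t)", OF s(1)]) (rule refl)
      also have "\<dots> = (LINT w|lborel. ?F (w, t) - indicator (ball 0 r) w *\<^sub>R ?F (s i w, t))"
        by (rule Bochner_Integration.integral_diff[symmetric, OF schwartz_section_integrable[OF F] simple_integral_bounded(2)[OF s(1)]])
      finally have "norm t ^ k * cmod (partials bs (\<lambda>t. ?G t - ?R t) t) =
        cmod (LINT w|lborel. of_real (norm t ^ k) * (?F (w, t) - indicator (ball 0 r) w *\<^sub>R ?F (s i w, t)))"
        by (simp add: norm_mult norm_power)
      also have "\<dots> \<le> (LINT w|lborel. L * (indicator (ball 0 r) w *\<^sub>R norm (w - s i w)) + D * (indicator (- ball 0 r) w *\<^sub>R wt w))"
      proof (rule Bochner_Integration.integral_norm_bound_integral)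
        show "integrable lborel (\<lambda>w. of_real (norm t ^ k) * (?F (w, t) - indicator (ball 0 r) w *\<^sub>R ?F (s i w, t)))"
          by (intro integrable_mult_right Bochner_Integration.integrable_diff schwartz_section_integrable[OF F] simple_integral_bounded(2)[OF s(1)])
        show "integrable lborel (\<lambda>w. L * (indicator (ball 0 r) w *\<^sub>R norm (w - s i w)) + D * (indicator (- ball 0 r) w *\<^sub>R wt w))"
          by (intro Bochner_Integration.integrable_add integrable_mult_right int1 int2)
        fix w
        show "cmod (of_real (norm t ^ k) * (?F (w, t) - indicator (ball 0 r) w *\<^sub>R ?F (s i w, t))) \<le>
          L * (indicator (ball 0 r) w *\<^sub>R norm (w - s i w)) + D * (indicator (- ball 0 r) w *\<^sub>R wt w)"
          using L(2)[OF o, of t w "s i w"] D(2)[OF o, of t w]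
          by (cases "w \<in> ball 0 r") (simp_all add: norm_mult norm_power)
      qed
      also have "\<dots> = L * e1 r i + D * e2 r"
        unfolding e1_def e2_def using int1 int2 by simp
      finally show "norm t ^ k * cmod (partials bs (\<lambda>t. ?G t - ?R t) t) \<le> L * e1 r i + D * e2 r" .
    qed
    then show ?thesis
      by (simp add: tempered_diff[OF assms(1) schwartz_marginal[OF assms(2)] R] uR)
  qed
  have e1_lim: "(\<lambda>i. e1 r i) \<longlonglongrightarrow> 0" for r
  proof -
    have "(\<lambda>i. e1 r i) \<longlonglongrightarrow> (LINT (w::'w)|lborel. 0)"
      unfolding e1_def
    proof (rule integral_dominated_convergence[where w="\<lambda>w. indicator (ball 0 r) w *\<^sub>R (3 * r)"])
      show "integrable lborel (\<lambda>w::'w. indicator (ball 0 r) w *\<^sub>R (3 * r))"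
        by (rule intB)
      show "AE w in lborel. (\<lambda>i. indicator (ball 0 r) w *\<^sub>R norm (w - s i w)) \<longlonglongrightarrow> 0"
      proof (intro always_eventually allI)
        fix w :: 'w
        have "(\<lambda>i. indicator (ball 0 r) w *\<^sub>R norm (w - s i w)) \<longlonglongrightarrow> indicator (ball 0 r) w *\<^sub>R norm (w - w)"
          by (intro tendsto_intros s(2))
        then show "(\<lambda>i. indicator (ball 0 r) w *\<^sub>R norm (w - s i w)) \<longlonglongrightarrow> 0" by simp
      qed
      show "AE w in lborel. norm (indicator (ball 0 r) w *\<^sub>R norm (w - s i w)) \<le> indicator (ball 0 r) w *\<^sub>R (3 * r)" for i
      proof (intro always_eventually allI)
        fix w :: 'w
        show "norm (indicator (ball 0 r) w *\<^sub>R norm (w - s i w)) \<le> indicator (ball 0 r) w *\<^sub>R (3 * r)"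
          using s(3)[of i w] norm_triangle_ineq4[of w "s i w"] by (auto simp: indicator_def dist_norm)
      qed
    qed measurable
    then show ?thesis by simp
  qed
  have step1: "cmod (u ?G - (LINT w|lborel. indicator (ball 0 r) w *\<^sub>R U w)) \<le> C * (D * e2 r)" for r
  proof (rule LIMSEQ_le)
    show "(\<lambda>i. C * (L * e1 r i + D * e2 r)) \<longlonglongrightarrow> C * (D * e2 r)"
      by (rule tendsto_eq_intros e1_lim refl)+ simp
    show "\<exists>M. \<forall>i\<ge>M. cmod (u ?G - (LINT w|lborel. indicator (ball 0 r) w *\<^sub>R U (s i w))) \<le> C * (L * e1 r i + D * e2 r)"
      using approx by blast
    have "(\<lambda>i. LINT w|lborel. indicator (ball 0 r) w *\<^sub>R U (s i w)) \<longlonglongrightarrow> (LINT w|lborel. indicator (ball 0 r) w *\<^sub>R U w)"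
    proof (rule integral_dominated_convergence[where w="\<lambda>w. indicator (ball 0 r) w *\<^sub>R (C * D)"])
      show "integrable lborel (\<lambda>w::'w. indicator (ball 0 r) w *\<^sub>R (C * D))"
        by (rule intB)
      show "AE w in lborel. (\<lambda>i. indicator (ball 0 r) w *\<^sub>R U (s i w)) \<longlonglongrightarrow> indicator (ball 0 r) w *\<^sub>R U w"
      proof (intro always_eventually allI tendsto_intros)
        fix w :: 'w
        have "isCont U w" using U_cont by (simp add: continuous_on_eq_continuous_at)
        then show "(\<lambda>i. U (s i w)) \<longlonglongrightarrow> U w" by (rule isCont_tendsto_compose[OF _ s(2)])
      qed
      show "AE w in lborel. norm (indicator (ball 0 r) w *\<^sub>R U (s i w)) \<le> indicator (ball 0 r) w *\<^sub>R (C * D)" for i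
      proof (intro always_eventually allI)
        fix w :: 'w
        have "cmod (U (s i w)) \<le> C * D"
          using U_bound[of "s i w"] C(1) D(1) wt_le_1[of "s i w"]
          by (meson mult_left_le mult_left_mono order_trans wt_nonneg)
        then show "norm (indicator (ball 0 r) w *\<^sub>R U (s i w)) \<le> indicator (ball 0 r) w *\<^sub>R (C * D)"
          by (auto simp: indicator_def)
      qed
    qed measurable
    then show "(\<lambda>i. cmod (u ?G - (LINT w|lborel. indicator (ball 0 r) w *\<^sub>R U (s i w)))) \<longlonglongrightarrow>
      cmod (u ?G - (LINT w|lborel. indicator (ball 0 r) w *\<^sub>R U w))"
      by (intro tendsto_intros)
  qed
  have ind: "(\<lambda>n. indicator (ball 0 (real n)) w :: real) \<longlonglongrightarrow> 1" for w :: 'w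
  proof (rule tendsto_eventually)
    obtain n0 where n0: "norm w < real n0" using reals_Archimedean2 by blast
    show "\<forall>\<^sub>F n in sequentially. indicator (ball 0 (real n)) w = (1::real)"
      using eventually_ge_at_top[of n0] by eventually_elim (use n0 in \<open>auto simp: indicator_def\<close>)
  qed
  \<comment> \<open>The radius tends to infinity along the integers: the tails \<open>e2\<close>
    vanish, and the truncated integrals converge because U is integrable.\<close>
  have "cmod (u ?G - (LINT w|lborel. U w)) \<le> 0"
  proof (rule LIMSEQ_le)
    show "\<exists>M. \<forall>n\<ge>M. cmod (u ?G - (LINT w|lborel. indicator (ball 0 (real n)) w *\<^sub>R U w)) \<le> C * (D * e2 (real n))"
      using step1 by blast
    have "(\<lambda>n. e2 (real n)) \<longlonglongrightarrow> (LINT (w::'w)|lborel. 0)"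
      unfolding e2_def
    proof (rule integral_dominated_convergence[where w=wt])
      show "AE w::'w in lborel. (\<lambda>i. indicator (- ball 0 (real i)) w *\<^sub>R wt w) \<longlonglongrightarrow> 0"
      proof (intro always_eventually allI)
        fix w :: 'w
        have "(\<lambda>i. (1 - indicator (ball 0 (real i)) w) *\<^sub>R wt w) \<longlonglongrightarrow> (1 - 1) *\<^sub>R wt w"
          by (intro tendsto_intros ind)
        moreover have "1 - indicator (ball 0 (real i)) w = (indicator (- ball 0 (real i)) w :: real)" for i
          by (auto simp: indicator_def)
        ultimately show "(\<lambda>i. indicator (- ball 0 (real i)) w *\<^sub>R wt w) \<longlonglongrightarrow> 0" by simp
      qed
      show "AE w::'w in lborel. norm (indicator (- ball 0 (real i)) w *\<^sub>R wt w) \<le> wt w" for i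
        by (auto simp: indicator_def)
    qed (measurable, rule integrable_wt)
    then have "(\<lambda>n. e2 (real n)) \<longlonglongrightarrow> 0" by simp
    from tendsto_mult_left[OF tendsto_mult_left[OF this, of D], of C]
    show "(\<lambda>n. C * (D * e2 (real n))) \<longlonglongrightarrow> 0" by simp
    have "(\<lambda>n. LINT w|lborel. indicator (ball 0 (real n)) w *\<^sub>R U w) \<longlonglongrightarrow> (LINT w|lborel. U w)"
    proof (rule integral_dominated_convergence[where w="\<lambda>w. norm (U w)"])
      show "AE w in lborel. (\<lambda>i. indicator (ball 0 (real i)) w *\<^sub>R U w) \<longlonglongrightarrow> U w"
      proof (intro always_eventually allI)
        fix w
        have "(\<lambda>i. indicator (ball 0 (real i)) w *\<^sub>R U w) \<longlonglongrightarrow> 1 *\<^sub>R U w" by (intro tendsto_intros ind)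
        then show "(\<lambda>i. indicator (ball 0 (real i)) w *\<^sub>R U w) \<longlonglongrightarrow> U w" by simp
      qed
      show "AE w in lborel. norm (indicator (ball 0 (real i)) w *\<^sub>R U w) \<le> norm (U w)" for i
        by (auto simp: indicator_def)
      show "integrable lborel (\<lambda>w. norm (U w))" using U_int unfolding U_def by (rule integrable_norm)
    qed measurable
    then show "(\<lambda>n. cmod (u ?G - (LINT w|lborel. indicator (ball 0 (real n)) w *\<^sub>R U w))) \<longlonglongrightarrow> cmod (u ?G - (LINT w|lborel. U w))"
      by (intro tendsto_intros)
  qed
  then show "u ?G = (LINT w|lborel. u (\<lambda>t. K (w, t)))" by (simp add: U_def)
qed

section \<open>The Fourier transform of Schwartz functions\<close>

definition ch :: "real \<Rightarrow> complex" where
  "ch r = cis (2 * pi * r)"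

lemma ch_add: "ch (r + s) = ch r * ch s"
  by (simp add: ch_def cis_mult distrib_left)

lemma cnj_ch [simp]: "cnj (ch r) = ch (- r)"
  by (simp add: ch_def cis_cnj)

lemma norm_ch [simp]: "cmod (ch r) = 1"
  by (simp add: ch_def)

lemma ch_0 [simp]: "ch 0 = 1"
  by (simp add: ch_def)

lemma ch_minus_mult [simp]: "ch (- r) * ch r = 1" "ch r * ch (- r) = 1"
  by (simp_all flip: ch_add)

lemma ch_eq_exp: "exp (2 * complex_of_real pi * \<i> * complex_of_real r) = ch r"
  by (simp add: ch_def cis_conv_exp mult_ac)

lemma continuous_on_ch [continuous_intros]: "continuous_on A f \<Longrightarrow> continuous_on A (\<lambda>x. ch (f x))"
  unfolding ch_def by (intro continuous_intros)

lemma measurable_ch [measurable]: "ch \<in> borel_measurable borel"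
  by (intro borel_measurable_continuous_onI continuous_intros)

lemma slow_ch_inner:
  fixes L M :: "'a::euclidean_space \<Rightarrow> 'b::euclidean_space"
  assumes "bounded_linear L" "bounded_linear M"
  shows "(\<lambda>x. ch (L x \<bullet> M x)) \<in> slow" "(\<lambda>x. ch (- (L x \<bullet> M x))) \<in> slow"
  using slow_chirp[OF assms, of "2 * pi"] slow_chirp[OF assms, of "- (2 * pi)"]
  by (simp_all add: ch_def cis_conv_exp)

lemma slow_ch: "(\<lambda>x. ch (x \<bullet> a)) \<in> slow" "(\<lambda>x. ch (- (x \<bullet> a))) \<in> slow"
  using slow_character[of "2 * pi" a] slow_character[of "- (2 * pi)" a]
  by (simp_all add: ch_def cis_conv_exp)

subsection \<open>Gaussians\<close>

definition gs :: "real \<Rightarrow> 'a::euclidean_space \<Rightarrow> complex" where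
  "gs a x = complex_of_real (exp (- (pi * a * (x \<bullet> x))))"

lemma gs_has_derivative: "(gs a has_derivative (\<lambda>v. of_real (- (2 * pi * a * (x \<bullet> v))) * gs a x)) (at x)"
proof -
  have "((\<lambda>x. exp (- (pi * a * (x \<bullet> x)))) has_derivative
      (\<lambda>v. exp (- (pi * a * (x \<bullet> x))) * (- (pi * a * (x \<bullet> v + v \<bullet> x))))) (at x)"
    by (auto intro!: derivative_eq_intros)
  then have "(gs a has_derivative (\<lambda>v. complex_of_real (exp (- (pi * a * (x \<bullet> x))) * (- (pi * a * (x \<bullet> v + v \<bullet> x)))))) (at x)"
    unfolding gs_def[abs_def] by (rule has_derivative_of_real)
  then show ?thesis by (simp add: gs_def inner_commute algebra_simps)
qed

text \<open>After 1 + n \<le> exp n the exponent is m n - c n^2, a quadratic with maximum m^2 /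
  (4c).\<close>

lemma power_exp_bound:
  fixes n c :: real assumes "n \<ge> 0" "c > 0"
  shows "(1 + n) ^ m * exp (- (c * n\<^sup>2)) \<le> exp ((real m)\<^sup>2 / (4 * c))"
proof -
  have "(1 + n) ^ m \<le> exp n ^ m" using assms by (intro power_mono exp_ge_add_one_self) auto
  also have "\<dots> = exp (real m * n)" by (simp add: exp_of_nat_mult)
  finally have "(1 + n) ^ m * exp (- (c * n\<^sup>2)) \<le> exp (real m * n - c * n\<^sup>2)"
    by (simp add: exp_diff exp_minus field_simps)
  also have "real m * n - c * n\<^sup>2 \<le> (real m)\<^sup>2 / (4 * c)"
  proof -
    have "0 \<le> (2 * c * n - real m)\<^sup>2" by simp
    also have "\<dots> = 4 * c * (c * n\<^sup>2 - real m * n) + (real m)\<^sup>2"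
      by (simp add: power2_eq_square algebra_simps)
    finally show ?thesis using assms by (simp add: field_simps)
  qed
  finally show ?thesis by simp
qed

lemma slow_gs:
  assumes "a > 0" "P \<in> slow" shows "(\<lambda>x. P x * gs a x) \<in> schwartz"
proof (rule schwartz_image[OF assms(2)])
  fix P :: "'a \<Rightarrow> complex" assume P: "P \<in> slow"
  show "((\<lambda>x. P x * gs a x) has_derivative (\<lambda>v. P x * (of_real (- (2 * pi * a * (x \<bullet> v))) * gs a x) + pd v P x * gs a x)) (at x)" for x
    by (rule has_derivative_mult[OF smooth_has_derivative[OF slow_smooth[OF P]] gs_has_derivative])
  show "(\<lambda>x. P x * (of_real (- (2 * pi * a * (x \<bullet> b))) * gs a x) + pd b P x * gs a x) \<in> (\<lambda>(P :: 'a \<Rightarrow> complex) x. P x * gs a x) ` slow"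
    if "b \<in> Basis" for b
  proof (rule image_eqI)
    show "(\<lambda>x. P x * (of_real (- (2 * pi * a * (x \<bullet> b))) * gs a x) + pd b P x * gs a x) =
      (\<lambda>x. (P x * of_real (- (2 * pi * a * (x \<bullet> b))) + pd b P x) * gs a x)"
      by (simp add: algebra_simps)
    show "(\<lambda>x. P x * of_real (- (2 * pi * a * (x \<bullet> b))) + pd b P x) \<in> slow"
      by (intro slow_add slow_mult P slow_pd that slow_linear bounded_linear_minus
          bounded_linear_const_mult bounded_linear_inner_left)
  qed
  show "rapid (\<lambda>x. P x * gs a x)"
    unfolding rapid_def
  proof
    fix k
    obtain m C where C: "C > 0" "\<And>x. cmod (P x) \<le> C * (1 + norm x) ^ m" using slow_bound[OF P] by metis
    have "(1 + norm x) ^ k * cmod (P x * gs a x) \<le> C * exp ((real (k + m))\<^sup>2 / (4 * (pi * a)))" for x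
    proof -
      have "(1 + norm x) ^ k * cmod (P x * gs a x) \<le> (1 + norm x) ^ k * ((C * (1 + norm x) ^ m) * exp (- (pi * a * (norm x)\<^sup>2)))"
        unfolding norm_mult using C(2)[of x] order_trans[OF norm_ge_zero C(2)[of x]]
        by (intro mult_left_mono mult_mono) (auto simp: gs_def dot_square_norm)
      also have "\<dots> = C * ((1 + norm x) ^ (k + m) * exp (- (pi * a * (norm x)\<^sup>2)))"
        by (simp add: power_add mult_ac)
      also have "\<dots> \<le> C * exp ((real (k + m))\<^sup>2 / (4 * (pi * a)))"
        using C(1) assms(1) by (intro mult_left_mono power_exp_bound) auto
      finally show ?thesis .
    qed
    then show "\<exists>C. \<forall>x. (1 + norm x) ^ k * cmod (P x * gs a x) \<le> C" by blast
  qed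
qed

lemma gs_schwartz: "a > 0 \<Longrightarrow> gs a \<in> schwartz"
  using slow_gs[OF _ slow_const[of 1]] by simp

lemma gs_nonzero [simp]: "gs a x \<noteq> 0"
  by (simp add: gs_def)

lemma nn_integral_gs:
  assumes "a > 0"
  shows "(\<integral>\<^sup>+ (x::'a::euclidean_space). ennreal (exp (- (pi * a * (x \<bullet> x)))) \<partial>lborel) = ennreal ((1 / sqrt a) ^ DIM('a))"
proof -
  \<comment> \<open>With variance 1 / (2 pi a) the normal density is the one-dimensional Gaussian
    times sqrt a, so its known total mass 1 gives the integral in each coordinate.\<close>
  let ?s = "sqrt (1 / (2 * pi * a))"
  have s: "?s > 0" using assms by simp
  have nd: "normal_density 0 ?s t = sqrt a * exp (- (pi * a * t\<^sup>2))" for t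
    using assms by (simp add: normal_density_def real_sqrt_divide field_simps)
  have "integrable lborel (normal_density 0 ?s)" "integral\<^sup>L lborel (normal_density 0 ?s) = 1"
    using s by (rule integrable_normal_density integral_normal_density)+
  then have "(\<integral>\<^sup>+ t. ennreal (normal_density 0 ?s t) \<partial>lborel) = 1"
    by (subst nn_integral_eq_integral) (auto simp del: nd)
  then have "(\<integral>\<^sup>+ t. ennreal (sqrt a) * ennreal (exp (- (pi * a * t\<^sup>2))) \<partial>lborel) = 1"
    unfolding nd using assms by (simp add: ennreal_mult)
  then have e: "ennreal (sqrt a) * (\<integral>\<^sup>+ t. ennreal (exp (- (pi * a * t\<^sup>2))) \<partial>lborel) = 1"
    by (subst (asm) nn_integral_cmult) auto
  have J: "(\<integral>\<^sup>+ t. ennreal (exp (- (pi * a * t\<^sup>2))) \<partial>lborel) = ennreal (1 / sqrt a)"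
  proof -
    have "(\<integral>\<^sup>+ t. ennreal (exp (- (pi * a * t\<^sup>2))) \<partial>lborel) =
      ennreal (1 / sqrt a) * (ennreal (sqrt a) * (\<integral>\<^sup>+ t. ennreal (exp (- (pi * a * t\<^sup>2))) \<partial>lborel))"
      unfolding mult.assoc[symmetric] using assms by (simp flip: ennreal_mult)
    then show ?thesis unfolding e by simp
  qed
  have "ennreal (exp (- (pi * a * (x \<bullet> x)))) = (\<Prod>b\<in>Basis. ennreal (exp (- (pi * a * (x \<bullet> b)\<^sup>2))))" for x :: 'a
    unfolding euclidean_inner[of x x]
    by (simp add: prod_ennreal exp_sum[symmetric] sum_distrib_left sum_negf power2_eq_square)
  then have "(\<integral>\<^sup>+ (x::'a). ennreal (exp (- (pi * a * (x \<bullet> x)))) \<partial>lborel) =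
      (\<integral>\<^sup>+ (x::'a). (\<Prod>b\<in>Basis. ennreal (exp (- (pi * a * (x \<bullet> b)\<^sup>2)))) \<partial>lborel)" by simp
  also have "\<dots> = (\<Prod>b\<in>(Basis::'a set). \<integral>\<^sup>+ t. ennreal (exp (- (pi * a * t\<^sup>2))) \<partial>lborel)"
    by (rule nn_integral_lborel_prod) auto
  also have "\<dots> = ennreal ((1 / sqrt a) ^ DIM('a))"
    unfolding J using assms by (simp add: ennreal_power)
  finally show ?thesis .
qed

lemma integral_gs:
  assumes "a > 0"
  shows "(LINT (x::'a::euclidean_space)|lborel. gs a x) = complex_of_real ((1 / sqrt a) ^ DIM('a))"
proof -
  have "(LINT (x::'a)|lborel. exp (- (pi * a * (x \<bullet> x)))) = (1 / sqrt a) ^ DIM('a)"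
    by (subst integral_eq_nn_integral) (use assms in \<open>auto simp: nn_integral_gs\<close>)
  then show ?thesis unfolding gs_def integral_complex_of_real by simp
qed

subsection \<open>Changes of variables in integrals\<close>

lemma lborel_translate: "distr lborel borel (\<lambda>x. x - a) = (lborel :: 'a::euclidean_space measure)"
proof -
  have "(\<lambda>x. x - a) = (+) (- a)" by auto
  then show ?thesis by (simp add: lborel_distr_plus)
qed

lemma lborel_reflect: "distr lborel borel (\<lambda>x. a - x) = (lborel :: 'a::euclidean_space measure)"
  using lborel_affine[of "-1" a] by (simp add: density_1)

lemma integral_translate:
  fixes f :: "'a::euclidean_space \<Rightarrow> complex"
  assumes [measurable]: "f \<in> borel_measurable borel"
  shows "(LINT x|lborel. f (x - a)) = (LINT x|lborel. f x)"
  by (subst (2) lborel_translate[of a, symmetric]) (simp add: integral_distr)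

lemma integral_reflect_translate:
  fixes f :: "'a::euclidean_space \<Rightarrow> complex"
  assumes [measurable]: "f \<in> borel_measurable borel"
  shows "(LINT x|lborel. f (a - x)) = (LINT x|lborel. f x)"
  by (subst (2) lborel_reflect[of a, symmetric]) (simp add: integral_distr)

lemma integral_dilate:
  fixes f :: "'a::euclidean_space \<Rightarrow> complex"
  assumes [measurable]: "f \<in> borel_measurable borel" and "c > 0"
  shows "(LINT x|lborel. f x) = of_real (c ^ DIM('a)) * (LINT x|lborel. f (c *\<^sub>R x))"
proof -
  have "(LINT x|lborel. f x) = (LINT x|density (distr lborel borel (\<lambda>x::'a. 0 + c *\<^sub>R x)) (\<lambda>_. \<bar>c\<bar> ^ DIM('a)). f x)"
    using \<open>c > 0\<close> by (subst lborel_affine[of c 0]) auto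
  also have "\<dots> = (LINT x|distr lborel borel (\<lambda>x::'a. 0 + c *\<^sub>R x). \<bar>c\<bar> ^ DIM('a) *\<^sub>R f x)"
    by (rule integral_density) auto
  also have "\<dots> = of_real (c ^ DIM('a)) * (LINT x|lborel. f (c *\<^sub>R x))"
    using \<open>c > 0\<close> by (subst integral_distr) (auto simp: scaleR_conv_of_real)
  finally show ?thesis .
qed

lemma Pair_triangle: "norm (x, y) \<le> norm x + norm y"
  by (rule norm_Pair_le)

lemma schwartz_shear:
  fixes f g :: "'a::euclidean_space \<Rightarrow> complex"
  assumes "f \<in> schwartz" "g \<in> schwartz"
  shows "(\<lambda>(z, t). f (t - z) * g t) \<in> schwartz" "(\<lambda>(z, t). f (t + z) * g t) \<in> schwartz"
proof -
  have 1: "norm z \<le> 3 * norm (snd z - fst z, snd z)" "norm z \<le> 3 * norm (snd z + fst z, snd z)" for z :: "'a \<times> 'a"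
  proof -
    obtain x t where z: "z = (x, t)" by (cases z)
    have "norm x \<le> norm (t - x) + norm t" using norm_triangle_ineq4[of t "t - x"] by simp
    moreover have "norm x \<le> norm (t + x) + norm t" using norm_triangle_ineq4[of "t + x" t] by simp
    ultimately show "norm z \<le> 3 * norm (snd z - fst z, snd z)" "norm z \<le> 3 * norm (snd z + fst z, snd z)"
      unfolding z using Pair_triangle[of x t] norm_fst_le[of "t - x" t] norm_snd_le[of t "t - x"]
        norm_fst_le[of "t + x" t] norm_snd_le[of t "t + x"] by simp_all
  qed
  have "(\<lambda>z. (\<lambda>z. f (fst z) * g (snd z)) (snd z - fst z, snd z)) \<in> schwartz"
    by (rule schwartz_linear_comp[OF _ 1(1) schwartz_tensor_fst_snd[OF assms]])
      (intro bounded_linear_Pair bounded_linear_sub bounded_linear_fst bounded_linear_snd)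
  then show "(\<lambda>(z, t). f (t - z) * g t) \<in> schwartz" by (simp add: case_prod_unfold)
  have "(\<lambda>z. (\<lambda>z. f (fst z) * g (snd z)) (snd z + fst z, snd z)) \<in> schwartz"
    by (rule schwartz_linear_comp[OF _ 1(2) schwartz_tensor_fst_snd[OF assms]])
      (intro bounded_linear_Pair bounded_linear_add bounded_linear_fst bounded_linear_snd)
  then show "(\<lambda>(z, t). f (t + z) * g t) \<in> schwartz" by (simp add: case_prod_unfold)
qed

text \<open>The translates of \<open>f\<close> all have the same integral, so multiplying them by a Gaussian and
  differentiating under the integral shows that the integral of a derivative vanishes.\<close>

lemma integral_pd:
  fixes f :: "'a::euclidean_space \<Rightarrow> complex"
  assumes f: "f \<in> schwartz" and b: "b \<in> Basis"
  shows "(LINT x|lborel. pd b f x) = 0"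
proof -
  let ?K = "\<lambda>(w, t::'a). f (t + w) * gs 1 t"
  let ?I = "\<lambda>g::'a \<Rightarrow> complex. LINT x|lborel. g x"
  have K: "?K \<in> schwartz" by (rule schwartz_shear(2)[OF f gs_schwartz]) simp
  have sh: "(LINT w|lborel. h (t + w)) = ?I h" if "h \<in> schwartz" for h and t :: 'a
    using integral_translate[OF schwartz_measurable[OF that], of "- t"] by (simp add: add.commute)
  have ishift: "integrable lborel (\<lambda>w. h (t + w))" if "h \<in> schwartz" for h and t :: 'a
    using schwartz_integrable[OF schwartz_translation[OF that, of "- t"]] by (simp add: add.commute)
  have m: "(\<lambda>t. LINT w|lborel. ?K (w, t)) = (\<lambda>t. ?I f * gs 1 t)"
    using sh[OF f] by simp
  have 1: "((\<lambda>t. LINT w|lborel. ?K (w, t)) has_derivative (\<lambda>v. LINT w|lborel. pd (0, v) ?K (w, t))) (at t)" for t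
    by (rule marginal_has_derivative[OF K])
  have 2: "((\<lambda>t. ?I f * gs 1 t) has_derivative (\<lambda>v. ?I f * (of_real (- (2 * pi * 1 * (t \<bullet> v))) * gs 1 t))) (at t)" for t
    by (rule has_derivative_mult_right[OF gs_has_derivative])
  have 3: "(LINT w|lborel. pd (0, v) ?K (w, t)) = ?I f * (of_real (- (2 * pi * 1 * (t \<bullet> v))) * gs 1 t)" for t v
    using has_derivative_unique[OF 1[unfolded m] 2] by metis
  have 4: "pd (0, v) ?K (w, t) = f (t + w) * (of_real (- (2 * pi * 1 * (t \<bullet> v))) * gs 1 t) + pd v f (t + w) * gs 1 t" for w t v
  proof -
    have "((\<lambda>t. f (t + w)) has_derivative (\<lambda>v. pd v f (t + w))) (at t)"
      by (rule has_derivative_compose[OF _ schwartz_has_derivative[OF f]]) (auto intro!: derivative_eq_intros)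
    from has_derivative_mult[OF this gs_has_derivative[of 1]]
    have "((\<lambda>t. ?K (w, t)) has_derivative (\<lambda>v. f (t + w) * (of_real (- (2 * pi * 1 * (t \<bullet> v))) * gs 1 t) + pd v f (t + w) * gs 1 t)) (at t)"
      by simp
    from has_derivative_unique[OF this section_has_derivative[OF K]] show ?thesis by metis
  qed
  have "(LINT w|lborel. pd (0, b) ?K (w, 0)) = ?I (pd b f)"
    unfolding 4 using sh[OF schwartz_pd[OF f b], of 0] by (simp add: gs_def)
  then show ?thesis using 3[of b 0] by simp
qed

subsection \<open>Fourier transforms\<close>

definition fourier :: "('a::euclidean_space \<Rightarrow> complex) \<Rightarrow> 'a \<Rightarrow> complex" where
  "fourier f \<xi> = (LINT t|lborel. f t * ch (- (t \<bullet> \<xi>)))"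

lemma norm_fourier_le:
  assumes "integrable lborel f" shows "cmod (fourier f \<xi>) \<le> (LINT t|lborel. cmod (f t))"
  unfolding fourier_def by (rule order_trans[OF integral_norm_bound]) (simp add: norm_mult)

lemma ch_has_derivative:
  "((\<lambda>t. ch (- (t \<bullet> \<xi>))) has_derivative (\<lambda>v. - (2 * pi * \<i> * of_real (v \<bullet> \<xi>)) * ch (- (t \<bullet> \<xi>)))) (at t)"
  "((\<lambda>\<xi>. ch (- (t \<bullet> \<xi>))) has_derivative (\<lambda>v. - (2 * pi * \<i> * of_real (t \<bullet> v)) * ch (- (t \<bullet> \<xi>)))) (at \<xi>)"
proof -
  have e: "ch (- (t \<bullet> \<xi>)) = exp (- (2 * pi * \<i>) * of_real (t \<bullet> \<xi>))" for t \<xi> :: 'a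
    unfolding ch_eq_exp[symmetric] by (simp add: mult_ac)
  have "((\<lambda>t. - (2 * pi * \<i>) * of_real (t \<bullet> \<xi>)) has_derivative (\<lambda>v. - (2 * pi * \<i>) * of_real (v \<bullet> \<xi>))) (at t)"
    by (intro has_derivative_mult_right has_derivative_of_real has_derivative_inner_left has_derivative_ident)
  from has_derivative_compose[OF this DERIV_exp[unfolded has_field_derivative_def]]
  show "((\<lambda>t. ch (- (t \<bullet> \<xi>))) has_derivative (\<lambda>v. - (2 * pi * \<i> * of_real (v \<bullet> \<xi>)) * ch (- (t \<bullet> \<xi>)))) (at t)"
    unfolding e by (simp add: mult_ac)
  have "((\<lambda>\<xi>. - (2 * pi * \<i>) * of_real (t \<bullet> \<xi>)) has_derivative (\<lambda>v. - (2 * pi * \<i>) * of_real (t \<bullet> v))) (at \<xi>)"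
    by (intro has_derivative_mult_right has_derivative_of_real has_derivative_inner_right has_derivative_ident)
  from has_derivative_compose[OF this DERIV_exp[unfolded has_field_derivative_def]]
  show "((\<lambda>\<xi>. ch (- (t \<bullet> \<xi>))) has_derivative (\<lambda>v. - (2 * pi * \<i> * of_real (t \<bullet> v)) * ch (- (t \<bullet> \<xi>)))) (at \<xi>)"
    unfolding e by (simp add: mult_ac)
qed

text \<open>Integration by parts in the form of \<open>integral_pd\<close>: the integral of the
  derivative of f times a character vanishes.\<close>

lemma fourier_pd:
  assumes f: "f \<in> schwartz" and b: "b \<in> Basis"
  shows "fourier (pd b f) \<xi> = 2 * pi * \<i> * of_real (b \<bullet> \<xi>) * fourier f \<xi>"
proof -
  let ?g = "\<lambda>t. f t * ch (- (t \<bullet> \<xi>))"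
  have sl: "(\<lambda>t. ch (- (t \<bullet> \<xi>))) \<in> slow" by (rule slow_ch)
  have g: "h \<in> schwartz \<Longrightarrow> (\<lambda>t. h t * ch (- (t \<bullet> \<xi>))) \<in> schwartz" for h
    using schwartz_slow_mult[OF sl] by (simp add: mult.commute)
  have "pd b ?g = (\<lambda>t. f t * (- (2 * pi * \<i> * of_real (b \<bullet> \<xi>)) * ch (- (t \<bullet> \<xi>))) + pd b f t * ch (- (t \<bullet> \<xi>)))"
    by (rule pd_eqI[OF has_derivative_mult[OF schwartz_has_derivative[OF f] ch_has_derivative(1)]])
  then have "0 = (LINT t|lborel. - (2 * pi * \<i> * of_real (b \<bullet> \<xi>)) * (f t * ch (- (t \<bullet> \<xi>))) + pd b f t * ch (- (t \<bullet> \<xi>)))"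
    using integral_pd[OF g[OF f] b] by (simp add: mult_ac)
  also have "\<dots> = - (2 * pi * \<i> * of_real (b \<bullet> \<xi>)) * fourier f \<xi> + fourier (pd b f) \<xi>"
    unfolding fourier_def
    using schwartz_integrable[OF g[OF f]] schwartz_integrable[OF g[OF schwartz_pd[OF f b]]]
    by (subst Bochner_Integration.integral_add) auto
  finally show ?thesis by simp
qed

lemma coord_mult_schwartz: "f \<in> schwartz \<Longrightarrow> (\<lambda>t. - (2 * pi * \<i> * of_real (t \<bullet> b)) * f t) \<in> schwartz"
proof (rule schwartz_slow_mult)
  have "(\<lambda>t. - (2 * pi * \<i>) * of_real (t \<bullet> b)) \<in> slow"
    by (intro slow_mult slow_const slow_linear bounded_linear_inner_left)
  then show "(\<lambda>t. - (2 * pi * \<i> * of_real (t \<bullet> b))) \<in> slow" by simp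
qed

lemma fourier_has_derivative:
  assumes "f \<in> schwartz"
  shows "(fourier f has_derivative (\<lambda>v. fourier (\<lambda>t. - (2 * pi * \<i> * of_real (t \<bullet> v)) * f t) \<xi>)) (at \<xi>)"
proof -
  have "((\<lambda>\<xi>. LINT t|lborel. f t * ch (- (t \<bullet> \<xi>))) has_derivative
      (\<lambda>v. LINT t|lborel. f t * (- (2 * pi * \<i> * of_real (t \<bullet> v)) * ch (- (t \<bullet> \<xi>))))) (at \<xi>)"
  proof (rule has_derivative_integral_dominated[where f = "\<lambda>t \<xi>. f t * ch (- (t \<bullet> \<xi>))"
        and f' = "\<lambda>t \<xi> v. f t * (- (2 * pi * \<i> * of_real (t \<bullet> v)) * ch (- (t \<bullet> \<xi>)))"
        and B = "\<lambda>t. 2 * pi * (norm t * cmod (f t))"])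
    have [measurable]: "f \<in> borel_measurable borel" by (rule schwartz_measurable[OF assms])
    show "((\<lambda>\<xi>. f t * ch (- (t \<bullet> \<xi>))) has_derivative (\<lambda>v. f t * (- (2 * pi * \<i> * of_real (t \<bullet> v)) * ch (- (t \<bullet> \<xi>))))) (at \<xi>)" for t \<xi>
      by (rule has_derivative_mult_right[OF ch_has_derivative(2)])
    show "cmod (f t * (- (2 * pi * \<i> * of_real (t \<bullet> v)) * ch (- (t \<bullet> \<xi>)))) \<le> 2 * pi * (norm t * cmod (f t)) * norm v" for t \<xi> v
      using mult_left_mono[OF Cauchy_Schwarz_ineq2[of t v], of "2 * pi * cmod (f t)"]
      by (simp add: norm_mult mult_ac)
    obtain C where C: "C > 0" "\<And>t. (1 + norm t) ^ 1 * cmod (f t) \<le> C * wt t ^ 1"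
      using rapid_wt_bound[OF schwartz_rapid[OF assms]] by metis
    show "integrable lborel (\<lambda>t. 2 * pi * (norm t * cmod (f t)))"
    proof (intro integrable_mult_right, rule Bochner_Integration.integrable_bound[of _ "\<lambda>t. C * wt t"])
      show "integrable lborel (\<lambda>t::'a. C * wt t)" by (intro integrable_mult_right integrable_wt)
      show "AE t in lborel. norm (norm t * cmod (f t)) \<le> norm (C * wt t)"
      proof (intro always_eventually allI)
        fix t
        have "norm t * cmod (f t) \<le> (1 + norm t) ^ 1 * cmod (f t)" by (simp add: mult_right_mono)
        also have "\<dots> \<le> C * wt t" using C(2)[of t] by simp
        finally show "norm (norm t * cmod (f t)) \<le> norm (C * wt t)" using C(1) by (simp add: abs_mult)
      qed
    qed measurable
    show "integrable lborel (\<lambda>t. f t * ch (- (t \<bullet> \<xi>)))" for \<xi>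
      using schwartz_integrable[OF schwartz_slow_mult[OF slow_ch(2) assms]] by (simp add: mult.commute)
    show "(\<lambda>t. f t * (- (2 * pi * \<i> * of_real (t \<bullet> v)) * ch (- (t \<bullet> \<xi>)))) \<in> borel_measurable borel" for v \<xi>
      by measurable
  qed
  then show ?thesis unfolding fourier_def[abs_def] by (simp add: mult_ac)
qed

lemma one_plus_norm_le_sum: "1 + norm x \<le> 1 + (\<Sum>b\<in>Basis. \<bar>x \<bullet> b\<bar>)"
  using norm_le_l1[of x] by simp

text \<open>Each power of 1 + |\<xi>| is traded for one derivative in t. The induction runs over all
  F because its step is applied to \<open>pd (0, b) F\<close>, and the parameter x is carried along
  since the decay of the short-time Fourier transform needs both variables at once.\<close>

lemma fourier_section_decay:
  fixes F :: "'w::euclidean_space \<times> 'a::euclidean_space \<Rightarrow> complex"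
  assumes "F \<in> schwartz"
  shows "\<exists>C>0. \<forall>x \<xi>. (1 + norm \<xi>) ^ k * cmod (fourier (\<lambda>t. F (x, t)) \<xi>) \<le> C * wt x ^ m"
  using assms
proof (induction k arbitrary: F)
  case (0 F)
  then have F: "F \<in> schwartz" by simp
  obtain C where C: "C > 0" "\<And>x t. (1 + norm t) ^ (2 * DIM('a)) * cmod (F (x, t)) \<le> C * wt x ^ m"
    using rapid_prod_bound[OF schwartz_rapid[OF F]] by metis
  have b: "cmod (F (x, t)) \<le> C * wt x ^ m * wt t" for x t
  proof -
    have "0 < (1 + norm t) ^ (2 * DIM('a))" by (intro zero_less_power) (simp add: add_pos_nonneg)
    then show ?thesis using C(2)[of t x] by (simp add: wt_def[of t] pos_le_divide_eq mult.commute)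
  qed
  let ?I = "LINT (t::'a)|lborel. wt t"
  have "cmod (fourier (\<lambda>t. F (x, t)) \<xi>) \<le> (C * (?I + 1)) * wt x ^ m" for x \<xi>
  proof -
    have "cmod (fourier (\<lambda>t. F (x, t)) \<xi>) \<le> (LINT t|lborel. cmod (F (x, t)))"
      by (rule norm_fourier_le[OF schwartz_integrable[OF schwartz_section[OF F]]])
    also have "\<dots> \<le> (LINT (t::'a)|lborel. C * wt x ^ m * wt t)"
      by (rule integral_mono) (use b in \<open>simp_all add: integrable_wt schwartz_integrable[OF schwartz_section[OF F]]\<close>)
    also have "\<dots> = C * ?I * wt x ^ m" by (simp add: mult_ac)
    also have "\<dots> \<le> (C * (?I + 1)) * wt x ^ m"
      using C(1) by (intro mult_right_mono mult_left_mono) auto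
    finally show ?thesis .
  qed
  moreover have "0 < C * (?I + 1)" using C(1) by (intro mult_pos_pos add_nonneg_pos) (auto intro: Bochner_Integration.integral_nonneg)
  ultimately show ?case by auto
next
  case (Suc k F)
  have "\<exists>C>0. \<forall>x \<xi>. (1 + norm \<xi>) ^ k * cmod (fourier (\<lambda>t. pd (0, b) F (x, t)) \<xi>) \<le> C * wt x ^ m" if "b \<in> Basis" for b :: 'a
    by (rule Suc.IH[OF schwartz_pd[OF Suc.prems Pair0_Basis[OF that]]])
  then obtain Cb where Cb: "\<And>b. b \<in> Basis \<Longrightarrow> 0 < Cb b"
    "\<And>b x \<xi>. b \<in> Basis \<Longrightarrow> (1 + norm \<xi>) ^ k * cmod (fourier (\<lambda>t. pd (0, b) F (x, t)) \<xi>) \<le> Cb b * wt x ^ m"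
    by metis
  obtain C where C: "C > 0" "\<And>x \<xi>. (1 + norm \<xi>) ^ k * cmod (fourier (\<lambda>t. F (x, t)) \<xi>) \<le> C * wt x ^ m"
    using Suc.IH[OF Suc.prems] by metis
  have c: "\<bar>\<xi> \<bullet> b\<bar> * cmod (fourier (\<lambda>t. F (x, t)) \<xi>) \<le> cmod (fourier (\<lambda>t. pd (0, b) F (x, t)) \<xi>)"
    if b: "b \<in> Basis" for b x and \<xi> :: 'a
  proof -
    have "pd b (\<lambda>t. F (x, t)) = (\<lambda>t. pd (0, b) F (x, t))"
      by (rule pd_eqI[OF section_has_derivative[OF Suc.prems]])
    then have "cmod (fourier (\<lambda>t. pd (0, b) F (x, t)) \<xi>) = 2 * pi * \<bar>\<xi> \<bullet> b\<bar> * cmod (fourier (\<lambda>t. F (x, t)) \<xi>)"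
      using fourier_pd[OF schwartz_section[OF Suc.prems] b, of x \<xi>] by (simp add: norm_mult inner_commute)
    \<comment> \<open>The factor 2 pi produced by \<open>fourier_pd\<close> exceeds 1 and is given
      away.\<close>
    moreover have "1 * (\<bar>\<xi> \<bullet> b\<bar> * cmod (fourier (\<lambda>t. F (x, t)) \<xi>)) \<le> (2 * pi) * (\<bar>\<xi> \<bullet> b\<bar> * cmod (fourier (\<lambda>t. F (x, t)) \<xi>))"
      using pi_ge_two by (intro mult_right_mono) auto
    ultimately show ?thesis by simp
  qed
  have "(1 + norm \<xi>) ^ Suc k * cmod (fourier (\<lambda>t. F (x, t)) \<xi>) \<le> (C + (\<Sum>b\<in>(Basis::'a set). Cb b)) * wt x ^ m" for x \<xi>
  proof -
    let ?f = "cmod (fourier (\<lambda>t. F (x, t)) \<xi>)"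
    have "(1 + norm \<xi>) ^ Suc k * ?f = (1 + norm \<xi>) ^ k * ((1 + norm \<xi>) * ?f)" by simp
    also have "\<dots> \<le> (1 + norm \<xi>) ^ k * ((1 + (\<Sum>b\<in>Basis. \<bar>\<xi> \<bullet> b\<bar>)) * ?f)"
      by (intro mult_left_mono mult_right_mono one_plus_norm_le_sum) auto
    also have "\<dots> = (1 + norm \<xi>) ^ k * ?f + (\<Sum>b\<in>Basis. (1 + norm \<xi>) ^ k * (\<bar>\<xi> \<bullet> b\<bar> * ?f))"
      by (simp add: distrib_left distrib_right sum_distrib_left sum_distrib_right)
    also have "\<dots> \<le> C * wt x ^ m + (\<Sum>b\<in>Basis. Cb b * wt x ^ m)"
    proof (intro add_mono C(2) sum_mono)
      fix b :: 'a assume b: "b \<in> Basis"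
      have "(1 + norm \<xi>) ^ k * (\<bar>\<xi> \<bullet> b\<bar> * ?f) \<le> (1 + norm \<xi>) ^ k * cmod (fourier (\<lambda>t. pd (0, b) F (x, t)) \<xi>)"
        by (intro mult_left_mono c b) auto
      also have "\<dots> \<le> Cb b * wt x ^ m" by (rule Cb(2)[OF b])
      finally show "(1 + norm \<xi>) ^ k * (\<bar>\<xi> \<bullet> b\<bar> * ?f) \<le> Cb b * wt x ^ m" .
    qed
    finally show ?thesis by (simp add: distrib_right sum_distrib_right)
  qed
  moreover have "0 < C + (\<Sum>b\<in>(Basis::'a set). Cb b)"
    using C(1) Cb(1) by (intro add_pos_nonneg sum_nonneg) (auto intro: less_imp_le)
  ultimately show ?case by blast
qed

lemma fourier_rapid:
  fixes f :: "'a::euclidean_space \<Rightarrow> complex"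
  assumes "f \<in> schwartz" shows "rapid (fourier f)"
  unfolding rapid_def
proof
  fix k
  \<comment> \<open>The section of this tensor product at x = 0 is f itself, as
    \<open>gs 1 0\<close> is 1.\<close>
  let ?F = "\<lambda>(x::real, t). gs 1 x * f t"
  have F: "?F \<in> schwartz" by (intro schwartz_tensor gs_schwartz assms) simp
  obtain C where "\<And>x \<xi>. (1 + norm \<xi>) ^ k * cmod (fourier (\<lambda>t. ?F (x, t)) \<xi>) \<le> C * wt x ^ 0"
    using fourier_section_decay[OF F, of k 0] by blast
  from this[of _ 0] show "\<exists>C. \<forall>\<xi>. (1 + norm \<xi>) ^ k * cmod (fourier f \<xi>) \<le> C"
    by (auto simp: gs_def)
qed

lemma fourier_schwartz:
  assumes "f \<in> schwartz" shows "fourier f \<in> schwartz"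
proof (rule schwartz_image[where T = fourier, OF assms])
  fix f :: "'a \<Rightarrow> complex" assume f: "f \<in> schwartz"
  show "(fourier f has_derivative (\<lambda>v. fourier (\<lambda>t. - (2 * pi * \<i> * of_real (t \<bullet> v)) * f t) \<xi>)) (at \<xi>)" for \<xi>
    by (rule fourier_has_derivative[OF f])
  show "(\<lambda>\<xi>. fourier (\<lambda>t. - (2 * pi * \<i> * of_real (t \<bullet> b)) * f t) \<xi>) \<in> fourier ` schwartz" for b
    by (rule image_eqI[OF refl coord_mult_schwartz[OF f]])
  show "rapid (fourier f)" by (rule fourier_rapid[OF f])
qed

text \<open>For a Gaussian, multiplication by a coordinate is a multiple of differentiation. Its
  Fourier transform therefore solves the same first-order equation with a replaced by 1 / a, and the
  constant is read off at 0.\<close>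

lemma fourier_gs:
  assumes a: "a > 0"
  shows "fourier (gs a) (\<xi>::'a::euclidean_space) = of_real ((1 / sqrt a) ^ DIM('a)) * gs (1 / a) \<xi>"
proof -
  let ?\<gamma> = "gs a :: 'a \<Rightarrow> complex"
  have S: "?\<gamma> \<in> schwartz" by (rule gs_schwartz[OF a])
  have pdg: "pd b ?\<gamma> = (\<lambda>x. of_real (- (2 * pi * a * (x \<bullet> b))) * ?\<gamma> x)" for b
    by (rule pd_eqI[OF gs_has_derivative])
  have D: "(fourier ?\<gamma> has_derivative (\<lambda>v. of_real (- (2 * pi / a * (\<xi> \<bullet> v))) * fourier ?\<gamma> \<xi>)) (at \<xi>)" for \<xi>
  proof -
    have lin: "fourier (\<lambda>t. c * f t) \<xi> = c * fourier f \<xi>" for c f and \<xi> :: 'a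
      unfolding fourier_def by (simp add: mult.assoc)
    have b: "fourier (\<lambda>t. - (2 * pi * \<i> * of_real (t \<bullet> b)) * ?\<gamma> t) \<xi> = of_real (- (2 * pi / a * (\<xi> \<bullet> b))) * fourier ?\<gamma> \<xi>"
      if "b \<in> Basis" for b
    proof -
      have "(\<lambda>t. - (2 * pi * \<i> * of_real (t \<bullet> b)) * ?\<gamma> t) = (\<lambda>t. (\<i> / a) * pd b ?\<gamma> t)"
        using a by (simp add: pdg field_simps)
      then have "fourier (\<lambda>t. - (2 * pi * \<i> * of_real (t \<bullet> b)) * ?\<gamma> t) \<xi> = (\<i> / a) * (2 * pi * \<i> * of_real (b \<bullet> \<xi>) * fourier ?\<gamma> \<xi>)"
        by (simp only: lin fourier_pd[OF S that])
      also have "\<dots> = of_real (- (2 * pi / a * (\<xi> \<bullet> b))) * fourier ?\<gamma> \<xi>"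
        by (simp add: inner_commute field_simps)
      finally show ?thesis .
    qed
    have "pd v (fourier ?\<gamma>) \<xi> = of_real (- (2 * pi / a * (\<xi> \<bullet> v))) * fourier ?\<gamma> \<xi>" for v
    proof -
      have "pd v (fourier ?\<gamma>) \<xi> = (\<Sum>b\<in>Basis. of_real (v \<bullet> b) * pd b (fourier ?\<gamma>) \<xi>)"
        by (rule pd_sum_Basis[OF schwartz_smooth[OF fourier_schwartz[OF S]]])
      also have "\<dots> = (\<Sum>b\<in>Basis. of_real (v \<bullet> b) * (of_real (- (2 * pi / a * (\<xi> \<bullet> b))) * fourier ?\<gamma> \<xi>))"
        by (rule sum.cong[OF refl]) (simp only: pd_eqI[OF fourier_has_derivative[OF S]] b)
      also have "\<dots> = of_real (- (2 * pi / a * (\<Sum>b\<in>Basis. (v \<bullet> b) * (\<xi> \<bullet> b)))) * fourier ?\<gamma> \<xi>"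
        by (simp add: sum_distrib_left sum_distrib_right mult_ac sum_negf)
      also have "(\<Sum>b\<in>Basis. (v \<bullet> b) * (\<xi> \<bullet> b)) = \<xi> \<bullet> v"
        by (subst euclidean_inner[of \<xi> v]) (simp add: mult.commute)
      finally show ?thesis .
    qed
    then show ?thesis using schwartz_has_derivative[OF fourier_schwartz[OF S], of \<xi>] by simp
  qed
  have G: "(gs (- (1 / a)) has_derivative (\<lambda>v. of_real (- (2 * pi * (- (1 / a)) * (\<xi> \<bullet> v))) * gs (- (1 / a)) \<xi>)) (at \<xi>)" for \<xi> :: 'a
    by (rule gs_has_derivative)
  \<comment> \<open>\<open>gs (- (1 / a))\<close> is the growing Gaussian, the reciprocal of the
    expected answer; the product with it has derivative 0.\<close>
  have "((\<lambda>\<xi>. fourier ?\<gamma> \<xi> * gs (- (1 / a)) \<xi>) has_derivative (\<lambda>v. 0)) (at \<xi> within UNIV)" for \<xi>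
    using has_derivative_mult[OF D G, of \<xi>] by (simp add: algebra_simps)
  then obtain c where c: "\<And>\<xi>. fourier ?\<gamma> \<xi> * gs (- (1 / a)) \<xi> = c"
    using has_derivative_zero_constant[of UNIV "\<lambda>\<xi>. fourier ?\<gamma> \<xi> * gs (- (1 / a)) \<xi>"] by auto
  have "fourier ?\<gamma> 0 = of_real ((1 / sqrt a) ^ DIM('a))"
    by (simp add: fourier_def integral_gs[OF a])
  then have "c = of_real ((1 / sqrt a) ^ DIM('a))" using c[of 0] by (simp add: gs_def)
  moreover have "gs (- (1 / a)) \<xi> * gs (1 / a) \<xi> = 1"
    by (simp add: gs_def flip: of_real_mult exp_add)
  ultimately show ?thesis using c[of \<xi>]
    by (metis mult.assoc mult.right_neutral)
qed

lemma fourier_multiplication: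
  fixes f g :: "'a::euclidean_space \<Rightarrow> complex"
  assumes "f \<in> schwartz" "g \<in> schwartz"
  shows "(LINT \<xi>|lborel. fourier f \<xi> * g \<xi>) = (LINT t|lborel. f t * fourier g t)"
proof -
  let ?H = "\<lambda>(t, \<xi>). f t * g \<xi> * ch (- (t \<bullet> \<xi>))"
  have "(\<lambda>z. ch (- (fst z \<bullet> snd z)) * (\<lambda>(t, \<xi>). f t * g \<xi>) z) \<in> schwartz"
    by (intro schwartz_slow_mult slow_ch_inner schwartz_tensor assms bounded_linear_fst bounded_linear_snd)
  then have "?H \<in> schwartz" by (simp add: case_prod_unfold mult_ac)
  then have int: "integrable (lborel \<Otimes>\<^sub>M lborel) ?H"
    unfolding lborel_prod by (rule schwartz_integrable)
  have "(LINT \<xi>|lborel. fourier f \<xi> * g \<xi>) = (LINT \<xi>|lborel. LINT t|lborel. f t * g \<xi> * ch (- (t \<bullet> \<xi>)))"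
    unfolding fourier_def by (simp add: mult_ac flip: integral_mult_right_zero)
  also have "\<dots> = (LINT t|lborel. LINT \<xi>|lborel. f t * g \<xi> * ch (- (t \<bullet> \<xi>)))"
    by (rule lborel_pair.Fubini_integral[OF int])
  also have "\<dots> = (LINT t|lborel. f t * fourier g t)"
    unfolding fourier_def by (simp add: mult_ac inner_commute flip: integral_mult_right_zero)
  finally show ?thesis .
qed

text \<open>Pairing \<open>fourier f\<close> with a wide Gaussian amounts to averaging \<open>f\<close> against a narrow one.\<close>

lemma integral_fourier:
  fixes f :: "'a::euclidean_space \<Rightarrow> complex"
  assumes f: "f \<in> schwartz"
  shows "(LINT \<xi>|lborel. fourier f \<xi>) = f 0"
proof (rule LIMSEQ_unique)
  have f_meas [measurable]: "f \<in> borel_measurable borel" by (rule schwartz_measurable[OF f])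
  have ff_meas [measurable]: "fourier f \<in> borel_measurable borel" by (rule schwartz_measurable[OF fourier_schwartz[OF f]])
  have gs_meas [measurable]: "(gs a :: 'a \<Rightarrow> complex) \<in> borel_measurable borel" for a
    unfolding gs_def[abs_def] by measurable
  define e where "e n = 1 / real (Suc n)" for n
  have e: "e n > 0" "e \<longlonglongrightarrow> 0" for n
    unfolding e_def using LIMSEQ_inverse_real_of_nat by (simp_all add: inverse_eq_divide)
  have en: "e n \<noteq> 0" for n using e(1)[of n] by linarith
  have gs0: "(\<lambda>n. gs (e n ^ 2) x) \<longlonglongrightarrow> 1" for x :: 'a
  proof -
    have "(\<lambda>n. gs (e n ^ 2) x) \<longlonglongrightarrow> complex_of_real (exp (- (pi * 0 ^ 2 * (x \<bullet> x))))"
      unfolding gs_def by (intro tendsto_intros e)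
    then show ?thesis by simp
  qed
  have gs_le: "cmod (gs a x) \<le> 1" if "a \<ge> 0" for a and x :: 'a
    using that by (simp add: gs_def)
  show "(\<lambda>n. LINT \<xi>|lborel. fourier f \<xi> * gs (e n ^ 2) \<xi>) \<longlonglongrightarrow> (LINT \<xi>|lborel. fourier f \<xi>)"
  proof (rule integral_dominated_convergence[where w = "\<lambda>\<xi>. cmod (fourier f \<xi>)"])
    show "AE \<xi> in lborel. (\<lambda>n. fourier f \<xi> * gs (e n ^ 2) \<xi>) \<longlonglongrightarrow> fourier f \<xi>"
    proof (intro always_eventually allI)
      show "(\<lambda>n. fourier f \<xi> * gs (e n ^ 2) \<xi>) \<longlonglongrightarrow> fourier f \<xi>" for \<xi>
        using tendsto_mult[OF tendsto_const gs0, of "fourier f \<xi>" \<xi>] by simp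
    qed
    show "AE \<xi> in lborel. cmod (fourier f \<xi> * gs (e n ^ 2) \<xi>) \<le> cmod (fourier f \<xi>)" for n
      using gs_le[of "e n ^ 2"] by (auto simp: norm_mult intro!: mult_left_le)
    show "integrable lborel (\<lambda>\<xi>. cmod (fourier f \<xi>))"
      by (intro integrable_norm schwartz_integrable fourier_schwartz f)
  qed measurable
  have eq: "(LINT \<xi>|lborel. fourier f \<xi> * gs (e n ^ 2) \<xi>) = (LINT y|lborel. f (e n *\<^sub>R y) * gs 1 y)" for n
  proof -
    have "(LINT \<xi>|lborel. fourier f \<xi> * gs (e n ^ 2) \<xi>) = (LINT t|lborel. f t * fourier (gs (e n ^ 2)) t)"
      by (rule fourier_multiplication[OF f gs_schwartz]) (use en in simp)
    also have "\<dots> = (LINT t|lborel. f t * (of_real ((1 / e n) ^ DIM('a)) * gs (1 / e n ^ 2) t))"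
      using e(1)[of n] by (simp add: fourier_gs real_sqrt_abs)
    also have "\<dots> = of_real (e n ^ DIM('a)) * (LINT y|lborel. f (e n *\<^sub>R y) * (of_real ((1 / e n) ^ DIM('a)) * gs (1 / e n ^ 2) (e n *\<^sub>R y)))"
      by (rule integral_dilate[OF _ e(1)]) measurable
    also have "\<dots> = (LINT y|lborel. of_real (e n ^ DIM('a)) * (f (e n *\<^sub>R y) * (of_real ((1 / e n) ^ DIM('a)) * gs (1 / e n ^ 2) (e n *\<^sub>R y))))"
      by simp
    also have "\<dots> = (LINT y|lborel. f (e n *\<^sub>R y) * gs 1 y)"
      using en[of n] by (simp add: gs_def power_divide power2_eq_square)
    finally show ?thesis .
  qed
  show "(\<lambda>n. LINT \<xi>|lborel. fourier f \<xi> * gs (e n ^ 2) \<xi>) \<longlonglongrightarrow> f 0"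
  proof -
    obtain C where C: "\<And>x. cmod (f x) \<le> C"
      using rapidE[OF schwartz_rapid[OF f], of 0] by (metis mult_1 power_0)
    have "(\<lambda>n. LINT y|lborel. f (e n *\<^sub>R y) * gs 1 y) \<longlonglongrightarrow> (LINT (y::'a)|lborel. f 0 * gs 1 y)"
    proof (rule integral_dominated_convergence[where w = "\<lambda>y. C * cmod (gs 1 y)"])
      show "AE y in lborel. (\<lambda>n. f (e n *\<^sub>R y) * gs 1 y) \<longlonglongrightarrow> f 0 * gs 1 y"
      proof (intro always_eventually allI tendsto_mult tendsto_const)
        fix y :: 'a
        have "isCont f 0" using schwartz_continuous[OF f] by (simp add: continuous_on_eq_continuous_at)
        moreover have "(\<lambda>n. e n *\<^sub>R y) \<longlonglongrightarrow> 0" using tendsto_scaleR[OF e(2) tendsto_const, of y] by simp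
        ultimately show "(\<lambda>n. f (e n *\<^sub>R y)) \<longlonglongrightarrow> f 0" by (rule isCont_tendsto_compose)
      qed
      show "AE y in lborel. cmod (f (e n *\<^sub>R y) * gs 1 y) \<le> C * cmod (gs 1 y)" for n
        using C by (auto simp: norm_mult intro!: mult_right_mono)
      show "integrable lborel (\<lambda>y::'a. C * cmod (gs 1 y))"
        by (intro integrable_mult_right integrable_norm schwartz_integrable gs_schwartz) simp
    qed measurable
    then show ?thesis unfolding eq by (simp add: integral_gs)
  qed
qed

text \<open>This is \<open>integral_fourier\<close> for the translate of f that moves t to the
  origin; translation multiplies the transform by the character.\<close>

lemma fourier_inversion:
  fixes f :: "'a::euclidean_space \<Rightarrow> complex"
  assumes f: "f \<in> schwartz"
  shows "(LINT \<xi>|lborel. fourier f \<xi> * ch (t \<bullet> \<xi>)) = f t"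
proof -
  have g: "(\<lambda>x. f (x - (- t))) \<in> schwartz" by (rule schwartz_translation[OF f])
  have [measurable]: "f \<in> borel_measurable borel" by (rule schwartz_measurable[OF f])
  have "fourier (\<lambda>x. f (x - (- t))) \<xi> = fourier f \<xi> * ch (t \<bullet> \<xi>)" for \<xi>
  proof -
    have "fourier (\<lambda>x. f (x - (- t))) \<xi> = (LINT x|lborel. (\<lambda>x. f x * ch (- ((x - t) \<bullet> \<xi>))) (x - (- t)))"
      unfolding fourier_def by simp
    also have "\<dots> = (LINT x|lborel. f x * ch (- ((x - t) \<bullet> \<xi>)))"
      by (rule integral_translate) measurable
    also have "\<dots> = (LINT x|lborel. (f x * ch (- (x \<bullet> \<xi>))) * ch (t \<bullet> \<xi>))"
      by (simp add: inner_diff_left mult.assoc flip: ch_add)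
    finally show ?thesis unfolding fourier_def by simp
  qed
  then show ?thesis using integral_fourier[OF g] by simp
qed

text \<open>By inversion the conjugate of \<open>fourier g\<close> is transformed into the conjugate
  of g, so Parseval follows from the multiplication formula.\<close>

lemma parseval:
  fixes f g :: "'a::euclidean_space \<Rightarrow> complex"
  assumes "f \<in> schwartz" "g \<in> schwartz"
  shows "pairing (fourier f) (fourier g) = pairing f g"
proof -
  have "fourier (\<lambda>\<xi>. cnj (fourier g \<xi>)) t = cnj (g t)" for t
  proof -
    have "cnj (LINT \<xi>|lborel. fourier g \<xi> * ch (t \<bullet> \<xi>)) = (LINT \<xi>|lborel. cnj (fourier g \<xi> * ch (t \<bullet> \<xi>)))"
      by (rule Bochner_Integration.integral_cnj[symmetric])
    then show ?thesis unfolding fourier_inversion[OF assms(2)] by (simp add: fourier_def[of "\<lambda>\<xi>. cnj (fourier g \<xi>)"] inner_commute)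
  qed
  then show ?thesis
    using fourier_multiplication[OF assms(1) schwartz_cnj[OF fourier_schwartz[OF assms(2)]]]
    by (simp add: pairing_def)
qed

section \<open>The short-time Fourier transform\<close>

lemma modulation_eq: "modulation \<xi> g = (\<lambda>t. ch (t \<bullet> \<xi>) * g t)"
  unfolding modulation_def ch_eq_exp[symmetric] by simp

lemma modulation_schwartz: "g \<in> schwartz \<Longrightarrow> modulation \<xi> g \<in> schwartz"
  unfolding modulation_eq by (intro schwartz_slow_mult slow_ch)

lemma translation_schwartz: "g \<in> schwartz \<Longrightarrow> translation x g \<in> schwartz"
  unfolding translation_def by (rule schwartz_translation)

lemma STFT_eq: "STFT \<phi> u x \<xi> = u (\<lambda>t. ch (t \<bullet> \<xi>) * \<phi> (t - x))"
  unfolding STFT_def modulation_eq translation_def ..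

lemma STFT_pairing: "STFT \<phi> (pairing f) x \<xi> = fourier (\<lambda>t. f t * cnj (\<phi> (t - x))) \<xi>"
  unfolding STFT_eq pairing_def fourier_def by (simp add: mult_ac)

lemma STFT_window_schwartz:
  assumes "f \<in> schwartz" "\<phi> \<in> schwartz" shows "(\<lambda>t. f t * cnj (\<phi> (t - x))) \<in> schwartz"
  by (intro schwartz_mult schwartz_cnj schwartz_translation assms)

lemma schwartz_shear_cnj:
  assumes "f \<in> schwartz" "\<phi> \<in> schwartz" shows "(\<lambda>(x, t). f t * cnj (\<phi> (t - x))) \<in> schwartz"
  using schwartz_shear(1)[OF schwartz_cnj[OF assms(2)] assms(1)] by (simp add: mult.commute)

lemma le_wt:
  fixes x :: "'a::euclidean_space"
  assumes "(1 + norm x) ^ (2 * DIM('a) * m) * y \<le> C" shows "y \<le> C * wt x ^ m"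
proof -
  have "0 < (1 + norm x) ^ (2 * DIM('a) * m)" by (intro zero_less_power) (simp add: add_pos_nonneg)
  then show ?thesis using assms
    by (simp add: wt_def power_divide power_mult[symmetric] pos_le_divide_eq mult.commute)
qed

lemma STFT_decay:
  fixes f \<phi> :: "'a::euclidean_space \<Rightarrow> complex"
  assumes "f \<in> schwartz" "\<phi> \<in> schwartz"
  shows "\<exists>C>0. \<forall>x \<xi>. cmod (STFT \<phi> (pairing f) x \<xi>) \<le> C * (wt x ^ m * wt \<xi> ^ m)"
proof -
  obtain C where C: "C > 0" "\<And>x \<xi>. (1 + norm \<xi>) ^ (2 * DIM('a) * m) * cmod (STFT \<phi> (pairing f) x \<xi>) \<le> C * wt x ^ m"
    using fourier_section_decay[OF schwartz_shear_cnj[OF assms], of "2 * DIM('a) * m" m]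
    unfolding STFT_pairing prod.case by metis
  show ?thesis using le_wt[OF C(2)] C(1) by (auto simp: mult.assoc)
qed

text \<open>The test functions need not decay in the parameters x and \<xi>, so they are not the
  sections of a Schwartz function. Multiplying by Gaussians in x and \<xi> makes them so, and the
  nowhere vanishing Gaussians are divided out afterwards. The shear \<open>?L\<close> makes the
  translated window a tensor product.\<close>

lemma STFT_continuous:
  fixes u :: "('a::euclidean_space \<Rightarrow> complex) \<Rightarrow> complex"
  assumes "u \<in> tempered" "\<phi> \<in> schwartz"
  shows "continuous_on UNIV (\<lambda>(x, \<xi>). STFT \<phi> u x \<xi>)"
proof -
  let ?L = "\<lambda>z::('a \<times> 'a) \<times> 'a. (fst z, snd z - fst (fst z))"
  have norm_le: "norm z \<le> 3 * norm (?L z)" for z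
  proof -
    obtain x \<xi> t where z: "z = ((x, \<xi>), t)" by (metis prod.exhaust)
    have "norm t \<le> norm x + norm (t - x)" using norm_triangle_ineq[of x "t - x"] by simp
    moreover have "norm x \<le> norm (x, \<xi>)" using norm_fst_le[of x \<xi>] by simp
    ultimately show ?thesis
      unfolding z using norm_fst_le[of "(x, \<xi>)" "t - x"] norm_snd_le[of "t - x" "(x, \<xi>)"]
        norm_Pair_le[of "(x, \<xi>)" t] by simp
  qed
  let ?T = "\<lambda>(w, s). (\<lambda>(x, \<xi>). gs 1 x * gs 1 \<xi>) w * \<phi> s"
  have T: "?T \<in> schwartz" by (intro schwartz_tensor gs_schwartz assms) auto
  have "(\<lambda>z. ?T (?L z)) \<in> schwartz"
    by (rule schwartz_linear_comp[OF _ norm_le T])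
      (intro bounded_linear_Pair bounded_linear_sub bounded_linear_fst bounded_linear_snd
        bounded_linear_compose[OF bounded_linear_fst bounded_linear_fst])
  then have K: "(\<lambda>z. ch (snd z \<bullet> snd (fst z)) * ?T (?L z)) \<in> schwartz" (is "?K \<in> _")
    by (intro schwartz_slow_mult slow_ch_inner bounded_linear_snd
        bounded_linear_compose[OF bounded_linear_snd bounded_linear_fst])
  have "continuous_on UNIV (\<lambda>w. u (\<lambda>t. ?K (w, t)))"
    by (rule tempered_section_continuous[OF assms(1) K])
  moreover have "u (\<lambda>t. ?K (w, t)) = cnj (gs 1 (fst w) * gs 1 (snd w)) * STFT \<phi> u (fst w) (snd w)" for w
  proof -
    have "(\<lambda>t. ?K (w, t)) = (\<lambda>t. (gs 1 (fst w) * gs 1 (snd w)) * (modulation (snd w) (translation (fst w) \<phi>)) t)"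
      by (simp add: modulation_eq translation_def case_prod_unfold mult_ac)
    then show ?thesis unfolding STFT_def
      by (simp only: tempered_cmult[OF assms(1) modulation_schwartz[OF translation_schwartz[OF assms(2)]]])
  qed
  ultimately have "continuous_on UNIV (\<lambda>w. cnj (gs 1 (fst w) * gs 1 (snd w)) * STFT \<phi> u (fst w) (snd w))" by simp
  moreover have "continuous_on UNIV (\<lambda>w::'a \<times> 'a. cnj (gs 1 (fst w) * gs 1 (snd w)))"
    unfolding gs_def by (intro continuous_intros)
  ultimately have "continuous_on UNIV (\<lambda>w. (cnj (gs 1 (fst w) * gs 1 (snd w)) * STFT \<phi> u (fst w) (snd w)) / cnj (gs 1 (fst w) * gs 1 (snd w)))"
    by (intro continuous_on_divide) auto
  then show ?thesis by (simp add: case_prod_unfold)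
qed

lemma STFT_measurable:
  assumes "u \<in> tempered" "\<phi> \<in> schwartz"
  shows "(\<lambda>(x, \<xi>). ennreal (cmod (STFT \<phi> u x \<xi>))) \<in> borel_measurable (borel \<Otimes>\<^sub>M borel)"
proof -
  have "(\<lambda>(x, \<xi>). STFT \<phi> u x \<xi>) \<in> borel_measurable (borel \<Otimes>\<^sub>M borel)"
    unfolding borel_prod by (rule borel_measurable_continuous_onI[OF STFT_continuous[OF assms]])
  then have "(\<lambda>z. ennreal (cmod ((\<lambda>(x, \<xi>). STFT \<phi> u x \<xi>) z))) \<in> borel_measurable (borel \<Otimes>\<^sub>M borel)"
    by measurable
  then show ?thesis by (simp add: case_prod_unfold)
qed

text \<open>The reproducing formula for the STFT, obtained by decomposing \<open>G\<close> first into its pieces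
  \<open>\<lambda>t. \<Phi> (t - z) * cnj (\<Gamma> (t - z)) * G t\<close> and then each piece by Fourier inversion.\<close>

theorem STFT_duality:
  fixes u :: "('a::euclidean_space \<Rightarrow> complex) \<Rightarrow> complex"
  assumes u: "u \<in> tempered" and \<Phi>: "\<Phi> \<in> schwartz" and \<Gamma>: "\<Gamma> \<in> schwartz" and G: "G \<in> schwartz"
  shows "ennreal (cmod (pairing \<Phi> \<Gamma>) * cmod (u G)) \<le>
    (\<integral>\<^sup>+ z. \<integral>\<^sup>+ \<zeta>. ennreal (cmod (STFT \<Phi> u z \<zeta>)) * ennreal (cmod (STFT \<Gamma> (pairing G) z \<zeta>)) \<partial>lborel \<partial>lborel)"
proof -
  define h where "h z t = G t * cnj (\<Gamma> (t - z))" for z t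
  have h: "h z \<in> schwartz" for z
    unfolding h_def by (rule STFT_window_schwartz[OF G \<Gamma>])
  have fh: "fourier (h z) \<zeta> = STFT \<Gamma> (pairing G) z \<zeta>" for z \<zeta>
    unfolding STFT_pairing h_def ..
  define K1 where "K1 = (\<lambda>(z, t). (\<Phi> (t - z) * cnj (\<Gamma> (t - z))) * G t)"
  have PG: "(\<lambda>x. \<Phi> x * cnj (\<Gamma> x)) \<in> schwartz" by (intro schwartz_mult schwartz_cnj \<Phi> \<Gamma>)
  have K1: "K1 \<in> schwartz" unfolding K1_def by (rule schwartz_shear(1)[OF PG G])
  have K1_int: "(\<lambda>t. LINT z|lborel. K1 (z, t)) = (\<lambda>t. pairing \<Phi> \<Gamma> * G t)"
  proof
    fix t
    have "(LINT z|lborel. (\<lambda>x. \<Phi> x * cnj (\<Gamma> x)) (t - z)) = pairing \<Phi> \<Gamma>"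
      unfolding pairing_def by (rule integral_reflect_translate[OF schwartz_measurable[OF PG]])
    then show "(LINT z|lborel. K1 (z, t)) = pairing \<Phi> \<Gamma> * G t" by (simp add: K1_def)
  qed
  have outer: "cnj (pairing \<Phi> \<Gamma>) * u G = (LINT z|lborel. u (\<lambda>t. K1 (z, t)))"
    using tempered_integral(2)[OF u K1] unfolding K1_int tempered_cmult[OF u G] .
  have inner: "ennreal (cmod (u (\<lambda>t. K1 (z, t)))) \<le>
    (\<integral>\<^sup>+ \<zeta>. ennreal (cmod (STFT \<Phi> u z \<zeta>)) * ennreal (cmod (STFT \<Gamma> (pairing G) z \<zeta>)) \<partial>lborel)" for z
  proof -
    define K2 where "K2 = (\<lambda>(\<zeta>, t). ch (t \<bullet> \<zeta>) * (fourier (h z) \<zeta> * translation z \<Phi> t))"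
    have "(\<lambda>w. ch (snd w \<bullet> fst w) * (\<lambda>(\<zeta>, t). fourier (h z) \<zeta> * translation z \<Phi> t) w) \<in> schwartz"
      by (intro schwartz_slow_mult slow_ch_inner schwartz_tensor fourier_schwartz h translation_schwartz \<Phi>
          bounded_linear_fst bounded_linear_snd)
    then have K2: "K2 \<in> schwartz" unfolding K2_def by (simp add: case_prod_unfold)
    have "(LINT \<zeta>|lborel. K2 (\<zeta>, t)) = K1 (z, t)" for t
    proof -
      have "(LINT \<zeta>|lborel. K2 (\<zeta>, t)) = (LINT \<zeta>|lborel. translation z \<Phi> t * (fourier (h z) \<zeta> * ch (t \<bullet> \<zeta>)))"
        unfolding K2_def by (simp add: mult_ac)
      also have "\<dots> = translation z \<Phi> t * h z t" by (simp add: fourier_inversion[OF h])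
      finally show ?thesis by (simp add: K1_def h_def translation_def)
    qed
    then have "u (\<lambda>t. K1 (z, t)) = (LINT \<zeta>|lborel. u (\<lambda>t. K2 (\<zeta>, t)))"
      using tempered_integral(2)[OF u K2] by simp
    then have "ennreal (cmod (u (\<lambda>t. K1 (z, t)))) \<le> (\<integral>\<^sup>+ \<zeta>. ennreal (cmod (u (\<lambda>t. K2 (\<zeta>, t)))) \<partial>lborel)"
      using integral_norm_bound_ennreal[OF tempered_integral(1)[OF u K2]] by simp
    also have "(\<lambda>\<zeta>. u (\<lambda>t. K2 (\<zeta>, t))) = (\<lambda>\<zeta>. cnj (fourier (h z) \<zeta>) * STFT \<Phi> u z \<zeta>)"
    proof
      fix \<zeta>
      have "(\<lambda>t. K2 (\<zeta>, t)) = (\<lambda>t. fourier (h z) \<zeta> * modulation \<zeta> (translation z \<Phi>) t)"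
        unfolding K2_def modulation_eq by (simp add: mult_ac)
      then show "u (\<lambda>t. K2 (\<zeta>, t)) = cnj (fourier (h z) \<zeta>) * STFT \<Phi> u z \<zeta>"
        unfolding STFT_def by (simp only: tempered_cmult[OF u modulation_schwartz[OF translation_schwartz[OF \<Phi>]]])
    qed
    finally show ?thesis by (simp add: fh norm_mult ennreal_mult mult.commute)
  qed
  have "ennreal (cmod (pairing \<Phi> \<Gamma>) * cmod (u G)) = ennreal (cmod (LINT z|lborel. u (\<lambda>t. K1 (z, t))))"
    unfolding outer[symmetric] by (simp add: norm_mult)
  also have "\<dots> \<le> (\<integral>\<^sup>+ z. ennreal (cmod (u (\<lambda>t. K1 (z, t)))) \<partial>lborel)"
    by (rule integral_norm_bound_ennreal[OF tempered_integral(1)[OF u K1]])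
  also have "\<dots> \<le> (\<integral>\<^sup>+ z. \<integral>\<^sup>+ \<zeta>. ennreal (cmod (STFT \<Phi> u z \<zeta>)) * ennreal (cmod (STFT \<Gamma> (pairing G) z \<zeta>)) \<partial>lborel \<partial>lborel)"
    by (intro nn_integral_mono inner)
  finally show ?thesis .
qed

section \<open>Mixed Lebesgue norms\<close>

lemma epow_top [simp]: "ennreal_powr \<infinity> r = \<infinity>" "ennreal_powr top r = top"
  by (simp_all add: ennreal_powr_def)

lemma epow_ennreal: "0 \<le> x \<Longrightarrow> ennreal_powr (ennreal x) r = ennreal (x powr r)"
  by (simp add: ennreal_powr_def)

lemma epow_0 [simp]: "ennreal_powr 0 r = 0"
  by (simp add: ennreal_powr_def)

lemma epow_one [simp]: "ennreal_powr 1 r = 1"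
  by (simp add: ennreal_powr_def)

lemma epow_1 [simp]: "ennreal_powr x 1 = x"
  by (cases x) (auto simp: epow_ennreal)

lemma epow_eq_0_iff [simp]: "ennreal_powr x r = 0 \<longleftrightarrow> x = 0"
  by (cases x) (auto simp: epow_ennreal ennreal_eq_0_iff)

lemma epow_eq_top_iff: "ennreal_powr x r = top \<longleftrightarrow> x = top"
  by (cases x) (auto simp: epow_ennreal)

lemma epow_mono:
  assumes "r > 0" "x \<le> y" shows "ennreal_powr x r \<le> ennreal_powr y r"
  using assms by (cases x; cases y) (auto simp: epow_ennreal top_unique intro!: ennreal_leI powr_mono2)

lemma epow_epow: "ennreal_powr (ennreal_powr x r) s = ennreal_powr x (r * s)"
  by (cases x) (auto simp: epow_ennreal powr_powr)

lemma epow_inverse: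
  assumes "r > 0"
  shows "ennreal_powr (ennreal_powr x r) (1 / r) = x" "ennreal_powr (ennreal_powr x (1 / r)) r = x"
  using assms by (simp_all add: epow_epow)

lemma epow_le_iff: "r > 0 \<Longrightarrow> ennreal_powr x r \<le> ennreal_powr y r \<longleftrightarrow> x \<le> y"
  by (metis epow_inverse(1) epow_mono zero_less_divide_1_iff)

lemma epow_le_swap: "r > 0 \<Longrightarrow> ennreal_powr x r \<le> y \<longleftrightarrow> x \<le> ennreal_powr y (1 / r)"
  by (metis epow_inverse(2) epow_le_iff)

lemma epow_mult:
  assumes "r > 0" shows "ennreal_powr (x * y) r = ennreal_powr x r * ennreal_powr y r"
proof (cases "x = 0 \<or> y = 0")
  case False
  then show ?thesis
    using assms by (cases x; cases y) (auto simp: epow_ennreal powr_mult ennreal_mult_top ennreal_top_mult ennreal_mult[symmetric] epow_eq_0_iff)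
qed auto

lemma epow_add: "r > 0 \<Longrightarrow> s > 0 \<Longrightarrow> ennreal_powr x (r + s) = ennreal_powr x r * ennreal_powr x s"
  by (cases x) (auto simp: epow_ennreal powr_add ennreal_mult[symmetric])

lemma epow_measurable [measurable]:
  "f \<in> borel_measurable M \<Longrightarrow> (\<lambda>x. ennreal_powr (f x) r) \<in> borel_measurable M"
proof -
  assume [measurable]: "f \<in> borel_measurable M"
  have "{x \<in> space M. f x = \<infinity>} = f -` {\<infinity>} \<inter> space M" by auto
  also have "\<dots> \<in> sets M" by (intro measurable_sets[of f M borel]) auto
  finally have [measurable]: "{x \<in> space M. f x = \<infinity>} \<in> sets M" .
  show ?thesis unfolding ennreal_powr_def by measurable
qed

lemma epow_SUP:
  assumes "r > 0" shows "ennreal_powr (SUP n\<in>A. g n) r = (SUP n\<in>A. ennreal_powr (g n) r)"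
proof (rule antisym)
  have "g n \<le> ennreal_powr (SUP n\<in>A. ennreal_powr (g n) r) (1 / r)" if "n \<in> A" for n
    unfolding epow_le_swap[OF assms, symmetric] by (rule SUP_upper[OF that])
  then show "ennreal_powr (SUP n\<in>A. g n) r \<le> (SUP n\<in>A. ennreal_powr (g n) r)"
    unfolding epow_le_swap[OF assms] by (rule SUP_least)
  show "(SUP n\<in>A. ennreal_powr (g n) r) \<le> ennreal_powr (SUP n\<in>A. g n) r"
    by (intro SUP_least epow_mono assms SUP_upper)
qed

section \<open>Exponents, their conjugates and their reciprocals\<close>

lemma exponent_cases:
  assumes "1 \<le> (p::ennreal)"
  obtains (top) "p = \<infinity>" | (real) P where "p = ennreal P" "1 \<le> P"
  using assms by (cases p) (auto simp: ennreal_ge_1)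

lemma Lp_norm_top: "Lp_norm \<infinity> f = esssup lborel f" "Lp_norm top f = esssup lborel f"
  by (simp_all add: Lp_norm_def)

lemma Lp_norm_real:
  "1 \<le> P \<Longrightarrow> Lp_norm (ennreal P) f = ennreal_powr (\<integral>\<^sup>+ x. ennreal_powr (f x) P \<partial>lborel) (1 / P)"
  by (simp add: Lp_norm_def)

lemma Lp_norm_1: "Lp_norm 1 f = (\<integral>\<^sup>+ x. f x \<partial>lborel)"
  using Lp_norm_real[of 1 f] by simp

lemma conj_exponent_real:
  assumes "1 < P" shows "conj_exponent (ennreal P) = ennreal (P / (P - 1))"
proof -
  have "1 - inverse (ennreal P) = ennreal (1 - 1 / P)"
    using assms by (simp add: inverse_ennreal inverse_eq_divide ennreal_minus flip: ennreal_1)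
  then show ?thesis
    unfolding conj_exponent_def using assms by (simp add: inverse_ennreal field_simps)
qed

lemma conj_exponent_1 [simp]: "conj_exponent 1 = \<infinity>"
  by (simp add: conj_exponent_def)

lemma conj_exponent_top [simp]: "conj_exponent \<infinity> = 1" "conj_exponent top = 1"
  by (simp_all add: conj_exponent_def)

lemma conj_exponent_ge_1: "1 \<le> conj_exponent p"
proof -
  have "1 \<le> inverse y" if "y \<le> 1" for y :: ennreal
  proof (cases y)
    case (real t)
    then have "t \<le> 1" using that by simp
    show ?thesis
    proof (cases "t = 0")
      case False
      then have "inverse (ennreal t) = ennreal (inverse t)" "1 \<le> inverse t"
        using real \<open>t \<le> 1\<close> by (auto intro!: inverse_ennreal one_le_inverse)
      then show ?thesis using real by simp
    qed (use real in simp)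
  qed (use that in \<open>simp add: top_unique\<close>)
  then show ?thesis unfolding conj_exponent_def by (simp add: diff_le_self_ennreal)
qed

text \<open>The reciprocal exponent as a real number, with 1 / \<infinity> = 0. In these numbers
  conjugation is 1 - t, and all conditions of the theorem become linear inequalities.\<close>

definition iv :: "ennreal \<Rightarrow> real" where
  "iv p = enn2real (inverse p)"

lemma iv_top [simp]: "iv \<infinity> = 0" "iv top = 0"
  by (simp_all add: iv_def)

lemma iv_1 [simp]: "iv 1 = 1"
  by (simp add: iv_def)

lemma iv_real: "1 \<le> P \<Longrightarrow> iv (ennreal P) = 1 / P"
  by (simp add: iv_def inverse_ennreal inverse_eq_divide)

lemma iv_nonneg: "0 \<le> iv p"
  by (simp add: iv_def)

lemma iv_le_iff:
  assumes "1 \<le> p" "1 \<le> q" shows "p \<le> q \<longleftrightarrow> iv q \<le> iv p"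
  using assms(1)
proof (cases rule: exponent_cases)
  case p: top
  show ?thesis using assms(2)
  proof (cases rule: exponent_cases)
    case (real Q)
    then show ?thesis by (simp add: p iv_real top_unique)
  qed (simp add: p)
next
  case p: (real P)
  show ?thesis using assms(2)
  proof (cases rule: exponent_cases)
    case (real Q)
    then show ?thesis using p by (simp add: iv_real field_simps)
  qed (use p in \<open>simp add: iv_real\<close>)
qed

lemma iv_conj:
  assumes "1 \<le> p" shows "iv (conj_exponent p) = 1 - iv p"
  using assms
proof (cases rule: exponent_cases)
  case (real P)
  show ?thesis
  proof (cases "P = 1")
    case False
    then have "1 < P" using real by simp
    moreover from this have "1 \<le> P / (P - 1)" by (simp add: field_simps)
    ultimately show ?thesis using real by (simp add: conj_exponent_real iv_real field_simps)
  qed (use real in simp)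
qed simp

section \<open>Elementary properties and measurability of Lebesgue norms\<close>

lemma Lp_norm_AE_le:
  assumes "1 \<le> p" "f \<in> borel_measurable borel" "AE x in lborel. f x \<le> g x"
  shows "Lp_norm p f \<le> Lp_norm p g"
  using assms(1)
proof (cases rule: exponent_cases)
  case top
  then show ?thesis unfolding top Lp_norm_top using assms by (intro esssup_AE_mono) auto
next
  case (real P)
  then show ?thesis using assms(3)
    by (auto simp: Lp_norm_real intro!: epow_mono nn_integral_mono_AE elim!: eventually_mono)
qed

lemma Lp_norm_mono:
  "1 \<le> p \<Longrightarrow> f \<in> borel_measurable borel \<Longrightarrow> (\<And>x. f x \<le> g x) \<Longrightarrow> Lp_norm p f \<le> Lp_norm p g"
  by (rule Lp_norm_AE_le) auto

lemma Lp_norm_cmult: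
  assumes "1 \<le> p" "f \<in> borel_measurable borel"
  shows "Lp_norm p (\<lambda>x. c * f x) \<le> c * Lp_norm p f"
  using assms(1)
proof (cases rule: exponent_cases)
  case top
  have "AE x in lborel. c * f x \<le> c * esssup lborel f"
    using esssup_AE[of f lborel] by eventually_elim (rule mult_left_mono, auto)
  then show ?thesis unfolding top Lp_norm_top using assms by (intro esssup_I) auto
next
  case (real P)
  then show ?thesis using assms
    by (simp add: Lp_norm_real epow_mult nn_integral_cmult epow_epow)
qed

lemma Lp_norm_distr:
  fixes T :: "'a::euclidean_space \<Rightarrow> 'a"
  assumes "1 \<le> p" "f \<in> borel_measurable borel" "distr lborel borel T = lborel" "T \<in> borel_measurable borel"
  shows "Lp_norm p (\<lambda>x. f (T x)) \<le> Lp_norm p f"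
proof -
  note [measurable] = assms(2,4)
  show ?thesis using assms(1)
  proof (cases rule: exponent_cases)
    case top
    have "AE x in distr lborel borel T. f x \<le> esssup lborel f"
      unfolding assms(3) by (rule esssup_AE)
    then have "AE x in lborel. f (T x) \<le> esssup lborel f" by (subst (asm) AE_distr_iff) auto
    then show ?thesis unfolding top Lp_norm_top by (intro esssup_I) auto
  next
    case (real P)
    have "(\<integral>\<^sup>+ x. ennreal_powr (f (T x)) P \<partial>lborel) = (\<integral>\<^sup>+ x. ennreal_powr (f x) P \<partial>distr lborel borel T)"
      by (subst nn_integral_distr) auto
    then show ?thesis using real unfolding assms(3) by (simp add: Lp_norm_real)
  qed
qed

lemma Lp_norm_translate:
  assumes "1 \<le> p" "f \<in> borel_measurable borel"
  shows "Lp_norm p (\<lambda>x. f (x - a)) \<le> Lp_norm p f" "Lp_norm p (\<lambda>x. f (x + a)) \<le> Lp_norm p f"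
    and "Lp_norm p (\<lambda>x. f (a - x)) \<le> Lp_norm p f"
  using Lp_norm_distr[OF assms lborel_translate[of a]] Lp_norm_distr[OF assms lborel_translate[of "- a"]]
    Lp_norm_distr[OF assms lborel_reflect[of a]] by simp_all

text \<open>The essential supremum exceeds c exactly if the set where h exceeds c has positive
  measure, and by Tonelli this measure depends measurably on x.\<close>

lemma borel_measurable_esssup:
  assumes [measurable]: "(\<lambda>(x, y). h x y) \<in> borel_measurable (M \<Otimes>\<^sub>M lborel)"
  shows "(\<lambda>x. esssup lborel (h x :: 'b::euclidean_space \<Rightarrow> ennreal)) \<in> borel_measurable M"
proof (rule borel_measurableI_greater)
  fix c :: ennreal
  have m: "h x \<in> borel_measurable borel" if "x \<in> space M" for x
    using measurable_compose[OF measurable_Pair1'[OF that] assms] by simp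
  have iff: "c < esssup lborel (h x) \<longleftrightarrow> 0 < (\<integral>\<^sup>+ y. indicator {y. c < h x y} y \<partial>lborel)" if x: "x \<in> space M" for x
  proof -
    have [measurable]: "h x \<in> borel_measurable borel" by (rule m[OF x])
    have "(\<integral>\<^sup>+ y. indicator {y. c < h x y} y \<partial>lborel) = emeasure lborel {y. c < h x y}"
      by (rule nn_integral_indicator) measurable
    moreover have "c < esssup lborel (h x) \<Longrightarrow> 0 < emeasure lborel {y. c < h x y}"
      using esssup_pos_measure[of "h x" lborel c] by simp
    moreover have "esssup lborel (h x) \<le> c \<Longrightarrow> emeasure lborel {y. c < h x y} = 0"
    proof -
      assume "esssup lborel (h x) \<le> c"
      then have "AE y in lborel. \<not> c < h x y"
        using esssup_AE[of "h x" lborel] by (auto elim!: eventually_mono intro: order_trans)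
      then show ?thesis by (subst (asm) AE_iff_measurable[OF _ refl]) auto
    qed
    ultimately show ?thesis by (metis less_irrefl linorder_le_less_linear)
  qed
  have "(\<lambda>x. \<integral>\<^sup>+ y. indicator {y. c < h x y} y \<partial>lborel) \<in> borel_measurable M"
  proof (rule lborel.borel_measurable_nn_integral)
    have "(\<lambda>z. indicator {z \<in> space (M \<Otimes>\<^sub>M lborel). c < (\<lambda>(x, y). h x y) z} z :: ennreal) \<in> borel_measurable (M \<Otimes>\<^sub>M lborel)"
      by measurable
    then show "(\<lambda>(x, y). indicator {y. c < h x y} y :: ennreal) \<in> borel_measurable (M \<Otimes>\<^sub>M lborel)"
      by (subst measurable_cong[where g = "\<lambda>z. indicator {z \<in> space (M \<Otimes>\<^sub>M lborel). c < (\<lambda>(x, y). h x y) z} z :: ennreal"])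
        (auto simp: indicator_def)
  qed
  then have "{x \<in> space M. 0 < (\<integral>\<^sup>+ y. indicator {y. c < h x y} y \<partial>lborel)} \<in> sets M" by measurable
  moreover have "{x \<in> space M. 0 < (\<integral>\<^sup>+ y. indicator {y. c < h x y} y \<partial>lborel)} = {x \<in> space M. c < esssup lborel (h x)}"
    using iff by auto
  ultimately show "{x \<in> space M. c < esssup lborel (h x)} \<in> sets M" by simp
qed

lemma borel_measurable_Lp_norm:
  assumes "1 \<le> p" and [measurable]: "(\<lambda>(x, y). h x y) \<in> borel_measurable (M \<Otimes>\<^sub>M lborel)"
  shows "(\<lambda>x. Lp_norm p (h x)) \<in> borel_measurable M"
  using assms(1)
proof (cases rule: exponent_cases)
  case top
  then show ?thesis unfolding top Lp_norm_top by (intro borel_measurable_esssup assms)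
next
  case (real P)
  have "(\<lambda>z. ennreal_powr ((\<lambda>(x, y). h x y) z) P) \<in> borel_measurable (M \<Otimes>\<^sub>M lborel)" by measurable
  then have "(\<lambda>(x, y). ennreal_powr (h x y) P) \<in> borel_measurable (M \<Otimes>\<^sub>M lborel)" by (simp add: case_prod_unfold)
  then have [measurable]: "(\<lambda>x. \<integral>\<^sup>+ y. ennreal_powr (h x y) P \<partial>lborel) \<in> borel_measurable M"
    by (rule lborel.borel_measurable_nn_integral)
  show ?thesis using real by (simp add: Lp_norm_real)
qed

subsection \<open>The inequalities of H\<ouml>lder and Minkowski\<close>

lemma ennreal_Young:
  assumes "1 < P" "1 < Q" "1 / P + 1 / Q = 1"
  shows "x * y \<le> ennreal (1 / P) * ennreal_powr x P + ennreal (1 / Q) * ennreal_powr y Q"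
proof (cases "x = 0 \<or> y = 0")
  case False
  show ?thesis
  proof (cases "x = top \<or> y = top")
    case True
    then show ?thesis using assms by (auto simp: ennreal_mult_top ennreal_eq_0_iff)
  next
    case f2: False
    then obtain a b where ab: "x = ennreal a" "0 \<le> a" "y = ennreal b" "0 \<le> b"
      by (cases x; cases y) auto
    have "a * b \<le> a powr P / P + b powr Q / Q"
      by (rule Youngs_inequality) (use assms ab in auto)
    then show ?thesis using ab assms
      by (simp add: epow_ennreal flip: ennreal_mult ennreal_plus)
  qed
qed auto

text \<open>Both functions are scaled to norm 1 and Young's inequality is integrated. Norms 0 and
  \<infinity> cannot be scaled: a zero norm makes the product vanish almost everywhere, and
  otherwise an infinite norm makes the right-hand side infinite.\<close>

lemma Holder_real:
  assumes PQ: "1 < P" "1 < Q" "1 / P + 1 / Q = 1"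
    and [measurable]: "f \<in> borel_measurable borel" "g \<in> borel_measurable borel"
  shows "(\<integral>\<^sup>+ x. f x * g x \<partial>lborel) \<le> Lp_norm (ennreal P) f * Lp_norm (ennreal Q) g"
proof -
  let ?A = "Lp_norm (ennreal P) f" and ?B = "Lp_norm (ennreal Q) g"
  have A: "?A = ennreal_powr (\<integral>\<^sup>+ x. ennreal_powr (f x) P \<partial>lborel) (1 / P)"
    and B: "?B = ennreal_powr (\<integral>\<^sup>+ x. ennreal_powr (g x) Q \<partial>lborel) (1 / Q)"
    using PQ by (simp_all add: Lp_norm_real)
  consider "?A = 0 \<or> ?B = 0" | "?A \<noteq> 0" "?B \<noteq> 0" "?A = top \<or> ?B = top" | "?A \<noteq> 0" "?B \<noteq> 0" "?A \<noteq> top" "?B \<noteq> top"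
    by blast
  then show ?thesis
  proof cases
    case 1
    then have "(AE x in lborel. f x = 0) \<or> (AE x in lborel. g x = 0)"
      unfolding A B by (auto simp: nn_integral_0_iff_AE)
    then have "AE x in lborel. f x * g x = 0" by (auto elim: eventually_mono)
    then have "(\<integral>\<^sup>+ x. f x * g x \<partial>lborel) = 0" by (simp add: nn_integral_0_iff_AE)
    then show ?thesis by simp
  next
    case 2
    then have "?A * ?B = top" by (auto simp: ennreal_mult_top ennreal_top_mult)
    then show ?thesis by simp
  next
    case 3
    define a b where "a = inverse ?A" and "b = inverse ?B"
    have ab: "a * ?A = 1" "b * ?B = 1"
      using 3 by (simp_all add: a_def b_def ennreal_inverse_mult mult.commute less_top divide_ennreal_def[symmetric] ennreal_divide_self)
    have int_f: "(\<integral>\<^sup>+ x. ennreal_powr (f x) P \<partial>lborel) = ennreal_powr ?A P"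
      unfolding A using PQ by (simp add: epow_inverse)
    have int_g: "(\<integral>\<^sup>+ x. ennreal_powr (g x) Q \<partial>lborel) = ennreal_powr ?B Q"
      unfolding B using PQ by (simp add: epow_inverse)
    have "a * b * (\<integral>\<^sup>+ x. f x * g x \<partial>lborel) = (\<integral>\<^sup>+ x. (a * f x) * (b * g x) \<partial>lborel)"
      by (subst nn_integral_cmult[symmetric]) (auto simp: mult_ac)
    also have "\<dots> \<le> (\<integral>\<^sup>+ x. ennreal (1 / P) * ennreal_powr (a * f x) P + ennreal (1 / Q) * ennreal_powr (b * g x) Q \<partial>lborel)"
      by (intro nn_integral_mono ennreal_Young PQ)
    also have "\<dots> = ennreal (1 / P) * (ennreal_powr a P * ennreal_powr ?A P) + ennreal (1 / Q) * (ennreal_powr b Q * ennreal_powr ?B Q)"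
      using PQ by (simp add: nn_integral_add nn_integral_cmult epow_mult int_f int_g)
    also have "\<dots> = ennreal (1 / P) + ennreal (1 / Q)"
      using PQ ab by (simp add: epow_mult[symmetric])
    also have "\<dots> = 1" using PQ by (simp flip: ennreal_plus)
    finally have "a * b * (\<integral>\<^sup>+ x. f x * g x \<partial>lborel) \<le> 1" .
    then have "(?A * ?B) * (a * b * (\<integral>\<^sup>+ x. f x * g x \<partial>lborel)) \<le> (?A * ?B) * 1"
      by (rule mult_left_mono) simp
    moreover have "(?A * ?B) * (a * b * (\<integral>\<^sup>+ x. f x * g x \<partial>lborel)) = (a * ?A) * (b * ?B) * (\<integral>\<^sup>+ x. f x * g x \<partial>lborel)"
      by (simp add: mult_ac)
    ultimately show ?thesis unfolding ab by simp
  qed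
qed

lemma Holder_1:
  assumes [measurable]: "f \<in> borel_measurable borel" "g \<in> borel_measurable borel"
  shows "(\<integral>\<^sup>+ x. f x * g x \<partial>lborel) \<le> Lp_norm 1 f * Lp_norm \<infinity> g"
proof -
  have "(\<integral>\<^sup>+ x. f x * g x \<partial>lborel) \<le> (\<integral>\<^sup>+ x. f x * esssup lborel g \<partial>lborel)"
    using esssup_AE[of g lborel] by (intro nn_integral_mono_AE, eventually_elim) (rule mult_left_mono, auto)
  then show ?thesis unfolding Lp_norm_1 Lp_norm_top by (simp add: nn_integral_multc)
qed

lemma Holder:
  assumes "1 \<le> p" and [measurable]: "f \<in> borel_measurable borel" "g \<in> borel_measurable borel"
  shows "(\<integral>\<^sup>+ x. f x * g x \<partial>lborel) \<le> Lp_norm p f * Lp_norm (conj_exponent p) g"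
  using assms(1)
proof (cases rule: exponent_cases)
  case top
  then show ?thesis using Holder_1[of g f] by (simp add: mult.commute)
next
  case (real P)
  show ?thesis
  proof (cases "P = 1")
    case True
    then show ?thesis using Holder_1[of f g] real by simp
  next
    case False
    then have "1 < P" using real by simp
    moreover from this have "1 < P / (P - 1)" "1 / P + 1 / (P / (P - 1)) = 1" by (simp_all add: field_simps)
    ultimately show ?thesis unfolding real conj_exponent_real[OF \<open>1 < P\<close>] by (intro Holder_real) auto
  qed
qed

text \<open>The exponent t is r / Q, or \<infinity> if r is. It is chosen before f, since
  \<open>Lp_norm_exchange\<close> applies the identity to many functions with the same t.\<close>

lemma Lp_norm_powr:
  fixes f :: "'a::euclidean_space \<Rightarrow> ennreal"
  assumes "1 \<le> Q" "ennreal Q \<le> r" and [measurable]: "f \<in> borel_measurable borel"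
  shows "\<exists>t\<ge>1. \<forall>f\<in>borel_measurable borel. Lp_norm t (\<lambda>x::'a. ennreal_powr (f x) Q) = ennreal_powr (Lp_norm r f) Q"
proof -
  have "1 \<le> r" using assms by (metis ennreal_1 ennreal_leI order_trans)
  then show ?thesis
  proof (cases rule: exponent_cases)
    case top
    have "esssup lborel (\<lambda>x. ennreal_powr (f x) Q) = ennreal_powr (esssup lborel f) Q"
      if f: "f \<in> borel_measurable borel" for f :: "'a \<Rightarrow> ennreal"
    proof (rule antisym)
      note [measurable] = f
      have "AE x in lborel. ennreal_powr (f x) Q \<le> ennreal_powr (esssup lborel f) Q"
        using esssup_AE[of f lborel] by eventually_elim (rule epow_mono, use assms in auto)
      then show "esssup lborel (\<lambda>x. ennreal_powr (f x) Q) \<le> ennreal_powr (esssup lborel f) Q"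
        by (intro esssup_I) auto
      have "AE x in lborel. f x \<le> ennreal_powr (esssup lborel (\<lambda>x. ennreal_powr (f x) Q)) (1 / Q)"
        using esssup_AE[of "\<lambda>x. ennreal_powr (f x) Q" lborel]
        by eventually_elim (use assms in \<open>simp add: epow_le_swap\<close>)
      then have "esssup lborel f \<le> ennreal_powr (esssup lborel (\<lambda>x. ennreal_powr (f x) Q)) (1 / Q)"
        by (intro esssup_I) auto
      then show "ennreal_powr (esssup lborel f) Q \<le> esssup lborel (\<lambda>x. ennreal_powr (f x) Q)"
        using assms by (simp add: epow_le_swap)
    qed
    then show ?thesis unfolding top by (intro exI[of _ \<infinity>]) (simp add: Lp_norm_top)
  next
    case (real R)
    then have "Q \<le> R" using assms by simp
    have 1: "1 \<le> R / Q" using \<open>Q \<le> R\<close> assms(1) by simp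
    show ?thesis
    proof (intro exI[of _ "ennreal (R / Q)"] conjI ballI)
      show "1 \<le> ennreal (R / Q)" using 1 by (simp add: ennreal_ge_1)
      show "Lp_norm (ennreal (R / Q)) (\<lambda>x. ennreal_powr (f x) Q) = ennreal_powr (Lp_norm r f) Q" for f :: "'a \<Rightarrow> ennreal"
        using 1 real assms(1) by (simp add: Lp_norm_real epow_epow)
    qed
  qed
qed

text \<open>The classical argument applies H\<ouml>lder to F^(R-1) times F and divides by a power of
  the integral of F^R, which must be finite for that. Hence F is first truncated, and monotone
  convergence removes the truncation.\<close>

lemma Minkowski_integral_real:
  fixes h :: "'m \<Rightarrow> 'b::euclidean_space \<Rightarrow> ennreal"
  assumes M: "sigma_finite_measure M" and R: "1 < R"
    and h [measurable]: "(\<lambda>(x, y). h x y) \<in> borel_measurable (M \<Otimes>\<^sub>M lborel)"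
  shows "Lp_norm (ennreal R) (\<lambda>y. \<integral>\<^sup>+ x. h x y \<partial>M) \<le> (\<integral>\<^sup>+ x. Lp_norm (ennreal R) (h x) \<partial>M)"
proof -
  interpret M: sigma_finite_measure M by fact
  interpret P: pair_sigma_finite M "lborel :: 'b measure" ..
  let ?Q = "R / (R - 1)"
  have PQ: "1 < ?Q" "1 / ?Q + 1 / R = 1" "?Q > 0" using R by (simp_all add: field_simps)
  define F where "F y = (\<integral>\<^sup>+ x. h x y \<partial>M)" for y
  have h': "(\<lambda>(y, x). h x y) \<in> borel_measurable (lborel \<Otimes>\<^sub>M M)"
    using measurable_compose[OF measurable_pair_swap' h] by (simp add: case_prod_unfold)
  have F [measurable]: "F \<in> borel_measurable borel"
    unfolding F_def[abs_def] using M.borel_measurable_nn_integral[OF h'] by simp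
  have hx: "h x \<in> borel_measurable borel" if "x \<in> space M" for x
    using measurable_compose[OF measurable_Pair1'[OF that] h] by simp
  let ?R = "\<integral>\<^sup>+ x. Lp_norm (ennreal R) (h x) \<partial>M"
  \<comment> \<open>Truncating both the height and the support at n makes the integral of the R-th
    power finite.\<close>
  define G where "G n y = (if norm y < real n then min (F y) (of_nat n) else 0)" for n :: nat and y
  have G [measurable]: "G n \<in> borel_measurable borel" for n
    unfolding G_def[abs_def] by measurable
  have bound: "(\<integral>\<^sup>+ y. ennreal_powr (G n y) R \<partial>lborel) \<le> ennreal_powr ?R R" for n
  proof -
    let ?I = "\<integral>\<^sup>+ y. ennreal_powr (G n y) R \<partial>lborel"
    have "?I \<le> (\<integral>\<^sup>+ (y::'b). ennreal (real n powr R) * indicator (ball 0 (real n)) y \<partial>lborel)"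
    proof (rule nn_integral_mono)
      fix y :: 'b
      have "ennreal_powr (G n y) R \<le> ennreal_powr (ennreal (real n)) R" if "norm y < real n"
        using that R by (intro epow_mono) (auto simp: G_def ennreal_of_nat_eq_real_of_nat)
      then show "ennreal_powr (G n y) R \<le> ennreal (real n powr R) * indicator (ball 0 (real n)) y"
        by (cases "norm y < real n") (auto simp: G_def epow_ennreal)
    qed
    also have "\<dots> = ennreal (real n powr R) * emeasure lborel (ball (0::'b) (real n))"
      by (rule nn_integral_cmult_indicator) simp
    also have "\<dots> < \<infinity>" by (simp add: ennreal_mult_less_top emeasure_lborel_ball_finite[unfolded infinity_ennreal_def])
    finally have fin: "?I < \<infinity>" .
    have "?I = (\<integral>\<^sup>+ y. ennreal_powr (G n y) (R - 1) * G n y \<partial>lborel)"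
    proof (rule nn_integral_cong)
      show "ennreal_powr (G n y) R = ennreal_powr (G n y) (R - 1) * G n y" for y
        using epow_add[of "R - 1" 1 "G n y"] R by simp
    qed
    also have "\<dots> \<le> (\<integral>\<^sup>+ y. ennreal_powr (G n y) (R - 1) * F y \<partial>lborel)"
      by (intro nn_integral_mono mult_left_mono) (auto simp: G_def)
    also have "\<dots> = (\<integral>\<^sup>+ y. \<integral>\<^sup>+ x. ennreal_powr (G n y) (R - 1) * h x y \<partial>M \<partial>lborel)"
      unfolding F_def
    proof (rule nn_integral_cong)
      fix y :: 'b
      have "(\<lambda>x. h x y) \<in> borel_measurable M"
        using measurable_compose[OF measurable_Pair2'[of y lborel M] h] by simp
      then show "ennreal_powr (G n y) (R - 1) * (\<integral>\<^sup>+ x. h x y \<partial>M) = (\<integral>\<^sup>+ x. ennreal_powr (G n y) (R - 1) * h x y \<partial>M)"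
        by (rule nn_integral_cmult[symmetric])
    qed
    also have "\<dots> = (\<integral>\<^sup>+ x. \<integral>\<^sup>+ y. ennreal_powr (G n y) (R - 1) * h x y \<partial>lborel \<partial>M)"
    proof (rule P.Fubini')
      have "(\<lambda>z. ennreal_powr (G n (snd z)) (R - 1) * (\<lambda>(x, y). h x y) z) \<in> borel_measurable (M \<Otimes>\<^sub>M lborel)"
        by measurable
      then show "(\<lambda>(x, y). ennreal_powr (G n y) (R - 1) * h x y) \<in> borel_measurable (M \<Otimes>\<^sub>M lborel)"
        by (simp add: case_prod_unfold)
    qed
    also have "\<dots> \<le> (\<integral>\<^sup>+ x. ennreal_powr ?I (1 / ?Q) * Lp_norm (ennreal R) (h x) \<partial>M)"
    proof (rule nn_integral_mono)
      fix x assume "x \<in> space M"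
      then have "(\<integral>\<^sup>+ y. ennreal_powr (G n y) (R - 1) * h x y \<partial>lborel) \<le>
        Lp_norm (ennreal ?Q) (\<lambda>y. ennreal_powr (G n y) (R - 1)) * Lp_norm (ennreal R) (h x)"
        using R PQ by (intro Holder_real hx) auto
      also have "Lp_norm (ennreal ?Q) (\<lambda>y. ennreal_powr (G n y) (R - 1)) = ennreal_powr ?I (1 / ?Q)"
        using PQ R by (simp add: Lp_norm_real epow_epow)
      finally show "(\<integral>\<^sup>+ y. ennreal_powr (G n y) (R - 1) * h x y \<partial>lborel) \<le> ennreal_powr ?I (1 / ?Q) * Lp_norm (ennreal R) (h x)" .
    qed
    also have "\<dots> = ennreal_powr ?I (1 / ?Q) * ?R"
      by (rule nn_integral_cmult) (rule borel_measurable_Lp_norm, use R in \<open>auto simp: ennreal_ge_1\<close>)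
    finally have le: "?I \<le> ennreal_powr ?I (1 / ?Q) * ?R" .
    show ?thesis
    proof (cases "?I = 0")
      case False
      \<comment> \<open>Splitting off the factor with exponent 1 / Q, which is neither 0 nor
        infinite, and cancelling it leaves the R-th root of the integral.\<close>
      have I: "?I = ennreal_powr ?I (1 / ?Q) * ennreal_powr ?I (1 / R)"
        using epow_add[of "1 / ?Q" "1 / R" ?I] PQ R by simp
      have J: "ennreal_powr ?I (1 / ?Q) \<noteq> 0" "ennreal_powr ?I (1 / ?Q) \<noteq> top"
        using False fin by (auto simp: epow_eq_top_iff)
      have "ennreal_powr ?I (1 / R) \<le> ?R"
        using le I J by (metis ennreal_mult_le_mult_iff)
      then show ?thesis using R by (simp add: epow_le_swap[symmetric] epow_le_swap[of "1 / R"])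
    qed simp
  qed
  have G_SUP: "(SUP n. G n y) = F y" for y
  proof (rule antisym)
    show "(SUP n. G n y) \<le> F y" by (intro SUP_least) (auto simp: G_def)
    show "F y \<le> (SUP n. G n y)"
    proof (rule dense_le)
      fix z assume z: "z < F y"
      then have "z < top" using less_le_trans top_greatest by blast
      then obtain n where n: "z < of_nat n" using ennreal_Ex_less_of_nat by blast
      obtain m where m: "norm y < real m" using reals_Archimedean2 by blast
      have "(of_nat n :: ennreal) \<le> of_nat (max n m)" by (intro of_nat_mono) simp
      then have "z \<le> G (max n m) y" using z n m by (auto simp: G_def intro: order_trans[OF less_imp_le[OF n]])
      also have "\<dots> \<le> (SUP n. G n y)" by (rule SUP_upper) simp
      finally show "z \<le> (SUP n. G n y)" .
    qed
  qed
  have "(\<integral>\<^sup>+ y. ennreal_powr (F y) R \<partial>lborel) = (\<integral>\<^sup>+ y. (SUP n. ennreal_powr (G n y) R) \<partial>lborel)"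
    using R by (simp add: G_SUP[symmetric] epow_SUP)
  also have "\<dots> = (SUP n. \<integral>\<^sup>+ y. ennreal_powr (G n y) R \<partial>lborel)"
  proof (rule nn_integral_monotone_convergence_SUP)
    have "G n y \<le> G m y" if "n \<le> m" for n m y
    proof -
      have "(of_nat n :: ennreal) \<le> of_nat m" using that by (intro of_nat_mono)
      then show ?thesis using that by (auto simp: G_def min_le_iff_disj)
    qed
    then show "incseq (\<lambda>n y. ennreal_powr (G n y) R)"
      using R by (auto simp: incseq_def le_fun_def intro!: epow_mono)
  qed measurable
  also have "\<dots> \<le> ennreal_powr ?R R" by (rule SUP_least) (rule bound)
  finally have "ennreal_powr (\<integral>\<^sup>+ y. ennreal_powr (F y) R \<partial>lborel) (1 / R) \<le> ?R"
    using R by (simp add: epow_le_swap)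
  then show ?thesis using R by (simp add: Lp_norm_real F_def)
qed

text \<open>M is kept general because the inequality serves twice: with Lebesgue measure, and with
  counting measure on the naturals, where it bounds the norm of a series
  (\<open>Lp_norm_suminf\<close>).\<close>

lemma Minkowski_integral:
  fixes h :: "'m \<Rightarrow> 'b::euclidean_space \<Rightarrow> ennreal"
  assumes M: "sigma_finite_measure M" and r: "1 \<le> r"
    and h [measurable]: "(\<lambda>(x, y). h x y) \<in> borel_measurable (M \<Otimes>\<^sub>M lborel)"
  shows "Lp_norm r (\<lambda>y. \<integral>\<^sup>+ x. h x y \<partial>M) \<le> (\<integral>\<^sup>+ x. Lp_norm r (h x) \<partial>M)"
proof -
  interpret M: sigma_finite_measure M by fact
  interpret P: pair_sigma_finite M "lborel :: 'b measure" ..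
  have h': "(\<lambda>(y, x). h x y) \<in> borel_measurable (lborel \<Otimes>\<^sub>M M)"
    using measurable_compose[OF measurable_pair_swap' h] by (simp add: case_prod_unfold)
  have F [measurable]: "(\<lambda>y. \<integral>\<^sup>+ x. h x y \<partial>M) \<in> borel_measurable borel"
    using M.borel_measurable_nn_integral[OF h'] by simp
  show ?thesis using r
  proof (cases rule: exponent_cases)
    case top
    have [measurable]: "(\<lambda>x. esssup lborel (h x)) \<in> borel_measurable M" by (rule borel_measurable_esssup[OF h])
    have s: "{z \<in> space (M \<Otimes>\<^sub>M lborel). h (fst z) (snd z) \<le> esssup lborel (h (fst z))} \<in> sets (M \<Otimes>\<^sub>M lborel)"
    proof -
      have "{z \<in> space (M \<Otimes>\<^sub>M lborel). (\<lambda>(x, y). h x y) z \<le> esssup lborel (h (fst z))} \<in> sets (M \<Otimes>\<^sub>M lborel)"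
        by measurable
      then show ?thesis by (simp add: case_prod_unfold)
    qed
    have "AE x in M. AE y in lborel. h x y \<le> esssup lborel (h x)" by (simp add: esssup_AE)
    then have "AE y in lborel. AE x in M. h x y \<le> esssup lborel (h x)" using P.AE_commute[OF s] by simp
    then have "AE y in lborel. (\<integral>\<^sup>+ x. h x y \<partial>M) \<le> (\<integral>\<^sup>+ x. esssup lborel (h x) \<partial>M)"
      by eventually_elim (rule nn_integral_mono_AE)
    then show ?thesis unfolding top Lp_norm_top by (intro esssup_I) auto
  next
    case (real R)
    show ?thesis
    proof (cases "R = 1")
      case True
      then show ?thesis using real P.Fubini'[OF h] by (simp add: Lp_norm_1)
    next
      case False
      then show ?thesis unfolding real using real by (intro Minkowski_integral_real M h) auto
    qed
  qed
qed

text \<open>Raised to the power q the inner norm on the left becomes an integral, and the claim is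
  Minkowski's inequality in L^(r/q). This is the source of all conditions that compare an exponent
  of the symbol with one of the target.\<close>

lemma Lp_norm_exchange:
  fixes h :: "'a::euclidean_space \<Rightarrow> 'b::euclidean_space \<Rightarrow> ennreal"
  assumes "1 \<le> q" "q \<le> r" and h [measurable]: "(\<lambda>(x, y). h x y) \<in> borel_measurable (borel \<Otimes>\<^sub>M borel)"
  shows "Lp_norm r (\<lambda>y. Lp_norm q (\<lambda>x. h x y)) \<le> Lp_norm q (\<lambda>x. Lp_norm r (h x))"
proof -
  have r: "1 \<le> r" using assms order_trans by blast
  have hl: "(\<lambda>(x, y). h x y) \<in> borel_measurable (lborel \<Otimes>\<^sub>M lborel)" using h by simp
  have h': "(\<lambda>(y, x). h x y) \<in> borel_measurable (lborel \<Otimes>\<^sub>M lborel)"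
    using measurable_compose[OF measurable_pair_swap' hl] by (simp add: case_prod_unfold)
  have m1: "(\<lambda>y. Lp_norm q (\<lambda>x. h x y)) \<in> borel_measurable borel"
    using borel_measurable_Lp_norm[OF assms(1) h'] by simp
  have m2 [measurable]: "(\<lambda>x. Lp_norm r (h x)) \<in> borel_measurable borel"
    using borel_measurable_Lp_norm[OF r hl] by simp
  show ?thesis using assms(1)
  proof (cases rule: exponent_cases)
    case top
    then have r_top: "r = \<infinity>" using assms(2) by (simp add: top_unique)
    let ?c = "esssup lborel (\<lambda>x. esssup lborel (h x))"
    have s: "{z \<in> space (lborel \<Otimes>\<^sub>M lborel). h (fst z) (snd z) \<le> ?c} \<in> sets (lborel \<Otimes>\<^sub>M lborel)"
    proof -
      have "{z \<in> space (lborel \<Otimes>\<^sub>M lborel). (\<lambda>(x, y). h x y) z \<le> ?c} \<in> sets (lborel \<Otimes>\<^sub>M lborel)"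
        using hl by measurable
      then show ?thesis by (simp add: case_prod_unfold)
    qed
    have "AE x in lborel. AE y in lborel. h x y \<le> ?c"
      using esssup_AE[of "\<lambda>x. esssup lborel (h x)" lborel]
    proof eventually_elim
      case (elim x)
      show ?case using esssup_AE[of "h x" lborel] by eventually_elim (use elim order_trans in blast)
    qed
    then have "AE y in lborel. AE x in lborel. h x y \<le> ?c" using lborel_pair.AE_commute[OF s] by simp
    then have "AE y in lborel. esssup lborel (\<lambda>x. h x y) \<le> ?c"
    proof eventually_elim
      case (elim y)
      have "(\<lambda>x. h x y) \<in> borel_measurable lborel"
        using measurable_compose[OF measurable_Pair2'[of y lborel lborel] hl] by simp
      then show ?case using elim by (intro esssup_I)
    qed
    then show ?thesis using m1 unfolding top r_top Lp_norm_top by (intro esssup_I) auto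
  next
    case (real Q)
    obtain t where t: "1 \<le> t" "\<And>f. f \<in> borel_measurable borel \<Longrightarrow> Lp_norm t (\<lambda>x::'b. ennreal_powr (f x) Q) = ennreal_powr (Lp_norm r f) Q"
      using Lp_norm_powr[of Q r "\<lambda>x. 0"] real assms(2) by auto
    have hx: "h x \<in> borel_measurable borel" for x
      using measurable_compose[OF measurable_Pair1'[of x lborel lborel] hl] by simp
    have "ennreal_powr (Lp_norm r (\<lambda>y. Lp_norm q (\<lambda>x. h x y))) Q = Lp_norm t (\<lambda>y. ennreal_powr (Lp_norm q (\<lambda>x. h x y)) Q)"
      by (rule t(2)[OF m1, symmetric])
    also have "\<dots> = Lp_norm t (\<lambda>y. \<integral>\<^sup>+ x. ennreal_powr (h x y) Q \<partial>lborel)"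
      using real by (simp add: Lp_norm_real epow_inverse)
    also have "\<dots> \<le> (\<integral>\<^sup>+ x. Lp_norm t (\<lambda>y. ennreal_powr (h x y) Q) \<partial>lborel)"
    proof (rule Minkowski_integral[OF sigma_finite_lborel t(1)])
      have "(\<lambda>z. ennreal_powr ((\<lambda>(x, y). h x y) z) Q) \<in> borel_measurable (lborel \<Otimes>\<^sub>M lborel)"
        using hl by measurable
      then show "(\<lambda>(x, y). ennreal_powr (h x y) Q) \<in> borel_measurable (lborel \<Otimes>\<^sub>M lborel)"
        by (simp add: case_prod_unfold)
    qed
    also have "\<dots> = (\<integral>\<^sup>+ x. ennreal_powr (Lp_norm r (h x)) Q \<partial>lborel)" by (simp add: t(2)[OF hx])
    also have "\<dots> = ennreal_powr (Lp_norm q (\<lambda>x. Lp_norm r (h x))) Q"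
      using real by (simp add: Lp_norm_real epow_inverse)
    finally show ?thesis using real by (simp add: epow_le_iff)
  qed
qed

text \<open>The first identity is Tonelli, with a separate null set argument for \<infinity>. The
  other order follows from \<open>Lp_norm_exchange\<close> with equal exponents, used in both
  directions.\<close>

lemma Lp_norm_prod:
  fixes F :: "'a::euclidean_space \<times> 'b::euclidean_space \<Rightarrow> ennreal"
  assumes "1 \<le> p" and F [measurable]: "F \<in> borel_measurable borel"
  shows "Lp_norm p F = Lp_norm p (\<lambda>x. Lp_norm p (\<lambda>y. F (x, y)))"
    and "Lp_norm p F = Lp_norm p (\<lambda>y. Lp_norm p (\<lambda>x. F (x, y)))"
proof -
  have F': "F \<in> borel_measurable (lborel \<Otimes>\<^sub>M lborel)" using F unfolding lborel_prod by simp
  have Fc: "(\<lambda>(x, y). F (x, y)) \<in> borel_measurable (borel \<Otimes>\<^sub>M borel)"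
    using F unfolding borel_prod by (simp add: case_prod_unfold)
  have ex: "Lp_norm p (\<lambda>y. Lp_norm p (\<lambda>x. F (x, y))) = Lp_norm p (\<lambda>x. Lp_norm p (\<lambda>y. F (x, y)))"
  proof (rule antisym)
    show "Lp_norm p (\<lambda>y. Lp_norm p (\<lambda>x. F (x, y))) \<le> Lp_norm p (\<lambda>x. Lp_norm p (\<lambda>y. F (x, y)))"
      using Lp_norm_exchange[OF assms(1) order_refl Fc] .
    have "(\<lambda>(y, x). F (x, y)) \<in> borel_measurable (borel \<Otimes>\<^sub>M borel)"
      using measurable_compose[OF measurable_pair_swap' Fc] by (simp add: case_prod_unfold)
    then show "Lp_norm p (\<lambda>x. Lp_norm p (\<lambda>y. F (x, y))) \<le> Lp_norm p (\<lambda>y. Lp_norm p (\<lambda>x. F (x, y)))"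
      by (rule Lp_norm_exchange[OF assms(1) order_refl])
  qed
  show *: "Lp_norm p F = Lp_norm p (\<lambda>x. Lp_norm p (\<lambda>y. F (x, y)))"
    using assms(1)
  proof (cases rule: exponent_cases)
    case top
    have m: "(\<lambda>x. esssup lborel (\<lambda>y. F (x, y))) \<in> borel_measurable lborel"
      using borel_measurable_esssup[of "\<lambda>x y. F (x, y)" lborel] F' by (simp add: case_prod_unfold)
    show ?thesis unfolding top Lp_norm_top
    proof (rule antisym)
      let ?c = "esssup lborel (\<lambda>x. esssup lborel (\<lambda>y. F (x, y)))"
      have "AE x in lborel. AE y in lborel. F (x, y) \<le> ?c"
        using esssup_AE[of "\<lambda>x. esssup lborel (\<lambda>y. F (x, y))" lborel]
      proof eventually_elim
        case (elim x)
        show ?case using esssup_AE[of "\<lambda>y. F (x, y)" lborel] by eventually_elim (use elim order_trans in blast)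
      qed
      then have "AE z in lborel \<Otimes>\<^sub>M lborel. F z \<le> ?c"
        by (intro lborel_pair.AE_pair_measure) (use F' in measurable)
      then show "esssup lborel F \<le> ?c" unfolding lborel_prod by (intro esssup_I) auto
      have "AE z in lborel \<Otimes>\<^sub>M lborel. F z \<le> esssup lborel F" unfolding lborel_prod by (rule esssup_AE)
      then have "AE x in lborel. AE y in lborel. F (x, y) \<le> esssup lborel F" by (rule lborel_pair.AE_pair)
      then have "AE x in lborel. esssup lborel (\<lambda>y. F (x, y)) \<le> esssup lborel F"
      proof eventually_elim
        case (elim x)
        have "(\<lambda>y. F (x, y)) \<in> borel_measurable lborel"
          using measurable_compose[OF measurable_Pair1'[of x lborel lborel] F'] by simp
        then show ?case using elim by (intro esssup_I)
      qed
      then show "?c \<le> esssup lborel F" using m by (intro esssup_I)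
    qed
  next
    case (real P)
    have "(\<integral>\<^sup>+ z. ennreal_powr (F z) P \<partial>lborel) = (\<integral>\<^sup>+ x. \<integral>\<^sup>+ y. ennreal_powr (F (x, y)) P \<partial>lborel \<partial>lborel)"
      unfolding lborel_prod[symmetric]
      by (rule lborel.nn_integral_fst[symmetric]) (use F' in measurable)
    then show ?thesis using real by (simp add: Lp_norm_real epow_inverse)
  qed
  then show "Lp_norm p F = Lp_norm p (\<lambda>y. Lp_norm p (\<lambda>x. F (x, y)))" using ex by simp
qed

subsection \<open>Convolution with weights\<close>

lemma Lp_norm_wt_finite:
  assumes "1 \<le> s" shows "Lp_norm s (\<lambda>x. ennreal (wt (x::'a::euclidean_space))) < \<infinity>"
  using assms
proof (cases rule: exponent_cases)
  case top
  have "esssup lborel (\<lambda>x::'a. ennreal (wt x)) \<le> 1"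
    by (rule esssup_I) (auto simp: wt_le_1 intro!: ennreal_le_1[THEN iffD2])
  then show ?thesis unfolding top Lp_norm_top by (rule le_less_trans) simp
next
  case (real P)
  have "(\<integral>\<^sup>+ x. ennreal_powr (ennreal (wt (x::'a))) P \<partial>lborel) \<le> (\<integral>\<^sup>+ x. ennreal (wt (x::'a)) \<partial>lborel)"
  proof (rule nn_integral_mono)
    fix x :: 'a
    have "wt x powr P \<le> wt x powr 1" using real wt_pos[of x] wt_le_1[of x] by (intro powr_mono') auto
    then show "ennreal_powr (ennreal (wt x)) P \<le> ennreal (wt x)"
      using wt_pos[of x] by (simp add: epow_ennreal)
  qed
  then have "(\<integral>\<^sup>+ x. ennreal_powr (ennreal (wt (x::'a))) P \<partial>lborel) \<noteq> top"
    using nn_integral_wt[where 'a='a] by (metis infinity_ennreal_def leD top.not_eq_extremum)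
  then show ?thesis using real by (simp add: Lp_norm_real epow_eq_top_iff less_top[symmetric])
qed

definition ew :: "'a::euclidean_space \<Rightarrow> ennreal" where
  "ew x = ennreal (wt x)"

lemma ew_measurable [measurable]: "ew \<in> borel_measurable borel"
  unfolding ew_def[abs_def] by measurable

lemma wt_uminus [simp]: "wt (- x) = wt x"
  by (simp add: wt_def)

lemma ew_minus_commute: "ew (x - y) = ew (y - x)"
  unfolding ew_def by (metis minus_diff_eq wt_uminus)

text \<open>Splitting the kernel \<open>ew (y - x) * ew (y - x)\<close> into its two factors, H\<ouml>lder's inequality
  removes one of them and exchanging the norms integrates out the other one.\<close>

lemma Lp_norm_convolution:
  fixes f :: "'a::euclidean_space \<Rightarrow> ennreal"
  assumes "1 \<le> p" "p \<le> r" and [measurable]: "f \<in> borel_measurable borel"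
  shows "Lp_norm r (\<lambda>x. \<integral>\<^sup>+ y. f y * (ew (y - x) * ew (y - x)) \<partial>lborel) \<le>
    (Lp_norm (conj_exponent p) (ew :: 'a \<Rightarrow> ennreal) * Lp_norm r (ew :: 'a \<Rightarrow> ennreal)) * Lp_norm p f"
proof -
  have r: "1 \<le> r" using assms order_trans by blast
  let ?W = "Lp_norm (conj_exponent p) (ew :: 'a \<Rightarrow> ennreal)"
  let ?V = "Lp_norm r (ew :: 'a \<Rightarrow> ennreal)"
  have m: "(\<lambda>(y, x). f y * ew (y - x)) \<in> borel_measurable (borel \<Otimes>\<^sub>M borel)" by measurable
  have mN [measurable]: "(\<lambda>x. Lp_norm p (\<lambda>y. f y * ew (y - x))) \<in> borel_measurable borel"
  proof -
    have "(\<lambda>(x, y). f y * ew (y - x)) \<in> borel_measurable (lborel \<Otimes>\<^sub>M lborel)" by measurable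
    from borel_measurable_Lp_norm[OF assms(1) this] show ?thesis by simp
  qed
  have pw: "(\<integral>\<^sup>+ y. f y * (ew (y - x) * ew (y - x)) \<partial>lborel) \<le> ?W * Lp_norm p (\<lambda>y. f y * ew (y - x))" for x
  proof -
    have "(\<integral>\<^sup>+ y. (f y * ew (y - x)) * ew (y - x) \<partial>lborel) \<le> Lp_norm p (\<lambda>y. f y * ew (y - x)) * Lp_norm (conj_exponent p) (\<lambda>y. ew (y - x))"
      by (rule Holder[OF assms(1)]) measurable
    also have "\<dots> \<le> Lp_norm p (\<lambda>y. f y * ew (y - x)) * ?W"
      by (intro mult_left_mono Lp_norm_translate conj_exponent_ge_1) auto
    finally show ?thesis by (simp add: mult_ac)
  qed
  have "Lp_norm r (\<lambda>x. \<integral>\<^sup>+ y. f y * (ew (y - x) * ew (y - x)) \<partial>lborel) \<le> Lp_norm r (\<lambda>x. ?W * Lp_norm p (\<lambda>y. f y * ew (y - x)))"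
  proof (rule Lp_norm_mono[OF r _ pw])
    have "(\<lambda>(x, y). f y * (ew (y - x) * ew (y - x))) \<in> borel_measurable (lborel \<Otimes>\<^sub>M lborel)" by measurable
    from lborel.borel_measurable_nn_integral[OF this]
    show "(\<lambda>x. \<integral>\<^sup>+ y. f y * (ew (y - x) * ew (y - x)) \<partial>lborel) \<in> borel_measurable borel" by simp
  qed
  also have "\<dots> \<le> ?W * Lp_norm r (\<lambda>x. Lp_norm p (\<lambda>y. f y * ew (y - x)))"
    by (rule Lp_norm_cmult[OF r mN])
  also have "Lp_norm r (\<lambda>x. Lp_norm p (\<lambda>y. f y * ew (y - x))) \<le> Lp_norm p (\<lambda>y. Lp_norm r (\<lambda>x. f y * ew (y - x)))"
    by (rule Lp_norm_exchange[OF assms(1,2) m])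
  also have "\<dots> \<le> Lp_norm p (\<lambda>y. ?V * f y)"
  proof (rule Lp_norm_mono[OF assms(1)])
    show "(\<lambda>y. Lp_norm r (\<lambda>x. f y * ew (y - x))) \<in> borel_measurable borel"
      using borel_measurable_Lp_norm[OF r, of "\<lambda>y x. f y * ew (y - x)" lborel] m by simp
    fix y
    have "Lp_norm r (\<lambda>x. f y * ew (y - x)) \<le> f y * Lp_norm r (\<lambda>x. ew (y - x))"
      by (rule Lp_norm_cmult[OF r]) measurable
    also have "\<dots> \<le> f y * ?V" by (intro mult_left_mono Lp_norm_translate r) auto
    finally show "Lp_norm r (\<lambda>x. f y * ew (y - x)) \<le> ?V * f y" by (simp add: mult.commute)
  qed
  also have "\<dots> \<le> ?V * Lp_norm p f" by (rule Lp_norm_cmult[OF assms(1)]) measurable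
  finally show ?thesis by (simp add: mult_left_mono mult.assoc)
qed

lemma Lp_norm_ew_finite: "1 \<le> s \<Longrightarrow> Lp_norm s (ew :: 'a::euclidean_space \<Rightarrow> ennreal) < top"
  using Lp_norm_wt_finite[of s, where 'a = 'a] unfolding ew_def[abs_def] by simp

section \<open>Tonelli and measurability on product spaces\<close>

lemma fst_borel_measurable [measurable]: "fst \<in> borel_measurable (borel :: ('a::euclidean_space \<times> 'b::euclidean_space) measure)"
  and snd_borel_measurable [measurable]: "snd \<in> borel_measurable (borel :: ('a::euclidean_space \<times> 'b::euclidean_space) measure)"
  by (intro borel_measurable_continuous_onI continuous_intros)+

lemma nn_integral_lborel_pair:
  fixes f :: "'a::euclidean_space \<times> 'b::euclidean_space \<Rightarrow> ennreal"
  assumes "f \<in> borel_measurable borel"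
  shows "(\<integral>\<^sup>+ z. f z \<partial>lborel) = (\<integral>\<^sup>+ x. \<integral>\<^sup>+ y. f (x, y) \<partial>lborel \<partial>lborel)"
proof -
  have "f \<in> borel_measurable (lborel \<Otimes>\<^sub>M lborel)" unfolding lborel_prod using assms by simp
  from lborel.nn_integral_fst[OF this] show ?thesis unfolding lborel_prod by simp
qed

lemma nn_integral_lborel_swap:
  fixes f :: "'a::euclidean_space \<Rightarrow> 'b::euclidean_space \<Rightarrow> ennreal"
  assumes "case_prod f \<in> borel_measurable (borel \<Otimes>\<^sub>M borel)"
  shows "(\<integral>\<^sup>+ x. \<integral>\<^sup>+ y. f x y \<partial>lborel \<partial>lborel) = (\<integral>\<^sup>+ y. \<integral>\<^sup>+ x. f x y \<partial>lborel \<partial>lborel)"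
  by (rule lborel_pair.Fubini'[symmetric]) (use assms in simp)

lemma Lp_norm_measurable [measurable (raw)]:
  fixes h :: "'m \<Rightarrow> 'b::euclidean_space \<Rightarrow> ennreal"
  assumes "case_prod h \<in> borel_measurable (M \<Otimes>\<^sub>M borel)" "1 \<le> p"
  shows "(\<lambda>x. Lp_norm p (h x)) \<in> borel_measurable M"
proof (rule borel_measurable_Lp_norm[OF assms(2)])
  have "sets (M \<Otimes>\<^sub>M borel) = sets (M \<Otimes>\<^sub>M (lborel :: 'b measure))" by (intro sets_pair_measure_cong) auto
  then show "(\<lambda>(x, y). h x y) \<in> borel_measurable (M \<Otimes>\<^sub>M lborel)"
    using assms(1) measurable_cong_sets by blast
qed

lemma nn_integral_lborel_measurable [measurable (raw)]:
  fixes h :: "'m \<Rightarrow> 'b::euclidean_space \<Rightarrow> ennreal"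
  assumes "case_prod h \<in> borel_measurable (M \<Otimes>\<^sub>M borel)"
  shows "(\<lambda>x. \<integral>\<^sup>+ y. h x y \<partial>lborel) \<in> borel_measurable M"
proof (rule lborel.borel_measurable_nn_integral)
  have "sets (M \<Otimes>\<^sub>M borel) = sets (M \<Otimes>\<^sub>M (lborel :: 'b measure))" by (intro sets_pair_measure_cong) auto
  then show "(\<lambda>(x, y). h x y) \<in> borel_measurable (M \<Otimes>\<^sub>M lborel)"
    using assms(1) measurable_cong_sets by blast
qed

text \<open>The convolution kernel of all later estimates. It is a square so that
  \<open>Lp_norm_convolution\<close> can spend its two factors separately; decay of order m = 2 in
  \<open>STFT_decay\<close> provides exactly this kernel.\<close>

definition w2 :: "'a::euclidean_space \<Rightarrow> ennreal" where
  "w2 x = ew x * ew x"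

lemma w2_measurable [measurable]: "w2 \<in> borel_measurable borel"
  unfolding w2_def[abs_def] by measurable

lemma w2_minus_commute: "w2 (x - y) = w2 (y - x)"
  unfolding w2_def ew_minus_commute[of x y] ..

text \<open>The constant of the convolution estimate. It depends on the underlying space, which only
  the \<open>itself\<close> argument can reveal.\<close>

definition yc :: "'a::euclidean_space itself \<Rightarrow> ennreal \<Rightarrow> ennreal \<Rightarrow> ennreal" where
  "yc _ p r = Lp_norm (conj_exponent p) (ew :: 'a \<Rightarrow> ennreal) * Lp_norm r (ew :: 'a \<Rightarrow> ennreal)"

lemma yc_finite: "1 \<le> r \<Longrightarrow> yc TYPE('a::euclidean_space) p r < top"
  unfolding yc_def using Lp_norm_ew_finite[of r, where 'a='a] Lp_norm_ew_finite[OF conj_exponent_ge_1, of p, where 'a='a]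
  by (simp add: ennreal_mult_less_top)

lemma Lp_norm_convolution_w2:
  fixes f :: "'a::euclidean_space \<Rightarrow> ennreal"
  assumes "1 \<le> p" "p \<le> r" "f \<in> borel_measurable borel"
  shows "Lp_norm r (\<lambda>x. \<integral>\<^sup>+ y. f y * w2 (y - x) \<partial>lborel) \<le> yc TYPE('a) p r * Lp_norm p f"
  unfolding w2_def yc_def by (rule Lp_norm_convolution[OF assms])

section \<open>Convolution in two variables under mixed norms\<close>

lemma Lp_norm_Minkowski:
  fixes h :: "'a::euclidean_space \<Rightarrow> 'b::euclidean_space \<Rightarrow> ennreal"
  assumes "1 \<le> r" "case_prod h \<in> borel_measurable (borel \<Otimes>\<^sub>M borel)"
  shows "Lp_norm r (\<lambda>y. \<integral>\<^sup>+ x. h x y \<partial>lborel) \<le> (\<integral>\<^sup>+ x. Lp_norm r (h x) \<partial>lborel)"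
  by (rule Minkowski_integral[OF sigma_finite_lborel assms(1)]) (use assms(2) in simp)

text \<open>The convolution of B with the tensor square of the even kernel \<open>w2\<close>,
  written with iterated integrals so that the one-variable estimate can be applied in each
  variable.\<close>

definition conv2 :: "('a::euclidean_space \<Rightarrow> 'b::euclidean_space \<Rightarrow> ennreal) \<Rightarrow> 'a \<Rightarrow> 'b \<Rightarrow> ennreal" where
  "conv2 B x \<xi> = (\<integral>\<^sup>+ \<eta>. (\<integral>\<^sup>+ y. B y \<eta> * w2 (y - x) \<partial>lborel) * w2 (\<eta> - \<xi>) \<partial>lborel)"

lemma conv2_swap:
  assumes [measurable]: "case_prod B \<in> borel_measurable (borel \<Otimes>\<^sub>M borel)"
  shows "conv2 B x \<xi> = conv2 (\<lambda>\<eta> y. B y \<eta>) \<xi> x"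
proof -
  have [measurable]: "(\<lambda>p. B (snd p) (fst p)) \<in> borel_measurable (borel \<Otimes>\<^sub>M borel)" by measurable
  have "conv2 B x \<xi> = (\<integral>\<^sup>+ \<eta>. \<integral>\<^sup>+ y. B y \<eta> * w2 (y - x) * w2 (\<eta> - \<xi>) \<partial>lborel \<partial>lborel)"
    unfolding conv2_def by (intro nn_integral_cong nn_integral_multc[symmetric]) measurable
  also have "\<dots> = (\<integral>\<^sup>+ y. \<integral>\<^sup>+ \<eta>. B y \<eta> * w2 (y - x) * w2 (\<eta> - \<xi>) \<partial>lborel \<partial>lborel)"
    by (rule nn_integral_lborel_swap) measurable
  also have "\<dots> = (\<integral>\<^sup>+ y. \<integral>\<^sup>+ \<eta>. B y \<eta> * w2 (\<eta> - \<xi>) * w2 (y - x) \<partial>lborel \<partial>lborel)"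
    by (simp add: mult_ac)
  also have "\<dots> = conv2 (\<lambda>\<eta> y. B y \<eta>) \<xi> x"
    unfolding conv2_def by (intro nn_integral_cong nn_integral_multc) measurable
  finally show ?thesis .
qed

lemma conv2_measurable [measurable (raw)]:
  assumes [measurable]: "case_prod B \<in> borel_measurable (borel \<Otimes>\<^sub>M borel)"
  shows "case_prod (conv2 B) \<in> borel_measurable (borel \<Otimes>\<^sub>M borel)"
  unfolding conv2_def[abs_def] by measurable

text \<open>Minkowski's inequality moves the inner norm under the \<eta>-integral; the one-variable
  estimate is then applied in y and afterwards in \<eta>.\<close>

lemma conv2_norm:
  fixes B :: "'a::euclidean_space \<Rightarrow> 'b::euclidean_space \<Rightarrow> ennreal"
  assumes p: "1 \<le> p\<^sub>1" "p\<^sub>1 \<le> p\<^sub>2" and q: "1 \<le> q\<^sub>1" "q\<^sub>1 \<le> q\<^sub>2"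
    and [measurable]: "case_prod B \<in> borel_measurable (borel \<Otimes>\<^sub>M borel)"
  shows "Lp_norm q\<^sub>2 (\<lambda>\<xi>. Lp_norm p\<^sub>2 (\<lambda>x. conv2 B x \<xi>)) \<le>
    (yc TYPE('a) p\<^sub>1 p\<^sub>2 * yc TYPE('b) q\<^sub>1 q\<^sub>2) * Lp_norm q\<^sub>1 (\<lambda>\<eta>. Lp_norm p\<^sub>1 (\<lambda>y. B y \<eta>))"
proof -
  have p2: "1 \<le> p\<^sub>2" and q2: "1 \<le> q\<^sub>2" using p q order_trans by blast+
  note [measurable] = p(1) q(1) p2 q2
  have [measurable]: "case_prod (conv2 B) \<in> borel_measurable (borel \<Otimes>\<^sub>M borel)" by (rule conv2_measurable) measurable
  let ?b = "\<lambda>\<eta>. Lp_norm p\<^sub>1 (\<lambda>y. B y \<eta>)"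
  let ?c = "yc TYPE('a) p\<^sub>1 p\<^sub>2"
  have inner: "Lp_norm p\<^sub>2 (\<lambda>x. conv2 B x \<xi>) \<le> ?c * (\<integral>\<^sup>+ \<eta>. ?b \<eta> * w2 (\<eta> - \<xi>) \<partial>lborel)" for \<xi>
  proof -
    have "Lp_norm p\<^sub>2 (\<lambda>x. conv2 B x \<xi>) \<le>
      (\<integral>\<^sup>+ \<eta>. Lp_norm p\<^sub>2 (\<lambda>x. (\<integral>\<^sup>+ y. B y \<eta> * w2 (y - x) \<partial>lborel) * w2 (\<eta> - \<xi>)) \<partial>lborel)"
      unfolding conv2_def by (rule Lp_norm_Minkowski[OF p2]) measurable
    also have "\<dots> \<le> (\<integral>\<^sup>+ \<eta>. ?c * (?b \<eta> * w2 (\<eta> - \<xi>)) \<partial>lborel)"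
    proof (rule nn_integral_mono)
      fix \<eta> :: 'b
      have "Lp_norm p\<^sub>2 (\<lambda>x. (\<integral>\<^sup>+ y. B y \<eta> * w2 (y - x) \<partial>lborel) * w2 (\<eta> - \<xi>)) \<le>
        w2 (\<eta> - \<xi>) * Lp_norm p\<^sub>2 (\<lambda>x. \<integral>\<^sup>+ y. B y \<eta> * w2 (y - x) \<partial>lborel)"
        by (subst mult.commute, rule Lp_norm_cmult[OF p2]) measurable
      also have "\<dots> \<le> w2 (\<eta> - \<xi>) * (?c * ?b \<eta>)"
        by (intro mult_left_mono Lp_norm_convolution_w2 p zero_le) measurable
      finally show "Lp_norm p\<^sub>2 (\<lambda>x. (\<integral>\<^sup>+ y. B y \<eta> * w2 (y - x) \<partial>lborel) * w2 (\<eta> - \<xi>)) \<le> ?c * (?b \<eta> * w2 (\<eta> - \<xi>))"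
        by (simp add: mult_ac)
    qed
    also have "\<dots> = ?c * (\<integral>\<^sup>+ \<eta>. ?b \<eta> * w2 (\<eta> - \<xi>) \<partial>lborel)"
      by (rule nn_integral_cmult) measurable
    finally show ?thesis .
  qed
  have "Lp_norm q\<^sub>2 (\<lambda>\<xi>. Lp_norm p\<^sub>2 (\<lambda>x. conv2 B x \<xi>)) \<le> Lp_norm q\<^sub>2 (\<lambda>\<xi>. ?c * (\<integral>\<^sup>+ \<eta>. ?b \<eta> * w2 (\<eta> - \<xi>) \<partial>lborel))"
    by (rule Lp_norm_mono[OF q2 _ inner]) measurable
  also have "\<dots> \<le> ?c * Lp_norm q\<^sub>2 (\<lambda>\<xi>. \<integral>\<^sup>+ \<eta>. ?b \<eta> * w2 (\<eta> - \<xi>) \<partial>lborel)"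
    by (rule Lp_norm_cmult[OF q2]) measurable
  also have "\<dots> \<le> ?c * (yc TYPE('b) q\<^sub>1 q\<^sub>2 * Lp_norm q\<^sub>1 ?b)"
    by (intro mult_left_mono Lp_norm_convolution_w2 q zero_le) measurable
  finally show ?thesis by (simp add: mult_ac)
qed

text \<open>Here the two sides integrate in opposite orders. \<open>q\<^sub>1\<close> \<le>
  \<open>q\<^sub>2\<close> pays for the exchange of norms, \<open>p\<^sub>1\<close> \<le>
  \<open>q\<^sub>2\<close> for the convolution in the first variable, \<open>q\<^sub>1\<close> \<le>
  \<open>p\<^sub>2\<close> for that in the second. For \<tau> = 1 these become the three conditions
  on the source space.\<close>

lemma conv2_norm_swap:
  fixes B :: "'a::euclidean_space \<Rightarrow> 'b::euclidean_space \<Rightarrow> ennreal"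
  assumes p: "1 \<le> p\<^sub>1" "p\<^sub>1 \<le> q\<^sub>2" and q: "1 \<le> q\<^sub>1" "q\<^sub>1 \<le> p\<^sub>2" "q\<^sub>1 \<le> q\<^sub>2"
    and [measurable]: "case_prod B \<in> borel_measurable (borel \<Otimes>\<^sub>M borel)"
  shows "Lp_norm q\<^sub>2 (\<lambda>x. Lp_norm p\<^sub>2 (\<lambda>\<xi>. conv2 B x \<xi>)) \<le>
    (yc TYPE('a) p\<^sub>1 q\<^sub>2 * yc TYPE('b) q\<^sub>1 p\<^sub>2) * Lp_norm q\<^sub>1 (\<lambda>\<eta>. Lp_norm p\<^sub>1 (\<lambda>y. B y \<eta>))"
proof -
  have p2: "1 \<le> p\<^sub>2" and q2: "1 \<le> q\<^sub>2" using p q order_trans by blast+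
  note [measurable] = p(1) q(1) p2 q2
  let ?C = "\<lambda>x \<eta>. \<integral>\<^sup>+ y. B y \<eta> * w2 (y - x) \<partial>lborel"
  let ?c = "yc TYPE('b) q\<^sub>1 p\<^sub>2" and ?d = "yc TYPE('a) p\<^sub>1 q\<^sub>2"
  have "Lp_norm q\<^sub>2 (\<lambda>x. Lp_norm p\<^sub>2 (\<lambda>\<xi>. conv2 B x \<xi>)) \<le> Lp_norm q\<^sub>2 (\<lambda>x. ?c * Lp_norm q\<^sub>1 (?C x))"
  proof (rule Lp_norm_mono[OF q2])
    show "Lp_norm p\<^sub>2 (\<lambda>\<xi>. conv2 B x \<xi>) \<le> ?c * Lp_norm q\<^sub>1 (?C x)" for x
      unfolding conv2_def by (rule Lp_norm_convolution_w2[OF q(1,2)]) measurable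
  qed measurable
  also have "\<dots> \<le> ?c * Lp_norm q\<^sub>2 (\<lambda>x. Lp_norm q\<^sub>1 (?C x))"
    by (rule Lp_norm_cmult[OF q2]) measurable
  also have "Lp_norm q\<^sub>2 (\<lambda>x. Lp_norm q\<^sub>1 (?C x)) \<le> Lp_norm q\<^sub>1 (\<lambda>\<eta>. Lp_norm q\<^sub>2 (\<lambda>x. ?C x \<eta>))"
    by (rule Lp_norm_exchange[OF q(1,3)]) measurable
  also have "\<dots> \<le> Lp_norm q\<^sub>1 (\<lambda>\<eta>. ?d * Lp_norm p\<^sub>1 (\<lambda>y. B y \<eta>))"
  proof (rule Lp_norm_mono[OF q(1)])
    show "Lp_norm q\<^sub>2 (\<lambda>x. ?C x \<eta>) \<le> ?d * Lp_norm p\<^sub>1 (\<lambda>y. B y \<eta>)" for \<eta>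
      by (rule Lp_norm_convolution_w2[OF p]) measurable
  qed measurable
  also have "\<dots> \<le> ?d * Lp_norm q\<^sub>1 (\<lambda>\<eta>. Lp_norm p\<^sub>1 (\<lambda>y. B y \<eta>))"
    by (rule Lp_norm_cmult[OF q(1)]) measurable
  finally show ?thesis by (simp add: mult_ac mult_left_mono mult_right_mono)
qed

lemma Holder2:
  fixes F G :: "'a::euclidean_space \<Rightarrow> 'b::euclidean_space \<Rightarrow> ennreal"
  assumes "1 \<le> p" "1 \<le> q"
    and [measurable]: "case_prod F \<in> borel_measurable (borel \<Otimes>\<^sub>M borel)" "case_prod G \<in> borel_measurable (borel \<Otimes>\<^sub>M borel)"
  shows "(\<integral>\<^sup>+ x. \<integral>\<^sup>+ \<xi>. F x \<xi> * G x \<xi> \<partial>lborel \<partial>lborel) \<le>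
    Lp_norm q (\<lambda>\<xi>. Lp_norm p (\<lambda>x. F x \<xi>)) *
    Lp_norm (conj_exponent q) (\<lambda>\<xi>. Lp_norm (conj_exponent p) (\<lambda>x. G x \<xi>))"
proof -
  note [measurable] = assms(1,2) conj_exponent_ge_1
  have "(\<integral>\<^sup>+ x. \<integral>\<^sup>+ \<xi>. F x \<xi> * G x \<xi> \<partial>lborel \<partial>lborel) = (\<integral>\<^sup>+ \<xi>. \<integral>\<^sup>+ x. F x \<xi> * G x \<xi> \<partial>lborel \<partial>lborel)"
    by (rule nn_integral_lborel_swap) measurable
  also have "\<dots> \<le> (\<integral>\<^sup>+ \<xi>. Lp_norm p (\<lambda>x. F x \<xi>) * Lp_norm (conj_exponent p) (\<lambda>x. G x \<xi>) \<partial>lborel)"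
    by (intro nn_integral_mono Holder assms(1)) measurable
  also have "\<dots> \<le> Lp_norm q (\<lambda>\<xi>. Lp_norm p (\<lambda>x. F x \<xi>)) *
    Lp_norm (conj_exponent q) (\<lambda>\<xi>. Lp_norm (conj_exponent p) (\<lambda>x. G x \<xi>))"
    by (rule Holder[OF assms(2)]) measurable
  finally show ?thesis .
qed

subsection \<open>The two mixed norm estimates\<close>

text \<open>S stands for |V\<sigma>|, B for |Vf|, and the \<open>w2\<close> factors bound the
  transform of the time-frequency shifted window. H\<ouml>lder is applied in the second component of
  \<zeta> (exponent p) and of z (exponent q); the first components remain as convolutions.
  \<open>p\<close> \<le> \<open>q\<^sub>2\<close> is used for the convolution in the first component
  of \<zeta>, \<open>q\<close> \<le> \<open>p\<^sub>2\<close> for that in the first component of z,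
  and \<open>q\<close> \<le> \<open>q\<^sub>2\<close> to bring the norm in \<xi> inside.\<close>

lemma mixed_estimate_0:
  fixes S :: "'a::euclidean_space \<times> 'a \<Rightarrow> 'a \<times> 'a \<Rightarrow> ennreal" and B :: "'a \<Rightarrow> 'a \<Rightarrow> ennreal"
  assumes p: "1 \<le> p" "p \<le> q\<^sub>2" and q: "1 \<le> q" "q \<le> p\<^sub>2" "q \<le> q\<^sub>2"
    and [measurable]: "case_prod S \<in> borel_measurable (borel \<Otimes>\<^sub>M borel)" "case_prod B \<in> borel_measurable (borel \<Otimes>\<^sub>M borel)"
  shows "Lp_norm q\<^sub>2 (\<lambda>\<xi>. Lp_norm p\<^sub>2 (\<lambda>x.
      \<integral>\<^sup>+ z. \<integral>\<^sup>+ \<zeta>. S z \<zeta> * (w2 (fst z - x) * w2 (snd z + fst \<zeta> - \<xi>) * B (fst z + snd \<zeta>) (snd z)) \<partial>lborel \<partial>lborel)) \<le>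
    (yc TYPE('a) p q\<^sub>2 * yc TYPE('a) q p\<^sub>2) * Lp_norm q (\<lambda>z. Lp_norm p (S z)) *
    Lp_norm (conj_exponent q) (\<lambda>\<eta>. Lp_norm (conj_exponent p) (\<lambda>y. B y \<eta>))"
proof -
  have p2: "1 \<le> p\<^sub>2" and q2: "1 \<le> q\<^sub>2" using p q order_trans by blast+
  note [measurable] = p(1) q(1) p2 q2 conj_exponent_ge_1
  let ?X = "\<lambda>x \<xi>. \<integral>\<^sup>+ z. \<integral>\<^sup>+ \<zeta>. S z \<zeta> * (w2 (fst z - x) * w2 (snd z + fst \<zeta> - \<xi>) * B (fst z + snd \<zeta>) (snd z)) \<partial>lborel \<partial>lborel"
  \<comment> \<open>\<open>s\<close> and \<open>b\<close> are the factors left by H\<ouml>lder in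
    the second component of \<zeta>, \<open>s'\<close> is the convolution in the first one, and
    \<open>T\<close> the factor left by H\<ouml>lder in the second component of z. The argument
    \<xi> - z_2 of \<open>s'\<close> comes from the kernel at z_2 + \<zeta>_1 - \<xi>.\<close>
  define s where "s z \<zeta>\<^sub>1 = Lp_norm p (\<lambda>\<zeta>\<^sub>2. S z (\<zeta>\<^sub>1, \<zeta>\<^sub>2))" for z \<zeta>\<^sub>1
  define b where "b \<eta> = Lp_norm (conj_exponent p) (\<lambda>y. B y \<eta>)" for \<eta>
  define s' where "s' z \<omega> = (\<integral>\<^sup>+ \<zeta>\<^sub>1. s z \<zeta>\<^sub>1 * w2 (\<zeta>\<^sub>1 - \<omega>) \<partial>lborel)" for z \<omega>
  define T where "T z\<^sub>1 \<xi> = Lp_norm q (\<lambda>z\<^sub>2. s' (z\<^sub>1, z\<^sub>2) (\<xi> - z\<^sub>2))" for z\<^sub>1 \<xi>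
  let ?\<beta> = "Lp_norm (conj_exponent q) b"
  have s_meas [measurable]: "case_prod s \<in> borel_measurable (borel \<Otimes>\<^sub>M borel)" unfolding s_def[abs_def] by measurable
  have b_meas [measurable]: "b \<in> borel_measurable borel" unfolding b_def[abs_def] by measurable
  have s'_meas [measurable]: "case_prod s' \<in> borel_measurable (borel \<Otimes>\<^sub>M borel)" unfolding s'_def[abs_def] by measurable
  have T_meas [measurable]: "case_prod T \<in> borel_measurable (borel \<Otimes>\<^sub>M borel)" unfolding T_def[abs_def] by measurable
  have pw: "?X x \<xi> \<le> ?\<beta> * (\<integral>\<^sup>+ z\<^sub>1. T z\<^sub>1 \<xi> * w2 (z\<^sub>1 - x) \<partial>lborel)" for x \<xi>
  proof -
    have in1: "(\<integral>\<^sup>+ \<zeta>. S z \<zeta> * (w2 (fst z - x) * w2 (snd z + fst \<zeta> - \<xi>) * B (fst z + snd \<zeta>) (snd z)) \<partial>lborel) \<le>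
      w2 (fst z - x) * (s' z (\<xi> - snd z) * b (snd z))" for z
    proof -
      have "(\<integral>\<^sup>+ \<zeta>. S z \<zeta> * (w2 (fst z - x) * w2 (snd z + fst \<zeta> - \<xi>) * B (fst z + snd \<zeta>) (snd z)) \<partial>lborel) =
        (\<integral>\<^sup>+ \<zeta>\<^sub>1. \<integral>\<^sup>+ \<zeta>\<^sub>2. S z (\<zeta>\<^sub>1, \<zeta>\<^sub>2) * (w2 (fst z - x) * w2 (snd z + \<zeta>\<^sub>1 - \<xi>) * B (fst z + \<zeta>\<^sub>2) (snd z)) \<partial>lborel \<partial>lborel)"
        by (subst nn_integral_lborel_pair, (measurable)[1], simp)
      also have "\<dots> = (\<integral>\<^sup>+ \<zeta>\<^sub>1. (w2 (fst z - x) * w2 (snd z + \<zeta>\<^sub>1 - \<xi>)) * (\<integral>\<^sup>+ \<zeta>\<^sub>2. S z (\<zeta>\<^sub>1, \<zeta>\<^sub>2) * B (fst z + \<zeta>\<^sub>2) (snd z) \<partial>lborel) \<partial>lborel)"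
        by (intro nn_integral_cong) (subst nn_integral_cmult[symmetric], (measurable)[1], simp add: mult_ac)
      also have "\<dots> \<le> (\<integral>\<^sup>+ \<zeta>\<^sub>1. (w2 (fst z - x) * w2 (snd z + \<zeta>\<^sub>1 - \<xi>)) * (s z \<zeta>\<^sub>1 * b (snd z)) \<partial>lborel)"
      proof (intro nn_integral_mono mult_left_mono)
        fix \<zeta>\<^sub>1
        have "(\<integral>\<^sup>+ \<zeta>\<^sub>2. S z (\<zeta>\<^sub>1, \<zeta>\<^sub>2) * B (fst z + \<zeta>\<^sub>2) (snd z) \<partial>lborel) \<le>
          s z \<zeta>\<^sub>1 * Lp_norm (conj_exponent p) (\<lambda>\<zeta>\<^sub>2. B (fst z + \<zeta>\<^sub>2) (snd z))"
          unfolding s_def by (rule Holder[OF p(1)]) measurable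
        also have "\<dots> \<le> s z \<zeta>\<^sub>1 * b (snd z)"
          using Lp_norm_translate(2)[OF conj_exponent_ge_1, of "\<lambda>y. B y (snd z)" p "fst z"]
          unfolding b_def by (intro mult_left_mono) (auto simp: add.commute)
        finally show "(\<integral>\<^sup>+ \<zeta>\<^sub>2. S z (\<zeta>\<^sub>1, \<zeta>\<^sub>2) * B (fst z + \<zeta>\<^sub>2) (snd z) \<partial>lborel) \<le> s z \<zeta>\<^sub>1 * b (snd z)" .
      qed simp
      also have "\<dots> = (\<integral>\<^sup>+ \<zeta>\<^sub>1. (w2 (fst z - x) * b (snd z)) * (s z \<zeta>\<^sub>1 * w2 (\<zeta>\<^sub>1 - (\<xi> - snd z))) \<partial>lborel)"
        by (intro nn_integral_cong) (simp add: mult_ac algebra_simps)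
      also have "\<dots> = (w2 (fst z - x) * b (snd z)) * s' z (\<xi> - snd z)"
        unfolding s'_def by (rule nn_integral_cmult) measurable
      finally show ?thesis by (simp add: mult_ac)
    qed
    have "?X x \<xi> \<le> (\<integral>\<^sup>+ z. w2 (fst z - x) * (s' z (\<xi> - snd z) * b (snd z)) \<partial>lborel)"
      by (intro nn_integral_mono in1)
    also have "\<dots> = (\<integral>\<^sup>+ z\<^sub>1. \<integral>\<^sup>+ z\<^sub>2. w2 (z\<^sub>1 - x) * (s' (z\<^sub>1, z\<^sub>2) (\<xi> - z\<^sub>2) * b z\<^sub>2) \<partial>lborel \<partial>lborel)"
      by (subst nn_integral_lborel_pair, (measurable)[1], simp)
    also have "\<dots> = (\<integral>\<^sup>+ z\<^sub>1. w2 (z\<^sub>1 - x) * (\<integral>\<^sup>+ z\<^sub>2. s' (z\<^sub>1, z\<^sub>2) (\<xi> - z\<^sub>2) * b z\<^sub>2 \<partial>lborel) \<partial>lborel)"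
      by (intro nn_integral_cong nn_integral_cmult) measurable
    also have "\<dots> \<le> (\<integral>\<^sup>+ z\<^sub>1. w2 (z\<^sub>1 - x) * (T z\<^sub>1 \<xi> * ?\<beta>) \<partial>lborel)"
      unfolding T_def by (intro nn_integral_mono mult_left_mono Holder q(1) zero_le) measurable
    also have "\<dots> = ?\<beta> * (\<integral>\<^sup>+ z\<^sub>1. T z\<^sub>1 \<xi> * w2 (z\<^sub>1 - x) \<partial>lborel)"
      by (subst nn_integral_cmult[symmetric], (measurable)[1], simp add: mult_ac)
    finally show ?thesis .
  qed
  have inner: "Lp_norm p\<^sub>2 (\<lambda>x. ?X x \<xi>) \<le> (?\<beta> * yc TYPE('a) q p\<^sub>2) * Lp_norm q (\<lambda>z\<^sub>1. T z\<^sub>1 \<xi>)" for \<xi>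
  proof -
    have "Lp_norm p\<^sub>2 (\<lambda>x. ?X x \<xi>) \<le> Lp_norm p\<^sub>2 (\<lambda>x. ?\<beta> * (\<integral>\<^sup>+ z\<^sub>1. T z\<^sub>1 \<xi> * w2 (z\<^sub>1 - x) \<partial>lborel))"
      by (rule Lp_norm_mono[OF p2 _ pw]) measurable
    also have "\<dots> \<le> ?\<beta> * Lp_norm p\<^sub>2 (\<lambda>x. \<integral>\<^sup>+ z\<^sub>1. T z\<^sub>1 \<xi> * w2 (z\<^sub>1 - x) \<partial>lborel)"
      by (rule Lp_norm_cmult[OF p2]) measurable
    also have "\<dots> \<le> ?\<beta> * (yc TYPE('a) q p\<^sub>2 * Lp_norm q (\<lambda>z\<^sub>1. T z\<^sub>1 \<xi>))"
      by (intro mult_left_mono Lp_norm_convolution_w2 q zero_le) measurable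
    finally show ?thesis by (simp add: mult_ac)
  qed
  \<comment> \<open>The norm in \<xi> is moved inside past both components of z. There the
    dependence on \<xi> - z_2 is a translation and disappears.\<close>
  have T_norm: "Lp_norm q\<^sub>2 (\<lambda>\<xi>. Lp_norm q (\<lambda>z\<^sub>1. T z\<^sub>1 \<xi>)) \<le> yc TYPE('a) p q\<^sub>2 * Lp_norm q (\<lambda>z. Lp_norm p (S z))"
  proof -
    have "Lp_norm q\<^sub>2 (\<lambda>\<xi>. Lp_norm q (\<lambda>z\<^sub>1. T z\<^sub>1 \<xi>)) \<le> Lp_norm q (\<lambda>z\<^sub>1. Lp_norm q\<^sub>2 (T z\<^sub>1))"
      by (rule Lp_norm_exchange[OF q(1,3)]) measurable
    also have "\<dots> \<le> Lp_norm q (\<lambda>z\<^sub>1. Lp_norm q (\<lambda>z\<^sub>2. Lp_norm q\<^sub>2 (\<lambda>\<xi>. s' (z\<^sub>1, z\<^sub>2) (\<xi> - z\<^sub>2))))"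
      unfolding T_def
      by (intro Lp_norm_mono q(1) Lp_norm_exchange[OF q(1,3)]) measurable
    also have "\<dots> \<le> Lp_norm q (\<lambda>z\<^sub>1. Lp_norm q (\<lambda>z\<^sub>2. yc TYPE('a) p q\<^sub>2 * Lp_norm p (S (z\<^sub>1, z\<^sub>2))))"
    proof (intro Lp_norm_mono q(1))
      fix z\<^sub>1 z\<^sub>2 :: 'a
      have "Lp_norm q\<^sub>2 (\<lambda>\<xi>. s' (z\<^sub>1, z\<^sub>2) (\<xi> - z\<^sub>2)) \<le> Lp_norm q\<^sub>2 (s' (z\<^sub>1, z\<^sub>2))"
        by (rule Lp_norm_translate(1)[OF q2]) measurable
      also have "\<dots> \<le> yc TYPE('a) p q\<^sub>2 * Lp_norm p (s (z\<^sub>1, z\<^sub>2))"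
        unfolding s'_def[abs_def] by (rule Lp_norm_convolution_w2[OF p]) measurable
      also have "Lp_norm p (s (z\<^sub>1, z\<^sub>2)) = Lp_norm p (S (z\<^sub>1, z\<^sub>2))"
        unfolding s_def[abs_def] by (rule Lp_norm_prod(1)[OF p(1), symmetric]) measurable
      finally show "Lp_norm q\<^sub>2 (\<lambda>\<xi>. s' (z\<^sub>1, z\<^sub>2) (\<xi> - z\<^sub>2)) \<le> yc TYPE('a) p q\<^sub>2 * Lp_norm p (S (z\<^sub>1, z\<^sub>2))" .
    qed measurable
    also have "\<dots> = Lp_norm q (\<lambda>z. yc TYPE('a) p q\<^sub>2 * Lp_norm p (S z))"
      by (rule Lp_norm_prod(1)[OF q(1), symmetric]) measurable
    also have "\<dots> \<le> yc TYPE('a) p q\<^sub>2 * Lp_norm q (\<lambda>z. Lp_norm p (S z))"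
      by (rule Lp_norm_cmult[OF q(1)]) measurable
    finally show ?thesis .
  qed
  have "Lp_norm q\<^sub>2 (\<lambda>\<xi>. Lp_norm p\<^sub>2 (\<lambda>x. ?X x \<xi>)) \<le> Lp_norm q\<^sub>2 (\<lambda>\<xi>. (?\<beta> * yc TYPE('a) q p\<^sub>2) * Lp_norm q (\<lambda>z\<^sub>1. T z\<^sub>1 \<xi>))"
    by (rule Lp_norm_mono[OF q2 _ inner]) measurable
  also have "\<dots> \<le> (?\<beta> * yc TYPE('a) q p\<^sub>2) * Lp_norm q\<^sub>2 (\<lambda>\<xi>. Lp_norm q (\<lambda>z\<^sub>1. T z\<^sub>1 \<xi>))"
    by (rule Lp_norm_cmult[OF q2]) measurable
  also have "\<dots> \<le> (?\<beta> * yc TYPE('a) q p\<^sub>2) * (yc TYPE('a) p q\<^sub>2 * Lp_norm q (\<lambda>z. Lp_norm p (S z)))"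
    by (rule mult_left_mono[OF T_norm]) simp
  finally show ?thesis unfolding b_def[abs_def] by (simp only: mult_ac)
qed

text \<open>The time and frequency roles are interchanged: H\<ouml>lder acts in the first components
  of \<zeta> and z and leaves B integrated in its second variable first. The convolutions in the
  second components require \<open>p\<close> \<le> \<open>p\<^sub>2\<close> and \<open>q\<close>
  \<le> \<open>q\<^sub>2\<close>. The norm in x passes under the z-integral by Minkowski's
  inequality, which needs no comparison of exponents.\<close>

lemma mixed_estimate_1:
  fixes S :: "'a::euclidean_space \<times> 'a \<Rightarrow> 'a \<times> 'a \<Rightarrow> ennreal" and B :: "'a \<Rightarrow> 'a \<Rightarrow> ennreal"
  assumes p: "1 \<le> p" "p \<le> p\<^sub>2" and q: "1 \<le> q" "q \<le> q\<^sub>2"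
    and [measurable]: "case_prod S \<in> borel_measurable (borel \<Otimes>\<^sub>M borel)" "case_prod B \<in> borel_measurable (borel \<Otimes>\<^sub>M borel)"
  shows "Lp_norm q\<^sub>2 (\<lambda>\<xi>. Lp_norm p\<^sub>2 (\<lambda>x.
      \<integral>\<^sup>+ z. \<integral>\<^sup>+ \<zeta>. S z \<zeta> * (w2 (fst z - snd \<zeta> - x) * w2 (snd z - \<xi>) * B (fst z) (snd z - fst \<zeta>)) \<partial>lborel \<partial>lborel)) \<le>
    (yc TYPE('a) p p\<^sub>2 * yc TYPE('a) q q\<^sub>2) * Lp_norm q (\<lambda>z. Lp_norm p (S z)) *
    Lp_norm (conj_exponent q) (\<lambda>y. Lp_norm (conj_exponent p) (\<lambda>\<eta>. B y \<eta>))"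
proof -
  have p2: "1 \<le> p\<^sub>2" and q2: "1 \<le> q\<^sub>2" using p q order_trans by blast+
  note [measurable] = p(1) q(1) p2 q2 conj_exponent_ge_1
  let ?X = "\<lambda>x \<xi>. \<integral>\<^sup>+ z. \<integral>\<^sup>+ \<zeta>. S z \<zeta> * (w2 (fst z - snd \<zeta> - x) * w2 (snd z - \<xi>) * B (fst z) (snd z - fst \<zeta>)) \<partial>lborel \<partial>lborel"
  define s where "s z \<zeta>\<^sub>2 = Lp_norm p (\<lambda>\<zeta>\<^sub>1. S z (\<zeta>\<^sub>1, \<zeta>\<^sub>2))" for z \<zeta>\<^sub>2
  define b where "b y = Lp_norm (conj_exponent p) (\<lambda>\<eta>. B y \<eta>)" for y
  define s' where "s' z \<omega> = (\<integral>\<^sup>+ \<zeta>\<^sub>2. s z \<zeta>\<^sub>2 * w2 (\<zeta>\<^sub>2 - \<omega>) \<partial>lborel)" for z \<omega>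
  define t where "t z = Lp_norm p (S z)" for z
  define T where "T z\<^sub>2 = Lp_norm q (\<lambda>z\<^sub>1. t (z\<^sub>1, z\<^sub>2))" for z\<^sub>2
  let ?\<beta> = "Lp_norm (conj_exponent q) b"
  have s_meas [measurable]: "case_prod s \<in> borel_measurable (borel \<Otimes>\<^sub>M borel)" unfolding s_def[abs_def] by measurable
  have b_meas [measurable]: "b \<in> borel_measurable borel" unfolding b_def[abs_def] by measurable
  have s'_meas [measurable]: "case_prod s' \<in> borel_measurable (borel \<Otimes>\<^sub>M borel)" unfolding s'_def[abs_def] by measurable
  have t_meas [measurable]: "t \<in> borel_measurable borel" unfolding t_def[abs_def] by measurable
  have T_meas [measurable]: "T \<in> borel_measurable borel" unfolding T_def[abs_def] by measurable
  have pw: "?X x \<xi> \<le> (\<integral>\<^sup>+ z. (w2 (snd z - \<xi>) * b (fst z)) * s' z (fst z - x) \<partial>lborel)" for x \<xi>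
  proof (rule nn_integral_mono)
    fix z :: "'a \<times> 'a"
    have "(\<integral>\<^sup>+ \<zeta>. S z \<zeta> * (w2 (fst z - snd \<zeta> - x) * w2 (snd z - \<xi>) * B (fst z) (snd z - fst \<zeta>)) \<partial>lborel) =
      (\<integral>\<^sup>+ \<zeta>\<^sub>1. \<integral>\<^sup>+ \<zeta>\<^sub>2. S z (\<zeta>\<^sub>1, \<zeta>\<^sub>2) * (w2 (fst z - \<zeta>\<^sub>2 - x) * w2 (snd z - \<xi>) * B (fst z) (snd z - \<zeta>\<^sub>1)) \<partial>lborel \<partial>lborel)"
      by (subst nn_integral_lborel_pair, (measurable)[1], simp)
    also have "\<dots> = (\<integral>\<^sup>+ \<zeta>\<^sub>2. \<integral>\<^sup>+ \<zeta>\<^sub>1. S z (\<zeta>\<^sub>1, \<zeta>\<^sub>2) * (w2 (fst z - \<zeta>\<^sub>2 - x) * w2 (snd z - \<xi>) * B (fst z) (snd z - \<zeta>\<^sub>1)) \<partial>lborel \<partial>lborel)"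
      by (rule nn_integral_lborel_swap) measurable
    also have "\<dots> = (\<integral>\<^sup>+ \<zeta>\<^sub>2. (w2 (fst z - \<zeta>\<^sub>2 - x) * w2 (snd z - \<xi>)) * (\<integral>\<^sup>+ \<zeta>\<^sub>1. S z (\<zeta>\<^sub>1, \<zeta>\<^sub>2) * B (fst z) (snd z - \<zeta>\<^sub>1) \<partial>lborel) \<partial>lborel)"
      by (intro nn_integral_cong) (subst nn_integral_cmult[symmetric], (measurable)[1], simp add: mult_ac)
    also have "\<dots> \<le> (\<integral>\<^sup>+ \<zeta>\<^sub>2. (w2 (fst z - \<zeta>\<^sub>2 - x) * w2 (snd z - \<xi>)) * (s z \<zeta>\<^sub>2 * b (fst z)) \<partial>lborel)"
    proof (intro nn_integral_mono mult_left_mono)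
      fix \<zeta>\<^sub>2
      have "(\<integral>\<^sup>+ \<zeta>\<^sub>1. S z (\<zeta>\<^sub>1, \<zeta>\<^sub>2) * B (fst z) (snd z - \<zeta>\<^sub>1) \<partial>lborel) \<le>
        s z \<zeta>\<^sub>2 * Lp_norm (conj_exponent p) (\<lambda>\<zeta>\<^sub>1. B (fst z) (snd z - \<zeta>\<^sub>1))"
        unfolding s_def by (rule Holder[OF p(1)]) measurable
      also have "\<dots> \<le> s z \<zeta>\<^sub>2 * b (fst z)"
        unfolding b_def by (intro mult_left_mono Lp_norm_translate(3) conj_exponent_ge_1 zero_le) measurable
      finally show "(\<integral>\<^sup>+ \<zeta>\<^sub>1. S z (\<zeta>\<^sub>1, \<zeta>\<^sub>2) * B (fst z) (snd z - \<zeta>\<^sub>1) \<partial>lborel) \<le> s z \<zeta>\<^sub>2 * b (fst z)" .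
    qed simp
    also have "\<dots> = (\<integral>\<^sup>+ \<zeta>\<^sub>2. (w2 (snd z - \<xi>) * b (fst z)) * (s z \<zeta>\<^sub>2 * w2 (\<zeta>\<^sub>2 - (fst z - x))) \<partial>lborel)"
    proof (intro nn_integral_cong)
      fix \<zeta>\<^sub>2
      have "w2 (fst z - \<zeta>\<^sub>2 - x) = w2 (\<zeta>\<^sub>2 - (fst z - x))"
        using w2_minus_commute[of "fst z - x" \<zeta>\<^sub>2] by (simp add: algebra_simps)
      then show "(w2 (fst z - \<zeta>\<^sub>2 - x) * w2 (snd z - \<xi>)) * (s z \<zeta>\<^sub>2 * b (fst z)) =
        (w2 (snd z - \<xi>) * b (fst z)) * (s z \<zeta>\<^sub>2 * w2 (\<zeta>\<^sub>2 - (fst z - x)))" by (simp add: mult_ac)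
    qed
    also have "\<dots> = (w2 (snd z - \<xi>) * b (fst z)) * s' z (fst z - x)"
      unfolding s'_def by (rule nn_integral_cmult) measurable
    finally show "(\<integral>\<^sup>+ \<zeta>. S z \<zeta> * (w2 (fst z - snd \<zeta> - x) * w2 (snd z - \<xi>) * B (fst z) (snd z - fst \<zeta>)) \<partial>lborel) \<le>
      (w2 (snd z - \<xi>) * b (fst z)) * s' z (fst z - x)" .
  qed
  let ?c = "yc TYPE('a) p p\<^sub>2"
  have inner: "Lp_norm p\<^sub>2 (\<lambda>x. ?X x \<xi>) \<le> (?c * ?\<beta>) * (\<integral>\<^sup>+ z\<^sub>2. T z\<^sub>2 * w2 (z\<^sub>2 - \<xi>) \<partial>lborel)" for \<xi>
  proof -
    have "Lp_norm p\<^sub>2 (\<lambda>x. ?X x \<xi>) \<le> Lp_norm p\<^sub>2 (\<lambda>x. \<integral>\<^sup>+ z. (w2 (snd z - \<xi>) * b (fst z)) * s' z (fst z - x) \<partial>lborel)"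
      by (rule Lp_norm_mono[OF p2 _ pw]) measurable
    also have "\<dots> \<le> (\<integral>\<^sup>+ z. Lp_norm p\<^sub>2 (\<lambda>x. (w2 (snd z - \<xi>) * b (fst z)) * s' z (fst z - x)) \<partial>lborel)"
      by (rule Lp_norm_Minkowski[OF p2]) measurable
    also have "\<dots> \<le> (\<integral>\<^sup>+ z. (w2 (snd z - \<xi>) * b (fst z)) * (?c * t z) \<partial>lborel)"
    proof (rule nn_integral_mono)
      fix z :: "'a \<times> 'a"
      have "Lp_norm p\<^sub>2 (\<lambda>x. (w2 (snd z - \<xi>) * b (fst z)) * s' z (fst z - x)) \<le>
        (w2 (snd z - \<xi>) * b (fst z)) * Lp_norm p\<^sub>2 (\<lambda>x. s' z (fst z - x))"
        by (rule Lp_norm_cmult[OF p2]) measurable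
      also have "\<dots> \<le> (w2 (snd z - \<xi>) * b (fst z)) * Lp_norm p\<^sub>2 (s' z)"
        by (intro mult_left_mono Lp_norm_translate(3)[OF p2] zero_le) measurable
      also have "\<dots> \<le> (w2 (snd z - \<xi>) * b (fst z)) * (?c * Lp_norm p (s z))"
        unfolding s'_def[abs_def] by (intro mult_left_mono Lp_norm_convolution_w2 p zero_le) measurable
      also have "Lp_norm p (s z) = t z"
        unfolding s_def[abs_def] t_def by (rule Lp_norm_prod(2)[OF p(1), symmetric]) measurable
      finally show "Lp_norm p\<^sub>2 (\<lambda>x. (w2 (snd z - \<xi>) * b (fst z)) * s' z (fst z - x)) \<le> (w2 (snd z - \<xi>) * b (fst z)) * (?c * t z)" .
    qed
    also have "\<dots> = (\<integral>\<^sup>+ z\<^sub>1. \<integral>\<^sup>+ z\<^sub>2. (w2 (z\<^sub>2 - \<xi>) * b z\<^sub>1) * (?c * t (z\<^sub>1, z\<^sub>2)) \<partial>lborel \<partial>lborel)"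
      by (subst nn_integral_lborel_pair, (measurable)[1], simp)
    also have "\<dots> = (\<integral>\<^sup>+ z\<^sub>2. \<integral>\<^sup>+ z\<^sub>1. (w2 (z\<^sub>2 - \<xi>) * b z\<^sub>1) * (?c * t (z\<^sub>1, z\<^sub>2)) \<partial>lborel \<partial>lborel)"
      by (rule nn_integral_lborel_swap) measurable
    also have "\<dots> = (\<integral>\<^sup>+ z\<^sub>2. (?c * w2 (z\<^sub>2 - \<xi>)) * (\<integral>\<^sup>+ z\<^sub>1. t (z\<^sub>1, z\<^sub>2) * b z\<^sub>1 \<partial>lborel) \<partial>lborel)"
      by (intro nn_integral_cong) (subst nn_integral_cmult[symmetric], (measurable)[1], simp add: mult_ac)
    also have "\<dots> \<le> (\<integral>\<^sup>+ z\<^sub>2. (?c * w2 (z\<^sub>2 - \<xi>)) * (T z\<^sub>2 * ?\<beta>) \<partial>lborel)"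
      unfolding T_def by (intro nn_integral_mono mult_left_mono Holder q(1) zero_le) measurable
    also have "\<dots> = (?c * ?\<beta>) * (\<integral>\<^sup>+ z\<^sub>2. T z\<^sub>2 * w2 (z\<^sub>2 - \<xi>) \<partial>lborel)"
      by (subst nn_integral_cmult[symmetric], (measurable)[1], simp add: mult_ac)
    finally show ?thesis .
  qed
  have "Lp_norm q\<^sub>2 (\<lambda>\<xi>. Lp_norm p\<^sub>2 (\<lambda>x. ?X x \<xi>)) \<le> Lp_norm q\<^sub>2 (\<lambda>\<xi>. (?c * ?\<beta>) * (\<integral>\<^sup>+ z\<^sub>2. T z\<^sub>2 * w2 (z\<^sub>2 - \<xi>) \<partial>lborel))"
    by (rule Lp_norm_mono[OF q2 _ inner]) measurable
  also have "\<dots> \<le> (?c * ?\<beta>) * Lp_norm q\<^sub>2 (\<lambda>\<xi>. \<integral>\<^sup>+ z\<^sub>2. T z\<^sub>2 * w2 (z\<^sub>2 - \<xi>) \<partial>lborel)"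
    by (rule Lp_norm_cmult[OF q2]) measurable
  also have "\<dots> \<le> (?c * ?\<beta>) * (yc TYPE('a) q q\<^sub>2 * Lp_norm q T)"
    by (intro mult_left_mono Lp_norm_convolution_w2 q zero_le) measurable
  also have "Lp_norm q T = Lp_norm q t"
    unfolding T_def[abs_def] by (rule Lp_norm_prod(2)[OF q(1), symmetric]) measurable
  finally show ?thesis unfolding b_def[abs_def] t_def[abs_def] by (simp only: mult_ac)
qed

section \<open>Change of windows\<close>

lemma cnj_borel_measurable [measurable]: "cnj \<in> borel_measurable borel"
  by (intro borel_measurable_continuous_onI continuous_intros)

text \<open>If the L2 norm vanished, f would be 0 almost everywhere; its zero set is closed, and a
  closed set of full measure is the whole space.\<close>

lemma pairing_self_nonzero:
  fixes f :: "'a::euclidean_space \<Rightarrow> complex"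
  assumes f: "f \<in> schwartz" and nz: "f \<noteq> (\<lambda>x. 0)"
  shows "pairing f f \<noteq> 0"
proof
  assume 0: "pairing f f = 0"
  have e: "f x * cnj (f x) = complex_of_real ((cmod (f x))\<^sup>2)" for x by (rule complex_norm_square[symmetric])
  have int: "integrable lborel (\<lambda>x. (cmod (f x))\<^sup>2)"
  proof -
    have "integrable lborel (\<lambda>x. f x * cnj (f x))" by (intro schwartz_integrable schwartz_mult schwartz_cnj f)
    then show ?thesis unfolding e complex_of_real_integrable_eq .
  qed
  have "(LINT x|lborel. (cmod (f x))\<^sup>2) = 0"
    using 0 unfolding pairing_def e integral_complex_of_real by simp
  then have "AE x in lborel. (cmod (f x))\<^sup>2 = 0"
    using integral_nonneg_eq_0_iff_AE[OF int] by simp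
  then have ae: "AE x in lborel. f x = 0" by eventually_elim simp
  then have "AE x in lborel. x \<in> {x. f x = 0}" by simp
  then have "AE x in lebesgue. x \<in> {x. f x = 0}" by (rule AE_completion)
  moreover have "closed {x. f x = 0}"
    using schwartz_continuous[OF f] by (intro closed_Collect_eq) auto
  ultimately have "f x = 0" for x using mem_closed_if_AE_lebesgue[of "{x. f x = 0}" x] by simp
  then show False using nz by auto
qed

definition eV :: "('a::euclidean_space \<Rightarrow> complex) \<Rightarrow> (('a \<Rightarrow> complex) \<Rightarrow> complex) \<Rightarrow> 'a \<Rightarrow> 'a \<Rightarrow> ennreal" where
  "eV \<phi> u x \<xi> = ennreal (cmod (STFT \<phi> u x \<xi>))"

lemma modulation_norm_eV: "modulation_norm \<phi> p q u = Lp_norm q (\<lambda>\<xi>. Lp_norm p (\<lambda>x. eV \<phi> u x \<xi>))"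
  by (simp add: modulation_norm_def eV_def)

lemma eV_measurable: "u \<in> tempered \<Longrightarrow> \<phi> \<in> schwartz \<Longrightarrow> case_prod (eV \<phi> u) \<in> borel_measurable (borel \<Otimes>\<^sub>M borel)"
  unfolding eV_def[abs_def] by (rule STFT_measurable)

lemma measurable_section:
  assumes "case_prod F \<in> borel_measurable (borel \<Otimes>\<^sub>M borel)"
  shows "F x \<in> borel_measurable borel" "(\<lambda>x. F x y) \<in> borel_measurable borel"
  using measurable_compose[OF measurable_Pair1'[of x borel borel] assms]
    measurable_compose[OF measurable_Pair2'[of y borel borel] assms] by simp_all

lemma mixed_norm_mono:
  fixes F G :: "'a::euclidean_space \<Rightarrow> 'b::euclidean_space \<Rightarrow> ennreal"
  assumes "1 \<le> p" "1 \<le> q"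
    and [measurable]: "case_prod F \<in> borel_measurable (borel \<Otimes>\<^sub>M borel)" "case_prod G \<in> borel_measurable (borel \<Otimes>\<^sub>M borel)"
    and le: "\<And>x \<xi>. F x \<xi> \<le> c * G x \<xi>"
  shows "Lp_norm q (\<lambda>\<xi>. Lp_norm p (\<lambda>x. F x \<xi>)) \<le> c * Lp_norm q (\<lambda>\<xi>. Lp_norm p (\<lambda>x. G x \<xi>))"
proof -
  note [measurable] = assms(1,2)
  have "Lp_norm q (\<lambda>\<xi>. Lp_norm p (\<lambda>x. F x \<xi>)) \<le> Lp_norm q (\<lambda>\<xi>. c * Lp_norm p (\<lambda>x. G x \<xi>))"
  proof (rule Lp_norm_mono[OF assms(2)])
    show "Lp_norm p (\<lambda>x. F x \<xi>) \<le> c * Lp_norm p (\<lambda>x. G x \<xi>)" for \<xi>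
      by (rule order_trans[OF Lp_norm_mono[OF assms(1) _ le] Lp_norm_cmult[OF assms(1)]]) measurable
  qed measurable
  also have "\<dots> \<le> c * Lp_norm q (\<lambda>\<xi>. Lp_norm p (\<lambda>x. G x \<xi>))"
    by (rule Lp_norm_cmult[OF assms(2)]) measurable
  finally show ?thesis .
qed

lemma measurable_swap_args:
  assumes "case_prod F \<in> borel_measurable (borel \<Otimes>\<^sub>M borel)"
  shows "case_prod (\<lambda>y x. F x y) \<in> borel_measurable (borel \<Otimes>\<^sub>M borel)"
  using measurable_compose[OF measurable_pair_swap' assms] by (simp add: case_prod_unfold)

lemma mixed_norm_mono':
  fixes F G :: "'a::euclidean_space \<Rightarrow> 'b::euclidean_space \<Rightarrow> ennreal"
  assumes "1 \<le> p" "1 \<le> q"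
    and "case_prod F \<in> borel_measurable (borel \<Otimes>\<^sub>M borel)" "case_prod G \<in> borel_measurable (borel \<Otimes>\<^sub>M borel)"
    and "\<And>x \<xi>. F x \<xi> \<le> c * G x \<xi>"
  shows "Lp_norm q (\<lambda>x. Lp_norm p (F x)) \<le> c * Lp_norm q (\<lambda>x. Lp_norm p (G x))"
  by (rule mixed_norm_mono[where F = "\<lambda>y x. F x y" and G = "\<lambda>y x. G x y"])
    (rule assms measurable_swap_args)+

lemma amalgam_norm_eV:
  assumes "1 \<le> p" "1 \<le> q" "u \<in> tempered" "\<Phi> \<in> schwartz"
  shows "amalgam_norm \<Phi> p q u = Lp_norm q (\<lambda>z. Lp_norm p (eV \<Phi> u z))"
proof -
  have "Lp_norm p (\<lambda>\<zeta>. eV \<Phi> u z (- \<zeta>)) = Lp_norm p (eV \<Phi> u z)" for z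
  proof -
    have m: "eV \<Phi> u z \<in> borel_measurable borel" by (rule measurable_section(1)[OF eV_measurable[OF assms(3,4)]])
    have [measurable]: "(\<lambda>\<zeta>. eV \<Phi> u z (- \<zeta>)) \<in> borel_measurable borel"
      using m by measurable
    show ?thesis
      using Lp_norm_translate(3)[OF assms(1) m, of 0] Lp_norm_translate(3)[OF assms(1), of "\<lambda>\<zeta>. eV \<Phi> u z (- \<zeta>)" 0]
      by (intro antisym) auto
  qed
  then show ?thesis by (simp add: amalgam_norm_def eV_def)
qed

text \<open>Covariance of the short-time Fourier transform: after a change of variables only a phase
  depending on z, \<eta> and \<zeta> is left over.\<close>

lemma norm_STFT_shift:
  fixes f \<phi> :: "'a::euclidean_space \<Rightarrow> complex"
  assumes f: "f \<in> schwartz" and \<phi>: "\<phi> \<in> schwartz"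
  shows "cmod (STFT \<phi> (pairing (modulation \<zeta> (translation z f))) y \<eta>) = cmod (STFT \<phi> (pairing f) (y - z) (\<eta> - \<zeta>))"
proof -
  let ?h = "\<lambda>t. (f t * cnj (\<phi> (t - (y - z)))) * ch (- ((t + z) \<bullet> (\<eta> - \<zeta>)))"
  have [measurable]: "f \<in> borel_measurable borel" "\<phi> \<in> borel_measurable borel"
    by (rule schwartz_measurable f \<phi>)+
  have e1: "STFT \<phi> (pairing (modulation \<zeta> (translation z f))) y \<eta> = (LINT t|lborel. ?h (t - z))"
    unfolding STFT_pairing fourier_def modulation_eq translation_def
  proof (rule Bochner_Integration.integral_cong[OF refl])
    fix t
    have "ch (t \<bullet> \<zeta>) * ch (- (t \<bullet> \<eta>)) = ch (- (t \<bullet> (\<eta> - \<zeta>)))"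
      by (simp add: inner_diff_right flip: ch_add)
    then show "ch (t \<bullet> \<zeta>) * f (t - z) * cnj (\<phi> (t - y)) * ch (- (t \<bullet> \<eta>)) = ?h (t - z)"
      by (simp add: mult_ac)
  qed
  have e: "STFT \<phi> (pairing (modulation \<zeta> (translation z f))) y \<eta> = (LINT t|lborel. ?h t)"
    unfolding e1 by (rule integral_translate) measurable
  have sp: "ch (- ((t + z) \<bullet> (\<eta> - \<zeta>))) = ch (- (t \<bullet> (\<eta> - \<zeta>))) * ch (- (z \<bullet> (\<eta> - \<zeta>)))" for t
    by (simp add: inner_add_left flip: ch_add)
  have "(LINT t|lborel. ?h t) = ch (- (z \<bullet> (\<eta> - \<zeta>))) * STFT \<phi> (pairing f) (y - z) (\<eta> - \<zeta>)"
    unfolding STFT_pairing fourier_def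
    by (simp add: sp mult_ac flip: integral_mult_right_zero)
  then show ?thesis unfolding e by (simp add: norm_mult)
qed

lemma eV_shift_le:
  fixes \<Phi> \<Gamma> :: "'a::euclidean_space \<Rightarrow> complex"
  assumes "\<Phi> \<in> schwartz" "\<Gamma> \<in> schwartz"
  shows "\<exists>C>0. \<forall>z \<zeta> y \<eta>. eV \<Phi> (pairing (modulation \<zeta> (translation z \<Gamma>))) y \<eta> \<le> ennreal C * (w2 (y - z) * w2 (\<eta> - \<zeta>))"
proof -
  obtain C where C: "C > 0" "\<And>x \<xi>. cmod (STFT \<Phi> (pairing \<Gamma>) x \<xi>) \<le> C * (wt x ^ 2 * wt \<xi> ^ 2)"
    using STFT_decay[OF assms(2,1), of 2] by metis
  have "eV \<Phi> (pairing (modulation \<zeta> (translation z \<Gamma>))) y \<eta> \<le> ennreal C * (w2 (y - z) * w2 (\<eta> - \<zeta>))" for z \<zeta> y \<eta>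
  proof -
    have "eV \<Phi> (pairing (modulation \<zeta> (translation z \<Gamma>))) y \<eta> \<le> ennreal (C * (wt (y - z) ^ 2 * wt (\<eta> - \<zeta>) ^ 2))"
      unfolding eV_def norm_STFT_shift[OF assms(2,1)] by (intro ennreal_leI C)
    then show ?thesis using C(1) by (simp add: w2_def ew_def power2_eq_square ennreal_mult)
  qed
  then show ?thesis using C(1) by blast
qed

text \<open>The reproducing formula is applied to the shifted window \<Gamma> as a test function,
  with \<Phi> as its own dual window; hence the division by the squared L2 norm of \<Phi>. C does
  not depend on u.\<close>

lemma change_window:
  fixes \<Phi> \<Gamma> :: "'a::euclidean_space \<Rightarrow> complex"
  assumes \<Phi>: "\<Phi> \<in> schwartz" "\<Phi> \<noteq> (\<lambda>x. 0)" and \<Gamma>: "\<Gamma> \<in> schwartz"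
  shows "\<exists>C>0. \<forall>u\<in>tempered. \<forall>z \<zeta>. eV \<Gamma> u z \<zeta> \<le> ennreal C * conv2 (eV \<Phi> u) z \<zeta>"
proof -
  obtain C where C: "C > 0" "\<And>z \<zeta> y \<eta>. eV \<Phi> (pairing (modulation \<zeta> (translation z \<Gamma>))) y \<eta> \<le> ennreal C * (w2 (y - z) * w2 (\<eta> - \<zeta>))"
    using eV_shift_le[OF \<Phi>(1) \<Gamma>] by metis
  define c where "c = cmod (pairing \<Phi> \<Phi>)"
  have c: "c > 0" using pairing_self_nonzero[OF \<Phi>] by (simp add: c_def)
  have "eV \<Gamma> u z \<zeta> \<le> ennreal (C / c) * conv2 (eV \<Phi> u) z \<zeta>" if u: "u \<in> tempered" for u z \<zeta>
  proof -
    note [measurable] = eV_measurable[OF u \<Phi>(1)]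
    have "ennreal (c * cmod (STFT \<Gamma> u z \<zeta>)) \<le>
      (\<integral>\<^sup>+ y. \<integral>\<^sup>+ \<eta>. eV \<Phi> u y \<eta> * eV \<Phi> (pairing (modulation \<zeta> (translation z \<Gamma>))) y \<eta> \<partial>lborel \<partial>lborel)"
      unfolding c_def STFT_def[of \<Gamma>] eV_def
      by (rule STFT_duality[OF u \<Phi>(1) \<Phi>(1) modulation_schwartz[OF translation_schwartz[OF \<Gamma>]]])
    also have "\<dots> \<le> (\<integral>\<^sup>+ y. \<integral>\<^sup>+ \<eta>. eV \<Phi> u y \<eta> * (ennreal C * (w2 (y - z) * w2 (\<eta> - \<zeta>))) \<partial>lborel \<partial>lborel)"
      by (intro nn_integral_mono mult_left_mono C zero_le)
    also have "\<dots> = (\<integral>\<^sup>+ \<eta>. \<integral>\<^sup>+ y. eV \<Phi> u y \<eta> * (ennreal C * (w2 (y - z) * w2 (\<eta> - \<zeta>))) \<partial>lborel \<partial>lborel)"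
      by (rule nn_integral_lborel_swap) measurable
    also have "\<dots> = (\<integral>\<^sup>+ \<eta>. ennreal C * ((\<integral>\<^sup>+ y. eV \<Phi> u y \<eta> * w2 (y - z) \<partial>lborel) * w2 (\<eta> - \<zeta>)) \<partial>lborel)"
    proof (rule nn_integral_cong)
      fix \<eta>
      have "(\<integral>\<^sup>+ y. (eV \<Phi> u y \<eta> * w2 (y - z)) * (ennreal C * w2 (\<eta> - \<zeta>)) \<partial>lborel) =
        (\<integral>\<^sup>+ y. eV \<Phi> u y \<eta> * w2 (y - z) \<partial>lborel) * (ennreal C * w2 (\<eta> - \<zeta>))"
        by (rule nn_integral_multc) measurable
      then show "(\<integral>\<^sup>+ y. eV \<Phi> u y \<eta> * (ennreal C * (w2 (y - z) * w2 (\<eta> - \<zeta>))) \<partial>lborel) =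
        ennreal C * ((\<integral>\<^sup>+ y. eV \<Phi> u y \<eta> * w2 (y - z) \<partial>lborel) * w2 (\<eta> - \<zeta>))"
        by (simp add: mult_ac)
    qed
    also have "\<dots> = ennreal C * conv2 (eV \<Phi> u) z \<zeta>"
      unfolding conv2_def by (rule nn_integral_cmult) measurable
    finally have le: "ennreal (c * cmod (STFT \<Gamma> u z \<zeta>)) \<le> ennreal C * conv2 (eV \<Phi> u) z \<zeta>" .
    have "eV \<Gamma> u z \<zeta> = ennreal (1 / c) * ennreal (c * cmod (STFT \<Gamma> u z \<zeta>))"
      using c by (simp add: eV_def flip: ennreal_mult)
    also have "\<dots> \<le> ennreal (1 / c) * (ennreal C * conv2 (eV \<Phi> u) z \<zeta>)"
      by (rule mult_left_mono[OF le]) simp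
    also have "\<dots> = ennreal (C / c) * conv2 (eV \<Phi> u) z \<zeta>"
      using c C(1) by (simp add: mult.assoc[symmetric] flip: ennreal_mult)
    finally show ?thesis .
  qed
  then show ?thesis using c C(1) by (intro exI[of _ "C / c"]) auto
qed

text \<open>Independence of the window and the inclusion of modulation spaces in one statement: the
  convolution in \<open>change_window\<close> may raise both exponents.\<close>

lemma modulation_norm_window:
  fixes \<phi> \<psi> :: "'a::euclidean_space \<Rightarrow> complex"
  assumes \<phi>: "\<phi> \<in> schwartz" "\<phi> \<noteq> (\<lambda>x. 0)" and \<psi>: "\<psi> \<in> schwartz"
    and p: "1 \<le> p\<^sub>1" "p\<^sub>1 \<le> p\<^sub>2" and q: "1 \<le> q\<^sub>1" "q\<^sub>1 \<le> q\<^sub>2"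
  shows "\<exists>K<top. \<forall>u\<in>tempered. modulation_norm \<psi> p\<^sub>2 q\<^sub>2 u \<le> K * modulation_norm \<phi> p\<^sub>1 q\<^sub>1 u"
proof -
  have p2: "1 \<le> p\<^sub>2" and q2: "1 \<le> q\<^sub>2" using p q order_trans by blast+
  obtain C where C: "C > 0" "\<And>u z \<zeta>. u \<in> tempered \<Longrightarrow> eV \<psi> u z \<zeta> \<le> ennreal C * conv2 (eV \<phi> u) z \<zeta>"
    using change_window[OF \<phi> \<psi>] by metis
  let ?K = "ennreal C * (yc TYPE('a) p\<^sub>1 p\<^sub>2 * yc TYPE('a) q\<^sub>1 q\<^sub>2)"
  have "modulation_norm \<psi> p\<^sub>2 q\<^sub>2 u \<le> ?K * modulation_norm \<phi> p\<^sub>1 q\<^sub>1 u" if u: "u \<in> tempered" for u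
  proof -
    have "modulation_norm \<psi> p\<^sub>2 q\<^sub>2 u \<le> ennreal C * Lp_norm q\<^sub>2 (\<lambda>\<xi>. Lp_norm p\<^sub>2 (\<lambda>x. conv2 (eV \<phi> u) x \<xi>))"
      unfolding modulation_norm_eV
      by (rule mixed_norm_mono[OF p2 q2 eV_measurable[OF u \<psi>] conv2_measurable[OF eV_measurable[OF u \<phi>(1)]] C(2)[OF u]])
    also have "\<dots> \<le> ennreal C * ((yc TYPE('a) p\<^sub>1 p\<^sub>2 * yc TYPE('a) q\<^sub>1 q\<^sub>2) * modulation_norm \<phi> p\<^sub>1 q\<^sub>1 u)"
      unfolding modulation_norm_eV by (intro mult_left_mono conv2_norm p q eV_measurable u \<phi> zero_le)
    finally show ?thesis by (simp add: mult.assoc)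
  qed
  moreover have "?K < top" using p2 q2 by (simp add: ennreal_mult_less_top yc_finite)
  ultimately show ?thesis by blast
qed

text \<open>The embedding of a modulation space into a space normed in the opposite order of
  integration; for \<tau> = 1 it adapts f to what \<open>mixed_estimate_1\<close> asks for.\<close>

lemma modulation_norm_window_swap:
  fixes \<phi> \<psi> :: "'a::euclidean_space \<Rightarrow> complex"
  assumes \<phi>: "\<phi> \<in> schwartz" "\<phi> \<noteq> (\<lambda>x. 0)" and \<psi>: "\<psi> \<in> schwartz"
    and p: "1 \<le> p\<^sub>1" "p\<^sub>1 \<le> q\<^sub>2" and q: "1 \<le> q\<^sub>1" "q\<^sub>1 \<le> p\<^sub>2" "q\<^sub>1 \<le> q\<^sub>2"
  shows "\<exists>K<top. \<forall>u\<in>tempered. Lp_norm q\<^sub>2 (\<lambda>x. Lp_norm p\<^sub>2 (eV \<psi> u x)) \<le> K * modulation_norm \<phi> p\<^sub>1 q\<^sub>1 u"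
proof -
  have p2: "1 \<le> p\<^sub>2" and q2: "1 \<le> q\<^sub>2" using p q order_trans by blast+
  obtain C where C: "C > 0" "\<And>u z \<zeta>. u \<in> tempered \<Longrightarrow> eV \<psi> u z \<zeta> \<le> ennreal C * conv2 (eV \<phi> u) z \<zeta>"
    using change_window[OF \<phi> \<psi>] by metis
  let ?K = "ennreal C * (yc TYPE('a) p\<^sub>1 q\<^sub>2 * yc TYPE('a) q\<^sub>1 p\<^sub>2)"
  have "Lp_norm q\<^sub>2 (\<lambda>x. Lp_norm p\<^sub>2 (eV \<psi> u x)) \<le> ?K * modulation_norm \<phi> p\<^sub>1 q\<^sub>1 u" if u: "u \<in> tempered" for u
  proof -
    have "Lp_norm q\<^sub>2 (\<lambda>x. Lp_norm p\<^sub>2 (eV \<psi> u x)) \<le> ennreal C * Lp_norm q\<^sub>2 (\<lambda>x. Lp_norm p\<^sub>2 (conv2 (eV \<phi> u) x))"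
      by (rule mixed_norm_mono'[OF p2 q2 eV_measurable[OF u \<psi>] conv2_measurable[OF eV_measurable[OF u \<phi>(1)]] C(2)[OF u]])
    also have "\<dots> \<le> ennreal C * ((yc TYPE('a) p\<^sub>1 q\<^sub>2 * yc TYPE('a) q\<^sub>1 p\<^sub>2) * modulation_norm \<phi> p\<^sub>1 q\<^sub>1 u)"
      unfolding modulation_norm_eV by (intro mult_left_mono conv2_norm_swap p q eV_measurable u \<phi> zero_le)
    finally show ?thesis by (simp add: mult.assoc)
  qed
  moreover have "?K < top" using p2 q2 by (simp add: ennreal_mult_less_top yc_finite)
  ultimately show ?thesis by blast
qed

lemma amalgam_norm_window:
  fixes \<Phi> \<Gamma> :: "'a::euclidean_space \<Rightarrow> complex"
  assumes \<Phi>: "\<Phi> \<in> schwartz" "\<Phi> \<noteq> (\<lambda>x. 0)" and \<Gamma>: "\<Gamma> \<in> schwartz" and p: "1 \<le> p" and q: "1 \<le> q"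
  shows "\<exists>K<top. \<forall>u\<in>tempered. amalgam_norm \<Gamma> p q u \<le> K * amalgam_norm \<Phi> p q u"
proof -
  obtain C where C: "C > 0" "\<And>u z \<zeta>. u \<in> tempered \<Longrightarrow> eV \<Gamma> u z \<zeta> \<le> ennreal C * conv2 (eV \<Phi> u) z \<zeta>"
    using change_window[OF \<Phi> \<Gamma>] by metis
  let ?K = "ennreal C * (yc TYPE('a) p p * yc TYPE('a) q q)"
  have "amalgam_norm \<Gamma> p q u \<le> ?K * amalgam_norm \<Phi> p q u" if u: "u \<in> tempered" for u
  proof -
    have m: "case_prod (eV \<Phi> u) \<in> borel_measurable (borel \<Otimes>\<^sub>M borel)" by (rule eV_measurable[OF u \<Phi>(1)])
    have "amalgam_norm \<Gamma> p q u \<le> ennreal C * Lp_norm q (\<lambda>x. Lp_norm p (conv2 (eV \<Phi> u) x))"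
      unfolding amalgam_norm_eV[OF p q u \<Gamma>]
      by (rule mixed_norm_mono'[OF p q eV_measurable[OF u \<Gamma>] conv2_measurable[OF m] C(2)[OF u]])
    \<comment> \<open>\<open>conv2_norm\<close> integrates the first variable inside, while the
      amalgam norm starts with the second, so the two variables are exchanged first.\<close>
    also have "Lp_norm q (\<lambda>x. Lp_norm p (conv2 (eV \<Phi> u) x)) = Lp_norm q (\<lambda>x. Lp_norm p (\<lambda>\<xi>. conv2 (\<lambda>\<eta> y. eV \<Phi> u y \<eta>) \<xi> x))"
      by (intro arg_cong[where f = "Lp_norm q"] arg_cong[where f = "Lp_norm p"] ext) (rule conv2_swap[OF m])
    also have "ennreal C * \<dots> \<le> ennreal C * ((yc TYPE('a) p p * yc TYPE('a) q q) * Lp_norm q (\<lambda>x. Lp_norm p (\<lambda>\<eta>. eV \<Phi> u x \<eta>)))"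
      by (rule mult_left_mono[OF conv2_norm[where B = "\<lambda>\<eta> y. eV \<Phi> u y \<eta>",
            OF p order_refl q order_refl measurable_swap_args[OF m]] zero_le])
    finally show ?thesis unfolding amalgam_norm_eV[OF p q u \<Phi>(1)] by (simp add: mult.assoc)
  qed
  moreover have "?K < top" using p q by (simp add: ennreal_mult_less_top yc_finite)
  ultimately show ?thesis by blast
qed

section \<open>Embedding functions into tempered distributions\<close>

definition schwartz_norm :: "nat \<Rightarrow> ('a::euclidean_space \<Rightarrow> complex) \<Rightarrow> real" where
  "schwartz_norm N f = (\<Sum>k\<le>N. \<Sum>bs\<in>{bs\<in>lists Basis. length bs \<le> N}. schwartz_seminorm k bs f)"

lemma schwartz_seminorm_upper:
  assumes "f \<in> schwartz" "bs \<in> lists Basis"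
  shows "norm x ^ k * cmod (partials bs f x) \<le> schwartz_seminorm k bs f"
  unfolding schwartz_seminorm_def
proof (rule cSUP_upper[OF UNIV_I])
  show "bdd_above (range (\<lambda>x. norm x ^ k * cmod (partials bs f x)))"
    using schwartz_rapid[OF schwartz_partials[OF assms]] unfolding rapid_iff by (rule spec)
qed

lemma schwartz_seminorm_nonneg:
  assumes "f \<in> schwartz" "bs \<in> lists Basis" shows "0 \<le> schwartz_seminorm k bs f"
  by (rule order_trans[OF _ schwartz_seminorm_upper[OF assms, of 0]]) simp

lemma schwartz_norm_upper:
  assumes f: "f \<in> schwartz" and k: "k \<le> N"
  shows "norm x ^ k * cmod (f x) \<le> schwartz_norm N f"
proof -
  have fin: "finite {bs\<in>lists (Basis :: 'a set). length bs \<le> N}"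
    using finite_lists_length_le[OF finite_Basis, of N] by (simp add: lists_eq_set conj_commute)
  have "norm x ^ k * cmod (f x) \<le> schwartz_seminorm k [] f"
    using schwartz_seminorm_upper[OF f, of "[]" x k] by simp
  also have "\<dots> \<le> (\<Sum>bs\<in>{bs\<in>lists Basis. length bs \<le> N}. schwartz_seminorm k bs f)"
    by (rule member_le_sum) (auto intro: schwartz_seminorm_nonneg f fin)
  also have "\<dots> \<le> schwartz_norm N f"
    unfolding schwartz_norm_def
    by (rule member_le_sum[of k "{..N}" "\<lambda>k. \<Sum>bs\<in>{bs\<in>lists Basis. length bs \<le> N}. schwartz_seminorm k bs f"])
      (auto intro!: sum_nonneg schwartz_seminorm_nonneg f k)
  finally show ?thesis .
qed

text \<open>The L1 norm is a continuous seminorm: sup bounds with weights 1 and |x|^(2d) control |f|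
  by a multiple of \<open>wt\<close>, and \<open>one_plus_power_le\<close> supplies the factor
  2^(2d).\<close>

lemma schwartz_norm_integral:
  fixes f :: "'a::euclidean_space \<Rightarrow> complex"
  assumes f: "f \<in> schwartz"
  shows "(LINT x|lborel. cmod (f x)) \<le> (2 ^ (2 * DIM('a)) * 2 * (LINT (x::'a)|lborel. wt x)) * schwartz_norm (2 * DIM('a)) f"
proof -
  let ?N = "2 * DIM('a)"
  have "cmod (f x) \<le> (2 ^ ?N * 2 * schwartz_norm ?N f) * wt x" for x
  proof -
    have "(1 + norm x) ^ ?N * cmod (f x) \<le> 2 ^ ?N * (1 + norm x ^ ?N) * cmod (f x)"
      by (intro mult_right_mono one_plus_power_le) auto
    also have "\<dots> = 2 ^ ?N * (norm x ^ 0 * cmod (f x) + norm x ^ ?N * cmod (f x))" by (simp add: algebra_simps)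
    also have "\<dots> \<le> 2 ^ ?N * (schwartz_norm ?N f + schwartz_norm ?N f)"
      by (intro mult_left_mono add_mono schwartz_norm_upper f) auto
    finally have "(1 + norm x) ^ (2 * DIM('a) * 1) * cmod (f x) \<le> 2 ^ ?N * 2 * schwartz_norm ?N f" by simp
    from le_wt[OF this] show ?thesis by simp
  qed
  then have "(LINT x|lborel. cmod (f x)) \<le> (LINT (x::'a)|lborel. (2 ^ ?N * 2 * schwartz_norm ?N f) * wt x)"
    by (intro integral_mono integrable_norm schwartz_integrable f integrable_mult_right integrable_wt)
  then show ?thesis by (simp add: mult_ac)
qed

text \<open>\<open>schwartz_norm 0\<close> is the supremum norm. A bound by supremum norm plus L1
  norm covers pairings with integrable as well as with bounded functions, the two cases needed for
  superpositions.\<close>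

lemma tempered_intro:
  fixes u :: "('a::euclidean_space \<Rightarrow> complex) \<Rightarrow> complex"
  assumes "\<And>f g. f \<in> schwartz \<Longrightarrow> g \<in> schwartz \<Longrightarrow> u (\<lambda>x. f x + g x) = u f + u g"
    and "\<And>c f. f \<in> schwartz \<Longrightarrow> u (\<lambda>x. c * f x) = cnj c * u f"
    and "\<And>f. f \<in> schwartz \<Longrightarrow> cmod (u f) \<le> C * (schwartz_norm 0 f + (LINT x|lborel. cmod (f x)))"
  shows "u \<in> tempered"
proof -
  let ?N = "2 * DIM('a)" and ?J = "2 ^ (2 * DIM('a)) * 2 * (LINT (x::'a)|lborel. wt x)"
  have "cmod (u f) \<le> (\<bar>C\<bar> * (1 + ?J)) * schwartz_norm ?N f" if f: "f \<in> schwartz" for f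
  proof -
    have fin: "finite {bs\<in>lists (Basis :: 'a set). length bs \<le> ?N}"
      using finite_lists_length_le[OF finite_Basis, of ?N] by (simp add: lists_eq_set conj_commute)
    have "schwartz_norm 0 f = schwartz_seminorm 0 [] f"
      unfolding schwartz_norm_def by (simp add: conj_commute cong: conj_cong)
    also have "\<dots> \<le> (\<Sum>bs\<in>{bs\<in>lists Basis. length bs \<le> ?N}. schwartz_seminorm 0 bs f)"
      by (rule member_le_sum) (auto intro: schwartz_seminorm_nonneg f fin)
    also have "\<dots> \<le> schwartz_norm ?N f"
      unfolding schwartz_norm_def
      by (rule member_le_sum[of 0 "{..?N}" "\<lambda>k. \<Sum>bs\<in>{bs\<in>lists Basis. length bs \<le> ?N}. schwartz_seminorm k bs f"])
        (auto intro!: sum_nonneg schwartz_seminorm_nonneg f)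
    finally have 0: "schwartz_norm 0 f \<le> schwartz_norm ?N f" .
    have n0: "0 \<le> schwartz_norm 0 f" using schwartz_norm_upper[OF f, of 0 0 "0 :: 'a"] order_trans[OF norm_ge_zero, of "f 0"] by simp
    have "cmod (u f) \<le> \<bar>C\<bar> * (schwartz_norm 0 f + (LINT x|lborel. cmod (f x)))"
      by (rule order_trans[OF assms(3)[OF f] mult_right_mono]) (auto intro!: add_nonneg_nonneg n0 Bochner_Integration.integral_nonneg)
    also have "\<dots> \<le> \<bar>C\<bar> * (schwartz_norm ?N f + ?J * schwartz_norm ?N f)"
      by (intro mult_left_mono add_mono 0 schwartz_norm_integral f) auto
    finally show ?thesis by (simp add: algebra_simps)
  qed
  then have "\<forall>f\<in>schwartz. cmod (u f) \<le> (\<bar>C\<bar> * (1 + ?J)) * schwartz_norm ?N f" by (rule ballI)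
  then have bd: "\<exists>C N. \<forall>f\<in>schwartz. cmod (u f) \<le> C * schwartz_norm N f" by (intro exI)
  have 1: "\<forall>f\<in>schwartz. \<forall>g\<in>schwartz. u (\<lambda>x. f x + g x) = u f + u g"
    by (intro ballI assms(1))
  have 2: "\<forall>c. \<forall>f\<in>schwartz. u (\<lambda>x. c * f x) = cnj c * u f"
    by (intro allI ballI assms(2))
  show ?thesis unfolding tempered_def mem_Collect_eq
    by (rule conjI[OF 1 conjI[OF 2 bd[unfolded schwartz_norm_def]]])
qed

lemma pairing_le_sup:
  assumes "f \<in> schwartz" "g \<in> schwartz"
  shows "cmod (pairing f g) \<le> (LINT x|lborel. cmod (f x)) * schwartz_norm 0 g"
proof -
  have "cmod (pairing f g) \<le> (LINT x|lborel. cmod (f x) * schwartz_norm 0 g)"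
    unfolding pairing_def
  proof (rule Bochner_Integration.integral_norm_bound_integral)
    show "integrable lborel (\<lambda>x. f x * cnj (g x))" by (intro schwartz_integrable schwartz_mult schwartz_cnj assms)
    show "integrable lborel (\<lambda>x. cmod (f x) * schwartz_norm 0 g)"
      by (intro integrable_mult_left integrable_norm schwartz_integrable assms)
    show "cmod (f x * cnj (g x)) \<le> cmod (f x) * schwartz_norm 0 g" for x
      using schwartz_norm_upper[OF assms(2), of 0 0 x] by (simp add: norm_mult mult_left_mono)
  qed
  then show ?thesis by simp
qed

lemma pairing_le_integral:
  assumes "f \<in> schwartz" "g \<in> schwartz" "\<And>x. cmod (f x) \<le> C"
  shows "cmod (pairing f g) \<le> C * (LINT x|lborel. cmod (g x))"
proof -
  have "cmod (pairing f g) \<le> (LINT x|lborel. C * cmod (g x))"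
    unfolding pairing_def
  proof (rule Bochner_Integration.integral_norm_bound_integral)
    show "integrable lborel (\<lambda>x. f x * cnj (g x))" by (intro schwartz_integrable schwartz_mult schwartz_cnj assms)
    show "integrable lborel (\<lambda>x. C * cmod (g x))"
      by (intro integrable_mult_right integrable_norm schwartz_integrable assms)
    show "cmod (f x * cnj (g x)) \<le> C * cmod (g x)" for x
      using assms(3)[of x] by (simp add: norm_mult mult_right_mono)
  qed
  then show ?thesis by simp
qed

lemma pairing_add:
  assumes "f \<in> schwartz" "g \<in> schwartz" "h \<in> schwartz"
  shows "pairing f (\<lambda>x. g x + h x) = pairing f g + pairing f h"
proof -
  have "integrable lborel (\<lambda>x. f x * cnj (g x))" "integrable lborel (\<lambda>x. f x * cnj (h x))"
    by (intro schwartz_integrable schwartz_mult schwartz_cnj assms)+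
  then show ?thesis unfolding pairing_def by (simp add: distrib_left)
qed

lemma pairing_cmult: "pairing f (\<lambda>x. c * g x) = cnj c * pairing f g"
  unfolding pairing_def by (simp add: mult_ac flip: integral_mult_right_zero)

lemma pairing_tempered:
  fixes f :: "'a::euclidean_space \<Rightarrow> complex"
  assumes "f \<in> schwartz" shows "pairing f \<in> tempered"
proof -
  have 1: "pairing f (\<lambda>x. g x + h x) = pairing f g + pairing f h" if "g \<in> schwartz" "h \<in> schwartz" for g h
    using that by (rule pairing_add[OF assms])
  have 2: "cmod (pairing f g) \<le> (LINT x|lborel. cmod (f x)) * (schwartz_norm 0 g + (LINT x|lborel. cmod (g x)))"
    if "g \<in> schwartz" for g
    by (rule order_trans[OF pairing_le_sup[OF assms that] mult_left_mono]) (auto intro: Bochner_Integration.integral_nonneg)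
  show ?thesis by (rule tempered_intro[OF 1 pairing_cmult 2])
qed

section \<open>The Wigner distributions for \<open>\<tau> = 0\<close> and \<open>\<tau> = 1\<close>\<close>

lemma exp_neg_eq_ch: "exp (- 2 * pi * \<i> * (r::real)) = ch (- r)"
  unfolding ch_def cis_conv_exp by (simp add: mult_ac)

text \<open>For \<tau> = 0 the Wigner distribution is the Rihaczek distribution, a tensor product up
  to a phase of modulus 1. Moyal's identity and the factorisation of its transform rest on this
  form.\<close>

lemma tau_wigner_0:
  fixes f g :: "'a::euclidean_space \<Rightarrow> complex"
  assumes "f \<in> schwartz"
  shows "tau_wigner 0 g f (x, \<xi>) = g x * cnj (fourier f \<xi>) * ch (- (x \<bullet> \<xi>))"
proof -
  have [measurable]: "f \<in> borel_measurable borel" by (rule schwartz_measurable[OF assms])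
  let ?h = "\<lambda>s. (g x * ch (- (x \<bullet> \<xi>))) * cnj (f s * ch (- (s \<bullet> \<xi>)))"
  have "tau_wigner 0 g f (x, \<xi>) = (LINT t|lborel. ?h (x - t))"
    unfolding tau_wigner_def prod.case
  proof (rule Bochner_Integration.integral_cong[OF refl])
    fix t
    have "ch (- (\<xi> \<bullet> t)) = ch (- (x \<bullet> \<xi>)) * ch ((x - t) \<bullet> \<xi>)"
      by (simp add: inner_diff_left inner_commute[of \<xi>] flip: ch_add)
    then show "g (x + 0 *\<^sub>R t) * cnj (f (x - (1 - 0) *\<^sub>R t)) * exp (- 2 * pi * \<i> * (\<xi> \<bullet> t)) = ?h (x - t)"
      unfolding exp_neg_eq_ch by simp
  qed
  also have "\<dots> = (LINT s|lborel. ?h s)" by (rule integral_reflect_translate) measurable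
  also have "\<dots> = (g x * ch (- (x \<bullet> \<xi>))) * cnj (fourier f \<xi>)"
    unfolding fourier_def by (simp only: integral_mult_right_zero Bochner_Integration.integral_cnj)
  finally show ?thesis by (simp add: mult_ac)
qed

text \<open>This reduces the case \<tau> = 1 to \<tau> = 0 by conjugation and exchange of the
  arguments.\<close>

lemma tau_wigner_1:
  fixes f g :: "'a::euclidean_space \<Rightarrow> complex"
  assumes "g \<in> schwartz"
  shows "tau_wigner 1 g f z = cnj (tau_wigner 0 f g z)"
proof -
  obtain x \<xi> where z: "z = (x, \<xi>)" by (cases z)
  have [measurable]: "g \<in> borel_measurable borel" by (rule schwartz_measurable[OF assms])
  let ?h = "\<lambda>s. (cnj (f x) * ch (x \<bullet> \<xi>)) * (g s * ch (- (s \<bullet> \<xi>)))"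
  have "tau_wigner 1 g f (x, \<xi>) = (LINT t|lborel. ?h (t - (- x)))"
    unfolding tau_wigner_def prod.case
  proof (rule Bochner_Integration.integral_cong[OF refl])
    fix t
    have "ch (- (\<xi> \<bullet> t)) = ch (x \<bullet> \<xi>) * ch (- ((t + x) \<bullet> \<xi>))"
      by (simp add: inner_add_left inner_commute[of \<xi>] flip: ch_add)
    then show "g (x + 1 *\<^sub>R t) * cnj (f (x - (1 - 1) *\<^sub>R t)) * exp (- 2 * pi * \<i> * (\<xi> \<bullet> t)) = ?h (t - (- x))"
      unfolding exp_neg_eq_ch by (simp add: add.commute)
  qed
  also have "\<dots> = (LINT s|lborel. ?h s)" by (rule integral_translate) measurable
  also have "\<dots> = (cnj (f x) * ch (x \<bullet> \<xi>)) * fourier g \<xi>"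
    unfolding fourier_def by (simp only: integral_mult_right_zero)
  finally show ?thesis unfolding z tau_wigner_0[OF assms] by (simp add: mult_ac)
qed

lemma tau_wigner_0_schwartz:
  fixes f g :: "'a::euclidean_space \<Rightarrow> complex"
  assumes "g \<in> schwartz" "f \<in> schwartz" shows "tau_wigner 0 g f \<in> schwartz"
proof -
  have "(\<lambda>z. ch (- (fst z \<bullet> snd z)) * (\<lambda>(x, \<xi>). g x * cnj (fourier f \<xi>)) z) \<in> schwartz"
    by (intro schwartz_slow_mult slow_ch_inner bounded_linear_fst bounded_linear_snd
        schwartz_tensor schwartz_cnj fourier_schwartz assms)
  moreover have "tau_wigner 0 g f = (\<lambda>z. ch (- (fst z \<bullet> snd z)) * (\<lambda>(x, \<xi>). g x * cnj (fourier f \<xi>)) z)"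
    by (rule ext) (auto simp: tau_wigner_0[OF assms(2)] case_prod_unfold)
  ultimately show ?thesis by simp
qed

lemma tau_wigner_schwartz:
  fixes f g :: "'a::euclidean_space \<Rightarrow> complex"
  assumes "\<tau> \<in> {0, 1}" "g \<in> schwartz" "f \<in> schwartz" shows "tau_wigner \<tau> g f \<in> schwartz"
proof -
  have "tau_wigner 1 g f = (\<lambda>z. cnj (tau_wigner 0 f g z))" by (rule ext) (rule tau_wigner_1[OF assms(2)])
  then show ?thesis
    using assms tau_wigner_0_schwartz schwartz_cnj[OF tau_wigner_0_schwartz[OF assms(3,2)]] by auto
qed

section \<open>Moyal's identity and the transform of a Wigner distribution\<close>

lemma integral_tensor:
  fixes f :: "'a::euclidean_space \<Rightarrow> complex" and g :: "'b::euclidean_space \<Rightarrow> complex"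
  assumes "f \<in> schwartz" "g \<in> schwartz"
  shows "(LINT z|lborel. f (fst z) * g (snd z)) = (LINT x|lborel. f x) * (LINT y|lborel. g y)"
proof -
  have "integrable (lborel \<Otimes>\<^sub>M lborel) (\<lambda>(x, y). f x * g y)"
    unfolding lborel_prod by (intro schwartz_integrable schwartz_tensor assms)
  from lborel_pair.integral_fst'[OF this]
  have "(LINT z|lborel. (\<lambda>(x, y). f x * g y) z) = (LINT x|lborel. LINT y|lborel. f x * g y)"
    unfolding lborel_prod by simp
  then show ?thesis by (simp add: case_prod_unfold)
qed

text \<open>The phases cancel, the integral splits into the two variables, and Parseval's identity
  turns the frequency factor back into a pairing of functions.\<close>

lemma moyal_0:
  fixes f g f\<^sub>1 g\<^sub>1 :: "'a::euclidean_space \<Rightarrow> complex"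
  assumes "f \<in> schwartz" "g \<in> schwartz" "f\<^sub>1 \<in> schwartz" "g\<^sub>1 \<in> schwartz"
  shows "pairing (tau_wigner 0 g\<^sub>1 f\<^sub>1) (tau_wigner 0 g f) = pairing g\<^sub>1 g * cnj (pairing f\<^sub>1 f)"
proof -
  let ?a = "\<lambda>x. g\<^sub>1 x * cnj (g x)" and ?b = "\<lambda>\<xi>. cnj (fourier f\<^sub>1 \<xi> * cnj (fourier f \<xi>))"
  have "pairing (tau_wigner 0 g\<^sub>1 f\<^sub>1) (tau_wigner 0 g f) = (LINT z|lborel. ?a (fst z) * ?b (snd z))"
    unfolding pairing_def
  proof (rule Bochner_Integration.integral_cong[OF refl])
    fix z :: "'a \<times> 'a"
    obtain x \<xi> where z: "z = (x, \<xi>)" by (cases z)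
    have "ch (- (x \<bullet> \<xi>)) * cnj (ch (- (x \<bullet> \<xi>))) = 1" by simp
    then show "tau_wigner 0 g\<^sub>1 f\<^sub>1 z * cnj (tau_wigner 0 g f z) = ?a (fst z) * ?b (snd z)"
      unfolding z tau_wigner_0[OF assms(1)] tau_wigner_0[OF assms(3)] by (simp add: mult_ac)
  qed
  also have "\<dots> = (LINT x|lborel. ?a x) * (LINT \<xi>|lborel. ?b \<xi>)"
    by (intro integral_tensor schwartz_mult schwartz_cnj fourier_schwartz assms)
  also have "\<dots> = pairing g\<^sub>1 g * cnj (pairing (fourier f\<^sub>1) (fourier f))"
    unfolding pairing_def by (simp only: Bochner_Integration.integral_cnj)
  finally show ?thesis unfolding parseval[OF assms(3,1)] .
qed

lemma pairing_cnj: "pairing (\<lambda>x. cnj (f x)) (\<lambda>x. cnj (g x)) = cnj (pairing f g)"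
  unfolding pairing_def by (subst Bochner_Integration.integral_cnj[symmetric]) simp

lemma moyal:
  fixes f g f\<^sub>1 g\<^sub>1 :: "'a::euclidean_space \<Rightarrow> complex"
  assumes "\<tau> \<in> {0, 1}" "f \<in> schwartz" "g \<in> schwartz" "f\<^sub>1 \<in> schwartz" "g\<^sub>1 \<in> schwartz"
  shows "pairing (tau_wigner \<tau> g\<^sub>1 f\<^sub>1) (tau_wigner \<tau> g f) = pairing g\<^sub>1 g * cnj (pairing f\<^sub>1 f)"
proof (cases "\<tau> = 0")
  case True
  then show ?thesis using moyal_0[OF assms(2-5)] by simp
next
  case False
  then have \<tau>: "\<tau> = 1" using assms(1) by simp
  have w: "tau_wigner 1 g f = (\<lambda>z. cnj (tau_wigner 0 f g z))" "tau_wigner 1 g\<^sub>1 f\<^sub>1 = (\<lambda>z. cnj (tau_wigner 0 f\<^sub>1 g\<^sub>1 z))"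
    by (rule ext, rule tau_wigner_1, fact)+
  show ?thesis unfolding \<tau> w pairing_cnj moyal_0[OF assms(3,2,5,4)] by simp
qed

lemma fourier_modulation_translation:
  fixes \<phi> :: "'a::euclidean_space \<Rightarrow> complex"
  assumes "\<phi> \<in> schwartz"
  shows "fourier (modulation b (translation a \<phi>)) \<xi> = ch (- (a \<bullet> (\<xi> - b))) * fourier \<phi> (\<xi> - b)"
proof -
  have [measurable]: "\<phi> \<in> borel_measurable borel" by (rule schwartz_measurable[OF assms])
  let ?h = "\<lambda>t. ch (- (a \<bullet> (\<xi> - b))) * (\<phi> t * ch (- (t \<bullet> (\<xi> - b))))"
  have "fourier (modulation b (translation a \<phi>)) \<xi> = (LINT t|lborel. ?h (t - a))"
    unfolding fourier_def modulation_eq translation_def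
  proof (rule Bochner_Integration.integral_cong[OF refl])
    fix t
    have "ch (t \<bullet> b) * ch (- (t \<bullet> \<xi>)) = ch (- (a \<bullet> (\<xi> - b))) * ch (- ((t - a) \<bullet> (\<xi> - b)))"
      by (simp add: inner_diff_left inner_diff_right flip: ch_add)
    then show "ch (t \<bullet> b) * \<phi> (t - a) * ch (- (t \<bullet> \<xi>)) = ?h (t - a)" by (simp add: mult_ac)
  qed
  also have "\<dots> = (LINT t|lborel. ?h t)" by (rule integral_translate) measurable
  also have "\<dots> = ch (- (a \<bullet> (\<xi> - b))) * fourier \<phi> (\<xi> - b)"
    unfolding fourier_def by (simp only: integral_mult_right_zero)
  finally show ?thesis .
qed

text \<open>The integrand is a tensor product up to phases. Collecting these splits the integral
  into a short-time Fourier transform of g in the first variable and, by Parseval, one of f in the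
  second.\<close>

lemma STFT_wigner_0:
  fixes f g \<phi>\<^sub>1 \<phi>\<^sub>2 :: "'a::euclidean_space \<Rightarrow> complex"
  assumes S: "f \<in> schwartz" "g \<in> schwartz" "\<phi>\<^sub>1 \<in> schwartz" "\<phi>\<^sub>2 \<in> schwartz"
  shows "cmod (STFT (tau_wigner 0 \<phi>\<^sub>1 \<phi>\<^sub>2) (pairing (tau_wigner 0 g f)) z \<zeta>) =
    cmod (STFT \<phi>\<^sub>1 (pairing g) (fst z) (snd z + fst \<zeta>)) * cmod (STFT \<phi>\<^sub>2 (pairing f) (fst z + snd \<zeta>) (snd z))"
proof -
  obtain z\<^sub>1 z\<^sub>2 where z: "z = (z\<^sub>1, z\<^sub>2)" by (cases z)
  obtain \<zeta>\<^sub>1 \<zeta>\<^sub>2 where \<zeta>: "\<zeta> = (\<zeta>\<^sub>1, \<zeta>\<^sub>2)" by (cases \<zeta>)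
  \<comment> \<open>The shift that carries the second window: its Fourier transform combines the
    translate by z_2 coming from the shifted Wigner window with a phase that involves
    \<zeta>_2.\<close>
  let ?m = "modulation z\<^sub>2 (translation (z\<^sub>1 + \<zeta>\<^sub>2) \<phi>\<^sub>2)"
  let ?c = "ch (z\<^sub>1 \<bullet> z\<^sub>2) * ch (- ((z\<^sub>1 + \<zeta>\<^sub>2) \<bullet> z\<^sub>2))"
  let ?a = "\<lambda>x. (g x * cnj (\<phi>\<^sub>1 (x - z\<^sub>1))) * ch (- (x \<bullet> (z\<^sub>2 + \<zeta>\<^sub>1)))"
  let ?b = "\<lambda>\<xi>. cnj (fourier f \<xi> * cnj (fourier ?m \<xi>))"
  have m: "?m \<in> schwartz" by (intro modulation_schwartz translation_schwartz S)
  have a: "?a \<in> schwartz"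
    using schwartz_slow_mult[OF slow_ch(2) STFT_window_schwartz[OF S(2,3)], of "z\<^sub>2 + \<zeta>\<^sub>1" z\<^sub>1] by (simp add: mult.commute)
  have b: "?b \<in> schwartz" by (intro schwartz_mult schwartz_cnj fourier_schwartz S m)
  have "STFT (tau_wigner 0 \<phi>\<^sub>1 \<phi>\<^sub>2) (pairing (tau_wigner 0 g f)) z \<zeta> = (LINT w|lborel. ?c * (?a (fst w) * ?b (snd w)))"
    unfolding STFT_pairing fourier_def[of "\<lambda>t. tau_wigner 0 g f t * _ t"]
  proof (rule Bochner_Integration.integral_cong[OF refl])
    fix w :: "'a \<times> 'a"
    obtain x \<xi> where w: "w = (x, \<xi>)" by (cases w)
    \<comment> \<open>The mixed term in x and \<xi> cancels. What remains is the constant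
      \<open>?c\<close>, a character in x, and the phase of the Fourier transform of
      \<open>?m\<close>.\<close>
    have ph: "ch (- (x \<bullet> \<xi>)) * cnj (ch (- ((x - z\<^sub>1) \<bullet> (\<xi> - z\<^sub>2)))) * ch (- ((x, \<xi>) \<bullet> (\<zeta>\<^sub>1, \<zeta>\<^sub>2))) =
      ?c * ch (- (x \<bullet> (z\<^sub>2 + \<zeta>\<^sub>1))) * ch (- ((z\<^sub>1 + \<zeta>\<^sub>2) \<bullet> (\<xi> - z\<^sub>2)))"
      by (simp add: inner_diff_left inner_diff_right inner_add_left inner_add_right inner_commute algebra_simps flip: ch_add)
    show "tau_wigner 0 g f w * cnj (tau_wigner 0 \<phi>\<^sub>1 \<phi>\<^sub>2 (w - z)) * ch (- (w \<bullet> \<zeta>)) = ?c * (?a (fst w) * ?b (snd w))"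
    proof -
      have "tau_wigner 0 g f w * cnj (tau_wigner 0 \<phi>\<^sub>1 \<phi>\<^sub>2 (w - z)) * ch (- (w \<bullet> \<zeta>)) =
        (g x * cnj (\<phi>\<^sub>1 (x - z\<^sub>1)) * cnj (fourier f \<xi>) * fourier \<phi>\<^sub>2 (\<xi> - z\<^sub>2)) *
        (ch (- (x \<bullet> \<xi>)) * cnj (ch (- ((x - z\<^sub>1) \<bullet> (\<xi> - z\<^sub>2)))) * ch (- ((x, \<xi>) \<bullet> (\<zeta>\<^sub>1, \<zeta>\<^sub>2))))"
        unfolding w z \<zeta> diff_Pair tau_wigner_0[OF S(1)] tau_wigner_0[OF S(4)] by (simp add: mult_ac)
      also have "\<dots> = ?c * (?a (fst w) * ?b (snd w))"
        unfolding ph w fst_conv snd_conv fourier_modulation_translation[OF S(4)] by (simp add: mult_ac)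
      finally show ?thesis .
    qed
  qed
  also have "\<dots> = ?c * (fourier (\<lambda>x. g x * cnj (\<phi>\<^sub>1 (x - z\<^sub>1))) (z\<^sub>2 + \<zeta>\<^sub>1) * cnj (pairing (fourier f) (fourier ?m)))"
    unfolding integral_mult_right_zero integral_tensor[OF a b] fourier_def[of "\<lambda>x. g x * cnj (\<phi>\<^sub>1 (x - z\<^sub>1))"] pairing_def
    by (simp only: Bochner_Integration.integral_cnj)
  also have "\<dots> = ?c * (STFT \<phi>\<^sub>1 (pairing g) z\<^sub>1 (z\<^sub>2 + \<zeta>\<^sub>1) * cnj (STFT \<phi>\<^sub>2 (pairing f) (z\<^sub>1 + \<zeta>\<^sub>2) z\<^sub>2))"
    unfolding parseval[OF S(1) m] STFT_pairing[of \<phi>\<^sub>1] STFT_def[of \<phi>\<^sub>2] ..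
  finally show ?thesis by (simp add: norm_mult z \<zeta>)
qed

text \<open>Conjugation changes the sign of \<zeta>, which accounts for the minus signs compared
  with \<tau> = 0.\<close>

lemma STFT_wigner_1:
  fixes f g \<phi>\<^sub>1 \<phi>\<^sub>2 :: "'a::euclidean_space \<Rightarrow> complex"
  assumes S: "f \<in> schwartz" "g \<in> schwartz" "\<phi>\<^sub>1 \<in> schwartz" "\<phi>\<^sub>2 \<in> schwartz"
  shows "cmod (STFT (tau_wigner 1 \<phi>\<^sub>1 \<phi>\<^sub>2) (pairing (tau_wigner 1 g f)) z \<zeta>) =
    cmod (STFT \<phi>\<^sub>1 (pairing g) (fst z - snd \<zeta>) (snd z)) * cmod (STFT \<phi>\<^sub>2 (pairing f) (fst z) (snd z - fst \<zeta>))"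
proof -
  have w: "tau_wigner 1 g f = (\<lambda>z. cnj (tau_wigner 0 f g z))" "tau_wigner 1 \<phi>\<^sub>1 \<phi>\<^sub>2 = (\<lambda>z. cnj (tau_wigner 0 \<phi>\<^sub>2 \<phi>\<^sub>1 z))"
    by (rule ext, rule tau_wigner_1, fact)+
  have "STFT (tau_wigner 1 \<phi>\<^sub>1 \<phi>\<^sub>2) (pairing (tau_wigner 1 g f)) z \<zeta> =
    cnj (STFT (tau_wigner 0 \<phi>\<^sub>2 \<phi>\<^sub>1) (pairing (tau_wigner 0 f g)) z (- \<zeta>))"
    unfolding STFT_pairing fourier_def w by (subst Bochner_Integration.integral_cnj[symmetric]) simp
  then show ?thesis using STFT_wigner_0[OF S(2,1,4,3), of z "- \<zeta>"] by (simp add: mult.commute)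
qed

section \<open>Sufficiency\<close>

lemma schwartz_param_shear:
  fixes K :: "'w::euclidean_space \<times> 'a::euclidean_space \<Rightarrow> complex"
  assumes A: "bounded_linear A" "\<And>w. norm (A w) \<le> norm w" and K: "K \<in> schwartz"
  shows "(\<lambda>z. K (fst z, snd z - A (fst z))) \<in> schwartz"
proof (rule schwartz_linear_comp[OF _ _ K])
  show "bounded_linear (\<lambda>z::'w \<times> 'a. (fst z, snd z - A (fst z)))"
    by (intro bounded_linear_Pair bounded_linear_sub bounded_linear_fst bounded_linear_snd
        bounded_linear_compose[OF A(1) bounded_linear_fst])
  show "norm z \<le> 3 * norm (fst z, snd z - A (fst z))" for z :: "'w \<times> 'a"
  proof -
    obtain w t where z: "z = (w, t)" by (cases z)
    have "norm t \<le> norm (A w) + norm (t - A w)" using norm_triangle_ineq[of "A w" "t - A w"] by simp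
    then show ?thesis
      unfolding z using A(2)[of w] norm_fst_le[of w "t - A w"] norm_snd_le[of "t - A w" w] norm_Pair_le[of w t] by simp
  qed
qed

text \<open>The Gaussian damping of \<open>STFT_continuous\<close>, for a general family of
  functionals: the damped values are continuous, and the Gaussians never vanish.\<close>

lemma tempered_param_measurable:
  fixes K :: "('a::euclidean_space \<times> 'a) \<times> 'b::euclidean_space \<Rightarrow> complex"
  assumes "u \<in> tempered" "K \<in> schwartz"
    and "\<And>w. u (\<lambda>t. K (w, t)) = cnj (gs 1 (fst w) * gs 1 (snd w)) * U (fst w) (snd w)"
  shows "(\<lambda>(x, \<xi>). ennreal (cmod (U x \<xi>))) \<in> borel_measurable (borel \<Otimes>\<^sub>M borel)"
proof -
  have "continuous_on UNIV (\<lambda>w. u (\<lambda>t. K (w, t)))"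
    by (rule tempered_section_continuous[OF assms(1,2)])
  moreover have "continuous_on UNIV (\<lambda>w::'a \<times> 'a. cnj (gs 1 (fst w) * gs 1 (snd w)))"
    unfolding gs_def by (intro continuous_intros)
  ultimately have "continuous_on UNIV (\<lambda>w. u (\<lambda>t. K (w, t)) / cnj (gs 1 (fst w) * gs 1 (snd w)))"
    by (intro continuous_on_divide) auto
  then have "continuous_on UNIV (\<lambda>w. U (fst w) (snd w))" unfolding assms(3) by simp
  then have "(\<lambda>w. U (fst w) (snd w)) \<in> borel_measurable (borel \<Otimes>\<^sub>M borel)"
    unfolding borel_prod by (rule borel_measurable_continuous_onI)
  then have "(\<lambda>w. ennreal (cmod (U (fst w) (snd w)))) \<in> borel_measurable (borel \<Otimes>\<^sub>M borel)" by measurable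
  then show ?thesis by (simp add: case_prod_unfold)
qed

text \<open>\<open>eV_measurable\<close> speaks about tempered functionals. Instead of proving this
  for \<open>OP 0 \<sigma> f\<close>, its transform is read as \<sigma> applied to a damped family
  of Wigner distributions, which is continuous in the parameters.\<close>

lemma OP_0_measurable:
  fixes f \<phi> :: "'a::euclidean_space \<Rightarrow> complex"
  assumes \<sigma>: "\<sigma> \<in> tempered" and f: "f \<in> schwartz" and \<phi>: "\<phi> \<in> schwartz"
  shows "case_prod (eV \<phi> (OP 0 \<sigma> f)) \<in> borel_measurable (borel \<Otimes>\<^sub>M borel)"
proof -
  let ?T = "\<lambda>(w, v). (\<lambda>(x, \<xi>). gs 1 x * gs 1 \<xi>) w * (\<lambda>(y, \<eta>). \<phi> y * cnj (fourier f \<eta>)) v"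
  have T: "?T \<in> schwartz" by (intro schwartz_tensor gs_schwartz schwartz_cnj fourier_schwartz f \<phi>) auto
  have "(\<lambda>z. ?T (fst z, snd z - (fst (fst z), 0))) \<in> schwartz"
    by (rule schwartz_param_shear[where A = "\<lambda>w. (fst w, 0)", OF _ _ T])
      (auto intro!: bounded_linear_Pair bounded_linear_fst bounded_linear_zero norm_fst_le simp: norm_Pair)
  then have K: "(\<lambda>z. ch (- (fst (snd z) \<bullet> snd (snd z))) * (ch (fst (snd z) \<bullet> snd (fst z)) * ?T (fst z, snd z - (fst (fst z), 0)))) \<in> schwartz"
    (is "?K \<in> _")
    by (intro schwartz_slow_mult slow_ch_inner bounded_linear_compose[OF bounded_linear_fst bounded_linear_snd]
        bounded_linear_compose[OF bounded_linear_snd bounded_linear_snd] bounded_linear_compose[OF bounded_linear_snd bounded_linear_fst])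
  have "\<sigma> (\<lambda>t. ?K (w, t)) = cnj (gs 1 (fst w) * gs 1 (snd w)) * STFT \<phi> (OP 0 \<sigma> f) (fst w) (snd w)" for w
  proof -
    let ?m = "modulation (snd w) (translation (fst w) \<phi>)"
    have m: "?m \<in> schwartz" by (intro modulation_schwartz translation_schwartz \<phi>)
    have "(\<lambda>t. ?K (w, t)) = (\<lambda>t. (gs 1 (fst w) * gs 1 (snd w)) * tau_wigner 0 ?m f t)"
    proof
      fix t :: "'a \<times> 'a"
      obtain y \<eta> where t: "t = (y, \<eta>)" by (cases t)
      show "?K (w, t) = (gs 1 (fst w) * gs 1 (snd w)) * tau_wigner 0 ?m f t"
        unfolding t tau_wigner_0[OF f] by (simp add: case_prod_unfold modulation_eq translation_def mult_ac)
    qed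
    then show ?thesis unfolding STFT_def OP_def
      by (simp only: tempered_cmult[OF \<sigma> tau_wigner_0_schwartz[OF m f]])
  qed
  from tempered_param_measurable[OF \<sigma> K this] show ?thesis unfolding eV_def[abs_def] .
qed

lemma OP_1_measurable:
  fixes f \<phi> :: "'a::euclidean_space \<Rightarrow> complex"
  assumes \<sigma>: "\<sigma> \<in> tempered" and f: "f \<in> schwartz" and \<phi>: "\<phi> \<in> schwartz"
  shows "case_prod (eV \<phi> (OP 1 \<sigma> f)) \<in> borel_measurable (borel \<Otimes>\<^sub>M borel)"
proof -
  \<comment> \<open>For \<tau> = 1 the window enters through its Fourier transform, so its
    modulation becomes the shear in \<eta> and its translation becomes a phase.\<close>
  let ?T = "\<lambda>(w, v). (\<lambda>(x, \<xi>). gs 1 x * gs 1 \<xi>) w * (\<lambda>(y, \<eta>). cnj (f y) * fourier \<phi> \<eta>) v"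
  let ?S = "\<lambda>z::('a \<times> 'a) \<times> ('a \<times> 'a). ?T (fst z, snd z - (0, snd (fst z)))"
  have T: "?T \<in> schwartz" by (intro schwartz_tensor gs_schwartz schwartz_cnj fourier_schwartz f \<phi>) auto
  have "?S \<in> schwartz"
    by (rule schwartz_param_shear[where A = "\<lambda>w. (0, snd w)", OF _ _ T])
      (auto intro!: bounded_linear_Pair bounded_linear_snd bounded_linear_zero norm_snd_le simp: norm_Pair)
  then have K: "(\<lambda>z. ch (fst (snd z) \<bullet> snd (snd z)) * (ch (- (fst (fst z) \<bullet> (snd (snd z) - snd (fst z)))) * ?S z)) \<in> schwartz"
    (is "?K \<in> _")
    by (intro schwartz_slow_mult slow_ch_inner bounded_linear_sub bounded_linear_compose[OF bounded_linear_fst bounded_linear_snd]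
        bounded_linear_compose[OF bounded_linear_snd bounded_linear_snd] bounded_linear_compose[OF bounded_linear_snd bounded_linear_fst]
        bounded_linear_compose[OF bounded_linear_fst bounded_linear_fst])
  have "\<sigma> (\<lambda>t. ?K (w, t)) = cnj (gs 1 (fst w) * gs 1 (snd w)) * STFT \<phi> (OP 1 \<sigma> f) (fst w) (snd w)" for w
  proof -
    let ?m = "modulation (snd w) (translation (fst w) \<phi>)"
    have m: "?m \<in> schwartz" by (intro modulation_schwartz translation_schwartz \<phi>)
    have "(\<lambda>t. ?K (w, t)) = (\<lambda>t. (gs 1 (fst w) * gs 1 (snd w)) * tau_wigner 1 ?m f t)"
    proof
      fix t :: "'a \<times> 'a"
      obtain y \<eta> where t: "t = (y, \<eta>)" by (cases t)
      show "?K (w, t) = (gs 1 (fst w) * gs 1 (snd w)) * tau_wigner 1 ?m f t"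
        unfolding t tau_wigner_1[OF m] tau_wigner_0[OF m] fourier_modulation_translation[OF \<phi>]
        by (simp add: case_prod_unfold mult_ac)
    qed
    then show ?thesis unfolding STFT_def OP_def
      by (simp only: tempered_cmult[OF \<sigma> tau_wigner_schwartz[of 1, OF _ m f]] insert_iff simp_thms)
  qed
  from tempered_param_measurable[OF \<sigma> K this] show ?thesis unfolding eV_def[abs_def] .
qed

text \<open>With the window \<open>tau_wigner \<tau> \<phi> \<phi>\<close> the STFT of \<open>tau_wigner \<tau> g f\<close> factors, so that the reproducing
  formula for \<open>\<sigma>\<close> bounds the STFT of \<open>OP \<tau> \<sigma> f\<close> by the integrals estimated in
  \<open>mixed_estimate_0\<close> and \<open>mixed_estimate_1\<close>.\<close>

lemma OP_duality:
  fixes \<phi> :: "'a::euclidean_space \<Rightarrow> complex"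
  assumes \<tau>: "\<tau> \<in> {0, 1}" and \<phi>: "\<phi> \<in> schwartz" "\<phi> \<noteq> (\<lambda>x. 0)"
  obtains C :: real where "C > 0" "\<And>\<sigma> f x \<xi>. \<sigma> \<in> tempered \<Longrightarrow> f \<in> schwartz \<Longrightarrow> eV \<phi> (OP \<tau> \<sigma> f) x \<xi> \<le> ennreal C *
    (\<integral>\<^sup>+ z. \<integral>\<^sup>+ \<zeta>. eV (tau_wigner \<tau> \<phi> \<phi>) \<sigma> z \<zeta> *
      eV (tau_wigner \<tau> \<phi> \<phi>) (pairing (tau_wigner \<tau> (modulation \<xi> (translation x \<phi>)) f)) z \<zeta> \<partial>lborel \<partial>lborel)"
proof -
  let ?\<Gamma> = "tau_wigner \<tau> \<phi> \<phi>"
  define c where "c = cmod (pairing ?\<Gamma> ?\<Gamma>)"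
  have c: "c > 0"
    using pairing_self_nonzero[OF \<phi>] unfolding c_def moyal[OF \<tau> \<phi>(1) \<phi>(1) \<phi>(1) \<phi>(1)] by simp
  have \<Gamma>: "?\<Gamma> \<in> schwartz" by (rule tau_wigner_schwartz[OF \<tau> \<phi>(1) \<phi>(1)])
  have "eV \<phi> (OP \<tau> \<sigma> f) x \<xi> \<le> ennreal (1 / c) *
    (\<integral>\<^sup>+ z. \<integral>\<^sup>+ \<zeta>. eV ?\<Gamma> \<sigma> z \<zeta> * eV ?\<Gamma> (pairing (tau_wigner \<tau> (modulation \<xi> (translation x \<phi>)) f)) z \<zeta> \<partial>lborel \<partial>lborel)"
    if \<sigma>: "\<sigma> \<in> tempered" and f: "f \<in> schwartz" for \<sigma> f x \<xi>
  proof -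
    let ?G = "tau_wigner \<tau> (modulation \<xi> (translation x \<phi>)) f"
    have G: "?G \<in> schwartz" by (intro tau_wigner_schwartz \<tau> modulation_schwartz translation_schwartz \<phi> f)
    have "eV \<phi> (OP \<tau> \<sigma> f) x \<xi> = ennreal (1 / c) * ennreal (c * cmod (\<sigma> ?G))"
      using c by (simp add: eV_def STFT_def OP_def flip: ennreal_mult)
    also have "\<dots> \<le> ennreal (1 / c) * (\<integral>\<^sup>+ z. \<integral>\<^sup>+ \<zeta>. eV ?\<Gamma> \<sigma> z \<zeta> * eV ?\<Gamma> (pairing ?G) z \<zeta> \<partial>lborel \<partial>lborel)"
      unfolding c_def eV_def by (rule mult_left_mono[OF STFT_duality[OF \<sigma> \<Gamma> \<Gamma> G]]) simp
    finally show ?thesis .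
  qed
  with c show ?thesis by (intro that[of "1 / c"]) simp_all
qed

lemma bounded_from_estimate:
  fixes \<phi> :: "'a::euclidean_space \<Rightarrow> complex"
  assumes "K < top" "\<And>f. f \<in> schwartz \<Longrightarrow> modulation_norm \<phi> p\<^sub>2 q\<^sub>2 (T f) \<le> K * modulation_norm \<phi> p\<^sub>1 q\<^sub>1 (pairing f)"
  shows "bounded_on_modulation \<phi> p\<^sub>1 q\<^sub>1 p\<^sub>2 q\<^sub>2 T"
  unfolding bounded_on_modulation_def
  by (rule exI[of _ "enn2real K"]) (use assms in simp)

text \<open>\<open>mixed_estimate_0\<close> leaves f in the norm with exponents p' and q'. The
  conditions on \<open>p\<^sub>1\<close> and \<open>q\<^sub>1\<close> say that the source space is
  included in that modulation space (\<open>K2\<close>), and \<open>K1\<close> changes the window of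
  the symbol.\<close>

lemma sufficiency_0:
  fixes \<phi> :: "'a::euclidean_space \<Rightarrow> complex"
  assumes \<phi>: "\<phi> \<in> schwartz" "\<phi> \<noteq> (\<lambda>x. 0)" and \<Phi>: "\<Phi> \<in> schwartz" "\<Phi> \<noteq> (\<lambda>z. 0)"
    and p: "1 \<le> p" "p \<le> q\<^sub>2" and q: "1 \<le> q" "q \<le> p\<^sub>2" "q \<le> q\<^sub>2"
    and p1: "1 \<le> p\<^sub>1" "p\<^sub>1 \<le> conj_exponent p" and q1: "1 \<le> q\<^sub>1" "q\<^sub>1 \<le> conj_exponent q"
    and \<sigma>: "\<sigma> \<in> wiener_amalgam \<Phi> p q"
  shows "bounded_on_modulation \<phi> p\<^sub>1 q\<^sub>1 p\<^sub>2 q\<^sub>2 (OP 0 \<sigma>)"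
proof -
  have p2: "1 \<le> p\<^sub>2" and q2: "1 \<le> q\<^sub>2" using p q order_trans by blast+
  have \<sigma>': "\<sigma> \<in> tempered" "amalgam_norm \<Phi> p q \<sigma> < top" using \<sigma> by (auto simp: wiener_amalgam_def)
  let ?\<Gamma> = "tau_wigner 0 \<phi> \<phi>"
  have \<Gamma>: "?\<Gamma> \<in> schwartz" by (rule tau_wigner_0_schwartz[OF \<phi>(1) \<phi>(1)])
  obtain K1 where K1: "K1 < top" "amalgam_norm ?\<Gamma> p q \<sigma> \<le> K1 * amalgam_norm \<Phi> p q \<sigma>"
    using amalgam_norm_window[OF \<Phi> \<Gamma> p(1) q(1)] \<sigma>'(1) by metis
  obtain K2 where K2: "K2 < top"
    "\<And>u. u \<in> tempered \<Longrightarrow> modulation_norm \<phi> (conj_exponent p) (conj_exponent q) u \<le> K2 * modulation_norm \<phi> p\<^sub>1 q\<^sub>1 u"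
    using modulation_norm_window[OF \<phi> \<phi>(1) p1 q1] by metis
  have \<tau>: "(0::real) \<in> {0, 1}" by simp
  obtain C where C: "C > 0" "\<And>\<sigma> f x \<xi>. \<sigma> \<in> tempered \<Longrightarrow> f \<in> schwartz \<Longrightarrow> eV \<phi> (OP 0 \<sigma> f) x \<xi> \<le> ennreal C *
    (\<integral>\<^sup>+ z. \<integral>\<^sup>+ \<zeta>. eV ?\<Gamma> \<sigma> z \<zeta> * eV ?\<Gamma> (pairing (tau_wigner 0 (modulation \<xi> (translation x \<phi>)) f)) z \<zeta> \<partial>lborel \<partial>lborel)"
    by (rule OP_duality[OF \<tau> \<phi>], rule that)
  obtain D where D: "D > 0" "\<And>x \<xi> y \<eta>. eV \<phi> (pairing (modulation \<xi> (translation x \<phi>))) y \<eta> \<le> ennreal D * (w2 (y - x) * w2 (\<eta> - \<xi>))"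
    using eV_shift_le[OF \<phi>(1) \<phi>(1)] by metis
  let ?Y = "yc TYPE('a) p q\<^sub>2 * yc TYPE('a) q p\<^sub>2"
  let ?K = "(ennreal C * ennreal D) * (?Y * (K1 * amalgam_norm \<Phi> p q \<sigma>) * K2)"
  show ?thesis
  proof (rule bounded_from_estimate)
    show "?K < top" using K1 K2 \<sigma>' p2 q2 by (simp add: ennreal_mult_less_top yc_finite)
    fix f :: "'a \<Rightarrow> complex" assume f: "f \<in> schwartz"
    let ?B = "eV \<phi> (pairing f)" and ?S = "eV ?\<Gamma> \<sigma>"
    have B [measurable]: "case_prod ?B \<in> borel_measurable (borel \<Otimes>\<^sub>M borel)"
      by (rule eV_measurable[OF pairing_tempered[OF f] \<phi>(1)])
    have S [measurable]: "case_prod ?S \<in> borel_measurable (borel \<Otimes>\<^sub>M borel)"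
      by (rule eV_measurable[OF \<sigma>'(1) \<Gamma>])
    let ?X = "\<lambda>x \<xi>. \<integral>\<^sup>+ z. \<integral>\<^sup>+ \<zeta>. ?S z \<zeta> * (w2 (fst z - x) * w2 (snd z + fst \<zeta> - \<xi>) * ?B (fst z + snd \<zeta>) (snd z)) \<partial>lborel \<partial>lborel"
    have X: "case_prod ?X \<in> borel_measurable (borel \<Otimes>\<^sub>M borel)" by measurable
    have pw: "eV \<phi> (OP 0 \<sigma> f) x \<xi> \<le> (ennreal C * ennreal D) * ?X x \<xi>" for x \<xi>
    proof -
      let ?g = "modulation \<xi> (translation x \<phi>)"
      have g: "?g \<in> schwartz" by (intro modulation_schwartz translation_schwartz \<phi>)
      have "eV ?\<Gamma> (pairing (tau_wigner 0 ?g f)) z \<zeta> \<le>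
        ennreal D * (w2 (fst z - x) * w2 (snd z + fst \<zeta> - \<xi>) * ?B (fst z + snd \<zeta>) (snd z))" for z \<zeta>
      proof -
        have "eV ?\<Gamma> (pairing (tau_wigner 0 ?g f)) z \<zeta> = eV \<phi> (pairing ?g) (fst z) (snd z + fst \<zeta>) * ?B (fst z + snd \<zeta>) (snd z)"
          unfolding eV_def STFT_wigner_0[OF f g \<phi>(1) \<phi>(1)] by (simp add: ennreal_mult)
        also have "\<dots> \<le> ennreal D * (w2 (fst z - x) * w2 (snd z + fst \<zeta> - \<xi>)) * ?B (fst z + snd \<zeta>) (snd z)"
          by (intro mult_right_mono D zero_le)
        finally show ?thesis by (simp add: mult_ac)
      qed
      then have "eV \<phi> (OP 0 \<sigma> f) x \<xi> \<le> ennreal C * (\<integral>\<^sup>+ z. \<integral>\<^sup>+ \<zeta>. ?S z \<zeta> *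
          (ennreal D * (w2 (fst z - x) * w2 (snd z + fst \<zeta> - \<xi>) * ?B (fst z + snd \<zeta>) (snd z))) \<partial>lborel \<partial>lborel)"
        by (intro order_trans[OF C(2)[OF \<sigma>'(1) f]] mult_left_mono nn_integral_mono zero_le)
      also have "(\<integral>\<^sup>+ z. \<integral>\<^sup>+ \<zeta>. ?S z \<zeta> * (ennreal D * (w2 (fst z - x) * w2 (snd z + fst \<zeta> - \<xi>) * ?B (fst z + snd \<zeta>) (snd z))) \<partial>lborel \<partial>lborel) =
        (\<integral>\<^sup>+ z. ennreal D * (\<integral>\<^sup>+ \<zeta>. ?S z \<zeta> * (w2 (fst z - x) * w2 (snd z + fst \<zeta> - \<xi>) * ?B (fst z + snd \<zeta>) (snd z)) \<partial>lborel) \<partial>lborel)"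
        by (intro nn_integral_cong) (subst nn_integral_cmult[symmetric], (measurable)[1], simp add: mult_ac)
      also have "\<dots> = ennreal D * ?X x \<xi>" by (rule nn_integral_cmult) measurable
      finally show ?thesis by (simp add: mult.assoc)
    qed
    have "modulation_norm \<phi> p\<^sub>2 q\<^sub>2 (OP 0 \<sigma> f) \<le> (ennreal C * ennreal D) * Lp_norm q\<^sub>2 (\<lambda>\<xi>. Lp_norm p\<^sub>2 (\<lambda>x. ?X x \<xi>))"
      unfolding modulation_norm_eV by (rule mixed_norm_mono[OF p2 q2 OP_0_measurable[OF \<sigma>'(1) f \<phi>(1)] X pw])
    also have "\<dots> \<le> (ennreal C * ennreal D) * (?Y * Lp_norm q (\<lambda>z. Lp_norm p (?S z)) *
        modulation_norm \<phi> (conj_exponent p) (conj_exponent q) (pairing f))"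
      unfolding modulation_norm_eV by (intro mult_left_mono mixed_estimate_0 p q S B zero_le)
    also have "Lp_norm q (\<lambda>z. Lp_norm p (?S z)) = amalgam_norm ?\<Gamma> p q \<sigma>"
      by (rule amalgam_norm_eV[OF p(1) q(1) \<sigma>'(1) \<Gamma>, symmetric])
    also have "(ennreal C * ennreal D) * (?Y * amalgam_norm ?\<Gamma> p q \<sigma> * modulation_norm \<phi> (conj_exponent p) (conj_exponent q) (pairing f)) \<le>
      (ennreal C * ennreal D) * (?Y * (K1 * amalgam_norm \<Phi> p q \<sigma>) * (K2 * modulation_norm \<phi> p\<^sub>1 q\<^sub>1 (pairing f)))"
      by (intro mult_left_mono mult_mono K1(2) K2(2) pairing_tempered f zero_le)
    finally show "modulation_norm \<phi> p\<^sub>2 q\<^sub>2 (OP 0 \<sigma> f) \<le> ?K * modulation_norm \<phi> p\<^sub>1 q\<^sub>1 (pairing f)"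
      by (simp only: mult.assoc)
  qed
qed

text \<open>Here f is left integrated in frequency first. The three conditions on
  \<open>p\<^sub>1\<close> and \<open>q\<^sub>1\<close> are those of
  \<open>modulation_norm_window_swap\<close>, which restores the order of the modulation
  norm.\<close>

lemma sufficiency_1:
  fixes \<phi> :: "'a::euclidean_space \<Rightarrow> complex"
  assumes \<phi>: "\<phi> \<in> schwartz" "\<phi> \<noteq> (\<lambda>x. 0)" and \<Phi>: "\<Phi> \<in> schwartz" "\<Phi> \<noteq> (\<lambda>z. 0)"
    and p: "1 \<le> p" "p \<le> p\<^sub>2" and q: "1 \<le> q" "q \<le> q\<^sub>2"
    and p1: "1 \<le> p\<^sub>1" "p\<^sub>1 \<le> conj_exponent q" and q1: "1 \<le> q\<^sub>1" "q\<^sub>1 \<le> conj_exponent p" "q\<^sub>1 \<le> conj_exponent q"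
    and \<sigma>: "\<sigma> \<in> wiener_amalgam \<Phi> p q"
  shows "bounded_on_modulation \<phi> p\<^sub>1 q\<^sub>1 p\<^sub>2 q\<^sub>2 (OP 1 \<sigma>)"
proof -
  have p2: "1 \<le> p\<^sub>2" and q2: "1 \<le> q\<^sub>2" using p q order_trans by blast+
  have \<sigma>': "\<sigma> \<in> tempered" "amalgam_norm \<Phi> p q \<sigma> < top" using \<sigma> by (auto simp: wiener_amalgam_def)
  let ?\<Gamma> = "tau_wigner 1 \<phi> \<phi>"
  have \<Gamma>: "?\<Gamma> \<in> schwartz" by (rule tau_wigner_schwartz[OF _ \<phi>(1) \<phi>(1)]) simp
  obtain K1 where K1: "K1 < top" "amalgam_norm ?\<Gamma> p q \<sigma> \<le> K1 * amalgam_norm \<Phi> p q \<sigma>"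
    using amalgam_norm_window[OF \<Phi> \<Gamma> p(1) q(1)] \<sigma>'(1) by metis
  obtain K2 where K2: "K2 < top"
    "\<And>u. u \<in> tempered \<Longrightarrow> Lp_norm (conj_exponent q) (\<lambda>x. Lp_norm (conj_exponent p) (eV \<phi> u x)) \<le> K2 * modulation_norm \<phi> p\<^sub>1 q\<^sub>1 u"
    using modulation_norm_window_swap[OF \<phi> \<phi>(1) p1 q1] by metis
  have \<tau>: "(1::real) \<in> {0, 1}" by simp
  obtain C where C: "C > 0" "\<And>\<sigma> f x \<xi>. \<sigma> \<in> tempered \<Longrightarrow> f \<in> schwartz \<Longrightarrow> eV \<phi> (OP 1 \<sigma> f) x \<xi> \<le> ennreal C *
    (\<integral>\<^sup>+ z. \<integral>\<^sup>+ \<zeta>. eV ?\<Gamma> \<sigma> z \<zeta> * eV ?\<Gamma> (pairing (tau_wigner 1 (modulation \<xi> (translation x \<phi>)) f)) z \<zeta> \<partial>lborel \<partial>lborel)"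
    by (rule OP_duality[OF \<tau> \<phi>], rule that)
  obtain D where D: "D > 0" "\<And>x \<xi> y \<eta>. eV \<phi> (pairing (modulation \<xi> (translation x \<phi>))) y \<eta> \<le> ennreal D * (w2 (y - x) * w2 (\<eta> - \<xi>))"
    using eV_shift_le[OF \<phi>(1) \<phi>(1)] by metis
  let ?Y = "yc TYPE('a) p p\<^sub>2 * yc TYPE('a) q q\<^sub>2"
  let ?K = "(ennreal C * ennreal D) * (?Y * (K1 * amalgam_norm \<Phi> p q \<sigma>) * K2)"
  show ?thesis
  proof (rule bounded_from_estimate)
    show "?K < top" using K1 K2 \<sigma>' p2 q2 by (simp add: ennreal_mult_less_top yc_finite)
    fix f :: "'a \<Rightarrow> complex" assume f: "f \<in> schwartz"
    let ?B = "eV \<phi> (pairing f)" and ?S = "eV ?\<Gamma> \<sigma>"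
    have B [measurable]: "case_prod ?B \<in> borel_measurable (borel \<Otimes>\<^sub>M borel)"
      by (rule eV_measurable[OF pairing_tempered[OF f] \<phi>(1)])
    have S [measurable]: "case_prod ?S \<in> borel_measurable (borel \<Otimes>\<^sub>M borel)"
      by (rule eV_measurable[OF \<sigma>'(1) \<Gamma>])
    let ?X = "\<lambda>x \<xi>. \<integral>\<^sup>+ z. \<integral>\<^sup>+ \<zeta>. ?S z \<zeta> * (w2 (fst z - snd \<zeta> - x) * w2 (snd z - \<xi>) * ?B (fst z) (snd z - fst \<zeta>)) \<partial>lborel \<partial>lborel"
    have X: "case_prod ?X \<in> borel_measurable (borel \<Otimes>\<^sub>M borel)" by measurable
    have pw: "eV \<phi> (OP 1 \<sigma> f) x \<xi> \<le> (ennreal C * ennreal D) * ?X x \<xi>" for x \<xi>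
    proof -
      let ?g = "modulation \<xi> (translation x \<phi>)"
      have g: "?g \<in> schwartz" by (intro modulation_schwartz translation_schwartz \<phi>)
      have "eV ?\<Gamma> (pairing (tau_wigner 1 ?g f)) z \<zeta> \<le>
        ennreal D * (w2 (fst z - snd \<zeta> - x) * w2 (snd z - \<xi>) * ?B (fst z) (snd z - fst \<zeta>))" for z \<zeta>
      proof -
        have "eV ?\<Gamma> (pairing (tau_wigner 1 ?g f)) z \<zeta> = eV \<phi> (pairing ?g) (fst z - snd \<zeta>) (snd z) * ?B (fst z) (snd z - fst \<zeta>)"
          unfolding eV_def STFT_wigner_1[OF f g \<phi>(1) \<phi>(1)] by (simp add: ennreal_mult)
        also have "\<dots> \<le> ennreal D * (w2 (fst z - snd \<zeta> - x) * w2 (snd z - \<xi>)) * ?B (fst z) (snd z - fst \<zeta>)"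
          by (intro mult_right_mono D zero_le)
        finally show ?thesis by (simp add: mult_ac)
      qed
      then have "eV \<phi> (OP 1 \<sigma> f) x \<xi> \<le> ennreal C * (\<integral>\<^sup>+ z. \<integral>\<^sup>+ \<zeta>. ?S z \<zeta> *
          (ennreal D * (w2 (fst z - snd \<zeta> - x) * w2 (snd z - \<xi>) * ?B (fst z) (snd z - fst \<zeta>))) \<partial>lborel \<partial>lborel)"
        by (intro order_trans[OF C(2)[OF \<sigma>'(1) f]] mult_left_mono nn_integral_mono zero_le)
      also have "(\<integral>\<^sup>+ z. \<integral>\<^sup>+ \<zeta>. ?S z \<zeta> * (ennreal D * (w2 (fst z - snd \<zeta> - x) * w2 (snd z - \<xi>) * ?B (fst z) (snd z - fst \<zeta>))) \<partial>lborel \<partial>lborel) =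
        (\<integral>\<^sup>+ z. ennreal D * (\<integral>\<^sup>+ \<zeta>. ?S z \<zeta> * (w2 (fst z - snd \<zeta> - x) * w2 (snd z - \<xi>) * ?B (fst z) (snd z - fst \<zeta>)) \<partial>lborel) \<partial>lborel)"
        by (intro nn_integral_cong) (subst nn_integral_cmult[symmetric], (measurable)[1], simp add: mult_ac)
      also have "\<dots> = ennreal D * ?X x \<xi>" by (rule nn_integral_cmult) measurable
      finally show ?thesis by (simp add: mult.assoc)
    qed
    have "modulation_norm \<phi> p\<^sub>2 q\<^sub>2 (OP 1 \<sigma> f) \<le> (ennreal C * ennreal D) * Lp_norm q\<^sub>2 (\<lambda>\<xi>. Lp_norm p\<^sub>2 (\<lambda>x. ?X x \<xi>))"
      unfolding modulation_norm_eV by (rule mixed_norm_mono[OF p2 q2 OP_1_measurable[OF \<sigma>'(1) f \<phi>(1)] X pw])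
    also have "\<dots> \<le> (ennreal C * ennreal D) * (?Y * Lp_norm q (\<lambda>z. Lp_norm p (?S z)) *
        Lp_norm (conj_exponent q) (\<lambda>x. Lp_norm (conj_exponent p) (?B x)))"
      by (intro mult_left_mono mixed_estimate_1 p q S B zero_le)
    also have "Lp_norm q (\<lambda>z. Lp_norm p (?S z)) = amalgam_norm ?\<Gamma> p q \<sigma>"
      by (rule amalgam_norm_eV[OF p(1) q(1) \<sigma>'(1) \<Gamma>, symmetric])
    also have "(ennreal C * ennreal D) * (?Y * amalgam_norm ?\<Gamma> p q \<sigma> * Lp_norm (conj_exponent q) (\<lambda>x. Lp_norm (conj_exponent p) (?B x))) \<le>
      (ennreal C * ennreal D) * (?Y * (K1 * amalgam_norm \<Phi> p q \<sigma>) * (K2 * modulation_norm \<phi> p\<^sub>1 q\<^sub>1 (pairing f)))"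
      by (intro mult_left_mono mult_mono K1(2) K2(2) pairing_tempered f zero_le)
    finally show "modulation_norm \<phi> p\<^sub>2 q\<^sub>2 (OP 1 \<sigma> f) \<le> ?K * modulation_norm \<phi> p\<^sub>1 q\<^sub>1 (pairing f)"
      by (simp only: mult.assoc)
  qed
qed

section \<open>Dilated and chirped Gaussians\<close>

definition gn :: "real \<Rightarrow> 'a::euclidean_space \<Rightarrow> ennreal" where
  "gn a x = ennreal (exp (- (pi * a * (x \<bullet> x))))"

lemma gn_measurable [measurable]: "gn a \<in> borel_measurable borel"
  unfolding gn_def[abs_def] by measurable

text \<open>The root of 8 / P is bounded by 8, and raising 8^d to the power 1 / P \<le> 1 does not
  increase it. What counts is the growth rate (2^d)^(i/r).\<close>

lemma Lp_norm_gn: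
  assumes r: "1 \<le> r"
  shows "Lp_norm r (gn ((1 / 4) ^ i / 8) :: 'a::euclidean_space \<Rightarrow> ennreal) \<le> ennreal (8 ^ DIM('a) * ((2 ^ DIM('a)) powr iv r) ^ i)"
using r
proof (cases rule: exponent_cases)
  case top
  have "AE x in lborel. gn ((1 / 4) ^ i / 8) (x::'a) \<le> 1" by (simp add: gn_def)
  then have "Lp_norm r (gn ((1 / 4) ^ i / 8) :: 'a \<Rightarrow> ennreal) \<le> 1"
    unfolding top Lp_norm_top by (intro esssup_I) measurable
  also have "1 \<le> ennreal (8 ^ DIM('a) * ((2 ^ DIM('a)) powr iv r) ^ i)"
    using one_le_power[of "8::real" "DIM('a)"] by (simp add: top)
  finally show ?thesis .
next
  case (real P)
  let ?a = "(1 / 4) ^ i / 8 * P :: real"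
  have a: "?a > 0" using real by simp
  have "1 / sqrt ?a \<le> 2 ^ i * 8"
  proof -
    have "1 / sqrt ?a = 2 ^ i * sqrt (8 / P)"
      using real by (simp add: real_sqrt_mult real_sqrt_divide real_sqrt_power power_divide field_simps)
    also have "sqrt (8 / P) \<le> sqrt (8 * 8)" using real by (intro real_sqrt_le_mono) (simp add: field_simps)
    also have "sqrt (8 * 8) = (8::real)" by (simp only: real_sqrt_mult_self abs_numeral real_sqrt_mult)
    finally show ?thesis by simp
  qed
  then have le: "(1 / sqrt ?a) ^ DIM('a) \<le> 8 ^ DIM('a) * (2 ^ DIM('a)) ^ i"
    using power_mono[of "1 / sqrt ?a" "2 ^ i * 8" "DIM('a)"] a by (simp add: power_mult_distrib power_commutes power_mult[symmetric] mult.commute)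
  have "Lp_norm r (gn ((1 / 4) ^ i / 8) :: 'a \<Rightarrow> ennreal) = ennreal_powr (ennreal ((1 / sqrt ?a) ^ DIM('a))) (1 / P)"
    unfolding real Lp_norm_real[OF real(2)] nn_integral_gs[OF a, symmetric]
    by (simp add: gn_def epow_ennreal powr_def mult_ac)
  also have "\<dots> = ennreal (((1 / sqrt ?a) ^ DIM('a)) powr (1 / P))" by (rule epow_ennreal) (use real in simp)
  also have "\<dots> \<le> ennreal (8 ^ DIM('a) * ((2 ^ DIM('a)) powr iv r) ^ i)"
  proof (rule ennreal_leI)
    have "((1 / sqrt ?a) ^ DIM('a)) powr (1 / P) \<le> (8 ^ DIM('a) * (2 ^ DIM('a)) ^ i) powr (1 / P)"
      by (rule powr_mono2) (use real le in auto)
    also have "\<dots> = (8 ^ DIM('a)) powr (1 / P) * ((2 ^ DIM('a)) powr (1 / P)) ^ i"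
      by (simp add: powr_mult powr_power powr_powr mult.commute flip: powr_realpow)
    also have "\<dots> \<le> (8 ^ DIM('a)) powr 1 * ((2 ^ DIM('a)) powr (1 / P)) ^ i"
      by (intro mult_right_mono powr_mono) (use real in auto)
    finally show "((1 / sqrt ?a) ^ DIM('a)) powr (1 / P) \<le> 8 ^ DIM('a) * ((2 ^ DIM('a)) powr iv r) ^ i"
      using iv_real[OF real(2)] by (simp add: real)
  qed
  finally show ?thesis .
qed

lemma gs_mult: "gs a x * gs b x = gs (a + b) x"
  by (simp add: gs_def algebra_simps flip: of_real_mult exp_add)

lemma norm_gs [simp]: "cmod (gs a x) = exp (- (pi * a * (x \<bullet> x)))"
  by (simp add: gs_def)

lemma cnj_gs [simp]: "cnj (gs a x) = gs a x"
  by (simp add: gs_def)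

text \<open>Completing the square writes the product of a Gaussian with the shifted window as a
  constant times one shifted Gaussian, whose transform is known.\<close>

lemma norm_STFT_gs:
  fixes x \<xi> :: "'a::euclidean_space"
  assumes a: "a > 0"
  shows "cmod (STFT (gs 1) (pairing (gs a)) x \<xi>) =
    (1 / sqrt (1 + a)) ^ DIM('a) * exp (- (pi * (a / (1 + a)) * (x \<bullet> x))) * exp (- (pi * (1 / (1 + a)) * (\<xi> \<bullet> \<xi>)))"
proof -
  \<comment> \<open>The centre of the product Gaussian, the minimiser of a |t|^2 + |t -
    x|^2.\<close>
  let ?y = "(1 / (1 + a)) *\<^sub>R x"
  have sq: "gs a t * cnj (gs 1 (t - x)) = gs (a / (1 + a)) x * modulation 0 (translation ?y (gs (1 + a))) t" for t
  proof -
    have "a * (t \<bullet> t) + (t - x) \<bullet> (t - x) = a / (1 + a) * (x \<bullet> x) + (1 + a) * ((t - ?y) \<bullet> (t - ?y))"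
    proof -
      define b where "b = 1 + a"
      define y where "y = ?y"
      have b: "b > 0" "a = b - 1" and x: "x = b *\<^sub>R y" using a by (auto simp: b_def y_def)
      have "(b - 1) * (t \<bullet> t) + (t - b *\<^sub>R y) \<bullet> (t - b *\<^sub>R y) = (b - 1) * (b * (y \<bullet> y)) + b * ((t - y) \<bullet> (t - y))"
        by (simp add: inner_diff_left inner_diff_right inner_commute algebra_simps)
      then show ?thesis unfolding y_def[symmetric] b_def[symmetric] x using b by simp
    qed
    from arg_cong[OF this, of "\<lambda>s. exp (- (pi * s))"] show ?thesis
      by (simp add: gs_def modulation_eq translation_def algebra_simps flip: of_real_mult exp_add)
  qed
  have "STFT (gs 1) (pairing (gs a)) x \<xi> = gs (a / (1 + a)) x * fourier (modulation 0 (translation ?y (gs (1 + a)))) \<xi>"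
    unfolding STFT_pairing sq fourier_def by (simp add: mult.assoc)
  also have "fourier (modulation 0 (translation ?y (gs (1 + a)))) \<xi> = ch (- (?y \<bullet> \<xi>)) * fourier (gs (1 + a)) \<xi>"
    using fourier_modulation_translation[OF gs_schwartz, of "1 + a" 0 ?y \<xi>] a by simp
  also have "fourier (gs (1 + a)) \<xi> = of_real ((1 / sqrt (1 + a)) ^ DIM('a)) * gs (1 / (1 + a)) \<xi>"
    using a by (intro fourier_gs) simp
  finally show ?thesis using a by (simp add: norm_mult norm_power norm_divide)
qed

lemma unit_factor_le: "a > 0 \<Longrightarrow> (1 / sqrt (1 + a)) ^ n \<le> 1"
  by (rule power_le_one) (auto simp: field_simps)

text \<open>Even a / 2 and 1 / 2 would do here. The eighths are shared with the chirped family,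
  which has to give up part of its decay.\<close>

lemma eV_wide:
  assumes a: "0 < a" "a \<le> 1"
  shows "eV (gs 1) (pairing (gs a)) x \<xi> \<le> gn (a / 8) x * gn (1 / 8) (\<xi>::'a::euclidean_space)"
proof -
  have "a / 8 \<le> a / (1 + a)" "1 / 8 \<le> 1 / (1 + a)" using a by (auto simp: field_simps)
  note le = this[THEN mult_left_mono, of pi, THEN mult_right_mono, OF _ inner_ge_zero]
  have "cmod (STFT (gs 1) (pairing (gs a)) x \<xi>) \<le> 1 * exp (- (pi * (a / 8) * (x \<bullet> x))) * exp (- (pi * (1 / 8) * (\<xi> \<bullet> \<xi>)))"
    unfolding norm_STFT_gs[OF a(1)]
    by (intro mult_mono unit_factor_le a) (use a le in \<open>auto\<close>)
  then show ?thesis by (simp add: eV_def gn_def flip: ennreal_mult)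
qed

text \<open>The factor makes \<open>narrow i\<close> the Fourier transform of \<open>wide i\<close>,
  of integral 1: the wide family is bounded uniformly, the narrow one in L1.\<close>

definition narrow :: "nat \<Rightarrow> 'a::euclidean_space \<Rightarrow> complex" where
  "narrow i x = of_real (2 ^ (i * DIM('a))) * gs (4 ^ i) x"

definition wide :: "nat \<Rightarrow> 'a::euclidean_space \<Rightarrow> complex" where
  "wide i = gs ((1 / 4) ^ i)"

text \<open>Multiplication by exp(pi \<i> |x|^2), which shears the time-frequency plane and so moves
  content along the time axis to the diagonal.\<close>

definition chirped :: "(nat \<Rightarrow> 'a \<Rightarrow> complex) \<Rightarrow> nat \<Rightarrow> 'a::euclidean_space \<Rightarrow> complex" where
  "chirped g i x = ch (x \<bullet> (x /\<^sub>R 2)) * g i x"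

lemma narrow_schwartz: "narrow i \<in> schwartz"
  unfolding narrow_def[abs_def] by (intro schwartz_cmult gs_schwartz) simp

lemma wide_schwartz: "wide i \<in> schwartz"
  unfolding wide_def by (intro gs_schwartz) simp

lemma chirped_schwartz: "g i \<in> schwartz \<Longrightarrow> chirped g i \<in> schwartz"
  unfolding chirped_def[abs_def]
  by (intro schwartz_slow_mult slow_ch_inner bounded_linear_ident bounded_linear_scaleR_right)

lemma eV_narrow: "eV (gs 1) (pairing (narrow i)) x \<xi> \<le> gn (1 / 8) x * gn ((1 / 4) ^ i / 8) (\<xi>::'a::euclidean_space)"
proof -
  let ?a = "4 ^ i :: real"
  have a: "?a \<ge> 1" "(1 / 4) ^ i = 1 / ?a" by (auto simp: power_divide)
  have "1 / 8 \<le> b / (1 + b)" "1 / b / 8 \<le> 1 / (1 + b)" if "b \<ge> 1" for b :: real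
    using that by (auto simp: field_simps)
  note this[OF a(1)]
  note le = this[THEN mult_left_mono, of pi, THEN mult_right_mono, OF _ inner_ge_zero]
  have "STFT (gs 1) (pairing (narrow i)) x \<xi> = of_real (2 ^ (i * DIM('a))) * STFT (gs 1) (pairing (gs ?a)) x \<xi>"
    unfolding STFT_pairing narrow_def fourier_def by (simp add: mult.assoc)
  then have "cmod (STFT (gs 1) (pairing (narrow i)) x \<xi>) = 2 ^ (i * DIM('a)) * cmod (STFT (gs 1) (pairing (gs ?a)) x \<xi>)"
    by (simp add: norm_mult norm_power)
  also have "\<dots> = (2 ^ i * (1 / sqrt (1 + ?a))) ^ DIM('a) * exp (- (pi * (?a / (1 + ?a)) * (x \<bullet> x))) * exp (- (pi * (1 / (1 + ?a)) * (\<xi> \<bullet> \<xi>)))"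
    by (subst norm_STFT_gs) (auto simp: power_mult_distrib power_mult power_divide)
  also have "\<dots> \<le> 1 * exp (- (pi * (1 / 8) * (x \<bullet> x))) * exp (- (pi * (1 / ?a / 8) * (\<xi> \<bullet> \<xi>)))"
  proof (intro mult_mono)
    have "2 ^ i = sqrt ?a" by (simp add: real_sqrt_power)
    then have "2 ^ i * (1 / sqrt (1 + ?a)) \<le> 1" by (simp add: divide_le_eq_1 add_pos_nonneg)
    then show "(2 ^ i * (1 / sqrt (1 + ?a))) ^ DIM('a) \<le> 1" by (intro power_le_one) auto
  qed (use le in auto)
  finally show ?thesis unfolding a(2) by (simp add: eV_def gn_def flip: ennreal_mult)
qed

text \<open>If the window carries the same chirp, the quadratic phases in t cancel; a linear one is
  left, which shifts the frequency by x, and a phase depending on x alone.\<close>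

lemma norm_STFT_chirped:
  "cmod (STFT (chirped h k) (pairing (chirped g i)) x \<xi>) = cmod (STFT (h k) (pairing (g i)) x (\<xi> - x))"
proof -
  have "chirped g i t * cnj (chirped h k (t - x)) * ch (- (t \<bullet> \<xi>)) =
    ch (- (x \<bullet> x) / 2) * (g i t * cnj (h k (t - x)) * ch (- (t \<bullet> (\<xi> - x))))" for t
  proof -
    have "t \<bullet> (t /\<^sub>R 2) + - ((t - x) \<bullet> ((t - x) /\<^sub>R 2)) + - (t \<bullet> \<xi>) = - (x \<bullet> x) / 2 + - (t \<bullet> (\<xi> - x))"
      by (simp add: inner_diff_left inner_diff_right inner_commute field_simps)
    then have "ch (t \<bullet> (t /\<^sub>R 2)) * ch (- ((t - x) \<bullet> ((t - x) /\<^sub>R 2))) * ch (- (t \<bullet> \<xi>)) = ch (- (x \<bullet> x) / 2) * ch (- (t \<bullet> (\<xi> - x)))"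
      by (simp only: ch_add[symmetric])
    from arg_cong[OF this, of "\<lambda>c. g i t * cnj (h k (t - x)) * c"] show ?thesis
      unfolding chirped_def complex_cnj_mult cnj_ch by (simp only: mult_ac)
  qed
  then show ?thesis unfolding STFT_pairing fourier_def by (simp add: norm_mult)
qed

text \<open>The transform lives near the diagonal \<xi> = x, where decay in x and decay in \<xi> are
  interchangeable at bounded cost. Either form is needed, one for each order of integration.\<close>

lemma eV_chirped:
  fixes x \<xi> :: "'a::euclidean_space"
  shows "eV (chirped wide 0) (pairing (chirped wide i)) x \<xi> \<le> gn ((1 / 4) ^ i / 8) x * gn (1 / 8) (\<xi> - x)"
    and "eV (chirped wide 0) (pairing (chirped wide i)) x \<xi> \<le> gn ((1 / 4) ^ i / 8) \<xi> * gn (1 / 8) (\<xi> - x)"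
proof -
  let ?a = "(1 / 4) ^ i :: real"
  have a: "0 < ?a" "?a \<le> 1" by (auto simp: power_le_one)
  have eq: "eV (chirped wide 0) (pairing (chirped wide i)) x \<xi> = eV (gs 1) (pairing (gs ?a)) x (\<xi> - x)"
    unfolding eV_def norm_STFT_chirped by (simp add: wide_def)
  show "eV (chirped wide 0) (pairing (chirped wide i)) x \<xi> \<le> gn ((1 / 4) ^ i / 8) x * gn (1 / 8) (\<xi> - x)"
    unfolding eq by (rule eV_wide[OF a])
  let ?z = "\<xi> - x"
  \<comment> \<open>The parallelogram law for \<xi> = x + z bounds |\<xi>|^2 by 2 |x|^2 + 2
    |z|^2.\<close>
  have "\<xi> \<bullet> \<xi> + (x - ?z) \<bullet> (x - ?z) = 2 * (x \<bullet> x) + 2 * (?z \<bullet> ?z)"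
    by (simp add: inner_diff_left inner_diff_right inner_commute)
  then have "\<xi> \<bullet> \<xi> \<le> 2 * (x \<bullet> x) + 2 * (?z \<bullet> ?z)" using inner_ge_zero[of "x - ?z"] by linarith
  moreover have "A / 8 * Y \<le> A / 4 * X + A / 4 * Z" if "Y \<le> 2 * X + 2 * Z" "0 < A" for A X Y Z :: real
    using mult_left_mono[OF that(1), of "A / 8"] that(2) by (simp add: algebra_simps)
  ultimately have 1: "?a / 8 * (\<xi> \<bullet> \<xi>) \<le> ?a / 4 * (x \<bullet> x) + ?a / 4 * (?z \<bullet> ?z)" using a(1) by blast
  \<comment> \<open>Of the coefficient 1 / (1 + A) \<ge> 1 / 2 of |z|^2, the amount A / 4 pays for
    the change from x to \<xi>, and 1 / 8 is kept as decay away from the diagonal.\<close>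
  have "A / 4 \<le> A / (1 + A)" "A / 4 + 1 / 8 \<le> 1 / (1 + A)" if "0 < A" "A \<le> 1" for A :: real
    using that mult_mono[of A 1 A 1] by (auto simp: field_simps)
  note this[OF a, THEN mult_right_mono, OF inner_ge_zero]
  from this(1)[of x] this(2)[of ?z]
  have le: "?a / 8 * (\<xi> \<bullet> \<xi>) + 1 / 8 * (?z \<bullet> ?z) \<le> ?a / (1 + ?a) * (x \<bullet> x) + 1 / (1 + ?a) * (?z \<bullet> ?z)"
    using 1 unfolding distrib_right by linarith
  have "exp (- (pi * A * X)) * exp (- (pi * B * Z)) \<le> exp (- (pi * C * Y)) * exp (- (pi * D * Z))"
    if "C * Y + D * Z \<le> A * X + B * Z" for A B C D X Y Z :: real
    using mult_left_mono[OF that, of pi] by (simp add: algebra_simps flip: exp_add)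
  note le' = this[OF le]
  have "cmod (STFT (gs 1) (pairing (gs ?a)) x ?z) \<le> 1 * (exp (- (pi * (?a / 8) * (\<xi> \<bullet> \<xi>))) * exp (- (pi * (1 / 8) * (?z \<bullet> ?z))))"
    unfolding norm_STFT_gs[OF a(1)] mult.assoc[of "(1 / sqrt (1 + ?a)) ^ DIM('a)"]
    by (rule mult_mono[OF unit_factor_le[OF a(1)] le']) auto
  then show "eV (chirped wide 0) (pairing (chirped wide i)) x \<xi> \<le> gn ((1 / 4) ^ i / 8) \<xi> * gn (1 / 8) (\<xi> - x)"
    unfolding eq by (simp add: eV_def gn_def flip: ennreal_mult)
qed

section \<open>Norms of Wigner distributions\<close>

lemma mixed_norm_tensor:
  fixes a :: "'a::euclidean_space \<Rightarrow> ennreal" and b :: "'b::euclidean_space \<Rightarrow> ennreal"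
  assumes "1 \<le> r" "1 \<le> s" and [measurable]: "a \<in> borel_measurable borel" "b \<in> borel_measurable borel"
  shows "Lp_norm s (\<lambda>\<xi>. Lp_norm r (\<lambda>x. a x * b \<xi>)) \<le> Lp_norm r a * Lp_norm s b"
proof -
  note [measurable] = assms(1)
  have "Lp_norm s (\<lambda>\<xi>. Lp_norm r (\<lambda>x. a x * b \<xi>)) \<le> Lp_norm s (\<lambda>\<xi>. Lp_norm r a * b \<xi>)"
  proof (rule Lp_norm_mono[OF assms(2)])
    show "(\<lambda>\<xi>. Lp_norm r (\<lambda>x. a x * b \<xi>)) \<in> borel_measurable borel" by measurable
    show "Lp_norm r (\<lambda>x. a x * b \<xi>) \<le> Lp_norm r a * b \<xi>" for \<xi>
      using Lp_norm_cmult[OF assms(1,3), of "b \<xi>"] by (simp add: mult.commute)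
  qed
  also have "\<dots> \<le> Lp_norm r a * Lp_norm s b" by (rule Lp_norm_cmult[OF assms(2,4)])
  finally show ?thesis .
qed

lemma Lp_norm_tensor:
  fixes a :: "'a::euclidean_space \<Rightarrow> ennreal" and b :: "'b::euclidean_space \<Rightarrow> ennreal"
  assumes "1 \<le> p" and [measurable]: "a \<in> borel_measurable borel" "b \<in> borel_measurable borel"
  shows "Lp_norm p (\<lambda>z. a (fst z) * b (snd z)) \<le> Lp_norm p a * Lp_norm p b"
proof -
  have "Lp_norm p (\<lambda>z. a (fst z) * b (snd z)) = Lp_norm p (\<lambda>y. Lp_norm p (\<lambda>x. a x * b y))"
    by (subst Lp_norm_prod(2)[OF assms(1)]) auto
  then show ?thesis using mixed_norm_tensor[OF assms(1) assms(1) assms(2,3)] by simp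
qed

text \<open>For fixed z the two components of \<zeta> run over the frequency of g and the time of f
  separately, and the outer components are the time of g and the frequency of f. Hence g is measured
  with frequency integrated first and f with time integrated first, which is why a test family needs
  two growth exponents.\<close>

lemma amalgam_wigner_0:
  fixes f g :: "'a::euclidean_space \<Rightarrow> complex"
  assumes p: "1 \<le> p" and q: "1 \<le> q" and S: "f \<in> schwartz" "g \<in> schwartz" "\<phi>\<^sub>1 \<in> schwartz" "\<phi>\<^sub>2 \<in> schwartz"
  shows "amalgam_norm (tau_wigner 0 \<phi>\<^sub>1 \<phi>\<^sub>2) p q (pairing (tau_wigner 0 g f)) \<le>
    amalgam_norm \<phi>\<^sub>1 p q (pairing g) * modulation_norm \<phi>\<^sub>2 p q (pairing f)"
proof -
  let ?G = "eV \<phi>\<^sub>1 (pairing g)" and ?F = "eV \<phi>\<^sub>2 (pairing f)"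
  note [measurable] = p q eV_measurable[OF pairing_tempered[OF S(2)] S(3)] eV_measurable[OF pairing_tempered[OF S(1)] S(4)]
  define A B where "A x = Lp_norm p (?G x)" and "B \<xi> = Lp_norm p (\<lambda>x. ?F x \<xi>)" for x \<xi>
  have [measurable]: "A \<in> borel_measurable borel" "B \<in> borel_measurable borel"
    unfolding A_def[abs_def] B_def[abs_def] by measurable
  have eq: "eV (tau_wigner 0 \<phi>\<^sub>1 \<phi>\<^sub>2) (pairing (tau_wigner 0 g f)) z \<zeta> = ?G (fst z) (snd z + fst \<zeta>) * ?F (fst z + snd \<zeta>) (snd z)" for z \<zeta>
    unfolding eV_def STFT_wigner_0[OF S] by (simp add: ennreal_mult)
  have W: "tau_wigner 0 g f \<in> schwartz" "tau_wigner 0 \<phi>\<^sub>1 \<phi>\<^sub>2 \<in> schwartz" by (intro tau_wigner_0_schwartz S)+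
  have "amalgam_norm (tau_wigner 0 \<phi>\<^sub>1 \<phi>\<^sub>2) p q (pairing (tau_wigner 0 g f)) =
    Lp_norm q (\<lambda>z. Lp_norm p (\<lambda>\<zeta>. ?G (fst z) (snd z + fst \<zeta>) * ?F (fst z + snd \<zeta>) (snd z)))"
    unfolding amalgam_norm_eV[OF p q pairing_tempered[OF W(1)] W(2)] eq[abs_def] ..
  also have "\<dots> \<le> Lp_norm q (\<lambda>z. A (fst z) * B (snd z))"
  proof (rule Lp_norm_mono[OF q])
    show "(\<lambda>z. Lp_norm p (\<lambda>\<zeta>. ?G (fst z) (snd z + fst \<zeta>) * ?F (fst z + snd \<zeta>) (snd z))) \<in> borel_measurable borel"
      by measurable
    fix z :: "'a \<times> 'a"
    have "Lp_norm p (\<lambda>\<zeta>. ?G (fst z) (snd z + fst \<zeta>) * ?F (fst z + snd \<zeta>) (snd z)) \<le>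
      Lp_norm p (\<lambda>\<eta>. ?G (fst z) (snd z + \<eta>)) * Lp_norm p (\<lambda>y. ?F (fst z + y) (snd z))"
      by (rule Lp_norm_tensor[OF p]) measurable
    also have "\<dots> \<le> A (fst z) * B (snd z)"
      unfolding A_def B_def add.commute[of "snd z"] add.commute[of "fst z"]
      by (intro mult_mono Lp_norm_translate[OF p] zero_le) measurable
    finally show "Lp_norm p (\<lambda>\<zeta>. ?G (fst z) (snd z + fst \<zeta>) * ?F (fst z + snd \<zeta>) (snd z)) \<le> A (fst z) * B (snd z)" .
  qed
  also have "\<dots> \<le> Lp_norm q A * Lp_norm q B" by (rule Lp_norm_tensor[OF q]) measurable
  finally show ?thesis
    unfolding A_def[abs_def] B_def[abs_def] modulation_norm_eV amalgam_norm_eV[OF p q pairing_tempered[OF S(2)] S(3)] .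
qed

lemma amalgam_wigner_1:
  fixes f g :: "'a::euclidean_space \<Rightarrow> complex"
  assumes p: "1 \<le> p" and q: "1 \<le> q" and S: "f \<in> schwartz" "g \<in> schwartz" "\<phi>\<^sub>1 \<in> schwartz" "\<phi>\<^sub>2 \<in> schwartz"
  shows "amalgam_norm (tau_wigner 1 \<phi>\<^sub>1 \<phi>\<^sub>2) p q (pairing (tau_wigner 1 g f)) \<le>
    amalgam_norm \<phi>\<^sub>2 p q (pairing f) * modulation_norm \<phi>\<^sub>1 p q (pairing g)"
proof -
  let ?G = "eV \<phi>\<^sub>1 (pairing g)" and ?F = "eV \<phi>\<^sub>2 (pairing f)"
  note [measurable] = p q eV_measurable[OF pairing_tempered[OF S(2)] S(3)] eV_measurable[OF pairing_tempered[OF S(1)] S(4)]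
  define A B where "A x = Lp_norm p (?F x)" and "B \<xi> = Lp_norm p (\<lambda>x. ?G x \<xi>)" for x \<xi>
  have [measurable]: "A \<in> borel_measurable borel" "B \<in> borel_measurable borel"
    unfolding A_def[abs_def] B_def[abs_def] by measurable
  have eq: "eV (tau_wigner 1 \<phi>\<^sub>1 \<phi>\<^sub>2) (pairing (tau_wigner 1 g f)) z \<zeta> = ?F (fst z) (snd z - fst \<zeta>) * ?G (fst z - snd \<zeta>) (snd z)" for z \<zeta>
    unfolding eV_def STFT_wigner_1[OF S] by (simp add: ennreal_mult mult.commute)
  have W: "tau_wigner 1 g f \<in> schwartz" "tau_wigner 1 \<phi>\<^sub>1 \<phi>\<^sub>2 \<in> schwartz" by (intro tau_wigner_schwartz S; simp)+
  have "amalgam_norm (tau_wigner 1 \<phi>\<^sub>1 \<phi>\<^sub>2) p q (pairing (tau_wigner 1 g f)) =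
    Lp_norm q (\<lambda>z. Lp_norm p (\<lambda>\<zeta>. ?F (fst z) (snd z - fst \<zeta>) * ?G (fst z - snd \<zeta>) (snd z)))"
    unfolding amalgam_norm_eV[OF p q pairing_tempered[OF W(1)] W(2)] eq[abs_def] ..
  also have "\<dots> \<le> Lp_norm q (\<lambda>z. A (fst z) * B (snd z))"
  proof (rule Lp_norm_mono[OF q])
    show "(\<lambda>z. Lp_norm p (\<lambda>\<zeta>. ?F (fst z) (snd z - fst \<zeta>) * ?G (fst z - snd \<zeta>) (snd z))) \<in> borel_measurable borel"
      by measurable
    fix z :: "'a \<times> 'a"
    have "Lp_norm p (\<lambda>\<zeta>. ?F (fst z) (snd z - fst \<zeta>) * ?G (fst z - snd \<zeta>) (snd z)) \<le>
      Lp_norm p (\<lambda>\<eta>. ?F (fst z) (snd z - \<eta>)) * Lp_norm p (\<lambda>y. ?G (fst z - y) (snd z))"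
      by (rule Lp_norm_tensor[OF p]) measurable
    also have "\<dots> \<le> A (fst z) * B (snd z)"
      unfolding A_def B_def by (intro mult_mono Lp_norm_translate[OF p] zero_le) measurable
    finally show "Lp_norm p (\<lambda>\<zeta>. ?F (fst z) (snd z - fst \<zeta>) * ?G (fst z - snd \<zeta>) (snd z)) \<le> A (fst z) * B (snd z)" .
  qed
  also have "\<dots> \<le> Lp_norm q A * Lp_norm q B" by (rule Lp_norm_tensor[OF q]) measurable
  finally show ?thesis
    unfolding A_def[abs_def] B_def[abs_def] modulation_norm_eV amalgam_norm_eV[OF p q pairing_tempered[OF S(1)] S(4)] .
qed

lemma modulation_amalgam_finite:
  fixes f \<phi> :: "'a::euclidean_space \<Rightarrow> complex"
  assumes "f \<in> schwartz" "\<phi> \<in> schwartz" "1 \<le> p" "1 \<le> q"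
  shows "modulation_norm \<phi> p q (pairing f) < top" "amalgam_norm \<phi> p q (pairing f) < top"
proof -
  obtain C where C: "C > 0" "\<And>x \<xi>. cmod (STFT \<phi> (pairing f) x \<xi>) \<le> C * (wt x ^ 1 * wt \<xi> ^ 1)"
    using STFT_decay[OF assms(1,2), of 1] by metis
  have le: "eV \<phi> (pairing f) x \<xi> \<le> ennreal C * (ew x * ew \<xi>)" for x \<xi>
    using ennreal_leI[OF C(2)] C(1) by (simp add: eV_def ew_def ennreal_mult)
  note M = eV_measurable[OF pairing_tempered[OF assms(1)] assms(2)]
  have T: "case_prod (\<lambda>(x::'a) (\<xi>::'a). ew x * ew \<xi>) \<in> borel_measurable (borel \<Otimes>\<^sub>M borel)" by measurable
  have fin: "ennreal C * (Lp_norm p (ew :: 'a \<Rightarrow> ennreal) * Lp_norm q (ew :: 'a \<Rightarrow> ennreal)) < top"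
    by (intro ennreal_mult_less_top[THEN iffD2] disjI2 conjI Lp_norm_ew_finite assms) auto
  have "modulation_norm \<phi> p q (pairing f) \<le> ennreal C * Lp_norm q (\<lambda>\<xi>. Lp_norm p (\<lambda>x::'a. ew x * ew (\<xi>::'a)))"
    unfolding modulation_norm_eV by (rule mixed_norm_mono[OF assms(3,4) M T le])
  also have "\<dots> \<le> ennreal C * (Lp_norm p (ew :: 'a \<Rightarrow> ennreal) * Lp_norm q (ew :: 'a \<Rightarrow> ennreal))"
    by (intro mult_left_mono mixed_norm_tensor assms zero_le) measurable
  finally show "modulation_norm \<phi> p q (pairing f) < top" using fin by (rule order_le_less_trans)
  have "amalgam_norm \<phi> p q (pairing f) \<le> ennreal C * Lp_norm q (\<lambda>x::'a. Lp_norm p (\<lambda>\<xi>. ew x * ew (\<xi>::'a)))"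
    unfolding amalgam_norm_eV[OF assms(3,4) pairing_tempered[OF assms(1)] assms(2)]
    by (rule mixed_norm_mono'[OF assms(3,4) M T le])
  also have "Lp_norm q (\<lambda>x::'a. Lp_norm p (\<lambda>\<xi>. ew x * ew (\<xi>::'a))) = Lp_norm q (\<lambda>x. Lp_norm p (\<lambda>\<xi>::'a. ew \<xi> * ew (x::'a)))"
    by (simp only: mult.commute)
  also have "ennreal C * \<dots> \<le> ennreal C * (Lp_norm p (ew :: 'a \<Rightarrow> ennreal) * Lp_norm q (ew :: 'a \<Rightarrow> ennreal))"
    by (intro mult_left_mono mixed_norm_tensor assms zero_le) measurable
  finally show "amalgam_norm \<phi> p q (pairing f) < top" using fin by (rule order_le_less_trans)
qed

text \<open>Functionals are compared on Schwartz functions only, as their values elsewhere are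
  arbitrary. The identities for \<open>OP\<close> of a superposition hold just there.\<close>

lemma modulation_norm_cong:
  assumes "\<phi> \<in> schwartz" "\<And>g. g \<in> schwartz \<Longrightarrow> u g = v g"
  shows "modulation_norm \<phi> p q u = modulation_norm \<phi> p q v"
  unfolding modulation_norm_def STFT_def using assms by (simp add: modulation_schwartz translation_schwartz)

text \<open>The reproducing formula followed by H\<ouml>lder in both variables, with \<phi> as its
  own dual window.\<close>

lemma modulation_duality:
  fixes \<phi> :: "'a::euclidean_space \<Rightarrow> complex"
  assumes \<phi>: "\<phi> \<in> schwartz" "\<phi> \<noteq> (\<lambda>x. 0)" and "1 \<le> p" "1 \<le> q"
  obtains C :: real where "C > 0" "\<And>u g. u \<in> tempered \<Longrightarrow> g \<in> schwartz \<Longrightarrow> ennreal (cmod (u g)) \<le>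
    ennreal C * (modulation_norm \<phi> p q u * modulation_norm \<phi> (conj_exponent p) (conj_exponent q) (pairing g))"
proof -
  let ?c = "cmod (pairing \<phi> \<phi>)"
  have c: "?c > 0" using pairing_self_nonzero[OF \<phi>] by simp
  have "ennreal (cmod (u g)) \<le> ennreal (1 / ?c) * (modulation_norm \<phi> p q u * modulation_norm \<phi> (conj_exponent p) (conj_exponent q) (pairing g))"
    if u: "u \<in> tempered" and g: "g \<in> schwartz" for u g
  proof -
    have "ennreal (cmod (u g)) = ennreal (1 / ?c) * ennreal (?c * cmod (u g))"
      using c by (simp flip: ennreal_mult)
    also have "\<dots> \<le> ennreal (1 / ?c) * (\<integral>\<^sup>+ x. \<integral>\<^sup>+ \<xi>. eV \<phi> u x \<xi> * eV \<phi> (pairing g) x \<xi> \<partial>lborel \<partial>lborel)"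
      unfolding eV_def by (rule mult_left_mono[OF STFT_duality[OF u \<phi>(1) \<phi>(1) g]]) simp
    also have "\<dots> \<le> ennreal (1 / ?c) * (modulation_norm \<phi> p q u * modulation_norm \<phi> (conj_exponent p) (conj_exponent q) (pairing g))"
      unfolding modulation_norm_eV by (intro mult_left_mono Holder2 assms eV_measurable u pairing_tempered g zero_le)
    finally show ?thesis .
  qed
  with c show ?thesis by (intro that[of "1 / ?c"]) simp_all
qed

section \<open>Superpositions\<close>

lemma Lp_norm_suminf:
  fixes h :: "nat \<Rightarrow> 'a::euclidean_space \<Rightarrow> ennreal"
  assumes r: "1 \<le> r" and h: "\<And>i. h i \<in> borel_measurable borel"
  shows "Lp_norm r (\<lambda>y. \<Sum>i. h i y) \<le> (\<Sum>i. Lp_norm r (h i))"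
proof -
  have "(\<lambda>(i, y). h i y) \<in> borel_measurable (count_space UNIV \<Otimes>\<^sub>M lborel)"
    by (rule measurable_pair_measure_countable1) (use h in auto)
  from Minkowski_integral[OF sigma_finite_measure_count_space r this]
  show ?thesis by (simp add: nn_integral_count_space_nat)
qed

lemma mixed_norm_suminf:
  fixes F :: "nat \<Rightarrow> 'a::euclidean_space \<Rightarrow> 'b::euclidean_space \<Rightarrow> ennreal"
  assumes p: "1 \<le> p" and q: "1 \<le> q" and F [measurable]: "\<And>i. case_prod (F i) \<in> borel_measurable (borel \<Otimes>\<^sub>M borel)"
  shows "Lp_norm q (\<lambda>x. Lp_norm p (\<lambda>\<xi>. \<Sum>i. ennreal (c i) * F i x \<xi>)) \<le> (\<Sum>i. ennreal (c i) * Lp_norm q (\<lambda>x. Lp_norm p (F i x)))"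
proof -
  note [measurable] = p q
  have "Lp_norm q (\<lambda>x. Lp_norm p (\<lambda>\<xi>. \<Sum>i. ennreal (c i) * F i x \<xi>)) \<le> Lp_norm q (\<lambda>x. \<Sum>i. ennreal (c i) * Lp_norm p (F i x))"
  proof (rule Lp_norm_mono[OF q])
    show "(\<lambda>x. Lp_norm p (\<lambda>\<xi>. \<Sum>i. ennreal (c i) * F i x \<xi>)) \<in> borel_measurable borel" by measurable
    fix x
    have "Lp_norm p (\<lambda>\<xi>. \<Sum>i. ennreal (c i) * F i x \<xi>) \<le> (\<Sum>i. Lp_norm p (\<lambda>\<xi>. ennreal (c i) * F i x \<xi>))"
      by (rule Lp_norm_suminf[OF p]) measurable
    also have "\<dots> \<le> (\<Sum>i. ennreal (c i) * Lp_norm p (F i x))"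
      by (intro suminf_le Lp_norm_cmult p summableI) measurable
    finally show "Lp_norm p (\<lambda>\<xi>. \<Sum>i. ennreal (c i) * F i x \<xi>) \<le> (\<Sum>i. ennreal (c i) * Lp_norm p (F i x))" .
  qed
  also have "\<dots> \<le> (\<Sum>i. Lp_norm q (\<lambda>x. ennreal (c i) * Lp_norm p (F i x)))"
    by (rule Lp_norm_suminf[OF q]) measurable
  also have "\<dots> \<le> (\<Sum>i. ennreal (c i) * Lp_norm q (\<lambda>x. Lp_norm p (F i x)))"
    by (intro suminf_le Lp_norm_cmult q summableI) measurable
  finally show ?thesis .
qed

text \<open>Either alternative bounds all pairings with one Schwartz function uniformly in i, so
  that summable weights suffice for convergence. Both are needed because the Fourier transform takes
  the bounded wide family to the narrow family, which is bounded only in L1.\<close>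

definition unif_bounded :: "(nat \<Rightarrow> 'a::euclidean_space \<Rightarrow> complex) \<Rightarrow> bool" where
  "unif_bounded h \<longleftrightarrow> (\<exists>C. \<forall>i x. cmod (h i x) \<le> C) \<or> (\<exists>C. \<forall>i. (LINT x|lborel. cmod (h i x)) \<le> C)"

lemma unif_bounded_pairing:
  fixes h :: "nat \<Rightarrow> 'a::euclidean_space \<Rightarrow> complex"
  assumes "unif_bounded h" "\<And>i. h i \<in> schwartz"
  obtains M where "\<And>i F. F \<in> schwartz \<Longrightarrow> cmod (pairing (h i) F) \<le> M * (schwartz_norm 0 F + (LINT x|lborel. cmod (F x)))"
proof -
  have nn: "0 \<le> schwartz_norm 0 F" if "F \<in> schwartz" for F :: "'a \<Rightarrow> complex"
    using order_trans[OF _ schwartz_norm_upper[OF that, of 0 0 0]] by simp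
  have nn': "0 \<le> (LINT x|lborel. cmod (F x))" for F :: "'a \<Rightarrow> complex" by simp
  from assms(1) consider C where "\<And>i x. cmod (h i x) \<le> C" | C where "\<And>i. (LINT x|lborel. cmod (h i x)) \<le> C"
    unfolding unif_bounded_def by metis
  then show ?thesis
  proof cases
    case (1 C)
    have C: "C \<ge> 0" using order_trans[OF norm_ge_zero 1] .
    have "cmod (pairing (h i) F) \<le> C * (schwartz_norm 0 F + (LINT x|lborel. cmod (F x)))" if "F \<in> schwartz" for i F
      by (rule order_trans[OF pairing_le_integral[OF assms(2) that 1]]) (use C nn[OF that] in \<open>auto intro!: mult_left_mono\<close>)
    then show ?thesis by (rule that)
  next
    case (2 C)
    have C: "C \<ge> 0" using order_trans[OF nn' 2] .
    have "cmod (pairing (h i) F) \<le> C * (schwartz_norm 0 F + (LINT x|lborel. cmod (F x)))" if "F \<in> schwartz" for i F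
      by (rule order_trans[OF pairing_le_sup[OF assms(2) that]]) (use C nn[OF that] nn' 2 in \<open>auto intro!: mult_mono\<close>)
    then show ?thesis by (rule that)
  qed
qed

lemma integral_norm_tensor:
  fixes f :: "'a::euclidean_space \<Rightarrow> complex" and g :: "'b::euclidean_space \<Rightarrow> complex"
  assumes "f \<in> schwartz" "g \<in> schwartz"
  shows "(LINT z|lborel. cmod (f (fst z)) * cmod (g (snd z))) = (LINT x|lborel. cmod (f x)) * (LINT y|lborel. cmod (g y))"
proof -
  have "integrable (lborel \<Otimes>\<^sub>M lborel) (\<lambda>z. cmod ((\<lambda>(x, y). f x * g y) z))"
    unfolding lborel_prod by (intro integrable_norm schwartz_integrable schwartz_tensor assms)
  from lborel_pair.integral_fst'[OF this]
  show ?thesis unfolding lborel_prod by (simp add: case_prod_unfold norm_mult)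
qed

lemma unif_bounded_tensor:
  fixes k :: "nat \<Rightarrow> 'a::euclidean_space \<times> 'b::euclidean_space \<Rightarrow> complex"
  assumes a: "unif_bounded a" "\<And>i. a i \<in> schwartz" and b: "b \<in> schwartz"
  shows "(\<And>i z. cmod (k i z) = cmod (a i (fst z)) * cmod (b (snd z))) \<Longrightarrow> unif_bounded k"
    and "(\<And>i z. cmod (l i z) = cmod (b (fst z)) * cmod (a i (snd z))) \<Longrightarrow> unif_bounded l"
proof -
  have b': "cmod (b x) \<le> schwartz_norm 0 b" for x
    using schwartz_norm_upper[OF b, of 0 0 x] by simp
  then have nn: "0 \<le> schwartz_norm 0 b" using order_trans[OF norm_ge_zero] by blast
  from a(1) consider C where "\<And>i x. cmod (a i x) \<le> C" | C where "\<And>i. (LINT x|lborel. cmod (a i x)) \<le> C"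
    unfolding unif_bounded_def by metis
  note C = this
  show "unif_bounded k" if k: "\<And>i z. cmod (k i z) = cmod (a i (fst z)) * cmod (b (snd z))"
    using C
  proof cases
    case (1 C)
    have "cmod (k i z) \<le> C * schwartz_norm 0 b" for i z
      unfolding k by (intro mult_mono 1 b' order_trans[OF norm_ge_zero 1]) auto
    then show ?thesis unfolding unif_bounded_def by metis
  next
    case (2 C)
    have "(LINT z|lborel. cmod (k i z)) \<le> C * (LINT y|lborel. cmod (b y))" for i
      unfolding k integral_norm_tensor[OF a(2) b] by (intro mult_right_mono 2) simp
    then show ?thesis unfolding unif_bounded_def by metis
  qed
  show "unif_bounded l" if l: "\<And>i z. cmod (l i z) = cmod (b (fst z)) * cmod (a i (snd z))"
    using C
  proof cases
    case (1 C)
    have "cmod (l i z) \<le> schwartz_norm 0 b * C" for i z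
      unfolding l by (intro mult_mono 1 b' nn) auto
    then show ?thesis unfolding unif_bounded_def by metis
  next
    case (2 C)
    have "(LINT z|lborel. cmod (l i z)) \<le> (LINT y|lborel. cmod (b y)) * C" for i
      unfolding l integral_norm_tensor[OF b a(2)] by (intro mult_left_mono 2) simp
    then show ?thesis unfolding unif_bounded_def by metis
  qed
qed

text \<open>In modulus a Wigner distribution is a tensor product of one argument with the Fourier
  transform of the other, and \<tau> decides which of the two is transformed. Hence the case
  distinctions in the assumptions.\<close>

lemma unif_bounded_wigner:
  fixes g :: "nat \<Rightarrow> 'a::euclidean_space \<Rightarrow> complex"
  assumes \<tau>: "\<tau> \<in> {0, 1}" and g: "\<And>i. g i \<in> schwartz" and \<gamma>: "\<gamma> \<in> schwartz"
  shows "unif_bounded (\<lambda>i. if \<tau> = 0 then g i else fourier (g i)) \<Longrightarrow> unif_bounded (\<lambda>i. tau_wigner \<tau> (g i) \<gamma>)"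
    and "unif_bounded (\<lambda>i. if \<tau> = 1 then g i else fourier (g i)) \<Longrightarrow> unif_bounded (\<lambda>i. tau_wigner \<tau> \<gamma> (g i))"
proof -
  have W0: "cmod (tau_wigner 0 h f z) = cmod (h (fst z)) * cmod (fourier f (snd z))" if "f \<in> schwartz" for f h :: "'a \<Rightarrow> complex" and z
    by (cases z) (simp add: tau_wigner_0[OF that] norm_mult)
  have W1: "cmod (tau_wigner 1 h f z) = cmod (f (fst z)) * cmod (fourier h (snd z))" if "h \<in> schwartz" for f h :: "'a \<Rightarrow> complex" and z
    by (simp add: tau_wigner_1[OF that] W0[OF that])
  show "unif_bounded (\<lambda>i. tau_wigner \<tau> (g i) \<gamma>)" if U: "unif_bounded (\<lambda>i. if \<tau> = 0 then g i else fourier (g i))"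
  proof (cases "\<tau> = 0")
    case True
    then have "unif_bounded g" using U by simp
    from unif_bounded_tensor(1)[where k = "\<lambda>i. tau_wigner 0 (g i) \<gamma>", OF this g fourier_schwartz[OF \<gamma>] W0[OF \<gamma>]] show ?thesis using True by simp
  next
    case False
    then have "unif_bounded (\<lambda>i. fourier (g i))" using U by simp
    from unif_bounded_tensor(2)[where l = "\<lambda>i. tau_wigner 1 (g i) \<gamma>", OF this fourier_schwartz[OF g] \<gamma> W1[OF g]] show ?thesis using \<tau> False by simp
  qed
  show "unif_bounded (\<lambda>i. tau_wigner \<tau> \<gamma> (g i))" if U: "unif_bounded (\<lambda>i. if \<tau> = 1 then g i else fourier (g i))"
  proof (cases "\<tau> = 0")
    case True
    then have "unif_bounded (\<lambda>i. fourier (g i))" using U by simp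
    from unif_bounded_tensor(2)[where l = "\<lambda>i. tau_wigner 0 \<gamma> (g i)", OF this fourier_schwartz[OF g] \<gamma> W0[OF g]] show ?thesis using True by simp
  next
    case False
    then have "unif_bounded g" using U \<tau> by simp
    from unif_bounded_tensor(1)[where k = "\<lambda>i. tau_wigner 1 \<gamma> (g i)", OF this g fourier_schwartz[OF \<gamma>] W1[OF \<gamma>]] show ?thesis using \<tau> False by simp
  qed
qed

definition superposition :: "(nat \<Rightarrow> real) \<Rightarrow> (nat \<Rightarrow> 'a::euclidean_space \<Rightarrow> complex) \<Rightarrow> ('a \<Rightarrow> complex) \<Rightarrow> complex" where
  "superposition c h F = (\<Sum>i. of_real (c i) * pairing (h i) F)"

context
  fixes c :: "nat \<Rightarrow> real" and h :: "nat \<Rightarrow> 'a::euclidean_space \<Rightarrow> complex"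
  assumes c: "\<And>i. 0 \<le> c i" "summable c" and h: "\<And>i. h i \<in> schwartz" "unif_bounded h"
begin

lemma superposition_summable:
  assumes F: "F \<in> schwartz"
  shows "summable (\<lambda>i. c i * cmod (pairing (h i) F))" "summable (\<lambda>i. of_real (c i) * pairing (h i) F)"
proof -
  obtain M where M: "\<And>i F. F \<in> schwartz \<Longrightarrow> cmod (pairing (h i) F) \<le> M * (schwartz_norm 0 F + (LINT x|lborel. cmod (F x)))"
    by (rule unif_bounded_pairing[OF h(2,1)]) metis
  show *: "summable (\<lambda>i. c i * cmod (pairing (h i) F))"
    by (rule summable_comparison_test'[OF summable_mult2[OF c(2), of "M * (schwartz_norm 0 F + (LINT x|lborel. cmod (F x)))"], of 0])
      (use c M[OF F] in \<open>auto simp: abs_mult intro!: mult_left_mono\<close>)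
  then show "summable (\<lambda>i. of_real (c i) * pairing (h i) F)"
    using c by (intro summable_norm_cancel[of "\<lambda>i. of_real (c i) * pairing (h i) F"]) (simp add: norm_mult)
qed

lemma norm_superposition_le:
  assumes "F \<in> schwartz" shows "cmod (superposition c h F) \<le> (\<Sum>i. c i * cmod (pairing (h i) F))"
proof -
  have eq: "cmod (of_real (c i) * pairing (h i) F) = c i * cmod (pairing (h i) F)" for i
    using c by (simp add: norm_mult)
  show ?thesis
    using summable_norm[of "\<lambda>i. of_real (c i) * pairing (h i) F"] superposition_summable(1)[OF assms]
    unfolding superposition_def eq .
qed

lemma superposition_tempered: "superposition c h \<in> tempered"
proof -
  obtain M where M: "\<And>i F. F \<in> schwartz \<Longrightarrow> cmod (pairing (h i) F) \<le> M * (schwartz_norm 0 F + (LINT x|lborel. cmod (F x)))"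
    by (rule unif_bounded_pairing[OF h(2,1)]) metis
  show ?thesis
  proof (rule tempered_intro)
    fix F G :: "'a \<Rightarrow> complex" assume F: "F \<in> schwartz" and G: "G \<in> schwartz"
    show "superposition c h (\<lambda>x. F x + G x) = superposition c h F + superposition c h G"
      unfolding superposition_def suminf_add[OF superposition_summable(2)[OF F] superposition_summable(2)[OF G]]
        pairing_add[OF h(1) F G] by (simp only: distrib_left)
  next
    fix a and F :: "'a \<Rightarrow> complex" assume F: "F \<in> schwartz"
    show "superposition c h (\<lambda>x. a * F x) = cnj a * superposition c h F"
      unfolding superposition_def suminf_mult[OF superposition_summable(2)[OF F], symmetric] pairing_cmult
      by (simp only: mult.left_commute)
  next
    fix F :: "'a \<Rightarrow> complex" assume F: "F \<in> schwartz"
    let ?N = "schwartz_norm 0 F + (LINT x|lborel. cmod (F x))"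
    have "cmod (superposition c h F) \<le> (\<Sum>i. c i * (M * ?N))"
      by (rule order_trans[OF norm_superposition_le[OF F] suminf_le[OF _ superposition_summable(1)[OF F] summable_mult2[OF c(2)]]])
        (intro mult_left_mono M F c)
    also have "\<dots> = (suminf c * M) * ?N" by (simp add: suminf_mult2[OF c(2), symmetric] mult.assoc)
    finally show "cmod (superposition c h F) \<le> (suminf c * M) * ?N" .
  qed
qed

lemma amalgam_norm_superposition:
  assumes "1 \<le> p" "1 \<le> q" "\<Gamma> \<in> schwartz"
  shows "amalgam_norm \<Gamma> p q (superposition c h) \<le> (\<Sum>i. ennreal (c i) * amalgam_norm \<Gamma> p q (pairing (h i)))"
proof -
  have le: "eV \<Gamma> (superposition c h) z \<zeta> \<le> 1 * (\<Sum>i. ennreal (c i) * eV \<Gamma> (pairing (h i)) z \<zeta>)" for z \<zeta>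
  proof -
    let ?F = "modulation \<zeta> (translation z \<Gamma>)"
    have F: "?F \<in> schwartz" by (intro modulation_schwartz translation_schwartz assms)
    have "ennreal (cmod (superposition c h ?F)) \<le> ennreal (\<Sum>i. c i * cmod (pairing (h i) ?F))"
      by (rule ennreal_leI[OF norm_superposition_le[OF F]])
    also have "\<dots> = (\<Sum>i. ennreal (c i * cmod (pairing (h i) ?F)))"
      by (rule suminf_ennreal2[symmetric]) (use c superposition_summable(1)[OF F] in auto)
    finally show ?thesis using c by (simp add: eV_def STFT_def ennreal_mult)
  qed
  note [measurable] = eV_measurable[OF pairing_tempered[OF h(1)] assms(3)]
  have "amalgam_norm \<Gamma> p q (superposition c h) \<le>
    1 * Lp_norm q (\<lambda>z. Lp_norm p (\<lambda>\<zeta>. \<Sum>i. ennreal (c i) * eV \<Gamma> (pairing (h i)) z \<zeta>))"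
    unfolding amalgam_norm_eV[OF assms(1,2) superposition_tempered assms(3)]
    by (rule mixed_norm_mono'[OF assms(1,2) eV_measurable[OF superposition_tempered assms(3)] _ le]) measurable
  also have "\<dots> \<le> (\<Sum>i. ennreal (c i) * Lp_norm q (\<lambda>z. Lp_norm p (eV \<Gamma> (pairing (h i)) z)))"
    unfolding mult_1 by (rule mixed_norm_suminf[OF assms(1,2)]) measurable
  finally show ?thesis unfolding amalgam_norm_eV[OF assms(1,2) pairing_tempered[OF h(1)] assms(3)] .
qed

text \<open>The window \<Gamma> is adapted to the h i, so that their norms can be computed; only the
  finiteness is transferred to the given window \<Phi>.\<close>

lemma superposition_wiener_amalgam:
  assumes "1 \<le> p" "1 \<le> q" and \<Phi>: "\<Phi> \<in> schwartz" and \<Gamma>: "\<Gamma> \<in> schwartz" "\<Gamma> \<noteq> (\<lambda>z. 0)"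
    and K: "K < top" "\<And>i. amalgam_norm \<Gamma> p q (pairing (h i)) \<le> K * ennreal (a ^ i)" "0 \<le> a" "summable (\<lambda>i. c i * a ^ i)"
  shows "superposition c h \<in> wiener_amalgam \<Phi> p q"
proof -
  obtain K' where K': "K' < top" "\<And>u. u \<in> tempered \<Longrightarrow> amalgam_norm \<Phi> p q u \<le> K' * amalgam_norm \<Gamma> p q u"
    using amalgam_norm_window[OF \<Gamma> \<Phi> assms(1,2)] by metis
  have "amalgam_norm \<Gamma> p q (superposition c h) \<le> (\<Sum>i. ennreal (c i) * amalgam_norm \<Gamma> p q (pairing (h i)))"
    by (rule amalgam_norm_superposition[OF assms(1,2) \<Gamma>(1)])
  also have "\<dots> \<le> (\<Sum>i. ennreal (c i) * (K * ennreal (a ^ i)))"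
    by (intro suminf_le mult_left_mono K summableI zero_le)
  also have "\<dots> = (\<Sum>i. K * ennreal (c i * a ^ i))" using c K(3) by (simp add: ennreal_mult mult_ac)
  also have "\<dots> = K * (\<Sum>i. ennreal (c i * a ^ i))" by simp
  also have "(\<Sum>i. ennreal (c i * a ^ i)) = ennreal (\<Sum>i. c i * a ^ i)"
    by (rule suminf_ennreal2) (use c K in auto)
  finally have "amalgam_norm \<Gamma> p q (superposition c h) < top"
    using K(1) by (auto simp: ennreal_mult_less_top intro: order_le_less_trans)
  then have "amalgam_norm \<Phi> p q (superposition c h) < top"
    using K' superposition_tempered by (auto simp: ennreal_mult_less_top intro!: order_le_less_trans[OF K'(2)])
  then show ?thesis using superposition_tempered by (simp add: wiener_amalgam_def)
qed

end

text \<open>With d half of the gap 1 - E - F the weights are c i = D^(-(E+d) i). Then c i D^(E i) =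
  D^(-d i) is summable, while c j D^j = D^((F+d) j) outgrows every multiple of D^(F j).\<close>

lemma separating_weights:
  fixes D E F :: real
  assumes D: "1 < D" and E: "0 \<le> E" "E + F < 1"
  obtains c :: "nat \<Rightarrow> real" where "\<And>i. 0 \<le> c i" "summable c" "summable (\<lambda>i. c i * (D powr E) ^ i)"
    "\<And>C. \<exists>j. C * (D powr F) ^ j < c j * D ^ j"
proof -
  define d where "d = (1 - E - F) / 2"
  have d: "d > 0" "1 - E - d = F + d" using E by (auto simp: d_def field_simps)
  define c where "c i = (D powr (- (E + d))) ^ i" for i :: nat
  have lt: "D powr (- s) < 1" if "0 < s" for s using D that by (simp add: powr_minus_divide)
  have 1: "c i * (D powr E) ^ i = (D powr (- d)) ^ i" for i
    using D by (simp add: c_def flip: power_mult_distrib powr_add)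
  have "D powr (- (E + d)) * D powr 1 = D powr (F + d)"
    unfolding powr_add[symmetric] d(2)[symmetric] by (rule arg_cong[of _ _ "(powr) D"]) simp
  then have 2: "c j * D ^ j = (D powr F) ^ j * (D powr d) ^ j" for j
    using D by (simp add: c_def powr_add flip: power_mult_distrib)
  show thesis
  proof (rule that)
    show "0 \<le> c i" for i by (simp add: c_def)
    show "summable c" unfolding c_def[abs_def] using lt[of "E + d"] E d by (intro summable_geometric) simp
    show "summable (\<lambda>i. c i * (D powr E) ^ i)" unfolding 1 using lt[of d] d by (intro summable_geometric) simp
    fix C
    have "1 < D powr d" using D d by simp
    then obtain j where "C < (D powr d) ^ j" using real_arch_pow by blast
    then show "\<exists>j. C * (D powr F) ^ j < c j * D ^ j"
      unfolding 2 using D by (intro exI[of _ j]) (simp add: mult.commute)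
  qed
qed

lemma tempered_scale: "u \<in> tempered \<Longrightarrow> (\<lambda>F. m * u F) \<in> tempered"
proof -
  assume u: "u \<in> tempered"
  from u obtain C N where CN: "\<And>f. f \<in> schwartz \<Longrightarrow> cmod (u f) \<le> C * (\<Sum>k\<le>N. \<Sum>bs\<in>{bs\<in>lists Basis. length bs \<le> N}. schwartz_seminorm k bs f)"
    unfolding tempered_def by blast
  have "cmod (m * u f) \<le> (cmod m * C) * (\<Sum>k\<le>N. \<Sum>bs\<in>{bs\<in>lists Basis. length bs \<le> N}. schwartz_seminorm k bs f)" if "f \<in> schwartz" for f
    using mult_left_mono[OF CN[OF that], of "cmod m"] by (simp add: norm_mult mult.assoc)
  then show ?thesis using u unfolding tempered_def by (auto simp: distrib_left mult.left_commute)
qed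

section \<open>Necessity\<close>

lemma wigner_nonzero:
  assumes "\<tau> \<in> {0, 1}" and a: "a \<in> schwartz" "a \<noteq> (\<lambda>x. 0)" and b: "b \<in> schwartz" "b \<noteq> (\<lambda>x. 0)"
  shows "tau_wigner \<tau> a b \<noteq> (\<lambda>z. 0)"
proof
  assume "tau_wigner \<tau> a b = (\<lambda>z. 0)"
  then have "pairing a a * cnj (pairing b b) = 0"
    using moyal[OF assms(1) b(1) a(1) b(1) a(1)] by (simp add: pairing_def)
  then show False using pairing_self_nonzero[OF a] pairing_self_nonzero[OF b] by simp
qed

text \<open>For a family \<open>g\<close> whose Gram matrix is nonnegative with diagonal of order \<open>D\<^sup>i\<close>, \<open>D = 2 ^ DIM('a)\<close>,
  no norm of \<open>\<Sum>i. c i * g i\<close> can be small: testing against \<open>g j\<close> picks up \<open>c j * D ^ j\<close>. Symbols are built from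
  \<open>g\<close> so that the operator outputs this sum (\<open>necessity_output\<close>) or pairs its input with it
  (\<open>necessity_input\<close>); the geometric weights that the norms of the symbol allow then violate the estimate
  unless the two growth exponents add up to at least 1. Here \<open>A\<close> and \<open>B\<close> are the growth exponents for
  integration in \<open>x\<close> first and in \<open>\<xi>\<close> first, respectively.\<close>

locale test_family =
  fixes \<psi> :: "'a::euclidean_space \<Rightarrow> complex" and g :: "nat \<Rightarrow> 'a \<Rightarrow> complex"
    and A B :: "ennreal \<Rightarrow> ennreal \<Rightarrow> real"
  assumes window: "\<psi> \<in> schwartz" "\<psi> \<noteq> (\<lambda>x. 0)"
    and schwartz: "\<And>i. g i \<in> schwartz" and unif: "unif_bounded g"
    and gram: "\<And>i j. pairing (g i) (g j) = of_real (cmod (pairing (g i) (g j)))"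
    and gram_diagonal: "\<And>j. (1 / sqrt 2) ^ DIM('a) * (2 ^ DIM('a)) ^ j \<le> cmod (pairing (g j) (g j))"
    and A_nonneg: "\<And>r s. 0 \<le> A r s" and B_nonneg: "\<And>r s. 0 \<le> B r s"
    and modulation_growth: "\<And>r s i. 1 \<le> r \<Longrightarrow> 1 \<le> s \<Longrightarrow>
      modulation_norm \<psi> r s (pairing (g i)) \<le> ennreal (64 ^ DIM('a)) * ennreal (((2 ^ DIM('a)) powr A r s) ^ i)"
    and amalgam_growth: "\<And>r s i. 1 \<le> r \<Longrightarrow> 1 \<le> s \<Longrightarrow>
      amalgam_norm \<psi> r s (pairing (g i)) \<le> ennreal (64 ^ DIM('a)) * ennreal (((2 ^ DIM('a)) powr B r s) ^ i)"
begin

lemma two_power_DIM_gt_1: "1 < (2 ^ DIM('a) :: real)"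
  by (rule one_less_power) auto

text \<open>Nonnegative weights and Gram entries exclude cancellation, so the single term with i = j
  bounds the whole sum from below.\<close>

lemma superposition_self:
  assumes c: "\<And>i. 0 \<le> c i" "summable c"
  shows "superposition c g (g j) = of_real (\<Sum>i. c i * cmod (pairing (g i) (g j)))"
    and "(1 / sqrt 2) ^ DIM('a) * (c j * (2 ^ DIM('a)) ^ j) \<le> cmod (superposition c g (g j))"
proof -
  let ?S = "\<Sum>i. c i * cmod (pairing (g i) (g j))"
  note S = superposition_summable(1)[where c = c and h = g, OF c schwartz unif schwartz]
  have "superposition c g (g j) = (\<Sum>i. of_real (c i * cmod (pairing (g i) (g j))))"
    unfolding superposition_def by (subst gram) simp
  also have "\<dots> = of_real ?S" by (rule suminf_of_real[OF S, symmetric])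
  finally show eq: "superposition c g (g j) = of_real ?S" .
  have "(1 / sqrt 2) ^ DIM('a) * (c j * (2 ^ DIM('a)) ^ j) \<le> c j * cmod (pairing (g j) (g j))"
    using mult_left_mono[OF gram_diagonal[of j] c(1)[of j]] by (simp add: mult_ac)
  also have "\<dots> \<le> ?S" using sum_le_suminf[OF S, of "{j}"] c by simp
  finally show "(1 / sqrt 2) ^ DIM('a) * (c j * (2 ^ DIM('a)) ^ j) \<le> cmod (superposition c g (g j))"
    unfolding eq using c by (simp add: suminf_nonneg[OF S])
qed

lemma growth_contradiction:
  assumes "T < top" "0 < n" "\<And>j. ennreal (n * (c j * (2 ^ DIM('a)) ^ j)) \<le> T * ennreal (((2 ^ DIM('a)) powr F) ^ j)"
    and "\<And>C. \<exists>j. C * ((2 ^ DIM('a)) powr F) ^ j < c j * (2 ^ DIM('a)) ^ j"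
  shows False
proof -
  obtain t where t: "T = ennreal t" "0 \<le> t" using assms(1) by (cases T) auto
  obtain j where j: "t / n * ((2 ^ DIM('a)) powr F) ^ j < c j * (2 ^ DIM('a)) ^ j" using assms(4) by blast
  have "n * (c j * (2 ^ DIM('a)) ^ j) \<le> t * ((2 ^ DIM('a)) powr F) ^ j"
    using assms(3)[of j] t by (simp flip: ennreal_mult)
  then show False using j assms(2) by (simp add: field_simps)
qed

lemma modulation_growth_window:
  assumes "1 \<le> r" "1 \<le> s" "\<phi> \<in> schwartz"
  obtains K where "K < top" "\<And>j. modulation_norm \<phi> r s (pairing (g j)) \<le> K * ennreal (((2 ^ DIM('a)) powr A r s) ^ j)"
proof -
  obtain K where K: "K < top" "\<And>u. u \<in> tempered \<Longrightarrow> modulation_norm \<phi> r s u \<le> K * modulation_norm \<psi> r s u"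
    using modulation_norm_window[OF window assms(3,1) order_refl assms(2) order_refl] by metis
  have "modulation_norm \<phi> r s (pairing (g j)) \<le> K * ennreal (64 ^ DIM('a)) * ennreal (((2 ^ DIM('a)) powr A r s) ^ j)" for j
    using order_trans[OF K(2)[OF pairing_tempered[OF schwartz]] mult_left_mono[OF modulation_growth[OF assms(1,2)]]]
    by (simp add: mult.assoc)
  then show ?thesis using K(1) by (intro that[of "K * ennreal (64 ^ DIM('a))"]) (simp_all add: ennreal_mult_less_top)
qed

context
  fixes \<phi> :: "'a \<Rightarrow> complex" and \<Phi> :: "'a \<times> 'a \<Rightarrow> complex" and p q p\<^sub>1 p\<^sub>2 q\<^sub>1 q\<^sub>2 :: ennreal and \<tau> :: real
  assumes p: "1 \<le> p" and q: "1 \<le> q" and p1: "1 \<le> p\<^sub>1" and q1: "1 \<le> q\<^sub>1" and p2: "1 \<le> p\<^sub>2" and q2: "1 \<le> q\<^sub>2"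
    and \<tau>: "\<tau> \<in> {0, 1}" and \<phi>: "\<phi> \<in> schwartz" "\<phi> \<noteq> (\<lambda>x. 0)" and \<Phi>: "\<Phi> \<in> schwartz"
    and bounded: "\<And>\<sigma>. \<sigma> \<in> wiener_amalgam \<Phi> p q \<Longrightarrow> bounded_on_modulation \<phi> p\<^sub>1 q\<^sub>1 p\<^sub>2 q\<^sub>2 (OP \<tau> \<sigma>)"
begin

lemma symbol_bounded:
  assumes k: "\<And>i. k i \<in> schwartz" "unif_bounded k" and c: "\<And>i. 0 \<le> c i" "summable c" "summable (\<lambda>i. c i * ((2 ^ DIM('a)) powr E) ^ i)"
    and \<Gamma>: "\<Gamma> \<in> schwartz" "\<Gamma> \<noteq> (\<lambda>z. 0)" "K < top" "\<And>i. amalgam_norm \<Gamma> p q (pairing (k i)) \<le> K * ennreal (((2 ^ DIM('a)) powr E) ^ i)"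
  obtains C :: real where "\<And>f. f \<in> schwartz \<Longrightarrow>
    modulation_norm \<phi> p\<^sub>2 q\<^sub>2 (OP \<tau> (superposition c k) f) \<le> ennreal C * modulation_norm \<phi> p\<^sub>1 q\<^sub>1 (pairing f)"
proof -
  have "superposition c k \<in> wiener_amalgam \<Phi> p q"
    by (rule superposition_wiener_amalgam[OF c(1,2) k p q \<Phi> \<Gamma> _ c(3)]) simp
  from bounded[OF this] show ?thesis unfolding bounded_on_modulation_def using that by metis
qed

text \<open>The symbol is the sum of the c i times W(g i, \<phi>) and the input is frozen at \<phi>,
  so by Moyal the output is a multiple of the sum of the c i g i. E is the growth exponent of the
  symbol's terms, F that of g j in the norm dual to the target. Boundedness and duality give c j D^j
  \<le> C D^(F j).\<close>

lemma necessity_output: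
  assumes u: "unif_bounded (\<lambda>i. if \<tau> = 0 then g i else fourier (g i))"
  shows "1 \<le> (if \<tau> = 0 then B p q else A p q) + A (conj_exponent p\<^sub>2) (conj_exponent q\<^sub>2)"
proof (rule ccontr)
  define E F where "E = (if \<tau> = 0 then B p q else A p q)" and "F = A (conj_exponent p\<^sub>2) (conj_exponent q\<^sub>2)"
  assume "\<not> 1 \<le> (if \<tau> = 0 then B p q else A p q) + A (conj_exponent p\<^sub>2) (conj_exponent q\<^sub>2)"
  then have EF: "0 \<le> E" "E + F < 1" unfolding E_def F_def using A_nonneg B_nonneg by auto
  obtain c where c: "\<And>i. 0 \<le> c i" "summable c" "summable (\<lambda>i. c i * ((2 ^ DIM('a)) powr E) ^ i)"
    "\<And>C. \<exists>j. C * ((2 ^ DIM('a)) powr F) ^ j < c j * (2 ^ DIM('a)) ^ j"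
    by (rule separating_weights[OF two_power_DIM_gt_1 EF], rule that)
  let ?k = "\<lambda>i. tau_wigner \<tau> (g i) \<phi>"
  have k: "?k i \<in> schwartz" "unif_bounded ?k" for i
    by (intro tau_wigner_schwartz[OF \<tau>] schwartz \<phi>) (rule unif_bounded_wigner(1)[OF \<tau> schwartz \<phi>(1) u])
  have \<Gamma>: "tau_wigner \<tau> \<psi> \<phi> \<in> schwartz" by (intro tau_wigner_schwartz[OF \<tau>] window \<phi>)
  define K where "K = ennreal (64 ^ DIM('a)) * (if \<tau> = 0 then modulation_norm \<phi> p q (pairing \<phi>) else amalgam_norm \<phi> p q (pairing \<phi>))"
  have K: "K < top" using modulation_amalgam_finite[OF \<phi>(1) \<phi>(1) p q] by (simp add: K_def ennreal_mult_less_top)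
  have "amalgam_norm (tau_wigner \<tau> \<psi> \<phi>) p q (pairing (?k i)) \<le> K * ennreal (((2 ^ DIM('a)) powr E) ^ i)" for i
  proof (cases "\<tau> = 0")
    case True
    then show ?thesis
      using order_trans[OF amalgam_wigner_0[OF p q \<phi>(1) schwartz window(1) \<phi>(1)] mult_right_mono[OF amalgam_growth[OF p q]]]
      by (simp add: K_def E_def mult_ac)
  next
    case False
    then show ?thesis
      using order_trans[OF amalgam_wigner_1[OF p q \<phi>(1) schwartz window(1) \<phi>(1)] mult_left_mono[OF modulation_growth[OF p q]]] \<tau>
      by (simp add: K_def E_def mult_ac)
  qed
  from symbol_bounded[OF k c(1,2,3) \<Gamma> wigner_nonzero[OF \<tau> window \<phi>] K this]
  obtain C1 where C1: "\<And>f. f \<in> schwartz \<Longrightarrow>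
    modulation_norm \<phi> p\<^sub>2 q\<^sub>2 (OP \<tau> (superposition c ?k) f) \<le> ennreal C1 * modulation_norm \<phi> p\<^sub>1 q\<^sub>1 (pairing f)" by metis
  let ?n = "cnj (pairing \<phi> \<phi>)"
  let ?v = "\<lambda>F. ?n * superposition c g F"
  have v: "?v \<in> tempered" by (intro tempered_scale superposition_tempered c schwartz unif)
  \<comment> \<open>Moyal's identity under the sum: the pairing of \<phi> with itself factors out of
    every term.\<close>
  have OP: "OP \<tau> (superposition c ?k) \<phi> h = ?v h" if h: "h \<in> schwartz" for h
    unfolding OP_def superposition_def suminf_mult[OF superposition_summable(2)[where c = c and h = g, OF c(1,2) schwartz unif h], symmetric]
      moyal[OF \<tau> \<phi>(1) h \<phi>(1) schwartz] by (simp only: mult_ac)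
  have v_norm: "modulation_norm \<phi> p\<^sub>2 q\<^sub>2 ?v \<le> ennreal C1 * modulation_norm \<phi> p\<^sub>1 q\<^sub>1 (pairing \<phi>)"
    using C1[OF \<phi>(1)] modulation_norm_cong[of \<phi> _ ?v, OF \<phi>(1) OP] by simp
  obtain C2 where C2: "C2 > 0" "\<And>u g. u \<in> tempered \<Longrightarrow> g \<in> schwartz \<Longrightarrow> ennreal (cmod (u g)) \<le>
    ennreal C2 * (modulation_norm \<phi> p\<^sub>2 q\<^sub>2 u * modulation_norm \<phi> (conj_exponent p\<^sub>2) (conj_exponent q\<^sub>2) (pairing g))"
    by (rule modulation_duality[OF \<phi> p2 q2], rule that)
  obtain K3 where K3: "K3 < top" "\<And>j. modulation_norm \<phi> (conj_exponent p\<^sub>2) (conj_exponent q\<^sub>2) (pairing (g j)) \<le> K3 * ennreal (((2 ^ DIM('a)) powr F) ^ j)"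
    by (rule modulation_growth_window[OF conj_exponent_ge_1[of p\<^sub>2] conj_exponent_ge_1[of q\<^sub>2] \<phi>(1), folded F_def], rule that)
  let ?T = "ennreal C2 * (ennreal C1 * modulation_norm \<phi> p\<^sub>1 q\<^sub>1 (pairing \<phi>)) * K3"
  show False
  proof (rule growth_contradiction[where T = ?T and n = "cmod ?n * (1 / sqrt 2) ^ DIM('a)"])
    show "?T < top" using K3 modulation_amalgam_finite[OF \<phi>(1) \<phi>(1) p1 q1] by (simp add: ennreal_mult_less_top)
    show "0 < cmod ?n * (1 / sqrt 2) ^ DIM('a)" using pairing_self_nonzero[OF \<phi>] by simp
    show "\<exists>j. C * ((2 ^ DIM('a)) powr F) ^ j < c j * (2 ^ DIM('a)) ^ j" for C by (rule c(4))
    fix j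
    have "cmod ?n * (1 / sqrt 2) ^ DIM('a) * (c j * (2 ^ DIM('a)) ^ j) \<le> cmod (?v (g j))"
      using mult_left_mono[OF superposition_self(2)[OF c(1,2)], of "cmod ?n"] by (simp add: norm_mult mult.assoc)
    then have "ennreal (cmod ?n * (1 / sqrt 2) ^ DIM('a) * (c j * (2 ^ DIM('a)) ^ j)) \<le> ennreal (cmod (?v (g j)))"
      by (rule ennreal_leI)
    also have "\<dots> \<le> ennreal C2 * (modulation_norm \<phi> p\<^sub>2 q\<^sub>2 ?v * modulation_norm \<phi> (conj_exponent p\<^sub>2) (conj_exponent q\<^sub>2) (pairing (g j)))"
      by (rule C2(2)[OF v schwartz])
    also have "\<dots> \<le> ennreal C2 * ((ennreal C1 * modulation_norm \<phi> p\<^sub>1 q\<^sub>1 (pairing \<phi>)) * (K3 * ennreal (((2 ^ DIM('a)) powr F) ^ j)))"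
      by (intro mult_left_mono mult_mono v_norm K3 zero_le)
    finally show "ennreal (cmod ?n * (1 / sqrt 2) ^ DIM('a) * (c j * (2 ^ DIM('a)) ^ j)) \<le> ?T * ennreal (((2 ^ DIM('a)) powr F) ^ j)"
      by (simp only: mult.assoc)
  qed
qed

text \<open>With W(\<phi>, g i) in the symbol every output is a multiple of \<phi>, and for the
  input g j the factor is at least of order c j D^j. Now F is the growth exponent of the input norm
  of g j.\<close>

lemma necessity_input:
  assumes u: "unif_bounded (\<lambda>i. if \<tau> = 1 then g i else fourier (g i))"
  shows "1 \<le> (if \<tau> = 0 then A p q else B p q) + A p\<^sub>1 q\<^sub>1"
proof (rule ccontr)
  define E F where "E = (if \<tau> = 0 then A p q else B p q)" and "F = A p\<^sub>1 q\<^sub>1"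
  assume "\<not> 1 \<le> (if \<tau> = 0 then A p q else B p q) + A p\<^sub>1 q\<^sub>1"
  then have EF: "0 \<le> E" "E + F < 1" unfolding E_def F_def using A_nonneg B_nonneg by auto
  obtain c where c: "\<And>i. 0 \<le> c i" "summable c" "summable (\<lambda>i. c i * ((2 ^ DIM('a)) powr E) ^ i)"
    "\<And>C. \<exists>j. C * ((2 ^ DIM('a)) powr F) ^ j < c j * (2 ^ DIM('a)) ^ j"
    by (rule separating_weights[OF two_power_DIM_gt_1 EF], rule that)
  let ?k = "\<lambda>i. tau_wigner \<tau> \<phi> (g i)"
  have k: "?k i \<in> schwartz" "unif_bounded ?k" for i
    by (intro tau_wigner_schwartz[OF \<tau>] schwartz \<phi>) (rule unif_bounded_wigner(2)[OF \<tau> schwartz \<phi>(1) u])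
  have \<Gamma>: "tau_wigner \<tau> \<phi> \<psi> \<in> schwartz" by (intro tau_wigner_schwartz[OF \<tau>] window \<phi>)
  define K where "K = ennreal (64 ^ DIM('a)) * (if \<tau> = 0 then amalgam_norm \<phi> p q (pairing \<phi>) else modulation_norm \<phi> p q (pairing \<phi>))"
  have K: "K < top" using modulation_amalgam_finite[OF \<phi>(1) \<phi>(1) p q] by (simp add: K_def ennreal_mult_less_top)
  have "amalgam_norm (tau_wigner \<tau> \<phi> \<psi>) p q (pairing (?k i)) \<le> K * ennreal (((2 ^ DIM('a)) powr E) ^ i)" for i
  proof (cases "\<tau> = 0")
    case True
    then show ?thesis
      using order_trans[OF amalgam_wigner_0[OF p q schwartz \<phi>(1) \<phi>(1) window(1)] mult_left_mono[OF modulation_growth[OF p q]]]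
      by (simp add: K_def E_def mult_ac)
  next
    case False
    then show ?thesis
      using order_trans[OF amalgam_wigner_1[OF p q schwartz \<phi>(1) \<phi>(1) window(1)] mult_right_mono[OF amalgam_growth[OF p q]]] \<tau>
      by (simp add: K_def E_def mult_ac)
  qed
  from symbol_bounded[OF k c(1,2,3) \<Gamma> wigner_nonzero[OF \<tau> \<phi> window] K this]
  obtain C1 where C1: "\<And>f. f \<in> schwartz \<Longrightarrow>
    modulation_norm \<phi> p\<^sub>2 q\<^sub>2 (OP \<tau> (superposition c ?k) f) \<le> ennreal C1 * modulation_norm \<phi> p\<^sub>1 q\<^sub>1 (pairing f)" by metis
  let ?m = "\<lambda>j. superposition c g (g j)"
  let ?v = "\<lambda>j F. ?m j * pairing \<phi> F"
  have v: "?v j \<in> tempered" for j by (intro tempered_scale pairing_tempered \<phi>)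
  have OP: "OP \<tau> (superposition c ?k) (g j) h = ?v j h" if h: "h \<in> schwartz" for h j
  proof -
    \<comment> \<open>Moyal's identity conjugates the pairing of the second arguments; the Gram
      entries are real, so the factor is the superposition itself.\<close>
    have "cnj (pairing (g i) (g j)) = pairing (g i) (g j)" for i
      by (subst (1 2) gram) simp
    then have "OP \<tau> (superposition c ?k) (g j) h = (\<Sum>i. pairing \<phi> h * (of_real (c i) * pairing (g i) (g j)))"
      unfolding OP_def superposition_def moyal[OF \<tau> schwartz h schwartz \<phi>(1)] by (simp only: mult_ac)
    also have "\<dots> = ?v j h"
      unfolding superposition_def
      by (subst suminf_mult) (auto intro: superposition_summable(2)[OF c(1,2) schwartz unif schwartz] simp: mult.commute)
    finally show ?thesis .
  qed
  obtain C2 where C2: "C2 > 0" "\<And>u g. u \<in> tempered \<Longrightarrow> g \<in> schwartz \<Longrightarrow> ennreal (cmod (u g)) \<le>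
    ennreal C2 * (modulation_norm \<phi> p\<^sub>2 q\<^sub>2 u * modulation_norm \<phi> (conj_exponent p\<^sub>2) (conj_exponent q\<^sub>2) (pairing g))"
    by (rule modulation_duality[OF \<phi> p2 q2], rule that)
  obtain K3 where K3: "K3 < top" "\<And>j. modulation_norm \<phi> p\<^sub>1 q\<^sub>1 (pairing (g j)) \<le> K3 * ennreal (((2 ^ DIM('a)) powr F) ^ j)"
    by (rule modulation_growth_window[OF p1 q1 \<phi>(1), folded F_def], rule that)
  let ?G = "modulation_norm \<phi> (conj_exponent p\<^sub>2) (conj_exponent q\<^sub>2) (pairing \<phi>)"
  let ?T = "ennreal C2 * ((ennreal C1 * K3) * ?G)"
  show False
  proof (rule growth_contradiction[where T = ?T and n = "cmod (pairing \<phi> \<phi>) * (1 / sqrt 2) ^ DIM('a)"])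
    show "?T < top" using K3 modulation_amalgam_finite[OF \<phi>(1) \<phi>(1) conj_exponent_ge_1 conj_exponent_ge_1]
      by (simp add: ennreal_mult_less_top)
    show "0 < cmod (pairing \<phi> \<phi>) * (1 / sqrt 2) ^ DIM('a)" using pairing_self_nonzero[OF \<phi>] by simp
    show "\<exists>j. C * ((2 ^ DIM('a)) powr F) ^ j < c j * (2 ^ DIM('a)) ^ j" for C by (rule c(4))
    fix j
    have "modulation_norm \<phi> p\<^sub>2 q\<^sub>2 (?v j) \<le> ennreal C1 * modulation_norm \<phi> p\<^sub>1 q\<^sub>1 (pairing (g j))"
      using C1[OF schwartz[of j]] modulation_norm_cong[of \<phi> _ "?v j", OF \<phi>(1) OP] by simp
    also have "\<dots> \<le> ennreal C1 * (K3 * ennreal (((2 ^ DIM('a)) powr F) ^ j))" by (intro mult_left_mono K3 zero_le)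
    finally have v_norm: "modulation_norm \<phi> p\<^sub>2 q\<^sub>2 (?v j) \<le> ennreal C1 * (K3 * ennreal (((2 ^ DIM('a)) powr F) ^ j))" .
    have "cmod (pairing \<phi> \<phi>) * (1 / sqrt 2) ^ DIM('a) * (c j * (2 ^ DIM('a)) ^ j) \<le> cmod (?v j \<phi>)"
      using mult_left_mono[OF superposition_self(2)[OF c(1,2)], of "cmod (pairing \<phi> \<phi>)"] by (simp add: norm_mult mult_ac)
    then have "ennreal (cmod (pairing \<phi> \<phi>) * (1 / sqrt 2) ^ DIM('a) * (c j * (2 ^ DIM('a)) ^ j)) \<le> ennreal (cmod (?v j \<phi>))"
      by (rule ennreal_leI)
    also have "\<dots> \<le> ennreal C2 * (modulation_norm \<phi> p\<^sub>2 q\<^sub>2 (?v j) * ?G)"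
      by (rule C2(2)[OF v \<phi>(1)])
    also have "\<dots> \<le> ennreal C2 * (ennreal C1 * (K3 * ennreal (((2 ^ DIM('a)) powr F) ^ j)) * ?G)"
      by (intro mult_left_mono mult_right_mono v_norm zero_le)
    finally show "ennreal (cmod (pairing \<phi> \<phi>) * (1 / sqrt 2) ^ DIM('a) * (c j * (2 ^ DIM('a)) ^ j)) \<le> ?T * ennreal (((2 ^ DIM('a)) powr F) ^ j)"
      by (simp only: mult_ac)
  qed
qed

end

end


subsection \<open>The test families\<close>

lemma mixed_norm_le_tensor:
  fixes V :: "'a::euclidean_space \<Rightarrow> 'b::euclidean_space \<Rightarrow> ennreal"
  assumes r: "1 \<le> r" "1 \<le> s" and V: "case_prod V \<in> borel_measurable (borel \<Otimes>\<^sub>M borel)"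
    and le: "\<And>x \<xi>. V x \<xi> \<le> a x * b \<xi>" and ab: "a \<in> borel_measurable borel" "b \<in> borel_measurable borel"
  shows "Lp_norm s (\<lambda>\<xi>. Lp_norm r (\<lambda>x. V x \<xi>)) \<le> Lp_norm r a * Lp_norm s b"
    and "Lp_norm s (\<lambda>x. Lp_norm r (V x)) \<le> Lp_norm s a * Lp_norm r b"
proof -
  note [measurable] = ab
  have T: "case_prod (\<lambda>x \<xi>. a x * b \<xi>) \<in> borel_measurable (borel \<Otimes>\<^sub>M borel)" by measurable
  have le': "V x \<xi> \<le> 1 * (a x * b \<xi>)" for x \<xi> using le by simp
  show "Lp_norm s (\<lambda>\<xi>. Lp_norm r (\<lambda>x. V x \<xi>)) \<le> Lp_norm r a * Lp_norm s b"
    using order_trans[OF mixed_norm_mono[OF r V T le']] mixed_norm_tensor[OF r ab] by simp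
  show "Lp_norm s (\<lambda>x. Lp_norm r (V x)) \<le> Lp_norm s a * Lp_norm r b"
    using order_trans[OF mixed_norm_mono'[OF r V T le']] mixed_norm_tensor[OF r ab(2,1)] by (simp add: mult.commute)
qed

text \<open>For fixed x the inner variable meets only a translate of b, so the inner norm is
  independent of the position on the diagonal and the outer norm falls on a alone.\<close>

lemma mixed_norm_le_shear:
  fixes V :: "'a::euclidean_space \<Rightarrow> 'a \<Rightarrow> ennreal"
  assumes r: "1 \<le> r" "1 \<le> s" and V: "case_prod V \<in> borel_measurable (borel \<Otimes>\<^sub>M borel)"
    and le: "\<And>x \<xi>. V x \<xi> \<le> a x * b (x - \<xi>)" and ab: "a \<in> borel_measurable borel" "b \<in> borel_measurable borel"
  shows "Lp_norm s (\<lambda>x. Lp_norm r (V x)) \<le> Lp_norm s a * Lp_norm r b"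
proof -
  note [measurable] = ab V r
  have "Lp_norm s (\<lambda>x. Lp_norm r (V x)) \<le> Lp_norm s (\<lambda>x. Lp_norm r b * a x)"
  proof (rule Lp_norm_mono[OF r(2)])
    show "(\<lambda>x. Lp_norm r (V x)) \<in> borel_measurable borel" by measurable
    fix x
    have "Lp_norm r (V x) \<le> Lp_norm r (\<lambda>\<xi>. a x * b (x - \<xi>))"
      by (rule Lp_norm_mono[OF r(1) _ le]) measurable
    also have "\<dots> \<le> a x * Lp_norm r (\<lambda>\<xi>. b (x - \<xi>))" by (rule Lp_norm_cmult[OF r(1)]) measurable
    also have "\<dots> \<le> a x * Lp_norm r b" by (intro mult_left_mono Lp_norm_translate(3)[OF r(1) ab(2)] zero_le)
    finally show "Lp_norm r (V x) \<le> Lp_norm r b * a x" by (simp add: mult.commute)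
  qed
  also have "\<dots> \<le> Lp_norm r b * Lp_norm s a" by (rule Lp_norm_cmult[OF r(2) ab(1)])
  finally show ?thesis by (simp add: mult.commute)
qed

text \<open>A spread direction with exponent r and an unspread one with exponent s, each
  contributing a constant 8^d; their product is the 64^d of \<open>test_family\<close>.\<close>

lemma gn_growth:
  assumes "1 \<le> r" "1 \<le> s"
  shows "Lp_norm r (gn ((1 / 4) ^ i / 8) :: 'a::euclidean_space \<Rightarrow> ennreal) * Lp_norm s (gn (1 / 8) :: 'a \<Rightarrow> ennreal) \<le>
    ennreal (64 ^ DIM('a)) * ennreal (((2 ^ DIM('a)) powr iv r) ^ i)"
proof -
  have "Lp_norm s (gn (1 / 8) :: 'a \<Rightarrow> ennreal) \<le> ennreal (8 ^ DIM('a))"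
    using Lp_norm_gn[OF assms(2), of 0, where 'a = 'a] by simp
  then have "Lp_norm r (gn ((1 / 4) ^ i / 8) :: 'a \<Rightarrow> ennreal) * Lp_norm s (gn (1 / 8) :: 'a \<Rightarrow> ennreal) \<le>
    ennreal (8 ^ DIM('a) * ((2 ^ DIM('a)) powr iv r) ^ i) * ennreal (8 ^ DIM('a))"
    by (intro mult_mono Lp_norm_gn assms) auto
  also have "\<dots> = ennreal ((8 * 8) ^ DIM('a) * ((2 ^ DIM('a)) powr iv r) ^ i)"
    unfolding power_mult_distrib by (simp add: mult_ac flip: ennreal_mult)
  finally show ?thesis by (simp flip: ennreal_mult)
qed

section \<open>Gram entries, uniform bounds and Fourier transforms of the Gaussians\<close>

lemma pairing_gs:
  assumes "0 < a" "0 < b"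
  shows "pairing (gs a) (gs b :: 'a::euclidean_space \<Rightarrow> complex) = of_real ((1 / sqrt (a + b)) ^ DIM('a))"
  unfolding pairing_def cnj_gs gs_mult using assms by (intro integral_gs) simp

lemma sqrt_4_power: "sqrt (4 ^ i) = 2 ^ i"
  by (simp add: real_sqrt_power)

lemma pairing_wide: "pairing (wide i) (wide j :: 'a::euclidean_space \<Rightarrow> complex) = of_real ((1 / sqrt ((1 / 4) ^ i + (1 / 4) ^ j)) ^ DIM('a))"
  unfolding wide_def by (rule pairing_gs) auto

lemma wide_gram: "pairing (wide i) (wide j :: 'a::euclidean_space \<Rightarrow> complex) = of_real (cmod (pairing (wide i) (wide j :: 'a \<Rightarrow> complex)))"
  unfolding pairing_wide norm_of_real by (simp add: norm_power)

lemma wide_diagonal: "(1 / sqrt 2) ^ DIM('a) * (2 ^ DIM('a)) ^ j \<le> cmod (pairing (wide j) (wide j :: 'a::euclidean_space \<Rightarrow> complex))"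
proof -
  have "1 / sqrt ((1 / 4) ^ j + (1 / 4) ^ j) = 1 / sqrt 2 * 2 ^ j"
    unfolding mult_2[symmetric] by (simp add: real_sqrt_mult real_sqrt_divide sqrt_4_power power_divide field_simps)
  then have "(1 / sqrt ((1 / 4) ^ j + (1 / 4) ^ j)) ^ DIM('a) = (1 / sqrt 2) ^ DIM('a) * (2 ^ DIM('a)) ^ j"
    by (simp only: power_mult_distrib power_mult[symmetric] mult.commute)
  then show ?thesis unfolding pairing_wide norm_of_real by simp
qed

lemma wide_unif_bounded: "unif_bounded wide"
  unfolding unif_bounded_def wide_def by (intro disjI1 exI[of _ 1]) simp

lemma narrow_unif_bounded: "unif_bounded (narrow :: nat \<Rightarrow> 'a::euclidean_space \<Rightarrow> complex)"
proof -
  have "(LINT (x::'a)|lborel. cmod (narrow i x)) = 1" for i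
  proof -
    have "of_real (LINT (x::'a)|lborel. cmod (narrow i x)) = (LINT (x::'a)|lborel. of_real (2 ^ (i * DIM('a))) * gs (4 ^ i) x)"
      unfolding integral_complex_of_real[symmetric] by (simp add: narrow_def norm_mult norm_power gs_def)
    also have "\<dots> = of_real (2 ^ (i * DIM('a)) * (1 / sqrt (4 ^ i)) ^ DIM('a))"
      unfolding integral_mult_right_zero by (subst integral_gs) simp_all
    finally show ?thesis unfolding of_real_eq_iff by (simp add: sqrt_4_power power_mult power_divide)
  qed
  then show ?thesis unfolding unif_bounded_def by (intro disjI2 exI[of _ 1]) simp
qed

lemma fourier_wide: "fourier (wide i) = (narrow i :: 'a::euclidean_space \<Rightarrow> complex)"
proof
  fix \<xi> :: 'a
  show "fourier (wide i) \<xi> = narrow i \<xi>"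
    unfolding wide_def by (subst fourier_gs) (simp_all add: narrow_def power_divide real_sqrt_divide sqrt_4_power power_mult)
qed

lemma fourier_narrow: "fourier (narrow i) = (wide i :: 'a::euclidean_space \<Rightarrow> complex)"
proof
  fix \<xi> :: 'a
  have "fourier (narrow i) \<xi> = of_real (2 ^ (i * DIM('a))) * fourier (gs (4 ^ i)) \<xi>"
    unfolding fourier_def narrow_def by (simp add: mult.assoc)
  then show "fourier (narrow i) \<xi> = wide i \<xi>"
    by (subst (asm) fourier_gs) (simp_all add: wide_def power_divide sqrt_4_power power_mult)
qed

lemma gs_neq_0: "gs a \<noteq> (\<lambda>x. 0)"
  by (rule notI, drule fun_cong[of _ _ 0]) simp

text \<open>The content is spread in x only, so the growth exponent is that of the x-integration:
  the inner one in the modulation norm, the outer one in the amalgam norm.\<close>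

lemma test_family_wide: "test_family (gs 1 :: 'a::euclidean_space \<Rightarrow> complex) wide (\<lambda>r s. iv r) (\<lambda>r s. iv s)"
proof
  fix r s :: ennreal and i assume rs: "1 \<le> r" "1 \<le> s"
  have le: "eV (gs 1) (pairing (wide i)) x \<xi> \<le> gn ((1 / 4) ^ i / 8) x * gn (1 / 8) \<xi>" for x \<xi> :: 'a
    unfolding wide_def by (rule eV_wide) (auto simp: power_le_one)
  have meas: "case_prod (eV (gs 1) (pairing (wide i :: 'a \<Rightarrow> complex))) \<in> borel_measurable (borel \<Otimes>\<^sub>M borel)"
    by (rule eV_measurable[OF pairing_tempered[OF wide_schwartz] gs_schwartz[OF zero_less_one]])
  note 1 = mixed_norm_le_tensor[where V = "eV (gs 1) (pairing (wide i :: 'a \<Rightarrow> complex))", OF rs meas le gn_measurable gn_measurable]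
  show "modulation_norm (gs 1) r s (pairing (wide i :: 'a \<Rightarrow> complex)) \<le> ennreal (64 ^ DIM('a)) * ennreal (((2 ^ DIM('a)) powr iv r) ^ i)"
    unfolding modulation_norm_eV by (rule order_trans[OF 1(1) gn_growth[OF rs]])
  show "amalgam_norm (gs 1) r s (pairing (wide i :: 'a \<Rightarrow> complex)) \<le> ennreal (64 ^ DIM('a)) * ennreal (((2 ^ DIM('a)) powr iv s) ^ i)"
    unfolding amalgam_norm_eV[OF rs pairing_tempered[OF wide_schwartz] gs_schwartz[OF zero_less_one]]
    by (rule order_trans[OF 1(2) gn_growth[OF rs(2,1)]])
qed (simp_all only: wide_schwartz gs_schwartz zero_less_one gs_neq_0 wide_unif_bounded wide_diagonal iv_nonneg wide_gram[symmetric] not_False_eq_True)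

text \<open>The spread is in \<xi> only, so the two growth exponents of the wide family are
  interchanged.\<close>

lemma test_family_narrow: "test_family (gs 1 :: 'a::euclidean_space \<Rightarrow> complex) narrow (\<lambda>r s. iv s) (\<lambda>r s. iv r)"
proof
  fix r s :: ennreal and i assume rs: "1 \<le> r" "1 \<le> s"
  have meas: "case_prod (eV (gs 1) (pairing (narrow i :: 'a \<Rightarrow> complex))) \<in> borel_measurable (borel \<Otimes>\<^sub>M borel)"
    by (rule eV_measurable[OF pairing_tempered[OF narrow_schwartz] gs_schwartz[OF zero_less_one]])
  note 1 = mixed_norm_le_tensor[where V = "eV (gs 1) (pairing (narrow i :: 'a \<Rightarrow> complex))", OF rs meas eV_narrow gn_measurable gn_measurable]
  show "modulation_norm (gs 1) r s (pairing (narrow i :: 'a \<Rightarrow> complex)) \<le> ennreal (64 ^ DIM('a)) * ennreal (((2 ^ DIM('a)) powr iv s) ^ i)"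
    unfolding modulation_norm_eV by (rule order_trans[OF 1(1)]) (use gn_growth[OF rs(2,1)] in \<open>simp add: mult.commute\<close>)
  show "amalgam_norm (gs 1) r s (pairing (narrow i :: 'a \<Rightarrow> complex)) \<le> ennreal (64 ^ DIM('a)) * ennreal (((2 ^ DIM('a)) powr iv r) ^ i)"
    unfolding amalgam_norm_eV[OF rs pairing_tempered[OF narrow_schwartz] gs_schwartz[OF zero_less_one]]
    by (rule order_trans[OF 1(2)]) (use gn_growth[OF rs] in \<open>simp add: mult.commute\<close>)
next
  have eq: "pairing (narrow i) (narrow j :: 'a \<Rightarrow> complex) = of_real (2 ^ (i * DIM('a)) * 2 ^ (j * DIM('a)) * (1 / sqrt (4 ^ i + 4 ^ j)) ^ DIM('a))" for i j
  proof -
    have "pairing (narrow i) (narrow j :: 'a \<Rightarrow> complex) = of_real (2 ^ (i * DIM('a)) * 2 ^ (j * DIM('a))) * pairing (gs (4 ^ i)) (gs (4 ^ j) :: 'a \<Rightarrow> complex)"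
      unfolding pairing_def narrow_def integral_mult_right_zero[symmetric] by (simp add: mult_ac)
    then show ?thesis by (subst (asm) pairing_gs) simp_all
  qed
  show "pairing (narrow i) (narrow j :: 'a \<Rightarrow> complex) = of_real (cmod (pairing (narrow i) (narrow j :: 'a \<Rightarrow> complex)))" for i j
    unfolding eq norm_of_real by (simp add: abs_mult)
  show "(1 / sqrt 2) ^ DIM('a) * (2 ^ DIM('a)) ^ j \<le> cmod (pairing (narrow j) (narrow j :: 'a \<Rightarrow> complex))" for j
  proof -
    have "2 ^ j * 2 ^ j * (1 / sqrt (4 ^ j + 4 ^ j)) = 1 / sqrt 2 * 2 ^ j"
      unfolding mult_2[symmetric] by (simp add: real_sqrt_mult sqrt_4_power)
    then have "2 ^ (j * DIM('a)) * 2 ^ (j * DIM('a)) * (1 / sqrt (4 ^ j + 4 ^ j)) ^ DIM('a) = (1 / sqrt 2) ^ DIM('a) * (2 ^ DIM('a)) ^ j"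
      unfolding power_mult power_mult_distrib[symmetric] by (simp only: power_mult_distrib power_mult[symmetric] mult.commute)
    then show ?thesis unfolding eq norm_of_real by simp
  qed
qed (auto simp: narrow_schwartz gs_schwartz gs_neq_0 narrow_unif_bounded iv_nonneg)

text \<open>Across the diagonal the width is bounded, so the inner integration costs a constant in
  either order and the outer one sees the length 2^i. The Gram matrix is that of the wide family,
  since equal chirps cancel in a pairing.\<close>

lemma test_family_chirped: "test_family (chirped wide 0 :: 'a::euclidean_space \<Rightarrow> complex) (chirped wide) (\<lambda>r s. iv s) (\<lambda>r s. iv s)"
proof
  have sym: "gn b (x - y) = gn b (y - x)" for b and x y :: 'a
    by (simp add: gn_def inner_diff_left inner_diff_right)
  have eq: "pairing (chirped wide i) (chirped wide j :: 'a \<Rightarrow> complex) = pairing (wide i) (wide j :: 'a \<Rightarrow> complex)" for i j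
    unfolding pairing_def by (intro Bochner_Integration.integral_cong) (auto simp: chirped_def)
  show "pairing (chirped wide i) (chirped wide j :: 'a \<Rightarrow> complex) = of_real (cmod (pairing (chirped wide i) (chirped wide j :: 'a \<Rightarrow> complex)))" for i j
    unfolding eq by (rule wide_gram)
  show "(1 / sqrt 2) ^ DIM('a) * (2 ^ DIM('a)) ^ j \<le> cmod (pairing (chirped wide j) (chirped wide j :: 'a \<Rightarrow> complex))" for j
    unfolding eq by (rule wide_diagonal)
  show "unif_bounded (chirped wide :: nat \<Rightarrow> 'a \<Rightarrow> complex)"
    unfolding unif_bounded_def by (intro disjI1 exI[of _ 1]) (simp add: chirped_def wide_def norm_mult)
  show "chirped wide 0 \<noteq> (\<lambda>x::'a. 0)" by (rule notI, drule fun_cong[of _ _ 0]) (simp add: chirped_def wide_def)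
  fix r s :: ennreal and i assume rs: "1 \<le> r" "1 \<le> s"
  have le: "eV (chirped wide 0) (pairing (chirped wide i)) x \<xi> \<le> gn ((1 / 4) ^ i / 8) x * gn (1 / 8) (x - (\<xi>::'a))" for x \<xi>
    using eV_chirped(1) unfolding sym[of _ x] .
  note meas = eV_measurable[OF pairing_tempered[OF chirped_schwartz[OF wide_schwartz]] chirped_schwartz[OF wide_schwartz]]
  have "case_prod (\<lambda>\<xi> x. eV (chirped wide 0) (pairing (chirped wide i)) x (\<xi>::'a)) \<in> borel_measurable (borel \<Otimes>\<^sub>M borel)"
    using meas[measurable] by measurable
  from mixed_norm_le_shear[where V = "\<lambda>\<xi> x. eV (chirped wide 0) (pairing (chirped wide i)) x (\<xi>::'a)" and a = "gn ((1 / 4) ^ i / 8)" and b = "gn (1 / 8)", OF rs this eV_chirped(2) gn_measurable gn_measurable]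
  show "modulation_norm (chirped wide 0) r s (pairing (chirped wide i :: 'a \<Rightarrow> complex)) \<le> ennreal (64 ^ DIM('a)) * ennreal (((2 ^ DIM('a)) powr iv s) ^ i)"
    unfolding modulation_norm_eV by (rule order_trans[OF _ gn_growth[OF rs(2,1)]])
  show "amalgam_norm (chirped wide 0) r s (pairing (chirped wide i :: 'a \<Rightarrow> complex)) \<le> ennreal (64 ^ DIM('a)) * ennreal (((2 ^ DIM('a)) powr iv s) ^ i)"
    unfolding amalgam_norm_eV[OF rs pairing_tempered[OF chirped_schwartz[OF wide_schwartz]] chirped_schwartz[OF wide_schwartz]]
    by (rule order_trans[OF mixed_norm_le_shear[where a = "gn ((1 / 4) ^ i / 8)" and b = "gn (1 / 8)", OF rs meas le gn_measurable gn_measurable] gn_growth[OF rs(2,1)]])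
qed (auto simp: chirped_schwartz wide_schwartz iv_nonneg)

lemma conj_exponent_le_iff: "1 \<le> a \<Longrightarrow> 1 \<le> b \<Longrightarrow> conj_exponent a \<le> conj_exponent b \<longleftrightarrow> iv a \<le> iv b"
  by (simp add: iv_le_iff[OF conj_exponent_ge_1 conj_exponent_ge_1] iv_conj)

lemma le_conj_exponent_iff: "1 \<le> a \<Longrightarrow> 1 \<le> b \<Longrightarrow> a \<le> conj_exponent b \<longleftrightarrow> 1 \<le> iv a + iv b"
  by (auto simp: iv_le_iff[OF _ conj_exponent_ge_1] iv_conj)

theorem theorem6p10:
  fixes p q p\<^sub>1 p\<^sub>2 q\<^sub>1 q\<^sub>2 :: ennreal
    and \<tau> :: real
    and \<phi> :: "real ^ 'd \<Rightarrow> complex"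
    and \<Phi> :: "(real ^ 'd) \<times> (real ^ 'd) \<Rightarrow> complex"
  assumes "1 \<le> p" "1 \<le> q" "1 \<le> p\<^sub>1" "1 \<le> p\<^sub>2" "1 \<le> q\<^sub>1" "1 \<le> q\<^sub>2"
    and "\<tau> \<in> {0, 1}"
    and "\<phi> \<in> schwartz" "\<phi> \<noteq> (\<lambda>x. 0)"
    and "\<Phi> \<in> schwartz" "\<Phi> \<noteq> (\<lambda>z. 0)"
  shows "(\<forall>\<sigma>\<in>wiener_amalgam \<Phi> p q. bounded_on_modulation \<phi> p\<^sub>1 q\<^sub>1 p\<^sub>2 q\<^sub>2 (OP \<tau> \<sigma>)) \<longleftrightarrow>
    (\<tau> = 0 \<longrightarrow>
       conj_exponent q\<^sub>2 \<le> conj_exponent p \<and> p\<^sub>1 \<le> conj_exponent p \<and>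
       conj_exponent p\<^sub>2 \<le> conj_exponent q \<and> conj_exponent q\<^sub>2 \<le> conj_exponent q \<and>
       q\<^sub>1 \<le> conj_exponent q) \<and>
    (\<tau> = 1 \<longrightarrow>
       q\<^sub>1 \<le> conj_exponent p \<and> conj_exponent p\<^sub>2 \<le> conj_exponent p \<and>
       p\<^sub>1 \<le> conj_exponent q \<and> q\<^sub>1 \<le> conj_exponent q \<and>
       conj_exponent q\<^sub>2 \<le> conj_exponent q)"
    (is "?bounded \<longleftrightarrow> ?C0 \<and> ?C1")
proof
  \<comment> \<open>The exponent assumptions in the order in which the necessity lemmas expect them,
    \<open>q\<^sub>1\<close> before \<open>p\<^sub>2\<close>.\<close>
  note ex = assms(1,2,3,5,4,6)
  note iffs = conj_exponent_le_iff[OF assms(6) assms(1)] conj_exponent_le_iff[OF assms(6) assms(2)]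
    conj_exponent_le_iff[OF assms(4) assms(1)] conj_exponent_le_iff[OF assms(4) assms(2)]
    le_conj_exponent_iff[OF assms(3) assms(1)] le_conj_exponent_iff[OF assms(3) assms(2)]
    le_conj_exponent_iff[OF assms(5) assms(1)] le_conj_exponent_iff[OF assms(5) assms(2)]
  {
    assume bounded: ?bounded
    note out = test_family.necessity_output[OF _ ex assms(7-10) bspec[OF bounded]]
    note inp = test_family.necessity_input[OF _ ex assms(7-10) bspec[OF bounded]]
    \<comment> \<open>In \<open>necessity_output\<close> the target exponents occur conjugated, so
      that 1 \<le> E + F turns into a comparison of two reciprocals.\<close>
    have conv: "iv (conj_exponent p\<^sub>2) = 1 - iv p\<^sub>2" "iv (conj_exponent q\<^sub>2) = 1 - iv q\<^sub>2"
      using assms by (simp_all add: iv_conj)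
    have "?C0"
    proof
      assume \<tau>: "\<tau> = 0"
      have 1: "iv q\<^sub>2 \<le> iv p"
        using out[OF test_family_narrow] \<tau> conv narrow_unif_bounded by simp
      have 2: "iv p\<^sub>2 \<le> iv q"
        using out[OF test_family_wide] \<tau> conv wide_unif_bounded by simp
      \<comment> \<open>Chirps are bounded themselves, as the output test for \<tau> = 0 requires,
        and their outer exponents relate \<open>q\<^sub>2\<close> to q.\<close>
      have 3: "iv q\<^sub>2 \<le> iv q"
        using out[OF test_family_chirped] \<tau> conv test_family.unif[OF test_family_chirped] by simp
      \<comment> \<open>For input tests with \<tau> = 0 the Fourier transforms have to be uniformly
        bounded; those of the wide family are the narrow functions, bounded in L1.\<close>
      have 4: "1 \<le> iv p + iv p\<^sub>1"
        using inp[OF test_family_wide] \<tau> narrow_unif_bounded by (simp add: fourier_wide[abs_def])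
      have 5: "1 \<le> iv q + iv q\<^sub>1"
        using inp[OF test_family_narrow] \<tau> wide_unif_bounded by (simp add: fourier_narrow[abs_def])
      show "conj_exponent q\<^sub>2 \<le> conj_exponent p \<and> p\<^sub>1 \<le> conj_exponent p \<and>
        conj_exponent p\<^sub>2 \<le> conj_exponent q \<and> conj_exponent q\<^sub>2 \<le> conj_exponent q \<and> q\<^sub>1 \<le> conj_exponent q"
        unfolding iffs using 1 2 3 4 5 by (simp add: add.commute)
    qed
    moreover have "?C1"
    proof
      assume \<tau>: "\<tau> = 1"
      have 1: "iv p\<^sub>2 \<le> iv p"
        using out[OF test_family_wide] \<tau> conv narrow_unif_bounded by (simp add: fourier_wide[abs_def])
      have 2: "iv q\<^sub>2 \<le> iv q"
        using out[OF test_family_narrow] \<tau> conv wide_unif_bounded by (simp add: fourier_narrow[abs_def])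
      \<comment> \<open>For \<tau> = 1 it is the input test that takes the family without Fourier
        transform, so here the chirps bound the source exponent \<open>q\<^sub>1\<close>.\<close>
      have 3: "1 \<le> iv q + iv q\<^sub>1"
        using inp[OF test_family_chirped] \<tau> test_family.unif[OF test_family_chirped] by simp
      have 4: "1 \<le> iv q + iv p\<^sub>1"
        using inp[OF test_family_wide] \<tau> wide_unif_bounded by simp
      have 5: "1 \<le> iv p + iv q\<^sub>1"
        using inp[OF test_family_narrow] \<tau> narrow_unif_bounded by simp
      show "q\<^sub>1 \<le> conj_exponent p \<and> conj_exponent p\<^sub>2 \<le> conj_exponent p \<and>
        p\<^sub>1 \<le> conj_exponent q \<and> q\<^sub>1 \<le> conj_exponent q \<and> conj_exponent q\<^sub>2 \<le> conj_exponent q"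
        unfolding iffs using 1 2 3 4 5 by (simp add: add.commute)
    qed
    ultimately show "?C0 \<and> ?C1" ..
  next
    assume C: "?C0 \<and> ?C1"
    \<comment> \<open>The conditions between conjugate exponents and the reversed ones between the
      exponents, as the sufficiency lemmas want them, are the same inequality between
      reciprocals.\<close>
    note le = iv_le_iff[OF assms(1) assms(6)] iv_le_iff[OF assms(2) assms(6)] iv_le_iff[OF assms(1) assms(4)] iv_le_iff[OF assms(2) assms(4)]
    show ?bounded
    proof (cases "\<tau> = 0")
      case True
      then have c: "p \<le> q\<^sub>2" "q \<le> p\<^sub>2" "q \<le> q\<^sub>2" "p\<^sub>1 \<le> conj_exponent p" "q\<^sub>1 \<le> conj_exponent q"
        using C by (auto simp: le iffs)
      show ?thesis using sufficiency_0[OF assms(8-11,1) c(1) assms(2) c(2,3) assms(3) c(4) assms(5) c(5)] True by simp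
    next
      case False
      then have \<tau>: "\<tau> = 1" using assms(7) by simp
      then have c: "p \<le> p\<^sub>2" "q \<le> q\<^sub>2" "p\<^sub>1 \<le> conj_exponent q" "q\<^sub>1 \<le> conj_exponent p" "q\<^sub>1 \<le> conj_exponent q"
        using C by (auto simp: le iffs)
      show ?thesis using sufficiency_1[OF assms(8-11,1) c(1) assms(2) c(2) assms(3) c(3) assms(5) c(4,5)] \<tau> by simp
    qed
  }
qed

end
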